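(* Let $\nabla$ be an analytic locally metric connection on an analytic simply-connected manifold $M$. Then $\nabla$ is a metric connection. Furthermore, there exist $\operatorname{rank}\widetilde{W}$ (linearly) independent parallel metrics on $M$.
   Context: $M$ is connected. Analytic means real analytic. A connection $\nabla$ on $M$ means a connection on $TM$, not necessarily symmetric. $\pi:W\to M$ is the vector bundle of symmetric elements of $T^*M\otimes T^*M$, with the induced connection, also denoted $\nabla$; $W_x=\pi^{-1}(x)$, and $R:TM\otimes TM\otimes W\to W$ is the curvature tensor of $\nabla$ on $W$. A metric is a positive-definite (Riemannian) metric; it is parallel if $\nabla g=0$. $\nabla$ is metric if there is a parallel metric on all of $M$; $\nabla$ is locally metric if every point of $M$ has a neighbourhood $U$ carrying a metric parallel with respect to $\nabla|_U$. Properties of a subset $W'\subseteq W$: (P1) for each $x\in M$, $W'_x:=W_x\cap W'$ is a linear subspace of $W_x$; (P2) for each $w\in W'$ there are an open neighbourhood $U$ of $\pi(w)$ and a smooth local section $X:U\to W$ with values in $W'$ such that $X(\pi(w))=w$. For $W'$ satisfying P1 and P2, the second fundamental 1-form $\alpha_{W'}:W'\to(W/W')\otimes T^*M$ (quotient taken fibrewise) is the fibrewise linear map sending $w\in W'$ to the class of $(\nabla X)(\pi(w))$ in $(W_{\pi(w)}/W'_{\pi(w)})\otimes T^*_{\pi(w)}M$, where $X$ is a local section with values in $W'$ and $X(\pi(w))=w$. For $V\subseteq W$ satisfying P1, $\mathcal{S}(V)$ is the set of $v\in V$ for which there is a smooth local section $X$ of $W$ near $\pi(v)$ with values in $V$ and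 $X(\pi(v))=v$. Derived flag: $V^{(0)}=\{w\in W: R(\cdot,\cdot)(w)=0\}$, $W^{(i)}=\mathcal{S}(V^{(i)})$, $V^{(i+1)}=\ker\alpha_{W^{(i)}}=\{w\in W^{(i)}:\alpha_{W^{(i)}}(w)=0\}$. The decreasing sequence $W\supseteq W^{(0)}\supseteq W^{(1)}\supseteq\cdots$ stabilizes: for some $k$, $W^{(l)}=W^{(k)}$ for all $l\ge k$. Define $\widetilde{W}=W^{(k)}$. For an analytic connection on an analytic manifold $\widetilde{W}$ is a vector bundle over $M$, and $\operatorname{rank}\widetilde{W}$ denotes the dimension of its fibres. *)

theory Defs
  imports "HOL-Analysis.Analysis"
begin

section \<open>Smooth and real analytic maps between open sets of coordinate spaces\<close>

primrec Ck_on :: "nat \<Rightarrow> (real^'n \<Rightarrow> 'b::real_normed_vector) \<Rightarrow> (real^'n) set \<Rightarrow> bool" where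
  "Ck_on 0 f S \<longleftrightarrow> continuous_on S f"
| "Ck_on (Suc k) f S \<longleftrightarrow>
     (\<forall>x\<in>S. f differentiable (at x)) \<and>
     (\<forall>v. Ck_on k (\<lambda>x. frechet_derivative f (at x) v) S)"

definition smooth_on :: "(real^'n \<Rightarrow> 'b::real_normed_vector) \<Rightarrow> (real^'n) set \<Rightarrow> bool" where
  "smooth_on f S \<longleftrightarrow> (\<forall>k. Ck_on k f S)"

text \<open>The sum runs over all multi-indices \<open>\<alpha>\<close>.\<close>

definition real_analytic_on ::
    "(real^'n::finite \<Rightarrow> 'b::real_normed_vector) \<Rightarrow> (real^'n) set \<Rightarrow> bool" where
  "real_analytic_on f S \<longleftrightarrow>
     (\<forall>a\<in>S. \<exists>r>0. \<exists>c :: ('n \<Rightarrow> nat) \<Rightarrow> 'b. \<forall>x\<in>ball a r.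
        ((\<lambda>\<alpha>. (\<Prod>i\<in>UNIV. ((x - a) $ i) ^ \<alpha> i) *\<^sub>R c \<alpha>) has_sum f x) UNIV)"


section \<open>Analytic manifolds\<close>

text \<open>The manifold is the whole type \<open>'m\<close>; with the topology of that type.
  A chart is a pair of a domain and a coordinate map (arbitrary outside the domain).\<close>

type_synonym ('m, 'n) chart = "'m set \<times> ('m \<Rightarrow> real^'n)"

abbreviation cdom :: "('m, 'n) chart \<Rightarrow> 'm set" where "cdom \<equiv> fst"
abbreviation cmap :: "('m, 'n) chart \<Rightarrow> 'm \<Rightarrow> real^'n" where "cmap \<equiv> snd"

definition cinv :: "('m, 'n) chart \<Rightarrow> real^'n \<Rightarrow> 'm" where
  "cinv c = inv_into (cdom c) (cmap c)"

definition is_chart :: "('m::topological_space, 'n::finite) chart \<Rightarrow> bool" where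
  "is_chart c \<longleftrightarrow> open (cdom c) \<and> open (cmap c ` cdom c) \<and>
     homeomorphism (cdom c) (cmap c ` cdom c) (cmap c) (cinv c)"

definition analytic_atlas :: "('m::topological_space, 'n::finite) chart set \<Rightarrow> bool" where
  "analytic_atlas A \<longleftrightarrow>
     (\<forall>c\<in>A. is_chart c) \<and> (\<Union>c\<in>A. cdom c) = UNIV \<and>
     (\<forall>c\<in>A. \<forall>d\<in>A. real_analytic_on (cmap d \<circ> cinv c) (cmap c ` (cdom c \<inter> cdom d)))"


section \<open>Tangent vectors and bilinear forms\<close>

text \<open>The tangent space at \<open>x\<close> consists of the pairs of a chart at \<open>x\<close> and a coordinate vector,
  modulo the differentials of the chart transitions. It is represented by the coordinate space
  itself, each tangent vector at \<open>x\<close> being given by its coordinates in the chart \<open>chart_at A x\<close>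
  chosen once and for all at \<open>x\<close>. Likewise an element of \<open>T\<^sup>*M \<otimes> T\<^sup>*M\<close> over \<open>x\<close> is given by its
  matrix in the chart \<open>chart_at A x\<close>. As the choice need not vary continuously with \<open>x\<close>,
  regularity of fields is always that of their coordinate expressions
  \<open>vec_rep\<close> and \<open>form_rep\<close> in fixed charts.\<close>

definition chart_at :: "('m, 'n) chart set \<Rightarrow> 'm \<Rightarrow> ('m, 'n) chart" where
  "chart_at A x = (SOME c. c \<in> A \<and> x \<in> cdom c)"

definition coord_change ::
    "('m, 'n::finite) chart \<Rightarrow> ('m, 'n) chart \<Rightarrow> 'm \<Rightarrow> real^'n \<Rightarrow> real^'n" where
  "coord_change c d x = frechet_derivative (cmap d \<circ> cinv c) (at (cmap c x))"

definition vec_rep ::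
    "('m, 'n::finite) chart set \<Rightarrow> ('m, 'n) chart \<Rightarrow> ('m \<Rightarrow> real^'n) \<Rightarrow> real^'n \<Rightarrow> real^'n" where
  "vec_rep A c Y p = (let y = cinv c p in coord_change (chart_at A y) c y (Y y))"

definition form_rep ::
    "('m, 'n::finite) chart set \<Rightarrow> ('m, 'n) chart \<Rightarrow> ('m \<Rightarrow> real^'n^'n) \<Rightarrow> real^'n \<Rightarrow> real^'n^'n" where
  "form_rep A c w p =
     (let y = cinv c p; T = matrix (coord_change c (chart_at A y) y)
      in transpose T ** w y ** T)"

definition form_eval :: "real^'n::finite^'n \<Rightarrow> real^'n \<Rightarrow> real^'n \<Rightarrow> real" where
  "form_eval B u v = u \<bullet> (B *v v)"

definition smooth_fun ::
    "('m, 'n::finite) chart set \<Rightarrow> 'm set \<Rightarrow> ('m \<Rightarrow> real) \<Rightarrow> bool" where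
  "smooth_fun A U f \<longleftrightarrow> (\<forall>c\<in>A. smooth_on (f \<circ> cinv c) (cmap c ` (cdom c \<inter> U)))"

definition smooth_vec ::
    "('m, 'n::finite) chart set \<Rightarrow> 'm set \<Rightarrow> ('m \<Rightarrow> real^'n) \<Rightarrow> bool" where
  "smooth_vec A U Y \<longleftrightarrow> (\<forall>c\<in>A. smooth_on (vec_rep A c Y) (cmap c ` (cdom c \<inter> U)))"

definition analytic_vec ::
    "('m, 'n::finite) chart set \<Rightarrow> 'm set \<Rightarrow> ('m \<Rightarrow> real^'n) \<Rightarrow> bool" where
  "analytic_vec A U Y \<longleftrightarrow> (\<forall>c\<in>A. real_analytic_on (vec_rep A c Y) (cmap c ` (cdom c \<inter> U)))"

definition smooth_form ::
    "('m, 'n::finite) chart set \<Rightarrow> 'm set \<Rightarrow> ('m \<Rightarrow> real^'n^'n) \<Rightarrow> bool" where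
  "smooth_form A U w \<longleftrightarrow> (\<forall>c\<in>A. smooth_on (form_rep A c w) (cmap c ` (cdom c \<inter> U)))"

definition deriv_fun ::
    "('m, 'n::finite) chart set \<Rightarrow> ('m \<Rightarrow> real) \<Rightarrow> 'm \<Rightarrow> real^'n \<Rightarrow> real" where
  "deriv_fun A f x v =
     (let c = chart_at A x in frechet_derivative (f \<circ> cinv c) (at (cmap c x)) v)"

definition lie_bracket ::
    "('m, 'n::finite) chart set \<Rightarrow> ('m \<Rightarrow> real^'n) \<Rightarrow> ('m \<Rightarrow> real^'n) \<Rightarrow> 'm \<Rightarrow> real^'n" where
  "lie_bracket A X Y x =
     (let c = chart_at A x; p = cmap c x in
        frechet_derivative (vec_rep A c Y) (at p) (X x)
      - frechet_derivative (vec_rep A c X) (at p) (Y x))"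


section \<open>Connections on the tangent bundle\<close>

text \<open>\<open>nabla Y x v\<close> is the covariant derivative at \<open>x\<close> of the vector field \<open>Y\<close> in the direction of
  the tangent vector \<open>v\<close>. Only its values on fields that are smooth near \<open>x\<close> are meaningful.
  The Leibniz rule, applied to functions that equal 1 on an open set and 0 elsewhere, shows that
  \<open>nabla Y x\<close> depends only on the germ of \<open>Y\<close> at \<open>x\<close>, so \<open>nabla\<close> also acts on local fields.\<close>

definition connection ::
    "('m::topological_space, 'n::finite) chart set \<Rightarrow>
     (('m \<Rightarrow> real^'n) \<Rightarrow> 'm \<Rightarrow> real^'n \<Rightarrow> real^'n) \<Rightarrow> bool" where
  "connection A nabla \<longleftrightarrow>
     (\<forall>U. open U \<longrightarrow>
        (\<forall>Y. smooth_vec A U Y \<longrightarrow> (\<forall>x\<in>U. linear (nabla Y x))) \<and>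
        (\<forall>Y Z. smooth_vec A U Y \<longrightarrow> smooth_vec A U Z \<longrightarrow>
           (\<forall>x\<in>U. \<forall>v. nabla (\<lambda>y. Y y + Z y) x v = nabla Y x v + nabla Z x v)) \<and>
        (\<forall>f Y. smooth_fun A U f \<longrightarrow> smooth_vec A U Y \<longrightarrow>
           (\<forall>x\<in>U. \<forall>v. nabla (\<lambda>y. f y *\<^sub>R Y y) x v
              = deriv_fun A f x v *\<^sub>R Y x + f x *\<^sub>R nabla Y x v)) \<and>
        (\<forall>Y Z. smooth_vec A U Y \<longrightarrow> smooth_vec A U Z \<longrightarrow>
           smooth_vec A U (\<lambda>x. nabla Y x (Z x))))"

definition analytic_connection ::
    "('m::topological_space, 'n::finite) chart set \<Rightarrow>
     (('m \<Rightarrow> real^'n) \<Rightarrow> 'm \<Rightarrow> real^'n \<Rightarrow> real^'n) \<Rightarrow> bool" where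
  "analytic_connection A nabla \<longleftrightarrow>
     connection A nabla \<and>
     (\<forall>U Y Z. open U \<longrightarrow> analytic_vec A U Y \<longrightarrow> analytic_vec A U Z \<longrightarrow>
        analytic_vec A U (\<lambda>x. nabla Y x (Z x)))"


section \<open>The bundle of symmetric bilinear forms and its induced connection\<close>

definition sym_form :: "real^'n::finite^'n \<Rightarrow> bool" where
  "sym_form B \<longleftrightarrow> transpose B = B"

definition W_section ::
    "('m, 'n::finite) chart set \<Rightarrow> 'm set \<Rightarrow> ('m \<Rightarrow> real^'n^'n) \<Rightarrow> bool" where
  "W_section A U w \<longleftrightarrow> smooth_form A U w \<and> (\<forall>x\<in>U. sym_form (w x))"

text \<open>The bilinear form \<open>\<nabla>\<^sub>v w\<close> at \<open>x\<close> is the unique one satisfying the product rule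
  \<open>(\<nabla>\<^sub>v w)(Y, Z) = v(w(Y, Z)) - w(\<nabla>\<^sub>v Y, Z) - w(Y, \<nabla>\<^sub>v Z)\<close>.\<close>

definition form_nabla ::
    "('m::topological_space, 'n::finite) chart set \<Rightarrow>
     (('m \<Rightarrow> real^'n) \<Rightarrow> 'm \<Rightarrow> real^'n \<Rightarrow> real^'n) \<Rightarrow>
     ('m \<Rightarrow> real^'n^'n) \<Rightarrow> 'm \<Rightarrow> real^'n \<Rightarrow> real^'n^'n" where
  "form_nabla A nabla w x v =
     (THE B. \<forall>U Y Z. open U \<and> x \<in> U \<and> smooth_vec A U Y \<and> smooth_vec A U Z \<longrightarrow>
        form_eval B (Y x) (Z x)
          = deriv_fun A (\<lambda>y. form_eval (w y) (Y y) (Z y)) x v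
          - form_eval (w x) (nabla Y x v) (Z x)
          - form_eval (w x) (Y x) (nabla Z x v))"

text \<open>\<open>R(u, v)(w)\<close> at \<open>x\<close> is \<open>\<nabla>\<^sub>X \<nabla>\<^sub>Y s - \<nabla>\<^sub>Y \<nabla>\<^sub>X s - \<nabla>\<^bsub>[X, Y]\<^esub> s\<close> for any local extensions
  \<open>X\<close>, \<open>Y\<close>, \<open>s\<close> of \<open>u\<close>, \<open>v\<close>, \<open>w\<close>.\<close>

definition W_curvature ::
    "('m::topological_space, 'n::finite) chart set \<Rightarrow>
     (('m \<Rightarrow> real^'n) \<Rightarrow> 'm \<Rightarrow> real^'n \<Rightarrow> real^'n) \<Rightarrow>
     'm \<Rightarrow> real^'n \<Rightarrow> real^'n \<Rightarrow> real^'n^'n \<Rightarrow> real^'n^'n" where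
  "W_curvature A nabla x u v w =
     (THE r. \<forall>U X Y s. open U \<and> x \<in> U \<and> smooth_vec A U X \<and> smooth_vec A U Y \<and> W_section A U s \<and>
          X x = u \<and> Y x = v \<and> s x = w \<longrightarrow>
        r = form_nabla A nabla (\<lambda>y. form_nabla A nabla s y (Y y)) x (X x)
          - form_nabla A nabla (\<lambda>y. form_nabla A nabla s y (X y)) x (Y x)
          - form_nabla A nabla s x (lie_bracket A X Y x))"


section \<open>Metrics\<close>

definition metric_on ::
    "('m, 'n::finite) chart set \<Rightarrow> 'm set \<Rightarrow> ('m \<Rightarrow> real^'n^'n) \<Rightarrow> bool" where
  "metric_on A U g \<longleftrightarrow> W_section A U g \<and> (\<forall>x\<in>U. \<forall>v. v \<noteq> 0 \<longrightarrow> form_eval (g x) v v > 0)"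

definition parallel_on ::
    "('m::topological_space, 'n::finite) chart set \<Rightarrow>
     (('m \<Rightarrow> real^'n) \<Rightarrow> 'm \<Rightarrow> real^'n \<Rightarrow> real^'n) \<Rightarrow> 'm set \<Rightarrow> ('m \<Rightarrow> real^'n^'n) \<Rightarrow> bool" where
  "parallel_on A nabla U g \<longleftrightarrow> (\<forall>x\<in>U. \<forall>v. form_nabla A nabla g x v = 0)"

definition metric_connection ::
    "('m::topological_space, 'n::finite) chart set \<Rightarrow>
     (('m \<Rightarrow> real^'n) \<Rightarrow> 'm \<Rightarrow> real^'n \<Rightarrow> real^'n) \<Rightarrow> bool" where
  "metric_connection A nabla \<longleftrightarrow> (\<exists>g. metric_on A UNIV g \<and> parallel_on A nabla UNIV g)"

definition locally_metric_connection ::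
    "('m::topological_space, 'n::finite) chart set \<Rightarrow>
     (('m \<Rightarrow> real^'n) \<Rightarrow> 'm \<Rightarrow> real^'n \<Rightarrow> real^'n) \<Rightarrow> bool" where
  "locally_metric_connection A nabla \<longleftrightarrow>
     (\<forall>x. \<exists>U g. open U \<and> x \<in> U \<and> metric_on A U g \<and> parallel_on A nabla U g)"


section \<open>The derived flag\<close>

text \<open>A subset of \<open>W\<close> is given by its family of fibres.\<close>

definition local_section_in ::
    "('m::topological_space, 'n::finite) chart set \<Rightarrow> ('m \<Rightarrow> (real^'n^'n) set) \<Rightarrow>
     'm set \<Rightarrow> ('m \<Rightarrow> real^'n^'n) \<Rightarrow> bool" where
  "local_section_in A V U X \<longleftrightarrow> open U \<and> W_section A U X \<and> (\<forall>y\<in>U. X y \<in> V y)"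

definition smooth_part ::
    "('m::topological_space, 'n::finite) chart set \<Rightarrow>
     ('m \<Rightarrow> (real^'n^'n) set) \<Rightarrow> 'm \<Rightarrow> (real^'n^'n) set" where
  "smooth_part A V x = {v \<in> V x. \<exists>U X. x \<in> U \<and> local_section_in A V U X \<and> X x = v}"

text \<open>An element of \<open>(W\<^sub>x / V x) \<otimes> T\<^sup>*\<^sub>x M\<close> is represented by the map sending a tangent vector to a
  coset of \<open>V x\<close>. The second fundamental form is given as the relation between \<open>w\<close> and the classes
  of \<open>\<nabla>X\<close> for the sections \<open>X\<close> of \<open>V\<close> through \<open>w\<close>. It is functional when \<open>V\<close> is a subbundle;
  where the rank of \<open>V\<close> jumps, the class may depend on \<open>X\<close>, and the kernel consists of
  the \<open>w\<close> for which the zero class occurs.\<close>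

definition second_fundamental_form ::
    "('m::topological_space, 'n::finite) chart set \<Rightarrow>
     (('m \<Rightarrow> real^'n) \<Rightarrow> 'm \<Rightarrow> real^'n \<Rightarrow> real^'n) \<Rightarrow> ('m \<Rightarrow> (real^'n^'n) set) \<Rightarrow>
     'm \<Rightarrow> real^'n^'n \<Rightarrow> (real^'n \<Rightarrow> (real^'n^'n) set) \<Rightarrow> bool" where
  "second_fundamental_form A nabla V x w \<beta> \<longleftrightarrow>
     (\<exists>U X. x \<in> U \<and> local_section_in A V U X \<and> X x = w \<and>
        \<beta> = (\<lambda>v. {form_nabla A nabla X x v + u | u. u \<in> V x}))"

definition second_fundamental_kernel ::
    "('m::topological_space, 'n::finite) chart set \<Rightarrow>
     (('m \<Rightarrow> real^'n) \<Rightarrow> 'm \<Rightarrow> real^'n \<Rightarrow> real^'n) \<Rightarrow> ('m \<Rightarrow> (real^'n^'n) set) \<Rightarrow>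
     'm \<Rightarrow> (real^'n^'n) set" where
  "second_fundamental_kernel A nabla V x =
     {w \<in> V x. second_fundamental_form A nabla V x w (\<lambda>v. V x)}"

primrec flag_V ::
    "('m::topological_space, 'n::finite) chart set \<Rightarrow>
     (('m \<Rightarrow> real^'n) \<Rightarrow> 'm \<Rightarrow> real^'n \<Rightarrow> real^'n) \<Rightarrow> nat \<Rightarrow> 'm \<Rightarrow> (real^'n^'n) set" where
  "flag_V A nabla 0 = (\<lambda>x. {w. sym_form w \<and> (\<forall>u v. W_curvature A nabla x u v w = 0)})"
| "flag_V A nabla (Suc i) = second_fundamental_kernel A nabla (smooth_part A (flag_V A nabla i))"

definition flag_W ::
    "('m::topological_space, 'n::finite) chart set \<Rightarrow>
     (('m \<Rightarrow> real^'n) \<Rightarrow> 'm \<Rightarrow> real^'n \<Rightarrow> real^'n) \<Rightarrow> nat \<Rightarrow> 'm \<Rightarrow> (real^'n^'n) set" where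
  "flag_W A nabla i = smooth_part A (flag_V A nabla i)"

definition W_tilde ::
    "('m::topological_space, 'n::finite) chart set \<Rightarrow>
     (('m \<Rightarrow> real^'n) \<Rightarrow> 'm \<Rightarrow> real^'n \<Rightarrow> real^'n) \<Rightarrow> 'm \<Rightarrow> (real^'n^'n) set" where
  "W_tilde A nabla =
     flag_W A nabla (LEAST k. \<forall>l\<ge>k. flag_W A nabla l = flag_W A nabla k)"

definition bundle_rank :: "('m \<Rightarrow> (real^'n::finite^'n) set) \<Rightarrow> nat" where
  "bundle_rank V = (THE r. \<forall>x. dim (V x) = r)"

definition independent_sections :: "nat \<Rightarrow> (nat \<Rightarrow> 'm \<Rightarrow> real^'n::finite^'n) \<Rightarrow> bool" where
  "independent_sections r g \<longleftrightarrow>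
     (\<forall>c :: nat \<Rightarrow> real. (\<forall>x. (\<Sum>i<r. c i *\<^sub>R g i x) = 0) \<longrightarrow> (\<forall>i<r. c i = 0))"

end

theory Submission imports Defs begin

text \<open>
  Let \<open>P x\<close> (\<open>parallel_fibre x\<close>) be the space of the values at \<open>x\<close> of symmetric forms that are parallel
  near \<open>x\<close>. The theorem follows from four facts about \<open>P\<close>.

  \<^bold>\<open>\<open>P x\<close> is given by linear equations at \<open>x\<close>.\<close> In a chart, \<open>h\<close> is parallel iff
  \<open>dh(\<nu>) = L \<nu> h\<close> for an analytic family of linear maps \<open>L\<close>. Any initial value \<open>w\<close> is
  transported along the rays from \<open>x\<close> by a convergent power series (\<open>radial_transport\<close>).
  On each ray the curvature, applied to the transported section, is an analytic function whose
  Taylor coefficients at \<open>x\<close> are linear in \<open>w\<close>: up to factorials they are the iterated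
  curvatures \<open>icurv\<close>. If all of them kill \<open>w\<close>, the curvature in the radial direction kills the section.
  The defect of the section from being parallel then satisfies a homogeneous linear equation along
  the rays and vanishes at \<open>x\<close>, so it is zero (\<open>flat_extension\<close>). Conversely the iterated
  curvatures kill every parallel section (\<open>flat_on_jets\<close>).

  \<^bold>\<open>\<open>P\<close> is a local system.\<close> The dimension of the common kernel of a continuous family of linear
  maps can only drop nearby; a basis of \<open>P x\<close> extends to parallel sections that stay independent, so the
  dimension of \<open>P\<close> can only grow nearby. Hence \<open>P\<close> has local frames of parallel sections
  (\<open>local_frame\<close>). Parallel sections are continued along paths, and on a simply connected manifold
  the result does not depend on the path (\<open>global_section\<close>). So each element of \<open>P x\<close> is the value of
  exactly one parallel section on all of \<open>M\<close>, and \<open>dim (P x)\<close> is constant.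

  \<^bold>\<open>The derived flag ends in \<open>P\<close>.\<close> Parallel sections lie in every term of the flag. For the converse take a
  section \<open>X\<close> of a late term. Every nonempty open set contains a smaller one on which two consecutive
  terms span the same spaces, because dimensions cannot drop forever. There the terms of the flag
  are killed by all iterated curvatures, by induction on the order, so \<open>X\<close> lies in \<open>P\<close>
  (\<open>flag_stationary_parallel\<close>). Thus the iterated curvatures of \<open>X\<close> vanish on a dense set, hence everywhere
  (\<open>FW_top_level\<close>).

  \<^bold>\<open>Positivity.\<close> Since the connection is locally metric, \<open>P x\<close> contains a positive definite form. The
  value of a parallel form on a vector that is transported along a ray is constant, so positivity
  of a global parallel form is a closed condition on the point, and it is clearly open
  (\<open>pos_def_global\<close>). The positive definite elements of \<open>P x\<close> form a nonempty open subset, which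
  contains a basis of \<open>P x\<close>. The global extensions of the basis are the required metrics, and their
  number is \<open>dim (P x)\<close>, the rank of the last term of the flag.
\<close>

section \<open>Absolutely convergent power series in several variables\<close>

definition mpow :: "('n::finite \<Rightarrow> nat) \<Rightarrow> real^'n \<Rightarrow> real" where
  "mpow \<alpha> z = (\<Prod>i\<in>UNIV. (z $ i) ^ \<alpha> i)"

definition tdeg :: "('n::finite \<Rightarrow> nat) \<Rightarrow> nat" where
  "tdeg \<alpha> = (\<Sum>i\<in>UNIV. \<alpha> i)"

text \<open>The number \<open>S\<close> bounds the weighted \<open>l\<^sup>1\<close> norm of the coefficients. This norm is
  submultiplicative and dominates the supremum on the ball, so products, compositions and infinite
  sums of power series are controlled by numerical bounds alone. The bound is stated on finite partial
  sums to keep summability out of the definition.\<close>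

definition psum_coeffs :: "real^'n::finite \<Rightarrow> real \<Rightarrow> real \<Rightarrow> (('n \<Rightarrow> nat) \<Rightarrow> 'b::banach) \<Rightarrow> (real^'n \<Rightarrow> 'b) \<Rightarrow> bool" where
  "psum_coeffs a r S c f \<longleftrightarrow> (\<forall>F. finite F \<longrightarrow> (\<Sum>\<alpha>\<in>F. norm (c \<alpha>) * r ^ tdeg \<alpha>) \<le> S) \<and>
     (\<forall>x\<in>ball a r. ((\<lambda>\<alpha>. mpow \<alpha> (x - a) *\<^sub>R c \<alpha>) has_sum f x) UNIV)"

definition psum :: "real^'n::finite \<Rightarrow> real \<Rightarrow> real \<Rightarrow> (real^'n \<Rightarrow> 'b::banach) \<Rightarrow> bool" where
  "psum a r S f \<longleftrightarrow> (\<exists>c. psum_coeffs a r S c f)"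

lemma psum_coeffsD:
  assumes "psum_coeffs a r S c f"
  shows "\<And>F. finite F \<Longrightarrow> (\<Sum>\<alpha>\<in>F. norm (c \<alpha>) * r ^ tdeg \<alpha>) \<le> S"
    and "\<And>x. x \<in> ball a r \<Longrightarrow> ((\<lambda>\<alpha>. mpow \<alpha> (x - a) *\<^sub>R c \<alpha>) has_sum f x) UNIV"
  using assms by (auto simp: psum_coeffs_def)

lemma psumI:
  assumes "\<And>F. finite F \<Longrightarrow> (\<Sum>\<alpha>\<in>F. norm (c \<alpha>) * r ^ tdeg \<alpha>) \<le> S"
    and "\<And>x. x \<in> ball a r \<Longrightarrow> ((\<lambda>\<alpha>. mpow \<alpha> (x - a) *\<^sub>R c \<alpha>) has_sum f x) UNIV"
  shows "psum a r S f"
  using assms unfolding psum_def psum_coeffs_def by blast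

lemma mpow_add: "mpow (\<lambda>i. \<alpha> i + \<beta> i) z = mpow \<alpha> z * mpow \<beta> z"
  by (simp add: mpow_def power_add prod.distrib)

lemma tdeg_add: "tdeg (\<lambda>i. \<alpha> i + \<beta> i) = tdeg \<alpha> + tdeg \<beta>"
  by (simp add: tdeg_def sum.distrib)

lemma mpow_scale: "mpow \<alpha> (t *\<^sub>R z) = t ^ tdeg \<alpha> * mpow \<alpha> z"
  by (simp add: mpow_def tdeg_def power_mult_distrib prod.distrib power_sum)

lemma tdeg_0_iff: "tdeg \<alpha> = 0 \<longleftrightarrow> \<alpha> = (\<lambda>_. 0)"
  by (auto simp: tdeg_def)

lemma mpow_0: "mpow (\<lambda>_. 0) z = 1"
  by (simp add: mpow_def)

lemma mpow_zero: "tdeg \<alpha> \<noteq> 0 \<Longrightarrow> mpow \<alpha> 0 = 0"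
  by (auto simp: mpow_def tdeg_def)

lemma abs_mpow_le:
  assumes "norm z \<le> r"
  shows "\<bar>mpow \<alpha> z\<bar> \<le> r ^ tdeg \<alpha>"
proof -
  have "\<bar>z $ i\<bar> \<le> r" for i
    using component_le_norm_cart[of z i] assms by linarith
  then have "(\<Prod>i\<in>UNIV. \<bar>z $ i\<bar> ^ \<alpha> i) \<le> (\<Prod>i\<in>UNIV. r ^ \<alpha> i)"
    by (intro prod_mono) (auto intro!: power_mono)
  then show ?thesis
    by (simp add: mpow_def tdeg_def abs_prod power_abs power_sum)
qed

lemma nonneg_bounded_sums:
  fixes g :: "'i \<Rightarrow> real"
  assumes "\<And>i. 0 \<le> g i" and "\<And>F. finite F \<Longrightarrow> F \<subseteq> A \<Longrightarrow> sum g F \<le> S"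
  shows "g summable_on A" "infsum g A \<le> S"
proof -
  show "g summable_on A"
    by (rule nonneg_bdd_above_summable_on) (use assms in \<open>auto simp: bdd_above_def\<close>)
  then show "infsum g A \<le> S"
    using assms by (intro infsum_le_finite_sums) auto
qed

text \<open>The partial sums of a double series are bounded by covering the finite index set with a rectangle.\<close>

lemma sum_UNIV_pairs_le:
  fixes g :: "'i \<times> 'j \<Rightarrow> real"
  assumes nn: "\<And>p. 0 \<le> g p"
    and inner: "\<And>i F. finite F \<Longrightarrow> (\<Sum>j\<in>F. g (i, j)) \<le> T i"
    and outer: "\<And>F. finite F \<Longrightarrow> sum T F \<le> S"
    and F: "finite F"
  shows "sum g F \<le> S"
proof -
  have "sum g F \<le> sum g (fst ` F \<times> snd ` F)"
    using F nn by (intro sum_mono2) (auto intro: rev_image_eqI)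
  also have "\<dots> = (\<Sum>i\<in>fst ` F. \<Sum>j\<in>snd ` F. g (i, j))"
    using F by (simp add: sum.cartesian_product)
  also have "\<dots> \<le> sum T (fst ` F)"
    using F inner by (intro sum_mono) auto
  also have "\<dots> \<le> S" using F outer by auto
  finally show ?thesis .
qed

lemma psum_bound_nonneg: "psum a r S f \<Longrightarrow> 0 \<le> S"
  unfolding psum_def psum_coeffs_def by (metis finite.emptyI sum.empty)

text \<open>The source of all closure properties of \<open>psum\<close>. Multiplying, composing and differentiating
  series produces families of monomials in which an exponent may occur many times, indexed by some other
  set. Absolute convergence allows collecting the terms with equal exponent without increasing the
  bound.\<close>

lemma psum_regroup:
  fixes e :: "'i \<Rightarrow> 'n::finite \<Rightarrow> nat" and c :: "'i \<Rightarrow> 'b::banach"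
  assumes r: "r > 0"
    and bd: "\<And>F. finite F \<Longrightarrow> (\<Sum>i\<in>F. norm (c i) * r ^ tdeg (e i)) \<le> S"
    and hs: "\<And>x. x \<in> ball a r \<Longrightarrow> ((\<lambda>i. mpow (e i) (x - a) *\<^sub>R c i) has_sum f x) UNIV"
  shows "psum a r S f"
proof -
  define I where "I = (\<lambda>\<alpha>. {i. e i = \<alpha>})"
  define C where "C = (\<lambda>\<alpha>. infsum c (I \<alpha>))"
  define g where "g = (\<lambda>i. norm (c i) * r ^ tdeg (e i))"
  have g0: "0 \<le> g i" for i using r by (simp add: g_def)
  have gs: "g summable_on A" "infsum g A \<le> S" for A
    using nonneg_bounded_sums[of g A S] g0 bd by (auto simp: g_def)
  have cs: "c abs_summable_on (I \<alpha>)" for \<alpha>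
  proof -
    have "(\<lambda>i. g i * (1 / r ^ tdeg \<alpha>)) summable_on I \<alpha>"
      by (intro summable_on_cmult_left gs)
    moreover have "g i * (1 / r ^ tdeg \<alpha>) = norm (c i)" if "i \<in> I \<alpha>" for i
      using that r by (simp add: g_def I_def)
    ultimately show ?thesis by (simp cong: summable_on_cong)
  qed
  have Csum: "(c has_sum C \<alpha>) (I \<alpha>)" for \<alpha>
    unfolding C_def using abs_summable_summable[OF cs] by simp
  have Cn: "norm (C \<alpha>) * r ^ tdeg \<alpha> \<le> infsum g (I \<alpha>)" for \<alpha>
  proof -
    have "norm (C \<alpha>) * r ^ tdeg \<alpha> \<le> (\<Sum>\<^sub>\<infinity>i\<in>I \<alpha>. norm (c i)) * r ^ tdeg \<alpha>"
      unfolding C_def using r by (intro mult_right_mono norm_infsum_bound cs) auto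
    also have "\<dots> = (\<Sum>\<^sub>\<infinity>i\<in>I \<alpha>. norm (c i) * r ^ tdeg \<alpha>)"
      by (rule infsum_cmult_left[symmetric]) (use cs in auto)
    also have "\<dots> = infsum g (I \<alpha>)"
      by (rule infsum_cong) (auto simp: g_def I_def)
    finally show ?thesis .
  qed
  have 1: "(\<Sum>\<alpha>\<in>F. norm (C \<alpha>) * r ^ tdeg \<alpha>) \<le> S" if "finite F" for F
  proof -
    have "(\<Sum>\<alpha>\<in>F. norm (C \<alpha>) * r ^ tdeg \<alpha>) \<le> (\<Sum>\<alpha>\<in>F. infsum g (I \<alpha>))"
      by (intro sum_mono Cn)
    also have "\<dots> = infsum g (\<Union>\<alpha>\<in>F. I \<alpha>)"
      by (rule sum_infsum) (use that gs in \<open>auto simp: I_def\<close>)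
    also have "\<dots> \<le> S" by (rule gs)
    finally show ?thesis .
  qed
  have 2: "((\<lambda>\<alpha>. mpow \<alpha> (x - a) *\<^sub>R C \<alpha>) has_sum f x) UNIV" if x: "x \<in> ball a r" for x
  proof -
    have "((\<lambda>p. mpow (fst p) (x - a) *\<^sub>R c (snd p)) has_sum f x) (Sigma UNIV I)
        \<longleftrightarrow> ((\<lambda>i. mpow (e i) (x - a) *\<^sub>R c i) has_sum f x) UNIV"
      by (rule has_sum_reindex_bij_witness[where i = "\<lambda>i. (e i, i)" and j = snd]) (auto simp: I_def)
    then have "((\<lambda>p. mpow (fst p) (x - a) *\<^sub>R c (snd p)) has_sum f x) (Sigma UNIV I)"
      using hs[OF x] by simp
    then show ?thesis
      by (rule has_sum_SigmaD) (auto intro!: has_sum_scaleR Csum)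
  qed
  show ?thesis using 1 2 by (rule psumI)
qed

lemma psum_abs_summable:
  fixes c :: "('n::finite \<Rightarrow> nat) \<Rightarrow> 'b::banach"
  assumes "r > 0" "\<And>F. finite F \<Longrightarrow> (\<Sum>\<alpha>\<in>F. norm (c \<alpha>) * r ^ tdeg \<alpha>) \<le> S" "norm z \<le> r"
  shows "(\<lambda>\<alpha>. norm (mpow \<alpha> z *\<^sub>R c \<alpha>)) summable_on UNIV" 
    "\<And>F. finite F \<Longrightarrow> (\<Sum>\<alpha>\<in>F. norm (mpow \<alpha> z *\<^sub>R c \<alpha>)) \<le> S"
proof -
  show *: "(\<Sum>\<alpha>\<in>F. norm (mpow \<alpha> z *\<^sub>R c \<alpha>)) \<le> S" if "finite F" for F
  proof -
    have "(\<Sum>\<alpha>\<in>F. norm (mpow \<alpha> z *\<^sub>R c \<alpha>)) \<le> (\<Sum>\<alpha>\<in>F. norm (c \<alpha>) * r ^ tdeg \<alpha>)"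
      using abs_mpow_le[OF assms(3)] by (intro sum_mono) (auto simp: mult.commute intro!: mult_left_mono)
    with assms(2)[OF that] show ?thesis by linarith
  qed
  show "(\<lambda>\<alpha>. norm (mpow \<alpha> z *\<^sub>R c \<alpha>)) summable_on UNIV"
    by (rule nonneg_bounded_sums(1)[where S = S]) (use * in auto)
qed

lemma psum_norm_le:
  assumes "r > 0" "psum a r S f" "x \<in> ball a r"
  shows "norm (f x) \<le> S"
proof -
  obtain c where "psum_coeffs a r S c f"
    using assms(2) unfolding psum_def by blast
  note c = psum_coeffsD[OF this]
  have nz: "norm (x - a) \<le> r" using assms(3) by (simp add: dist_norm norm_minus_commute)
  note s = psum_abs_summable[OF assms(1) c(1) nz]
  have "norm (f x) \<le> infsum (\<lambda>\<alpha>. norm (mpow \<alpha> (x - a) *\<^sub>R c \<alpha>)) UNIV"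
    by (rule norm_has_sum_bound[OF has_sum_infsum[OF s(1)] c(2)[OF assms(3)]])
  also have "\<dots> \<le> S" by (rule nonneg_bounded_sums(2)) (use s(2) in auto)
  finally show ?thesis .
qed

lemma psum_cong: "psum a r S f \<Longrightarrow> (\<And>x. x \<in> ball a r \<Longrightarrow> f x = g x) \<Longrightarrow> psum a r S g"
  unfolding psum_def psum_coeffs_def by simp

lemma psum_mono: "psum a r S f \<Longrightarrow> S \<le> T \<Longrightarrow> psum a r T f"
  unfolding psum_def psum_coeffs_def by (meson order_trans)

lemma psum_shrink:
  assumes "psum a r S f" "0 < r'" "r' \<le> r"
  shows "psum a r' S f"
proof -
  obtain c where "psum_coeffs a r S c f"
    using assms(1) unfolding psum_def by blast
  note c = psum_coeffsD[OF this]
  have "(\<Sum>\<alpha>\<in>F. norm (c \<alpha>) * r' ^ tdeg \<alpha>) \<le> S" if "finite F" for F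
  proof -
    have "(\<Sum>\<alpha>\<in>F. norm (c \<alpha>) * r' ^ tdeg \<alpha>) \<le> (\<Sum>\<alpha>\<in>F. norm (c \<alpha>) * r ^ tdeg \<alpha>)"
      using assms by (intro sum_mono mult_left_mono power_mono) auto
    with c(1)[OF that] show ?thesis by linarith
  qed
  with c(2) assms show ?thesis by (intro psumI[of c]) auto
qed

lemma psum_at_center:
  fixes c :: "('n::finite \<Rightarrow> nat) \<Rightarrow> 'b::banach"
  assumes "r > 0" and "((\<lambda>\<alpha>. mpow \<alpha> (a - a) *\<^sub>R c \<alpha>) has_sum f a) UNIV"
  shows "c (\<lambda>_. 0) = f a"
proof -
  have "((\<lambda>\<alpha>. mpow \<alpha> (a - a) *\<^sub>R c \<alpha>) has_sum c (\<lambda>_. 0)) UNIV"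
    by (rule has_sum_finite_neutralI[where B = "{\<lambda>_. 0}"]) (auto simp: mpow_0 mpow_zero simp flip: tdeg_0_iff)
  then show ?thesis using assms has_sum_unique by blast
qed

text \<open>Without a constant term, every monomial gains at least one factor \<open>r' / r\<close> on the smaller
  ball. This is what makes a composition converge after shrinking the inner ball.\<close>

lemma psum_shrink_vanishing:
  assumes "psum a r S f" "0 < r'" "r' \<le> r" "f a = 0"
  shows "psum a r' (S * (r' / r)) f"
proof -
  obtain c where "psum_coeffs a r S c f"
    using assms(1) unfolding psum_def by blast
  note c = psum_coeffsD[OF this]
  have c0: "c (\<lambda>_. 0) = 0"
    using psum_at_center[of r a c f] c(2)[of a] assms by auto
  have "norm (c \<alpha>) * r' ^ tdeg \<alpha> \<le> norm (c \<alpha>) * r ^ tdeg \<alpha> * (r' / r)" for \<alpha>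
  proof (cases "tdeg \<alpha>")
    case 0 then show ?thesis using c0 by (simp add: tdeg_0_iff)
  next
    case (Suc k)
    have "r' ^ Suc k \<le> r ^ k * r'" using assms by (simp add: mult.commute mult_right_mono power_mono)
    also have "\<dots> = r ^ Suc k * (r' / r)" using assms by simp
    finally show ?thesis unfolding Suc mult.assoc by (rule mult_left_mono) simp
  qed
  then have "(\<Sum>\<alpha>\<in>F. norm (c \<alpha>) * r' ^ tdeg \<alpha>) \<le> (\<Sum>\<alpha>\<in>F. norm (c \<alpha>) * r ^ tdeg \<alpha>) * (r' / r)" for F
    unfolding sum_distrib_right by (rule sum_mono)
  moreover have "(\<Sum>\<alpha>\<in>F. norm (c \<alpha>) * r ^ tdeg \<alpha>) * (r' / r) \<le> S * (r' / r)" if "finite F" for F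
    using c(1)[OF that] assms by (intro mult_right_mono) auto
  ultimately have "(\<Sum>\<alpha>\<in>F. norm (c \<alpha>) * r' ^ tdeg \<alpha>) \<le> S * (r' / r)" if "finite F" for F
    using that by (meson order_trans)
  with c(2) assms show ?thesis by (intro psumI[of c]) auto
qed

lemma psum_monomial:
  assumes "r > 0"
  shows "psum a r (r ^ tdeg \<alpha> * norm b) (\<lambda>x. mpow \<alpha> (x - a) *\<^sub>R b)"
proof (rule psum_regroup[OF assms, where e = "\<lambda>_::unit. \<alpha>" and c = "\<lambda>_. b"])
  show "(\<Sum>i\<in>F. norm b * r ^ tdeg \<alpha>) \<le> r ^ tdeg \<alpha> * norm b" for F :: "unit set"
  proof (cases "F = {}")
    case False
    then have "F = {()}" by auto
    then show ?thesis by (simp add: mult.commute)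
  qed (use assms in simp)
  show "((\<lambda>i::unit. mpow \<alpha> (x - a) *\<^sub>R b) has_sum mpow \<alpha> (x - a) *\<^sub>R b) UNIV" for x
    by (rule has_sum_finiteI) (auto simp: UNIV_unit)
qed

lemma psum_const: "r > 0 \<Longrightarrow> psum a r (norm b) (\<lambda>_. b)"
  using psum_monomial[of r a "\<lambda>_. 0" b] by (simp add: mpow_0 tdeg_def)

lemma psum_coord: "r > 0 \<Longrightarrow> psum a r r (\<lambda>x. (x - a) $ i)"
proof -
  have 1: "mpow (\<lambda>j. if j = i then 1 else 0) z = z $ i" for z
    unfolding mpow_def by (simp add: if_distrib [of "power _"] cong: if_cong)
  have 2: "tdeg (\<lambda>j. if j = i then 1 else 0) = 1"
    unfolding tdeg_def by simp
  show "r > 0 \<Longrightarrow> ?thesis"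
    using psum_monomial[of r a "\<lambda>j. if j = i then 1 else 0" "1::real"] by (simp add: 1 2)
qed

text \<open>Expanding each summand gives a double series, whose weighted norm is at most the sum of the
  bounds.\<close>

lemma psum_infinite_sum:
  fixes f :: "'i \<Rightarrow> real^'n::finite \<Rightarrow> 'b::banach"
  assumes r: "r > 0" and f: "\<And>i. psum a r (T i) (f i)"
    and T: "\<And>F. finite F \<Longrightarrow> sum T F \<le> S"
    and g: "\<And>x. x \<in> ball a r \<Longrightarrow> ((\<lambda>i. f i x) has_sum g x) UNIV"
  shows "psum a r S g"
proof -
  have "\<exists>c. \<forall>i. (\<forall>F. finite F \<longrightarrow> (\<Sum>\<alpha>\<in>F. norm (c i \<alpha>) * r ^ tdeg \<alpha>) \<le> T i) \<and>
     (\<forall>x\<in>ball a r. ((\<lambda>\<alpha>. mpow \<alpha> (x - a) *\<^sub>R c i \<alpha>) has_sum f i x) UNIV)"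
    using f unfolding psum_def psum_coeffs_def by (intro choice) blast
  then obtain c where c': "\<forall>i. (\<forall>F. finite F \<longrightarrow> (\<Sum>\<alpha>\<in>F. norm (c i \<alpha>) * r ^ tdeg \<alpha>) \<le> T i) \<and>
     (\<forall>x\<in>ball a r. ((\<lambda>\<alpha>. mpow \<alpha> (x - a) *\<^sub>R c i \<alpha>) has_sum f i x) UNIV)"
    by (rule exE)
  have c: "\<And>i F. finite F \<Longrightarrow> (\<Sum>\<alpha>\<in>F. norm (c i \<alpha>) * r ^ tdeg \<alpha>) \<le> T i"
    "\<And>i x. x \<in> ball a r \<Longrightarrow> ((\<lambda>\<alpha>. mpow \<alpha> (x - a) *\<^sub>R c i \<alpha>) has_sum f i x) UNIV"
    using c' by auto
  show ?thesis
  proof (rule psum_regroup[OF r, where e = snd and c = "\<lambda>p. c (fst p) (snd p)"])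
    show "(\<Sum>p\<in>F. norm (c (fst p) (snd p)) * r ^ tdeg (snd p)) \<le> S" if "finite F" for F
      by (rule sum_UNIV_pairs_le[where T = T]) (use r c(1) T that in auto)
    fix x assume x: "x \<in> ball a r"
    then have nx: "norm (x - a) \<le> r" by (simp add: dist_norm norm_minus_commute)
    let ?h = "\<lambda>p. mpow (snd p) (x - a) *\<^sub>R c (fst p) (snd p)"
    have "(\<lambda>p. norm (?h p)) summable_on UNIV"
    proof (rule nonneg_bounded_sums(1))
      show "(\<Sum>p\<in>F. norm (?h p)) \<le> S" if "finite F" for F
        by (rule sum_UNIV_pairs_le[where T = T])
          (use psum_abs_summable(2)[OF r c(1) nx] T that in auto)
    qed auto
    then have "?h summable_on UNIV" by (rule abs_summable_summable)
    then have s: "?h summable_on (UNIV \<times> UNIV)" by simp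
    have "(?h has_sum g x) (UNIV \<times> UNIV)"
      by (rule has_sum_SigmaI[OF _ _ s]) (use c(2)[OF x] g[OF x] in auto)
    then show "(?h has_sum g x) UNIV" by simp
  qed
qed

lemma psum_sum:
  fixes f :: "'i \<Rightarrow> real^'n::finite \<Rightarrow> 'b::banach"
  assumes r: "r > 0" and I: "finite I" and f: "\<And>i. i \<in> I \<Longrightarrow> psum a r (T i) (f i)"
  shows "psum a r (sum T I) (\<lambda>x. \<Sum>i\<in>I. f i x)"
proof (rule psum_infinite_sum[OF r, where T = "\<lambda>i. if i \<in> I then T i else 0" and f = "\<lambda>i x. if i \<in> I then f i x else 0"])
  show "psum a r (if i \<in> I then T i else 0) (\<lambda>x. if i \<in> I then f i x else 0)" for i
    using f[of i] psum_const[OF r, of a "0::'b"] by auto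
  show "(\<Sum>i\<in>F. if i \<in> I then T i else 0) \<le> sum T I" if "finite F" for F
  proof -
    have "(\<Sum>i\<in>F. if i \<in> I then T i else 0) = sum T (F \<inter> I)" using that by (simp add: sum.inter_restrict)
    also have "\<dots> \<le> sum T I" using I psum_bound_nonneg[OF f] by (intro sum_mono2) auto
    finally show ?thesis .
  qed
  show "((\<lambda>i. if i \<in> I then f i x else 0) has_sum (\<Sum>i\<in>I. f i x)) UNIV" for x
    by (rule has_sum_finite_neutralI[OF I]) auto
qed

lemma psum_add:
  assumes "r > 0" "psum a r S f" "psum a r T g"
  shows "psum a r (S + T) (\<lambda>x. f x + g x)"
  using psum_sum[OF assms(1), of "UNIV::bool set" a "\<lambda>b. if b then S else T" "\<lambda>b. if b then f else g"] assms(2,3)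
  by (simp add: UNIV_bool add.commute)

lemma psum_bounded_linear:
  assumes "psum a r S f" "bounded_linear L" "\<And>x. norm (L x) \<le> K * norm x" "K \<ge> 0" "r > 0"
  shows "psum a r (K * S) (\<lambda>x. L (f x))"
proof -
  obtain c where "psum_coeffs a r S c f"
    using assms(1) unfolding psum_def by blast
  note c = psum_coeffsD[OF this]
  have "(\<Sum>\<alpha>\<in>F. norm (L (c \<alpha>)) * r ^ tdeg \<alpha>) \<le> K * S" if "finite F" for F
  proof -
    have "(\<Sum>\<alpha>\<in>F. norm (L (c \<alpha>)) * r ^ tdeg \<alpha>) \<le> (\<Sum>\<alpha>\<in>F. K * (norm (c \<alpha>) * r ^ tdeg \<alpha>))"
      using assms by (intro sum_mono) (auto simp: mult.assoc[symmetric] intro!: mult_right_mono)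
    also have "\<dots> \<le> K * S" unfolding sum_distrib_left[symmetric] using c(1)[OF that] assms(4) by (rule mult_left_mono)
    finally show ?thesis .
  qed
  moreover have "((\<lambda>\<alpha>. mpow \<alpha> (x - a) *\<^sub>R L (c \<alpha>)) has_sum L (f x)) UNIV" if "x \<in> ball a r" for x
    using has_sum_bounded_linear[OF assms(2) c(2)[OF that]]
    by (simp add: linear_simps[OF assms(2)])
  ultimately show ?thesis by (rule psumI)
qed

text \<open>The product is the sum over \<open>\<alpha>\<close> of the series of \<open>g\<close> multiplied by the \<open>\<alpha>\<close>-th monomial
  of \<open>f\<close>, and multiplication by a monomial only shifts exponents.\<close>

lemma psum_scaleR:
  fixes f :: "real^'n::finite \<Rightarrow> real" and g :: "real^'n \<Rightarrow> 'b::banach"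
  assumes r: "r > 0" and f: "psum a r S f" and g: "psum a r T g"
  shows "psum a r (S * T) (\<lambda>x. f x *\<^sub>R g x)"
proof -
  obtain c where "psum_coeffs a r S c f"
    using f unfolding psum_def by blast
  note c = psum_coeffsD[OF this]
  have T0: "T \<ge> 0" using g psum_bound_nonneg by blast
  show ?thesis
  proof (rule psum_infinite_sum[OF r, where f = "\<lambda>\<alpha> x. (mpow \<alpha> (x - a) * c \<alpha>) *\<^sub>R g x"
        and T = "\<lambda>\<alpha>. norm (c \<alpha>) * r ^ tdeg \<alpha> * T"])
    show "(\<Sum>\<alpha>\<in>F. norm (c \<alpha>) * r ^ tdeg \<alpha> * T) \<le> S * T" if "finite F" for F
      unfolding sum_distrib_right[symmetric] using c(1)[OF that] T0 by (rule mult_right_mono)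
    show "((\<lambda>\<alpha>. (mpow \<alpha> (x - a) * c \<alpha>) *\<^sub>R g x) has_sum f x *\<^sub>R g x) UNIV" if "x \<in> ball a r" for x
      using has_sum_bounded_linear[OF bounded_linear_scaleR_left c(2)[OF that], of "g x"] by simp
    fix \<alpha>
    obtain d where "psum_coeffs a r T d g"
      using g unfolding psum_def by blast
    note d = psum_coeffsD[OF this]
    show "psum a r (norm (c \<alpha>) * r ^ tdeg \<alpha> * T) (\<lambda>x. (mpow \<alpha> (x - a) * c \<alpha>) *\<^sub>R g x)"
    proof (rule psum_regroup[OF r, where e = "\<lambda>\<beta> i. \<alpha> i + \<beta> i" and c = "\<lambda>\<beta>. c \<alpha> *\<^sub>R d \<beta>"])
      fix F :: "('n \<Rightarrow> nat) set" assume F: "finite F"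
      have "(\<Sum>\<beta>\<in>F. norm (c \<alpha> *\<^sub>R d \<beta>) * r ^ tdeg (\<lambda>i. \<alpha> i + \<beta> i))
          = (norm (c \<alpha>) * r ^ tdeg \<alpha>) * (\<Sum>\<beta>\<in>F. norm (d \<beta>) * r ^ tdeg \<beta>)"
        unfolding sum_distrib_left by (rule sum.cong) (auto simp: tdeg_add power_add mult_ac)
      also have "\<dots> \<le> (norm (c \<alpha>) * r ^ tdeg \<alpha>) * T"
        using d(1)[OF F] r by (intro mult_left_mono) auto
      finally show "(\<Sum>\<beta>\<in>F. norm (c \<alpha> *\<^sub>R d \<beta>) * r ^ tdeg (\<lambda>i. \<alpha> i + \<beta> i)) \<le> norm (c \<alpha>) * r ^ tdeg \<alpha> * T" .
    next
      fix x assume x: "x \<in> ball a r"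
      show "((\<lambda>\<beta>. mpow (\<lambda>i. \<alpha> i + \<beta> i) (x - a) *\<^sub>R c \<alpha> *\<^sub>R d \<beta>) has_sum (mpow \<alpha> (x - a) * c \<alpha>) *\<^sub>R g x) UNIV"
        using has_sum_scaleR[OF d(2)[OF x], of "mpow \<alpha> (x - a) * c \<alpha>"] by (simp add: mpow_add mult_ac)
    qed
  qed
qed

lemma psum_mult:
  fixes f g :: "real^'n::finite \<Rightarrow> real"
  assumes "r > 0" "psum a r S f" "psum a r T g"
  shows "psum a r (S * T) (\<lambda>x. f x * g x)"
  using psum_scaleR[OF assms] by simp

lemma psum_power:
  fixes f :: "real^'n::finite \<Rightarrow> real"
  assumes "r > 0" "psum a r S f"
  shows "psum a r (S ^ k) (\<lambda>x. f x ^ k)"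
proof (induction k)
  case 0 then show ?case using psum_const[OF assms(1), of a "1::real"] by simp
next
  case (Suc k) then show ?case using psum_mult[OF assms Suc] by simp
qed

lemma psum_prod:
  fixes f :: "'i \<Rightarrow> real^'n::finite \<Rightarrow> real"
  assumes "r > 0" "finite I" "\<And>i. i \<in> I \<Longrightarrow> psum a r (T i) (f i)"
  shows "psum a r (prod T I) (\<lambda>x. \<Prod>i\<in>I. f i x)"
  using assms(2,3)
proof (induction I rule: finite_induct)
  case empty then show ?case using psum_const[OF assms(1), of a "1::real"] by simp
next
  case (insert i I)
  have "psum a r (T i * prod T I) (\<lambda>x. f i x * (\<Prod>i\<in>I. f i x))"
    by (rule psum_mult[OF assms(1)]) (use insert in auto)
  with insert show ?case by simp
qed

text \<open>On a small ball each coordinate of \<open>g x - g a\<close> has a weighted norm \<open>s'\<close> below \<open>s\<close>, so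
  the monomials of \<open>f\<close> evaluated at \<open>g\<close> are dominated by the monomials in the definition of the bound
  for \<open>f\<close>.\<close>

lemma psum_compose:
  fixes f :: "real^'k::finite \<Rightarrow> 'b::banach" and g :: "real^'n::finite \<Rightarrow> real^'k"
  assumes f: "psum (g a) s S f" and s: "s > 0"
    and g: "\<And>i. psum a r T (\<lambda>x. g x $ i)" and r: "r > 0"
  shows "\<exists>\<rho>>0. \<rho> \<le> r \<and> psum a \<rho> S (\<lambda>x. f (g x)) \<and> g ` ball a \<rho> \<subseteq> ball (g a) s"
proof -
  define N where "N = real CARD('k)"
  have N: "N > 0" by (simp add: N_def)
  have T0: "T \<ge> 0" using g psum_bound_nonneg by blast
  define T' where "T' = T + T"
  have T': "psum a r T' (\<lambda>x. (g x - g a) $ i)" for i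
  proof -
    have ga: "norm (g a $ i) \<le> T"
      using psum_norm_le[OF r g, of a] r by auto
    have "psum a r (T + norm (- g a $ i)) (\<lambda>x. g x $ i + - g a $ i)"
      by (intro psum_add r g psum_const)
    then have "psum a r (T + norm (- g a $ i)) (\<lambda>x. (g x - g a) $ i)" by simp
    then show ?thesis by (rule psum_mono) (use ga in \<open>auto simp: T'_def\<close>)
  qed
\<comment> \<open>The ball of \<open>f\<close> is Euclidean, so all \<open>N\<close> coordinates together must stay below \<open>s\<close>.\<close>
  define s' where "s' = s / (N + 1)"
  have s': "s' > 0" "N * s' < s" using s N by (auto simp: s'_def field_simps)
  have s's: "s' \<le> s" using s N by (auto simp: s'_def field_simps)
  define \<rho> where "\<rho> = min r (r * s' / (T' + 1))"
  have T'0: "T' \<ge> 0" using T0 by (simp add: T'_def)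
  have \<rho>: "\<rho> > 0" "\<rho> \<le> r" using r s' T'0 by (auto simp: \<rho>_def)
  have \<rho>2: "T' * (\<rho> / r) \<le> s'"
  proof -
    have "T' * (\<rho> / r) \<le> T' * (r * s' / (T' + 1) / r)"
      using T'0 r by (intro mult_left_mono divide_right_mono) (auto simp: \<rho>_def)
    also have "\<dots> = s' * (T' / (T' + 1))" using r by simp
    also have "\<dots> \<le> s' * 1" using s' T'0 by (intro mult_left_mono) auto
    finally show ?thesis by simp
  qed
  have small: "psum a \<rho> s' (\<lambda>x. (g x - g a) $ i)" for i
    by (rule psum_mono[OF psum_shrink_vanishing[OF T'[of i] \<rho>(1,2)] \<rho>2]) simp
  have inball: "g x \<in> ball (g a) s" if "x \<in> ball a \<rho>" for x
  proof -
    have "norm (g x - g a) \<le> (\<Sum>i\<in>UNIV. \<bar>(g x - g a) $ i\<bar>)" by (rule norm_le_l1_cart)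
    also have "\<dots> \<le> (\<Sum>i\<in>(UNIV::'k set). s')"
      using psum_norm_le[OF \<rho>(1) small that] by (intro sum_mono) auto
    also have "\<dots> < s" using s' by (simp add: N_def)
    finally show ?thesis by (simp add: dist_norm norm_minus_commute)
  qed
  obtain c where "psum_coeffs (g a) s S c f"
    using f unfolding psum_def by blast
  note c = psum_coeffsD[OF this]
  have "psum a \<rho> S (\<lambda>x. f (g x))"
  proof (rule psum_infinite_sum[OF \<rho>(1), where f = "\<lambda>\<alpha> x. mpow \<alpha> (g x - g a) *\<^sub>R c \<alpha>"
        and T = "\<lambda>\<alpha>. s' ^ tdeg \<alpha> * norm (c \<alpha>)"])
    show "psum a \<rho> (s' ^ tdeg \<alpha> * norm (c \<alpha>)) (\<lambda>x. mpow \<alpha> (g x - g a) *\<^sub>R c \<alpha>)" for \<alpha>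
    proof (rule psum_scaleR[OF \<rho>(1) _ psum_const[OF \<rho>(1)]])
      have "psum a \<rho> (\<Prod>i\<in>UNIV. s' ^ \<alpha> i) (\<lambda>x. \<Prod>i\<in>UNIV. (g x - g a) $ i ^ \<alpha> i)"
        by (intro psum_prod psum_power \<rho> small) auto
      then show "psum a \<rho> (s' ^ tdeg \<alpha>) (\<lambda>x. mpow \<alpha> (g x - g a))"
        by (simp add: mpow_def tdeg_def power_sum)
    qed
    show "(\<Sum>\<alpha>\<in>F. s' ^ tdeg \<alpha> * norm (c \<alpha>)) \<le> S" if "finite F" for F
    proof -
      have "(\<Sum>\<alpha>\<in>F. s' ^ tdeg \<alpha> * norm (c \<alpha>)) \<le> (\<Sum>\<alpha>\<in>F. norm (c \<alpha>) * s ^ tdeg \<alpha>)"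
        using s' s's by (intro sum_mono) (auto simp: mult.commute intro!: mult_left_mono power_mono)
      with c(1)[OF that] show ?thesis by linarith
    qed
    show "((\<lambda>\<alpha>. mpow \<alpha> (g x - g a) *\<^sub>R c \<alpha>) has_sum f (g x)) UNIV" if "x \<in> ball a \<rho>" for x
      using c(2) inball[OF that] by blast
  qed
  with \<rho> inball show ?thesis by blast
qed

section \<open>Termwise differentiation\<close>

lemma has_sum_minus:
  fixes f g :: "'i \<Rightarrow> 'b::real_normed_vector"
  assumes "(f has_sum a) A" "(g has_sum b) A"
  shows "((\<lambda>x. f x - g x) has_sum (a - b)) A"
  using has_sum_add[OF assms(1) has_sum_scaleR[OF assms(2), of "-1"]] by simp

text \<open>Derivatives dominated by a summable sequence \<open>B\<close>: a finite part of the series is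
  differentiated as usual, and the mean value inequality bounds the difference quotients of the
  remainder by the tail of \<open>B\<close>.\<close>

lemma has_derivative_has_sum:
  fixes f :: "'i \<Rightarrow> 'a::real_normed_vector \<Rightarrow> 'b::banach"
  assumes S: "open S" "convex S"
    and f': "\<And>i x. x \<in> S \<Longrightarrow> (f i has_derivative f' i x) (at x)"
    and B: "\<And>i x h. x \<in> S \<Longrightarrow> norm (f' i x h) \<le> B i * norm h" "B summable_on UNIV" "\<And>i. 0 \<le> B i"
    and g: "\<And>x. x \<in> S \<Longrightarrow> ((\<lambda>i. f i x) has_sum g x) UNIV"
    and x: "x \<in> S"
  shows "(g has_derivative (\<lambda>h. infsum (\<lambda>i. f' i x h) UNIV)) (at x)"
    and "((\<lambda>i. f' i x h) has_sum infsum (\<lambda>i. f' i x h) UNIV) UNIV"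
proof -
  have s: "(\<lambda>i. norm (f' i x h)) summable_on UNIV" for h
    by (rule Infinite_Sum.abs_summable_on_comparison_test'[where g = "\<lambda>i. B i * norm h"])
      (use B x in \<open>auto intro: summable_on_cmult_left\<close>)
  have hs: "((\<lambda>i. f' i x h) has_sum infsum (\<lambda>i. f' i x h) UNIV) UNIV" for h
    using abs_summable_summable[OF s] by simp
  then show "((\<lambda>i. f' i x h) has_sum infsum (\<lambda>i. f' i x h) UNIV) UNIV" .
  define G where "G h = infsum (\<lambda>i. f' i x h) UNIV" for h
  have hsG: "((\<lambda>i. f' i x h) has_sum G h) UNIV" for h unfolding G_def by (rule hs)
  have lin: "bounded_linear (f' i x)" for i using f'[OF x] by (rule has_derivative_bounded_linear)
  have Gb: "norm (G h) \<le> infsum B UNIV * norm h" for h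
  proof (rule norm_infsum_le[OF hsG])
    show "((\<lambda>i. B i * norm h) has_sum infsum B UNIV * norm h) UNIV"
      by (intro has_sum_cmult_left has_sum_infsum B)
  qed (use B x in auto)
  have Glin: "bounded_linear G"
  proof (rule bounded_linear_intro[where K = "infsum B UNIV"])
    show "G (u + v) = G u + G v" for u v
      by (rule has_sum_unique[OF hsG]) (use has_sum_add[OF hsG hsG] in \<open>simp add: linear_simps[OF lin]\<close>)
    show "G (c *\<^sub>R u) = c *\<^sub>R G u" for c u
      by (rule has_sum_unique[OF hsG]) (use has_sum_scaleR[OF hsG] in \<open>simp add: linear_simps[OF lin]\<close>)
    show "norm (G u) \<le> norm u * infsum B UNIV" for u using Gb[of u] by (simp add: mult.commute)
  qed
  have "(g has_derivative G) (at x)"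
    unfolding has_derivative_at_alt
  proof (intro conjI allI impI Glin)
    fix e :: real assume e: "e > 0"
    have "\<exists>F. finite F \<and> F \<subseteq> UNIV \<and> dist (sum B F) (infsum B UNIV) \<le> e / 4"
      by (rule has_sum_finite_approximation) (use e B in auto)
    then obtain F where F: "finite F" "dist (sum B F) (infsum B UNIV) \<le> e / 4" by blast
    have B0: "(B has_sum (infsum B UNIV - sum B F)) (- F)"
      using has_sum_Diff[OF has_sum_infsum[OF B(2)], of F "sum B F"] F
      by (simp add: Compl_eq_Diff_UNIV)
    have tail: "infsum B UNIV - sum B F \<le> e / 4" using F(2) abs_ge_minus_self[of "sum B F - infsum B UNIV"] unfolding dist_real_def by linarith
    have "((\<lambda>y. \<Sum>i\<in>F. f i y) has_derivative (\<lambda>h. \<Sum>i\<in>F. f' i x h)) (at x)"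
      by (intro has_derivative_sum f' x)
    then obtain d1 where d1: "d1 > 0" "\<And>y. norm (y - x) < d1 \<Longrightarrow>
        norm ((\<Sum>i\<in>F. f i y) - (\<Sum>i\<in>F. f i x) - (\<Sum>i\<in>F. f' i x (y - x))) \<le> e / 4 * norm (y - x)"
      unfolding has_derivative_at_alt using e by (metis divide_pos_pos zero_less_numeral)
    obtain d2 where d2: "d2 > 0" "ball x d2 \<subseteq> S" using S x openE by blast
    have "norm (g y - g x - G (y - x)) \<le> e * norm (y - x)" if y: "norm (y - x) < min d1 d2" for y
    proof -
      have yS: "y \<in> S" using y d2 by (auto simp: dist_norm norm_minus_commute subset_iff)
      let ?h = "\<lambda>i. f i y - f i x - f' i x (y - x)"
      have all: "(?h has_sum (g y - g x - G (y - x))) UNIV"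
        by (intro has_sum_minus g yS x hsG)
      have fin: "(?h has_sum (sum ?h F)) F" using F by simp
      have tl: "(?h has_sum (g y - g x - G (y - x) - sum ?h F)) (- F)"
        using has_sum_Diff[OF all fin] by (simp add: Compl_eq_Diff_UNIV)
      have "norm (g y - g x - G (y - x) - sum ?h F) \<le> (infsum B UNIV - sum B F) * (2 * norm (y - x))"
      proof (rule norm_infsum_le[OF tl])
        show "((\<lambda>i. B i * (2 * norm (y - x))) has_sum (infsum B UNIV - sum B F) * (2 * norm (y - x))) (- F)"
          by (intro has_sum_cmult_left B0)
        fix i
        have "norm (f i y - f i x) \<le> B i * norm (y - x)"
        proof (rule differentiable_bound[OF S(2)])
          show "(f i has_derivative f' i z) (at z within S)" if "z \<in> S" for z
            using f'[OF that] by (rule has_derivative_at_withinI)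
          show "onorm (f' i z) \<le> B i" if "z \<in> S" for z
            by (rule onorm_bound) (use B that in auto)
        qed (use yS x in auto)
        moreover have "norm (f' i x (y - x)) \<le> B i * norm (y - x)" using B x by auto
        ultimately show "norm (?h i) \<le> B i * (2 * norm (y - x))"
          using norm_triangle_ineq4[of "f i y - f i x" "f' i x (y - x)"] by (simp add: algebra_simps)
      qed
      also have "\<dots> \<le> e / 4 * (2 * norm (y - x))" using tail by (intro mult_right_mono) auto
      finally have 1: "norm (g y - g x - G (y - x) - sum ?h F) \<le> e / 4 * (2 * norm (y - x))" .
      have 2: "norm (sum ?h F) \<le> e / 4 * norm (y - x)"
        using d1(2)[of y] y by (simp add: sum_subtractf)
      have "norm (g y - g x - G (y - x)) \<le> e / 4 * (2 * norm (y - x)) + e / 4 * norm (y - x)"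
        using norm_triangle_ineq[of "g y - g x - G (y - x) - sum ?h F" "sum ?h F"] 1 2 by simp
      also have "\<dots> \<le> e * norm (y - x)" using e by (simp add: algebra_simps)
      finally show ?thesis .
    qed
    then show "\<exists>d>0. \<forall>y. norm (y - x) < d \<longrightarrow> norm (g y - g x - G (y - x)) \<le> e * norm (y - x)"
      using d1 d2 by (intro exI[of _ "min d1 d2"]) auto
  qed
  then show "(g has_derivative (\<lambda>h. infsum (\<lambda>i. f' i x h) UNIV)) (at x)" by (simp add: G_def[abs_def])
qed

definition lower_exponent :: "('n::finite \<Rightarrow> nat) \<Rightarrow> 'n \<Rightarrow> 'n \<Rightarrow> nat" where
  "lower_exponent \<alpha> i = \<alpha>(i := \<alpha> i - 1)"

lemma tdeg_lower_exponent: "\<alpha> i \<noteq> 0 \<Longrightarrow> tdeg (lower_exponent \<alpha> i) = tdeg \<alpha> - 1"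
proof -
  assume a: "\<alpha> i \<noteq> 0"
  have "tdeg \<alpha> = \<alpha> i + (\<Sum>j\<in>UNIV - {i}. \<alpha> j)"
    unfolding tdeg_def by (simp add: sum.remove)
  moreover have "tdeg (lower_exponent \<alpha> i) = (\<alpha> i - 1) + (\<Sum>j\<in>UNIV - {i}. \<alpha> j)"
    unfolding tdeg_def by (subst sum.remove[of _ i]) (auto simp: lower_exponent_def)
  ultimately show ?thesis using a by simp
qed

definition mpow_deriv :: "('n::finite \<Rightarrow> nat) \<Rightarrow> real^'n \<Rightarrow> real^'n \<Rightarrow> real" where
  "mpow_deriv \<alpha> z h = (\<Sum>i\<in>UNIV. h $ i * (real (\<alpha> i) * mpow (lower_exponent \<alpha> i) z))"

lemma has_derivative_mpow: "(mpow \<alpha> has_derivative mpow_deriv \<alpha> z) (at z)"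
proof -
  have 1: "((\<lambda>z. \<Prod>i\<in>UNIV. (z $ i) ^ \<alpha> i) has_derivative
    (\<lambda>h. \<Sum>i\<in>UNIV. (real (\<alpha> i) * h $ i * (z $ i) ^ (\<alpha> i - 1)) * (\<Prod>j\<in>UNIV - {i}. (z $ j) ^ \<alpha> j))) (at z)"
    by (intro has_derivative_prod) (auto intro!: derivative_eq_intros bounded_linear_imp_has_derivative bounded_linear_vec_nth simp: mult_ac)
  have 2: "(z $ i) ^ (\<alpha> i - 1) * (\<Prod>j\<in>UNIV - {i}. (z $ j) ^ \<alpha> j) = mpow (lower_exponent \<alpha> i) z" for i
    unfolding mpow_def by (subst (2) prod.remove[of _ i]) (auto simp: lower_exponent_def)
  have 3: "(real (\<alpha> i) * h $ i * (z $ i) ^ (\<alpha> i - 1)) * (\<Prod>j\<in>UNIV - {i}. (z $ j) ^ \<alpha> j)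
     = h $ i * (real (\<alpha> i) * mpow (lower_exponent \<alpha> i) z)" for i h
    by (simp add: 2[symmetric])
  have 4: "mpow \<alpha> = (\<lambda>z. \<Prod>i\<in>UNIV. (z $ i) ^ \<alpha> i)" by (simp add: mpow_def fun_eq_iff)
  show ?thesis using 1 unfolding 3 4 mpow_deriv_def[abs_def] by simp
qed

text \<open>Euler's relation for a homogeneous polynomial.\<close>

lemma mpow_deriv_self: "mpow_deriv \<alpha> z z = real (tdeg \<alpha>) * mpow \<alpha> z"
proof -
  have "z $ i * (real (\<alpha> i) * mpow (lower_exponent \<alpha> i) z) = real (\<alpha> i) * mpow \<alpha> z" for i
  proof (cases "\<alpha> i = 0")
    case False
    have "mpow \<alpha> z = (z $ i) ^ \<alpha> i * (\<Prod>j\<in>UNIV - {i}. (z $ j) ^ \<alpha> j)"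
      unfolding mpow_def by (simp add: prod.remove)
    moreover have "mpow (lower_exponent \<alpha> i) z = (z $ i) ^ (\<alpha> i - 1) * (\<Prod>j\<in>UNIV - {i}. (z $ j) ^ \<alpha> j)"
      unfolding mpow_def by (subst prod.remove[of _ i]) (auto simp: lower_exponent_def)
    moreover have "(z $ i) ^ \<alpha> i = z $ i * (z $ i) ^ (\<alpha> i - 1)"
      using False by (metis power_eq_if)
    ultimately show ?thesis by simp
  qed simp
  then show ?thesis unfolding mpow_deriv_def tdeg_def of_nat_sum sum_distrib_right by (intro sum.cong) auto
qed

text \<open>The loss in radius pays for the factor that differentiation brings down. The right hand side
  is the bound coming from \<open>m * r' ^ (m - 1) * (r - r') \<le> r ^ m - r' ^ m\<close>.\<close>

lemma power_gap:
  fixes r r' :: real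
  assumes "0 < r'" "r' < r"
  shows "real m * r' ^ (m - 1) \<le> r ^ m / (r - r')"
proof -
  have "real m * r' ^ (m - 1) * (r - r') \<le> r ^ m"
  proof (induction m)
    case (Suc m)
    have "real (Suc m) * r' ^ m * (r - r') = r' * (real m * r' ^ (m - 1) * (r - r')) + r' ^ m * (r - r')"
      by (cases m) (auto simp: algebra_simps)
    also have "\<dots> \<le> r' * r ^ m + r ^ m * (r - r')"
      using Suc assms by (intro add_mono mult_left_mono mult_right_mono power_mono) auto
    also have "\<dots> = r ^ Suc m" by (simp add: algebra_simps)
    finally show ?case by simp
  qed simp
  then show ?thesis using assms by (simp add: field_simps)
qed

lemma mpow_partial_bound:
  assumes "0 < r'" "norm z \<le> r'"
  shows "\<bar>h $ i * (real (\<alpha> i) * mpow (lower_exponent \<alpha> i) z)\<bar> \<le> norm h * (real (\<alpha> i) * r' ^ (tdeg \<alpha> - 1))"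
proof (cases "\<alpha> i = 0")
  case False
  have "\<bar>mpow (lower_exponent \<alpha> i) z\<bar> \<le> r' ^ (tdeg \<alpha> - 1)"
    using abs_mpow_le[OF assms(2), of "lower_exponent \<alpha> i"] tdeg_lower_exponent[of \<alpha> i, OF False] by simp
  then show ?thesis using component_le_norm_cart[of h i]
    by (auto simp: abs_mult intro!: mult_mono)
qed simp

lemma mpow_deriv_bound:
  assumes "0 < r'" "r' < r" "norm z \<le> r'"
  shows "\<bar>mpow_deriv \<alpha> z h\<bar> \<le> r ^ tdeg \<alpha> / (r - r') * norm h"
proof -
  have "\<bar>mpow_deriv \<alpha> z h\<bar> \<le> (\<Sum>i\<in>UNIV. norm h * (real (\<alpha> i) * r' ^ (tdeg \<alpha> - 1)))"
    unfolding mpow_deriv_def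
    by (rule order_trans[OF sum_abs]) (intro sum_mono mpow_partial_bound assms)
  also have "\<dots> = norm h * (real (tdeg \<alpha>) * r' ^ (tdeg \<alpha> - 1))"
    by (simp add: tdeg_def sum_distrib_left sum_distrib_right)
  also have "\<dots> \<le> norm h * (r ^ tdeg \<alpha> / (r - r'))"
    using power_gap[OF assms(1,2)] by (intro mult_left_mono) auto
  finally show ?thesis by (simp add: mult.commute)
qed

lemma psum_coeffs_deriv:
  fixes c :: "('n::finite \<Rightarrow> nat) \<Rightarrow> 'b::banach"
  assumes pc: "psum_coeffs a r S c f" and r: "r > 0" and x: "x \<in> ball a r"
  shows "f differentiable (at x)"
    and "((\<lambda>\<alpha>. mpow_deriv \<alpha> (x - a) h *\<^sub>R c \<alpha>) has_sum frechet_derivative f (at x) h) UNIV"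
proof -
  note c = psum_coeffsD[OF pc]
\<comment> \<open>A radius strictly between \<open>x\<close> and the boundary, where the derivatives are dominated.\<close>
  define r' where "r' = (dist a x + r) / 2"
  have r': "0 < r'" "r' < r" "x \<in> ball a r'"
    using x r zero_le_dist[of a x] by (auto simp: r'_def field_simps simp del: zero_le_dist)
  define B where "B \<alpha> = norm (c \<alpha>) * r ^ tdeg \<alpha> * (1 / (r - r'))" for \<alpha>
  have Bs: "B summable_on UNIV"
    unfolding B_def using r c(1)
    by (intro summable_on_cmult_left nonneg_bounded_sums(1)[where S = S]) auto
  have B0: "0 \<le> B \<alpha>" for \<alpha> using r r' by (simp add: B_def)
  have bound: "norm (mpow_deriv \<alpha> (y - a) h *\<^sub>R c \<alpha>) \<le> B \<alpha> * norm h" if "y \<in> ball a r'" for y \<alpha> h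
  proof -
    have "norm (mpow_deriv \<alpha> (y - a) h *\<^sub>R c \<alpha>) = \<bar>mpow_deriv \<alpha> (y - a) h\<bar> * norm (c \<alpha>)" by simp
    also have "\<dots> \<le> (r ^ tdeg \<alpha> / (r - r') * norm h) * norm (c \<alpha>)"
      by (rule mult_right_mono, rule mpow_deriv_bound)
        (use r' that in \<open>auto simp: dist_norm norm_minus_commute\<close>)
    finally show ?thesis by (simp add: B_def mult_ac)
  qed
  have d: "((\<lambda>y. mpow \<alpha> (y - a) *\<^sub>R c \<alpha>) has_derivative (\<lambda>h. mpow_deriv \<alpha> (y - a) h *\<^sub>R c \<alpha>)) (at y)" for \<alpha> y
    by (rule has_derivative_scaleR_left, rule has_derivative_compose[where f = "\<lambda>y. y - a" and g = "mpow \<alpha>" and f' = "\<lambda>h. h", simplified])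
      (auto intro!: has_derivative_mpow derivative_eq_intros)
  note D = has_derivative_has_sum[OF open_ball convex_ball d bound Bs B0 c(2) r'(3)]
  have sub: "y \<in> ball a r" if "y \<in> ball a r'" for y using that r' by auto
  have 1: "(f has_derivative (\<lambda>h. infsum (\<lambda>\<alpha>. mpow_deriv \<alpha> (x - a) h *\<^sub>R c \<alpha>) UNIV)) (at x)"
    by (rule D(1)) (use sub in auto)
  then show "f differentiable (at x)" by (auto simp: differentiable_def)
  have 2: "frechet_derivative f (at x) = (\<lambda>h. infsum (\<lambda>\<alpha>. mpow_deriv \<alpha> (x - a) h *\<^sub>R c \<alpha>) UNIV)"
    using frechet_derivative_at[OF 1] by simp
  show "((\<lambda>\<alpha>. mpow_deriv \<alpha> (x - a) h *\<^sub>R c \<alpha>) has_sum frechet_derivative f (at x) h) UNIV"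
    unfolding 2 by (rule D(2)) (use sub in auto)
qed

lemma psum_deriv:
  fixes f :: "real^'n::finite \<Rightarrow> 'b::banach"
  assumes f: "psum a r S f" and r': "0 < r'" "r' < r"
  shows "psum a r' (S / (r - r') * norm h) (\<lambda>x. frechet_derivative f (at x) h)"
proof -
  obtain c where pc: "psum_coeffs a r S c f"
    using f unfolding psum_def by blast
  note c = psum_coeffsD[OF pc]
  have r: "r > 0" using r' by simp
  have S0: "S \<ge> 0" using psum_bound_nonneg[OF f] .
  let ?T = "\<lambda>\<alpha>. norm (c \<alpha>) * r ^ tdeg \<alpha> * (norm h / (r - r'))"
  let ?c = "\<lambda>p. (h $ snd p * real (fst p (snd p))) *\<^sub>R c (fst p)"
  have outer: "sum ?T F \<le> S / (r - r') * norm h" if "finite F" for F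
  proof -
    have "sum ?T F = (\<Sum>\<alpha>\<in>F. norm (c \<alpha>) * r ^ tdeg \<alpha>) * (norm h / (r - r'))"
      by (rule sum_distrib_right[symmetric])
    also have "\<dots> \<le> S * (norm h / (r - r'))"
      using c(1)[OF that] r' by (intro mult_right_mono) auto
    finally show ?thesis by simp
  qed
  have inner0: "(\<Sum>i\<in>F. norm h * (real (\<alpha> i) * r' ^ (tdeg \<alpha> - 1)) * norm (c \<alpha>)) \<le> ?T \<alpha>" for \<alpha> and F :: "'n set"
  proof -
    have "(\<Sum>i\<in>F. norm h * (real (\<alpha> i) * r' ^ (tdeg \<alpha> - 1)) * norm (c \<alpha>))
        \<le> (\<Sum>i\<in>UNIV. norm h * (real (\<alpha> i) * r' ^ (tdeg \<alpha> - 1)) * norm (c \<alpha>))"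
      using r' by (intro sum_mono2) auto
    also have "\<dots> = norm h * norm (c \<alpha>) * (real (tdeg \<alpha>) * r' ^ (tdeg \<alpha> - 1))"
      by (simp add: tdeg_def sum_distrib_left sum_distrib_right mult_ac)
    also have "\<dots> \<le> norm h * norm (c \<alpha>) * (r ^ tdeg \<alpha> / (r - r'))"
      using power_gap[OF r'] by (intro mult_left_mono) auto
    finally show ?thesis by (simp add: mult_ac)
  qed
  show ?thesis
  proof (rule psum_regroup[OF r'(1), where e = "\<lambda>p. lower_exponent (fst p) (snd p)" and c = ?c])
    fix F :: "(('n \<Rightarrow> nat) \<times> 'n) set" assume F: "finite F"
    show "(\<Sum>p\<in>F. norm (?c p) * r' ^ tdeg (lower_exponent (fst p) (snd p))) \<le> S / (r - r') * norm h"
    proof (rule sum_UNIV_pairs_le[OF _ _ outer F])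
      fix \<alpha> and G :: "'n set" assume "finite G"
      have "norm (?c (\<alpha>, i)) * r' ^ tdeg (lower_exponent \<alpha> i) \<le> norm h * (real (\<alpha> i) * r' ^ (tdeg \<alpha> - 1)) * norm (c \<alpha>)" for i
      proof (cases "\<alpha> i = 0")
        case False
        have "norm (?c (\<alpha>, i)) * r' ^ tdeg (lower_exponent \<alpha> i) = \<bar>h $ i\<bar> * (real (\<alpha> i) * r' ^ (tdeg \<alpha> - 1)) * norm (c \<alpha>)"
          using False by (simp add: tdeg_lower_exponent abs_mult)
        also have "\<dots> \<le> norm h * (real (\<alpha> i) * r' ^ (tdeg \<alpha> - 1)) * norm (c \<alpha>)"
          using component_le_norm_cart[of h i] r' by (intro mult_right_mono) auto
        finally show ?thesis .
      qed simp
      then have "(\<Sum>i\<in>G. norm (?c (\<alpha>, i)) * r' ^ tdeg (lower_exponent \<alpha> i))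
        \<le> (\<Sum>i\<in>G. norm h * (real (\<alpha> i) * r' ^ (tdeg \<alpha> - 1)) * norm (c \<alpha>))"
        by (rule sum_mono)
      also have "\<dots> \<le> ?T \<alpha>" by (rule inner0)
      finally show "(\<Sum>i\<in>G. norm (?c (\<alpha>, i)) * r' ^ tdeg (lower_exponent (fst (\<alpha>, i)) (snd (\<alpha>, i)))) \<le> ?T \<alpha>" by simp
    qed (use r' in auto)
  next
    fix x assume x: "x \<in> ball a r'"
    then have xr: "x \<in> ball a r" and nx: "norm (x - a) \<le> r'"
      using r' by (auto simp: dist_norm norm_minus_commute)
    let ?h = "\<lambda>p. mpow (lower_exponent (fst p) (snd p)) (x - a) *\<^sub>R ?c p"
    have "(\<lambda>p. norm (?h p)) summable_on UNIV"
    proof (rule nonneg_bounded_sums(1))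
      fix F :: "(('n \<Rightarrow> nat) \<times> 'n) set" assume F: "finite F"
      show "(\<Sum>p\<in>F. norm (?h p)) \<le> S / (r - r') * norm h"
      proof (rule sum_UNIV_pairs_le[OF _ _ outer F])
        fix \<alpha> and G :: "'n set" assume "finite G"
        have "norm (?h (\<alpha>, i)) \<le> norm h * (real (\<alpha> i) * r' ^ (tdeg \<alpha> - 1)) * norm (c \<alpha>)" for i
        proof -
          have "norm (?h (\<alpha>, i)) = \<bar>h $ i * (real (\<alpha> i) * mpow (lower_exponent \<alpha> i) (x - a))\<bar> * norm (c \<alpha>)"
            by (simp add: abs_mult mult_ac)
          also have "\<dots> \<le> norm h * (real (\<alpha> i) * r' ^ (tdeg \<alpha> - 1)) * norm (c \<alpha>)"
            by (intro mult_right_mono mpow_partial_bound r' nx) auto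
          finally show ?thesis .
        qed
        then have "(\<Sum>i\<in>G. norm (?h (\<alpha>, i))) \<le> (\<Sum>i\<in>G. norm h * (real (\<alpha> i) * r' ^ (tdeg \<alpha> - 1)) * norm (c \<alpha>))"
          by (rule sum_mono)
        also have "\<dots> \<le> ?T \<alpha>" by (rule inner0)
        finally show "(\<Sum>i\<in>G. norm (?h (\<alpha>, i))) \<le> ?T \<alpha>" .
      qed auto
    qed auto
    then have s: "?h summable_on (UNIV \<times> UNIV)" by (simp add: abs_summable_summable)
    have "(?h has_sum frechet_derivative f (at x) h) (UNIV \<times> UNIV)"
    proof (rule has_sum_SigmaI[OF _ psum_coeffs_deriv(2)[OF pc r xr, of h] s])
      show "((\<lambda>i. ?h (\<alpha>, i)) has_sum mpow_deriv \<alpha> (x - a) h *\<^sub>R c \<alpha>) UNIV" for \<alpha>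
        by (rule has_sum_finiteI) (auto simp: mpow_deriv_def scaleR_sum_left mult_ac)
    qed
    then show "(?h has_sum frechet_derivative f (at x) h) UNIV" by simp
  qed
qed

lemma psum_differentiable:
  assumes "psum a r S f" "r > 0" "x \<in> ball a r"
  shows "f differentiable (at x)"
  using assms psum_coeffs_deriv(1) unfolding psum_def by blast

text \<open>The radial primitive of a series without constant term: Euler's relation shows that
  dividing each coefficient by the degree of its monomial solves the equation, and this does not
  increase the bound.\<close>

lemma psum_euler_primitive:
  fixes q :: "real^'n::finite \<Rightarrow> 'b::banach"
  assumes q: "psum a r S q" and r: "r > 0" and q0: "q a = 0"
  shows "\<exists>F. psum a r S F \<and> F a = 0 \<and> (\<forall>x\<in>ball a r. frechet_derivative F (at x) (x - a) = q x)"
proof -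
  obtain c where pc: "psum_coeffs a r S c q"
    using q unfolding psum_def by blast
  note c = psum_coeffsD[OF pc]
  have c0: "c (\<lambda>_. 0) = 0" using psum_at_center[of r a c q] c(2)[of a] r q0 by auto
  define d where "d \<alpha> = (1 / real (tdeg \<alpha>)) *\<^sub>R c \<alpha>" for \<alpha>
  define F where "F x = infsum (\<lambda>\<alpha>. mpow \<alpha> (x - a) *\<^sub>R d \<alpha>) UNIV" for x
  have dc: "norm (d \<alpha>) \<le> norm (c \<alpha>)" for \<alpha>
  proof -
    have "norm (d \<alpha>) = norm (c \<alpha>) / real (tdeg \<alpha>)" by (simp add: d_def)
    also have "\<dots> \<le> norm (c \<alpha>)" by (cases "tdeg \<alpha>") (auto simp: divide_le_eq_1 field_simps)
    finally show ?thesis .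
  qed
  have b: "(\<Sum>\<alpha>\<in>F. norm (d \<alpha>) * r ^ tdeg \<alpha>) \<le> S" if "finite F" for F
  proof -
    have "(\<Sum>\<alpha>\<in>F. norm (d \<alpha>) * r ^ tdeg \<alpha>) \<le> (\<Sum>\<alpha>\<in>F. norm (c \<alpha>) * r ^ tdeg \<alpha>)"
      using dc r by (intro sum_mono mult_right_mono) auto
    with c(1)[OF that] show ?thesis by linarith
  qed
  have F: "psum_coeffs a r S d F"
    unfolding psum_coeffs_def
  proof (intro conjI allI impI ballI b)
    fix x assume "x \<in> ball a r"
    then have "norm (x - a) \<le> r" by (simp add: dist_norm norm_minus_commute)
    from abs_summable_summable[OF psum_abs_summable(1)[OF r b this]]
    show "((\<lambda>\<alpha>. mpow \<alpha> (x - a) *\<^sub>R d \<alpha>) has_sum F x) UNIV" unfolding F_def by simp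
  qed
  have "F a = 0"
    using psum_at_center[of r a d F] psum_coeffsD(2)[OF F, of a] r by (simp add: d_def tdeg_def)
  moreover have "frechet_derivative F (at x) (x - a) = q x" if x: "x \<in> ball a r" for x
  proof (rule has_sum_unique[OF psum_coeffs_deriv(2)[OF F r x]])
    have "mpow_deriv \<alpha> (x - a) (x - a) *\<^sub>R d \<alpha> = mpow \<alpha> (x - a) *\<^sub>R c \<alpha>" for \<alpha>
      by (cases "tdeg \<alpha> = 0") (auto simp: mpow_deriv_self d_def tdeg_0_iff c0)
    then show "((\<lambda>\<alpha>. mpow_deriv \<alpha> (x - a) (x - a) *\<^sub>R d \<alpha>) has_sum q x) UNIV"
      using c(2)[OF x] by simp
  qed
  ultimately show ?thesis using F unfolding psum_def by blast
qed

lemma psum_Ck: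
  fixes f :: "real^'n::finite \<Rightarrow> 'b::banach"
  assumes "\<And>r'. 0 < r' \<Longrightarrow> r' < r \<Longrightarrow> \<exists>S. psum a r' S f"
  shows "Ck_on k f (ball a r)"
  using assms
proof (induction k arbitrary: f)
  have diff: "f differentiable (at x)" if f: "\<And>r'. 0 < r' \<Longrightarrow> r' < r \<Longrightarrow> \<exists>S. psum a r' S f"
    and x: "x \<in> ball a r" for x and f :: "real^'n \<Rightarrow> 'b"
  proof -
    define r' where "r' = (dist a x + r) / 2"
    have r': "0 < r'" "r' < r" "x \<in> ball a r'"
      using x zero_le_dist[of a x] by (auto simp: r'_def field_simps simp del: zero_le_dist)
    then show ?thesis using f psum_differentiable by blast
  qed
  {
    case 0
    then show ?case using diff[OF 0] 
      by (auto intro!: continuous_at_imp_continuous_on differentiable_imp_continuous_within)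
  next
    case (Suc k)
    have "\<exists>S. psum a r' S (\<lambda>x. frechet_derivative f (at x) v)" if r': "0 < r'" "r' < r" for v r'
    proof -
      obtain r'' where "r' < r''" "r'' < r" using dense[OF r'(2)] by blast
      then obtain S where "psum a r'' S f" using Suc.prems[of r''] r' by auto
      then show ?thesis using psum_deriv[OF _ r'(1) \<open>r' < r''\<close>] by blast
    qed
    then have "Ck_on k (\<lambda>x. frechet_derivative f (at x) v) (ball a r)" for v
      by (intro Suc.IH) auto
    then show ?case using diff[OF Suc.prems] by (simp del: mem_ball)
  }
qed

lemma psum_smooth: 
  assumes "psum a r S f"
  shows "smooth_on f (ball a r)"
  unfolding smooth_on_def
proof (intro allI psum_Ck)
  show "\<exists>S. psum a r' S f" if "0 < r'" "r' < r" for r'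
    using psum_shrink[OF assms, of r'] that by auto
qed

section \<open>Calculus of smooth maps\<close>

lemma frechet_derivative_cong_open:
  assumes "open S" "x \<in> S" "\<And>y. y \<in> S \<Longrightarrow> f y = g y"
  shows "frechet_derivative f (at x) = frechet_derivative g (at x)"
proof -
  have "(f has_derivative D) (at x) \<longleftrightarrow> (g has_derivative D) (at x)" for D
    using has_derivative_transform_within_open[of f D x UNIV S g]
      has_derivative_transform_within_open[of g D x UNIV S f] assms by auto
  then show ?thesis unfolding frechet_derivative_def by simp
qed

lemma differentiable_cong_open:
  assumes "open S" "x \<in> S" "\<And>y. y \<in> S \<Longrightarrow> f y = g y" "f differentiable (at x)"
  shows "g differentiable (at x)"
  using assms has_derivative_transform_within_open unfolding differentiable_def by blast

lemma has_derivative_frechet: "f differentiable (at x) \<Longrightarrow> (f has_derivative frechet_derivative f (at x)) (at x)"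
  by (simp add: frechet_derivative_works[symmetric])

lemma linear_frechet: "f differentiable (at x) \<Longrightarrow> linear (frechet_derivative f (at x))"
  using has_derivative_frechet has_derivative_linear by blast

lemma Ck_on_cong:
  assumes "open S" "\<And>x. x \<in> S \<Longrightarrow> f x = g x" "Ck_on k f S"
  shows "Ck_on k g S"
  using assms(2,3)
proof (induction k arbitrary: f g)
  case 0 then show ?case by (auto cong: continuous_on_cong)
next
  case (Suc k)
  have "Ck_on k (\<lambda>x. frechet_derivative g (at x) v) S" for v
    by (rule Suc.IH[of "\<lambda>x. frechet_derivative f (at x) v"])
      (use Suc.prems frechet_derivative_cong_open[OF assms(1) _ Suc.prems(1)] in auto)
  moreover have "g differentiable (at x)" if "x \<in> S" for x
    using differentiable_cong_open[OF assms(1) that] Suc.prems that by (metis Ck_on.simps(2))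
  ultimately show ?case by simp
qed

lemma Ck_on_subset: "Ck_on k f S \<Longrightarrow> T \<subseteq> S \<Longrightarrow> Ck_on k f T"
  by (induction k arbitrary: f) (auto intro: continuous_on_subset)

lemma Ck_on_Suc_imp: "Ck_on (Suc k) f S \<Longrightarrow> Ck_on k f S"
proof (induction k arbitrary: f)
  case 0 then show ?case
    by (auto intro!: continuous_at_imp_continuous_on differentiable_imp_continuous_within)
next
  case (Suc k) then show ?case by (metis Ck_on.simps(2))
qed

lemma Ck_on_const: "Ck_on k (\<lambda>_. c) S"
  by (induction k arbitrary: c) (auto simp: frechet_derivative_const)

lemma Ck_on_bounded_linear:
  assumes "open S" "bounded_linear L" "Ck_on k f S"
  shows "Ck_on k (\<lambda>x. L (f x)) S"
  using assms(3)
proof (induction k arbitrary: f)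
  case 0 then show ?case
    using assms(2) by (auto intro: bounded_linear.continuous_on)
next
  case (Suc k)
  have d: "((\<lambda>x. L (f x)) has_derivative (\<lambda>v. L (frechet_derivative f (at x) v))) (at x)" if "x \<in> S" for x
    using Suc.prems that by (intro bounded_linear.has_derivative[OF assms(2)] has_derivative_frechet) auto
  have "Ck_on k (\<lambda>x. frechet_derivative (\<lambda>x. L (f x)) (at x) v) S" for v
    by (rule Ck_on_cong[OF assms(1) _ Suc.IH[of "\<lambda>x. frechet_derivative f (at x) v"]])
      (use Suc.prems frechet_derivative_at[OF d] in \<open>auto intro: fun_cong\<close>)
  then show ?case using d by (auto simp: differentiable_def)
qed

lemma Ck_on_add:
  assumes "open S" "Ck_on k f S" "Ck_on k g S"
  shows "Ck_on k (\<lambda>x. f x + g x) S"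
  using assms(2,3)
proof (induction k arbitrary: f g)
  case 0 then show ?case by (auto intro: continuous_intros)
next
  case (Suc k)
  have d: "((\<lambda>x. f x + g x) has_derivative (\<lambda>v. frechet_derivative f (at x) v + frechet_derivative g (at x) v)) (at x)" if "x \<in> S" for x
    using Suc.prems that by (intro has_derivative_add has_derivative_frechet) auto
  have "Ck_on k (\<lambda>x. frechet_derivative (\<lambda>x. f x + g x) (at x) v) S" for v
    by (rule Ck_on_cong[OF assms(1) _ Suc.IH[of "\<lambda>x. frechet_derivative f (at x) v" "\<lambda>x. frechet_derivative g (at x) v"]])
      (use Suc.prems frechet_derivative_at[OF d] in \<open>auto intro: fun_cong\<close>)
  then show ?case using d by (auto simp: differentiable_def)
qed

lemma Ck_on_bilinear:
  assumes "open S" "bounded_bilinear B" "Ck_on k f S" "Ck_on k g S"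
  shows "Ck_on k (\<lambda>x. B (f x) (g x)) S"
  using assms(3,4)
proof (induction k arbitrary: f g)
  case 0 then show ?case using assms(2) by (auto intro: bounded_bilinear.continuous_on)
next
  case (Suc k)
  have d: "((\<lambda>x. B (f x) (g x)) has_derivative
      (\<lambda>v. B (f x) (frechet_derivative g (at x) v) + B (frechet_derivative f (at x) v) (g x))) (at x)" if "x \<in> S" for x
    using Suc.prems that by (intro bounded_bilinear.FDERIV[OF assms(2)] has_derivative_frechet) auto
  have "Ck_on k (\<lambda>x. B (f x) (frechet_derivative g (at x) v) + B (frechet_derivative f (at x) v) (g x)) S" for v
    using Suc.prems Ck_on_Suc_imp[of k f S] Ck_on_Suc_imp[of k g S]
    by (intro Ck_on_add[OF assms(1)] Suc.IH) auto
  then have "Ck_on k (\<lambda>x. frechet_derivative (\<lambda>x. B (f x) (g x)) (at x) v) S" for v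
    by (rule Ck_on_cong[OF assms(1), rotated]) (simp add: frechet_derivative_at[OF d, symmetric])
  then show ?case using d by (auto simp: differentiable_def)
qed

lemma Ck_on_sum:
  assumes "open S" "\<And>i. i \<in> I \<Longrightarrow> Ck_on k (f i) S"
  shows "Ck_on k (\<lambda>x. \<Sum>i\<in>I. f i x) S"
  using assms(2) by (induction I rule: infinite_finite_induct) (auto intro: Ck_on_const Ck_on_add[OF assms(1)])

lemma linear_axis_expand:
  fixes f :: "real^'n::finite \<Rightarrow> 'b::real_vector"
  assumes "linear f" shows "f v = (\<Sum>i\<in>UNIV. v $ i *\<^sub>R f (axis i 1))"
proof -
  have "f v = f (\<Sum>i\<in>UNIV. v $ i *\<^sub>R axis i 1)"
    using basis_expansion[of v] by (simp add: scalar_mult_eq_scaleR)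
  then show ?thesis by (simp add: linear_sum[OF assms] linear_scale[OF assms])
qed

lemma linear_basis_expand:
  fixes f :: "'a::euclidean_space \<Rightarrow> 'b::real_vector"
  assumes "linear f" shows "f v = (\<Sum>b\<in>Basis. (v \<bullet> b) *\<^sub>R f b)"
proof -
  have "f v = f (\<Sum>b\<in>Basis. (v \<bullet> b) *\<^sub>R b)" by (simp add: euclidean_representation)
  then show ?thesis by (simp add: linear_sum[OF assms] linear_scale[OF assms])
qed

text \<open>The chain rule expresses the derivative in a direction \<open>v\<close> through the partial derivatives of
  \<open>f\<close>, which are again maps composed with \<open>g\<close>; so the induction hypothesis applies to each of them.\<close>

lemma Ck_on_compose:
  fixes f :: "real^'k::finite \<Rightarrow> 'b::real_normed_vector" and g :: "real^'n::finite \<Rightarrow> real^'k"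
  assumes S: "open S" and g: "Ck_on k g S" and f: "Ck_on k f T" and ST: "g ` S \<subseteq> T"
  shows "Ck_on k (\<lambda>x. f (g x)) S"
  using g f
proof (induction k arbitrary: f)
  case 0 then show ?case using ST by (auto intro: continuous_on_compose2)
next
  case (Suc k)
  have d: "((\<lambda>x. f (g x)) has_derivative (\<lambda>v. frechet_derivative f (at (g x)) (frechet_derivative g (at x) v))) (at x)"
    if "x \<in> S" for x
    using Suc.prems that ST by (intro has_derivative_compose[OF has_derivative_frechet has_derivative_frechet]) auto
  have e: "frechet_derivative (\<lambda>x. f (g x)) (at x) v
      = (\<Sum>i\<in>UNIV. (frechet_derivative g (at x) v $ i) *\<^sub>R frechet_derivative f (at (g x)) (axis i 1))" if "x \<in> S" for x v
  proof -
    have "linear (frechet_derivative f (at (g x)))"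
      using Suc.prems that ST by (intro linear_frechet) auto
    then show ?thesis
      unfolding frechet_derivative_at[OF d[OF that], symmetric] by (rule linear_axis_expand)
  qed
  have "Ck_on k (\<lambda>x. \<Sum>i\<in>UNIV. (frechet_derivative g (at x) v $ i) *\<^sub>R frechet_derivative f (at (g x)) (axis i 1)) S" for v
    using Suc.prems Ck_on_Suc_imp[OF Suc.prems(1)]
    by (intro Ck_on_sum[OF S] Ck_on_bilinear[OF S bounded_bilinear_scaleR]
        Ck_on_bounded_linear[OF S bounded_linear_vec_nth] Suc.IH) auto
  then have "Ck_on k (\<lambda>x. frechet_derivative (\<lambda>x. f (g x)) (at x) v) S" for v
    by (rule Ck_on_cong[OF S, rotated]) (use e in auto)
  then show ?case using d by (auto simp: differentiable_def)
qed

lemma smooth_on_cong: "open S \<Longrightarrow> (\<And>x. x \<in> S \<Longrightarrow> f x = g x) \<Longrightarrow> smooth_on f S \<Longrightarrow> smooth_on g S"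
  unfolding smooth_on_def using Ck_on_cong by blast

lemma smooth_on_subset: "smooth_on f S \<Longrightarrow> T \<subseteq> S \<Longrightarrow> smooth_on f T"
  unfolding smooth_on_def using Ck_on_subset by blast

lemma smooth_on_const: "smooth_on (\<lambda>_. c) S"
  unfolding smooth_on_def using Ck_on_const by blast

lemma smooth_on_bounded_linear: "open S \<Longrightarrow> bounded_linear L \<Longrightarrow> smooth_on f S \<Longrightarrow> smooth_on (\<lambda>x. L (f x)) S"
  unfolding smooth_on_def using Ck_on_bounded_linear by blast

lemma smooth_on_add: "open S \<Longrightarrow> smooth_on f S \<Longrightarrow> smooth_on g S \<Longrightarrow> smooth_on (\<lambda>x. f x + g x) S"
  unfolding smooth_on_def using Ck_on_add by blast

lemma smooth_on_bilinear:
  "open S \<Longrightarrow> bounded_bilinear B \<Longrightarrow> smooth_on f S \<Longrightarrow> smooth_on g S \<Longrightarrow> smooth_on (\<lambda>x. B (f x) (g x)) S"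
  unfolding smooth_on_def using Ck_on_bilinear by blast

lemma smooth_on_sum: "open S \<Longrightarrow> (\<And>i. i \<in> I \<Longrightarrow> smooth_on (f i) S) \<Longrightarrow> smooth_on (\<lambda>x. \<Sum>i\<in>I. f i x) S"
  by (simp add: smooth_on_def Ck_on_sum)

lemma smooth_on_compose:
  "open S \<Longrightarrow> smooth_on g S \<Longrightarrow> smooth_on f T \<Longrightarrow> g ` S \<subseteq> T \<Longrightarrow> smooth_on (\<lambda>x. f (g x)) S"
  unfolding smooth_on_def using Ck_on_compose by blast

lemma smooth_on_differentiable: "smooth_on f S \<Longrightarrow> x \<in> S \<Longrightarrow> f differentiable (at x)"
  unfolding smooth_on_def using Ck_on.simps(2)[of 0 f S] by blast

lemma smooth_on_deriv: "smooth_on f S \<Longrightarrow> smooth_on (\<lambda>x. frechet_derivative f (at x) v) S"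
  unfolding smooth_on_def using Ck_on.simps(2)[of _ f S] by blast

lemma smooth_on_continuous: "smooth_on f S \<Longrightarrow> continuous_on S f"
  unfolding smooth_on_def using Ck_on.simps(1) by blast

lemma smooth_on_open_cover:
  assumes "\<And>x. x \<in> S \<Longrightarrow> \<exists>T. open T \<and> x \<in> T \<and> smooth_on f T"
  shows "smooth_on f S"
proof -
  have "Ck_on k f S" if "\<And>x. x \<in> S \<Longrightarrow> \<exists>T. open T \<and> x \<in> T \<and> Ck_on k f T" for k
    using that
  proof (induction k arbitrary: f)
    case 0
    have "isCont f x" if "x \<in> S" for x
      using 0[OF that] continuous_on_eq_continuous_at by auto
    then show ?case by (auto intro!: continuous_at_imp_continuous_on)
  next
    case (Suc k)
    have "Ck_on k (\<lambda>x. frechet_derivative f (at x) v) S" for v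
      by (rule Suc.IH) (use Suc.prems in fastforce)
    moreover have "f differentiable (at x)" if "x \<in> S" for x
      using Suc.prems[OF that] by auto
    ultimately show ?case by simp
  qed
  then show ?thesis using assms unfolding smooth_on_def by meson
qed

lemma has_vector_derivative_line:
  assumes "f differentiable (at (x + t *\<^sub>R v))"
  shows "((\<lambda>t. f (x + t *\<^sub>R v)) has_vector_derivative frechet_derivative f (at (x + t *\<^sub>R v)) v) (at t)"
proof -
  have "((\<lambda>t. f (x + t *\<^sub>R v)) has_derivative (\<lambda>s. frechet_derivative f (at (x + t *\<^sub>R v)) (s *\<^sub>R v))) (at t)"
    by (rule has_derivative_compose[where f = "\<lambda>t. x + t *\<^sub>R v" and g = f, OF _ has_derivative_frechet[OF assms]])
      (auto intro!: derivative_eq_intros)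
  then show ?thesis
    by (simp add: has_vector_derivative_def linear_scale[OF linear_frechet[OF assms]])
qed

lemma DERIV_line:
  fixes f :: "real^'n::finite \<Rightarrow> real"
  assumes "f differentiable (at (x + t *\<^sub>R v))"
  shows "((\<lambda>t. f (x + t *\<^sub>R v)) has_real_derivative frechet_derivative f (at (x + t *\<^sub>R v)) v) (at t)"
  using has_vector_derivative_line[OF assms] by (simp add: has_real_derivative_iff_has_vector_derivative)

text \<open>Two applications of the mean value theorem, in the direction \<open>u\<close> and then in the direction
  \<open>v\<close>, write the quotient as a mixed derivative at a nearby point.\<close>

lemma second_difference_quotient:
  fixes f :: "real^'n::finite \<Rightarrow> real"
  assumes S: "open S" and f: "Ck_on 2 f S" and x: "x \<in> S" and e: "e > 0"
  shows "\<exists>d>0. \<forall>h. 0 < h \<and> h < d \<longrightarrow>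
    \<bar>(f (x + h *\<^sub>R u + h *\<^sub>R v) - f (x + h *\<^sub>R u) - f (x + h *\<^sub>R v) + f x) / h\<^sup>2
      - frechet_derivative (\<lambda>y. frechet_derivative f (at y) u) (at x) v\<bar> < e"
proof -
  define fu where "fu y = frechet_derivative f (at y) u" for y
  define fuv where "fuv y = frechet_derivative fu (at y) v" for y
  have df: "f differentiable (at y)" and dfu: "fu differentiable (at y)" if "y \<in> S" for y
    using f that by (auto simp: numeral_2_eq_2 fu_def[abs_def])
  have cont: "continuous_on S fuv"
    using f by (auto simp: numeral_2_eq_2 fu_def[abs_def] fuv_def[abs_def])
  obtain d0 where d0: "d0 > 0" "ball x d0 \<subseteq> S" using S x openE by blast
  obtain d1 where d1: "d1 > 0" "\<And>y. y \<in> S \<Longrightarrow> dist y x < d1 \<Longrightarrow> dist (fuv y) (fuv x) < e"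
    using cont x e unfolding continuous_on_iff by blast
  define N where "N = norm u + norm v + 1"
  have N: "N > 0" by (simp add: N_def add_nonneg_pos)
  define d where "d = min d0 d1 / N"
  have d: "d > 0" using d0 d1 N by (simp add: d_def)
  have near: "y \<in> S \<and> dist y x < d1" if y: "y = x + a *\<^sub>R u + b *\<^sub>R v" and ab: "0 \<le> a" "a \<le> h" "0 \<le> b" "b \<le> h" "h < d" for y a b h
  proof -
    have "norm (a *\<^sub>R u + b *\<^sub>R v) \<le> a * norm u + b * norm v"
      using norm_triangle_ineq[of "a *\<^sub>R u" "b *\<^sub>R v"] ab by simp
    also have "\<dots> \<le> h * norm u + h * norm v" using ab by (intro add_mono mult_right_mono) auto
    also have "\<dots> \<le> h * N" using ab by (simp add: N_def algebra_simps)
    also have "\<dots> < d * N" using ab N by simp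
    also have "\<dots> = min d0 d1" using N by (simp add: d_def)
    finally have "dist y x < min d0 d1" by (simp add: y dist_norm add.assoc)
    then show ?thesis using d0 by (auto simp: dist_commute subset_iff)
  qed
  show ?thesis
  proof (intro exI[of _ d] conjI allI impI d)
    fix h assume h: "0 < h \<and> h < d"
    define \<phi> where "\<phi> s = f ((x + h *\<^sub>R v) + s *\<^sub>R u) - f (x + s *\<^sub>R u)" for s
    have "\<exists>z>0. z < h \<and> \<phi> h - \<phi> 0 = (h - 0) * (fu ((x + h *\<^sub>R v) + z *\<^sub>R u) - fu (x + z *\<^sub>R u))"
    proof (rule MVT2)
      fix s assume s: "0 \<le> s" "s \<le> h"
      have 1: "(x + h *\<^sub>R v) + s *\<^sub>R u \<in> S" "x + s *\<^sub>R u \<in> S"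
        using near[of _ s h h] near[of _ s 0 h] s h by (auto simp: add_ac)
      show "(\<phi> has_real_derivative fu ((x + h *\<^sub>R v) + s *\<^sub>R u) - fu (x + s *\<^sub>R u)) (at s)"
        unfolding \<phi>_def[abs_def] fu_def
        by (intro DERIV_diff DERIV_line df 1)
    qed (use h in auto)
    then obtain z where z: "0 < z" "z < h" "\<phi> h - \<phi> 0 = h * (fu ((x + z *\<^sub>R u) + h *\<^sub>R v) - fu (x + z *\<^sub>R u))"
      by (auto simp: add_ac)
    have "\<exists>w>0. w < h \<and> fu ((x + z *\<^sub>R u) + h *\<^sub>R v) - fu ((x + z *\<^sub>R u) + 0 *\<^sub>R v) = (h - 0) * fuv ((x + z *\<^sub>R u) + w *\<^sub>R v)"
    proof (rule MVT2)
      fix s assume s: "0 \<le> s" "s \<le> h"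
      have 1: "(x + z *\<^sub>R u) + s *\<^sub>R v \<in> S"
        using near[of _ z s h] s h z by auto
      show "((\<lambda>s. fu ((x + z *\<^sub>R u) + s *\<^sub>R v)) has_real_derivative fuv ((x + z *\<^sub>R u) + s *\<^sub>R v)) (at s)"
        unfolding fuv_def
        by (intro DERIV_line dfu 1)
    qed (use h in auto)
    then obtain w where w: "0 < w" "w < h" "fu ((x + z *\<^sub>R u) + h *\<^sub>R v) - fu (x + z *\<^sub>R u) = h * fuv (x + z *\<^sub>R u + w *\<^sub>R v)"
      by auto
    have "(f (x + h *\<^sub>R u + h *\<^sub>R v) - f (x + h *\<^sub>R u) - f (x + h *\<^sub>R v) + f x) = \<phi> h - \<phi> 0"
      by (simp add: \<phi>_def add_ac)
    also have "\<dots> = h\<^sup>2 * fuv (x + z *\<^sub>R u + w *\<^sub>R v)"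
      using z(3) w(3) by (simp add: power2_eq_square)
    finally have "(f (x + h *\<^sub>R u + h *\<^sub>R v) - f (x + h *\<^sub>R u) - f (x + h *\<^sub>R v) + f x) / h\<^sup>2 = fuv (x + z *\<^sub>R u + w *\<^sub>R v)"
      using h by simp
    moreover have "\<bar>fuv (x + z *\<^sub>R u + w *\<^sub>R v) - fuv x\<bar> < e"
      using d1(2)[of "x + z *\<^sub>R u + w *\<^sub>R v"] near[of _ z w h] z w h by (auto simp: dist_real_def)
    ultimately show "\<bar>(f (x + h *\<^sub>R u + h *\<^sub>R v) - f (x + h *\<^sub>R u) - f (x + h *\<^sub>R v) + f x) / h\<^sup>2
      - frechet_derivative (\<lambda>y. frechet_derivative f (at y) u) (at x) v\<bar> < e"
      by (simp add: fuv_def fu_def[abs_def])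
  qed
qed

text \<open>The second difference is symmetric in \<open>u\<close> and \<open>v\<close>, and both mixed derivatives are
  limits of its quotient.\<close>

lemma symmetric_second_derivative_real:
  fixes f :: "real^'n::finite \<Rightarrow> real"
  assumes "open S" "Ck_on 2 f S" "x \<in> S"
  shows "frechet_derivative (\<lambda>y. frechet_derivative f (at y) u) (at x) v
       = frechet_derivative (\<lambda>y. frechet_derivative f (at y) v) (at x) u" (is "?A = ?B")
proof (rule ccontr)
  assume "?A \<noteq> ?B"
  then have e: "\<bar>?A - ?B\<bar> / 2 > 0" by simp
  obtain d where d: "d > 0" "\<And>h. 0 < h \<and> h < d \<Longrightarrow>
      \<bar>(f (x + h *\<^sub>R u + h *\<^sub>R v) - f (x + h *\<^sub>R u) - f (x + h *\<^sub>R v) + f x) / h\<^sup>2 - ?A\<bar> < \<bar>?A - ?B\<bar> / 2"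
    using second_difference_quotient[OF assms e, of u v] by blast
  obtain d' where d': "d' > 0" "\<And>h. 0 < h \<and> h < d' \<Longrightarrow>
      \<bar>(f (x + h *\<^sub>R v + h *\<^sub>R u) - f (x + h *\<^sub>R v) - f (x + h *\<^sub>R u) + f x) / h\<^sup>2 - ?B\<bar> < \<bar>?A - ?B\<bar> / 2"
    using second_difference_quotient[OF assms e, of v u] by blast
  obtain h where h: "0 < h" "h < min d d'" using d d' dense[of 0 "min d d'"] by auto
  have eq: "f (x + h *\<^sub>R u + h *\<^sub>R v) - f (x + h *\<^sub>R u) - f (x + h *\<^sub>R v) + f x
    = f (x + h *\<^sub>R v + h *\<^sub>R u) - f (x + h *\<^sub>R v) - f (x + h *\<^sub>R u) + f x" by (simp add: add_ac)
  have "0 < h \<and> h < d" "0 < h \<and> h < d'" using h by auto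
  note 1 = d(2)[OF this(1), unfolded eq] and 2 = d'(2)[OF this(2)]
  have "False" if "\<bar>Q - A\<bar> < \<bar>A - B\<bar> / 2" "\<bar>Q - B\<bar> < \<bar>A - B\<bar> / 2" for A B Q :: real
    using that by (smt (verit) field_sum_of_halves)
  from this[OF 1 2] show False .
qed

lemma symmetric_second_derivative:
  fixes f :: "real^'n::finite \<Rightarrow> 'b::euclidean_space"
  assumes S: "open S" and f: "smooth_on f S" and x: "x \<in> S"
  shows "frechet_derivative (\<lambda>y. frechet_derivative f (at y) u) (at x) v
       = frechet_derivative (\<lambda>y. frechet_derivative f (at y) v) (at x) u"
proof (rule euclidean_eqI)
  fix b :: 'b assume b: "b \<in> Basis"
  have inner: "frechet_derivative g (at y) w \<bullet> b = frechet_derivative (\<lambda>y. g y \<bullet> b) (at y) w"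
    if "smooth_on g S" "y \<in> S" for g :: "real^'n \<Rightarrow> 'b" and y w
    using frechet_derivative_at[OF has_derivative_inner_left[OF has_derivative_frechet[OF smooth_on_differentiable[OF that]]], of b]
    by (auto intro: fun_cong)
  have 1: "frechet_derivative (\<lambda>y. frechet_derivative f (at y) u) (at x) v \<bullet> b
      = frechet_derivative (\<lambda>y. frechet_derivative (\<lambda>y. f y \<bullet> b) (at y) u) (at x) v" for u v
    unfolding inner[OF smooth_on_deriv[OF f] x]
    by (intro fun_cong[OF frechet_derivative_cong_open[OF S x]] inner f)
  have "smooth_on (\<lambda>y. f y \<bullet> b) S"
    by (rule smooth_on_bounded_linear[OF S bounded_linear_inner_left f])
  then have "Ck_on 2 (\<lambda>y. f y \<bullet> b) S" unfolding smooth_on_def by blast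
  from symmetric_second_derivative_real[OF S this x]
  show "frechet_derivative (\<lambda>y. frechet_derivative f (at y) u) (at x) v \<bullet> b
       = frechet_derivative (\<lambda>y. frechet_derivative f (at y) v) (at x) u \<bullet> b" unfolding 1 .
qed

section \<open>Families of linear maps\<close>

text \<open>Only the maps \<open>y \<mapsto> M y w\<close> for fixed \<open>w\<close> are assumed to be differentiable. As
  the fibre is finite dimensional, expanding in a basis turns this into the product rule.\<close>

lemma has_derivative_linear_family:
  fixes M :: "real^'n::finite \<Rightarrow> 'a::euclidean_space \<Rightarrow> 'b::real_normed_vector"
  assumes S: "open S" "z \<in> S" and lin: "\<And>y. y \<in> S \<Longrightarrow> linear (M y)"
    and M: "\<And>w. (\<lambda>y. M y w) differentiable (at z)" and h: "h differentiable (at z)"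
  shows "((\<lambda>y. M y (h y)) has_derivative
     (\<lambda>v. frechet_derivative (\<lambda>y. M y (h z)) (at z) v + M z (frechet_derivative h (at z) v))) (at z)"
proof -
  have 1: "((\<lambda>y. \<Sum>b\<in>Basis. (h y \<bullet> b) *\<^sub>R M y b) has_derivative
     (\<lambda>v. \<Sum>b\<in>Basis. (h z \<bullet> b) *\<^sub>R frechet_derivative (\<lambda>y. M y b) (at z) v + (frechet_derivative h (at z) v \<bullet> b) *\<^sub>R M z b)) (at z)"
    by (intro has_derivative_sum has_derivative_scaleR has_derivative_inner_left has_derivative_frechet M h)
  have 2: "((\<lambda>y. \<Sum>b\<in>Basis. (h z \<bullet> b) *\<^sub>R M y b) has_derivative
     (\<lambda>v. \<Sum>b\<in>Basis. (h z \<bullet> b) *\<^sub>R frechet_derivative (\<lambda>y. M y b) (at z) v)) (at z)"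
    by (intro has_derivative_sum has_derivative_scaleR_right has_derivative_frechet M)
  have e: "M y w = (\<Sum>b\<in>Basis. (w \<bullet> b) *\<^sub>R M y b)" if "y \<in> S" for y w
    by (rule linear_basis_expand[OF lin[OF that]])
  have "((\<lambda>y. M y (h z)) has_derivative
     (\<lambda>v. \<Sum>b\<in>Basis. (h z \<bullet> b) *\<^sub>R frechet_derivative (\<lambda>y. M y b) (at z) v)) (at z)"
    by (rule has_derivative_transform_within_open[OF 2 S]) (use e in auto)
  then have 3: "frechet_derivative (\<lambda>y. M y (h z)) (at z) = (\<lambda>v. \<Sum>b\<in>Basis. (h z \<bullet> b) *\<^sub>R frechet_derivative (\<lambda>y. M y b) (at z) v)"
    by (rule frechet_derivative_at[symmetric])
  have "((\<lambda>y. M y (h y)) has_derivative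
     (\<lambda>v. \<Sum>b\<in>Basis. (h z \<bullet> b) *\<^sub>R frechet_derivative (\<lambda>y. M y b) (at z) v + (frechet_derivative h (at z) v \<bullet> b) *\<^sub>R M z b)) (at z)"
    by (rule has_derivative_transform_within_open[OF 1 S]) (use e in auto)
  then show ?thesis unfolding 3 by (simp add: sum.distrib e[OF S(2), symmetric])
qed

lemma smooth_linear_family:
  fixes M :: "real^'n::finite \<Rightarrow> 'a::euclidean_space \<Rightarrow> 'b::real_normed_vector"
  assumes S: "open S" and lin: "\<And>y. y \<in> S \<Longrightarrow> linear (M y)"
    and M: "\<And>w. smooth_on (\<lambda>y. M y w) S" and h: "smooth_on h S"
  shows "smooth_on (\<lambda>y. M y (h y)) S"
  by (rule smooth_on_cong[OF S, of "\<lambda>y. \<Sum>b\<in>Basis. (h y \<bullet> b) *\<^sub>R M y b"])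
    (auto simp: linear_basis_expand[OF lin, symmetric]
      intro!: smooth_on_sum S smooth_on_bilinear[OF S bounded_bilinear_scaleR] M
        smooth_on_bounded_linear[OF S bounded_linear_inner_left] h)

section \<open>Real analytic maps\<close>

text \<open>Unconditional convergence is absolute in finite dimension.\<close>

lemma summable_imp_abs_summable:
  fixes f :: "'i \<Rightarrow> 'b::euclidean_space"
  assumes "f summable_on A"
  shows "(\<lambda>i. norm (f i)) summable_on A"
proof (rule nonneg_bounded_sums(1)[where S = "\<Sum>b\<in>Basis. infsum (\<lambda>i. \<bar>f i \<bullet> b\<bar>) A"])
  have s: "(\<lambda>i. \<bar>f i \<bullet> b\<bar>) summable_on A" for b
    using summable_on_bounded_linear[OF bounded_linear_inner_left assms, of b]
      summable_on_iff_abs_summable_on_real[of "\<lambda>i. f i \<bullet> b" A] by simp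
  fix F assume F: "finite F" "F \<subseteq> A"
  have "(\<Sum>i\<in>F. norm (f i)) \<le> (\<Sum>i\<in>F. \<Sum>b\<in>Basis. \<bar>f i \<bullet> b\<bar>)" by (intro sum_mono norm_le_l1)
  also have "\<dots> = (\<Sum>b\<in>Basis. \<Sum>i\<in>F. \<bar>f i \<bullet> b\<bar>)" by (rule sum.swap)
  also have "\<dots> \<le> (\<Sum>b\<in>Basis. infsum (\<lambda>i. \<bar>f i \<bullet> b\<bar>) A)"
    by (intro sum_mono finite_sum_le_infsum s F) auto
  finally show "(\<Sum>i\<in>F. norm (f i)) \<le> (\<Sum>b\<in>Basis. infsum (\<lambda>i. \<bar>f i \<bullet> b\<bar>) A)" .
qed auto

text \<open>Convergence on a ball is convergence at a point with equal positive coordinates \<open>\<rho>\<close>. There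
  the monomials are powers of \<open>\<rho>\<close>, and absolute convergence is the weighted bound for the radius
  \<open>\<rho>\<close>.\<close>

lemma real_analytic_on_iff_psum:
  fixes f :: "real^'n::finite \<Rightarrow> 'b::euclidean_space"
  shows "real_analytic_on f S \<longleftrightarrow> (\<forall>a\<in>S. \<exists>r>0. \<exists>T. psum a r T f)"
proof
  assume L: "real_analytic_on f S"
  show "\<forall>a\<in>S. \<exists>r>0. \<exists>T. psum a r T f"
  proof
    fix a assume "a \<in> S"
    then obtain r c where r: "r > 0" and c: "\<And>x. x \<in> ball a r \<Longrightarrow>
        ((\<lambda>\<alpha>. mpow \<alpha> (x - a) *\<^sub>R c \<alpha>) has_sum f x) UNIV"
      using L unfolding real_analytic_on_def mpow_def by blast
\<comment> \<open>The diagonal point \<open>z\<close> must lie in the Euclidean ball of radius \<open>r\<close>.\<close>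
    define \<rho> where "\<rho> = r / (2 * real CARD('n))"
    have \<rho>: "\<rho> > 0" using r by (simp add: \<rho>_def)
    define z :: "real^'n" where "z = (\<chi> i. \<rho>)"
    have "norm z \<le> (\<Sum>i\<in>UNIV. \<bar>z $ i\<bar>)" by (rule norm_le_l1_cart)
    also have "\<dots> = r / 2" using \<rho> r by (simp add: z_def \<rho>_def)
    finally have "a + z \<in> ball a r" using r by (simp add: dist_norm)
    from c[OF this] have "(\<lambda>\<alpha>. mpow \<alpha> z *\<^sub>R c \<alpha>) summable_on UNIV"
      by (auto simp: summable_on_def)
    then have s: "(\<lambda>\<alpha>. norm (mpow \<alpha> z *\<^sub>R c \<alpha>)) summable_on UNIV" by (rule summable_imp_abs_summable)
    have e: "norm (mpow \<alpha> z *\<^sub>R c \<alpha>) = norm (c \<alpha>) * \<rho> ^ tdeg \<alpha>" for \<alpha>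
      using \<rho> by (simp add: mpow_def z_def tdeg_def power_sum abs_prod mult.commute)
    have \<rho>r: "\<rho> \<le> r"
    proof -
      have "1 \<le> real CARD('n)" by (simp add: Suc_leI)
      then have "r * 1 \<le> r * (2 * real CARD('n))" using r by (intro mult_left_mono) linarith+
      then show ?thesis using r by (simp add: \<rho>_def divide_le_eq)
    qed
    have "psum a \<rho> (infsum (\<lambda>\<alpha>. norm (c \<alpha>) * \<rho> ^ tdeg \<alpha>) UNIV) f"
      by (rule psumI[of c]) (use s[unfolded e] c \<rho> \<rho>r in \<open>auto intro!: finite_sum_le_infsum\<close>)
    then show "\<exists>r>0. \<exists>T. psum a r T f" using \<rho> by blast
  qed
next
  assume R: "\<forall>a\<in>S. \<exists>r>0. \<exists>T. psum a r T f"
  show "real_analytic_on f S"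
    unfolding real_analytic_on_def
  proof
    fix a assume "a \<in> S"
    then obtain r T c where "r > 0" "psum_coeffs a r T c f" using R unfolding psum_def by blast
    then show "\<exists>r>0. \<exists>c. \<forall>x\<in>ball a r. ((\<lambda>\<alpha>. (\<Prod>i\<in>UNIV. ((x - a) $ i) ^ \<alpha> i) *\<^sub>R c \<alpha>) has_sum f x) UNIV"
      using psum_coeffsD(2) unfolding mpow_def by blast
  qed
qed

lemma common_radius:
  fixes f :: "'i \<Rightarrow> real^'n::finite \<Rightarrow> 'b::banach"
  assumes "finite I" "\<And>i. i \<in> I \<Longrightarrow> \<exists>r>0. \<exists>T. psum a r T (f i)"
  shows "\<exists>r>0. \<exists>T. \<forall>i\<in>I. psum a r T (f i)"
  using assms
proof (induction I rule: finite_induct)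
  case empty then show ?case by (intro exI[of _ 1]) auto
next
  case (insert i I)
  obtain r T where r: "r > 0" "\<forall>i\<in>I. psum a r T (f i)" using insert by auto
  obtain r' T' where r': "r' > 0" "psum a r' T' (f i)" using insert.prems[of i] by blast
  have "psum a (min r r') (max T T') (f j)" if "j \<in> insert i I" for j
  proof (cases "j = i")
    case True
    then show ?thesis using psum_mono[OF psum_shrink[OF r'(2), of "min r r'"]] r r' by auto
  next
    case False
    then show ?thesis using psum_mono[OF psum_shrink[of a r T "f j" "min r r'"]] r r' that by auto
  qed
  then show ?case using r r' by (intro exI[of _ "min r r'"]) auto
qed

lemma common_radius2:
  assumes "\<exists>r>0. \<exists>T. psum a r T f" "\<exists>r>0. \<exists>T. psum a r T g"
  obtains r T T' where "r > 0" "psum a r T f" "psum a r T' g"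
proof -
  obtain r T r' T' where "r > 0" "psum a r T f" "r' > 0" "psum a r' T' g" using assms by blast
  then show thesis using psum_shrink[of a r T f "min r r'"] psum_shrink[of a r' T' g "min r r'"]
    by (intro that[of "min r r'"]) auto
qed

lemma real_analytic_on_subset: "real_analytic_on f S \<Longrightarrow> T \<subseteq> S \<Longrightarrow> real_analytic_on f T"
  unfolding real_analytic_on_def by blast

lemma real_analytic_on_cong:
  fixes f :: "real^'n::finite \<Rightarrow> 'b::euclidean_space"
  assumes "open S" "\<And>x. x \<in> S \<Longrightarrow> f x = g x" "real_analytic_on f S"
  shows "real_analytic_on g S"
  unfolding real_analytic_on_iff_psum
proof
  fix a assume a: "a \<in> S"
  obtain r T where r: "r > 0" "psum a r T f" using assms(3) a unfolding real_analytic_on_iff_psum by blast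
  obtain d where d: "d > 0" "ball a d \<subseteq> S" using assms(1) a openE by blast
  have "psum a (min r d) T f" using psum_shrink[OF r(2)] r d by simp
  then have "psum a (min r d) T g" by (rule psum_cong) (use d assms(2) in auto)
  then show "\<exists>r>0. \<exists>T. psum a r T g" using r d by (intro exI[of _ "min r d"]) auto
qed

lemma real_analytic_on_const: "real_analytic_on (\<lambda>_. c :: 'b::euclidean_space) S"
  unfolding real_analytic_on_iff_psum using psum_const zero_less_one by blast

lemma real_analytic_on_sum:
  fixes f :: "'i \<Rightarrow> real^'n::finite \<Rightarrow> 'b::euclidean_space"
  assumes "finite I" "\<And>i. i \<in> I \<Longrightarrow> real_analytic_on (f i) S"
  shows "real_analytic_on (\<lambda>x. \<Sum>i\<in>I. f i x) S"
  unfolding real_analytic_on_iff_psum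
proof
  fix a assume "a \<in> S"
  then have "\<exists>r>0. \<exists>T. \<forall>i\<in>I. psum a r T (f i)"
    using assms unfolding real_analytic_on_iff_psum by (intro common_radius) blast+
  then obtain r T where "r > 0" "\<forall>i\<in>I. psum a r T (f i)" by blast
  then show "\<exists>r>0. \<exists>T. psum a r T (\<lambda>x. \<Sum>i\<in>I. f i x)"
    using psum_sum[of r I a "\<lambda>_. T" f] assms(1) by blast
qed

lemma real_analytic_on_add:
  fixes f g :: "real^'n::finite \<Rightarrow> 'b::euclidean_space"
  assumes "real_analytic_on f S" "real_analytic_on g S"
  shows "real_analytic_on (\<lambda>x. f x + g x) S"
  using real_analytic_on_sum[of "UNIV :: bool set" "\<lambda>b. if b then f else g" S] assms
  by (simp add: UNIV_bool add.commute)

lemma real_analytic_on_scaleR: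
  fixes f :: "real^'n::finite \<Rightarrow> real" and g :: "real^'n \<Rightarrow> 'b::euclidean_space"
  assumes "real_analytic_on f S" "real_analytic_on g S"
  shows "real_analytic_on (\<lambda>x. f x *\<^sub>R g x) S"
  unfolding real_analytic_on_iff_psum
proof
  fix a assume "a \<in> S"
  then have "\<exists>r>0. \<exists>T. psum a r T f" "\<exists>r>0. \<exists>T. psum a r T g"
    using assms unfolding real_analytic_on_iff_psum by blast+
  then obtain r T T' where "r > 0" "psum a r T f" "psum a r T' g"
    by (rule common_radius2)
  then show "\<exists>r>0. \<exists>T. psum a r T (\<lambda>x. f x *\<^sub>R g x)"
    using psum_scaleR by blast
qed

lemma real_analytic_on_bounded_linear:
  fixes f :: "real^'n::finite \<Rightarrow> 'b::euclidean_space" and L :: "'b \<Rightarrow> 'c::euclidean_space"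
  assumes "real_analytic_on f S" "bounded_linear L"
  shows "real_analytic_on (\<lambda>x. L (f x)) S"
proof -
  obtain K where "K \<ge> 0" "\<And>x. norm (L x) \<le> K * norm x"
    using bounded_linear.nonneg_bounded[OF assms(2)] by (metis mult.commute)
  then show ?thesis
    using assms psum_bounded_linear unfolding real_analytic_on_iff_psum by metis
qed

lemma real_analytic_on_compose:
  fixes f :: "real^'k::finite \<Rightarrow> 'b::euclidean_space" and g :: "real^'n::finite \<Rightarrow> real^'k"
  assumes "real_analytic_on g S" "real_analytic_on f T" "g ` S \<subseteq> T"
  shows "real_analytic_on (\<lambda>x. f (g x)) S"
  unfolding real_analytic_on_iff_psum
proof
  fix a assume a: "a \<in> S"
  obtain s T' where s: "s > 0" "psum (g a) s T' f"
    using assms a unfolding real_analytic_on_iff_psum by blast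
  have "real_analytic_on (\<lambda>x. g x $ i) S" for i
    by (rule real_analytic_on_bounded_linear[OF assms(1) bounded_linear_vec_nth])
  then have "\<exists>r>0. \<exists>T. \<forall>i\<in>UNIV. psum a r T (\<lambda>x. g x $ i)"
    using a unfolding real_analytic_on_iff_psum by (intro common_radius) auto
  then obtain r T where "r > 0" "\<And>i. psum a r T (\<lambda>x. g x $ i)" by blast
  then show "\<exists>r>0. \<exists>T. psum a r T (\<lambda>x. f (g x))"
    using psum_compose[of g a s T' f, OF s(2,1)] by blast
qed

lemma real_analytic_on_differentiable:
  fixes f :: "real^'n::finite \<Rightarrow> 'b::euclidean_space"
  assumes "real_analytic_on f S" "x \<in> S"
  shows "f differentiable (at x)"
  using assms psum_differentiable unfolding real_analytic_on_iff_psum by (metis centre_in_ball)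

lemma real_analytic_on_deriv:
  fixes f :: "real^'n::finite \<Rightarrow> 'b::euclidean_space"
  assumes "real_analytic_on f S"
  shows "real_analytic_on (\<lambda>x. frechet_derivative f (at x) v) S"
  unfolding real_analytic_on_iff_psum
proof
  fix a assume "a \<in> S"
  then obtain r T where r: "r > 0" "psum a r T f"
    using assms unfolding real_analytic_on_iff_psum by blast
  then have "psum a (r / 2) (T / (r - r / 2) * norm v) (\<lambda>x. frechet_derivative f (at x) v)"
    by (intro psum_deriv) auto
  then show "\<exists>r>0. \<exists>T. psum a r T (\<lambda>x. frechet_derivative f (at x) v)"
    using r by (intro exI[of _ "r / 2"]) auto
qed

lemma real_analytic_on_smooth:
  fixes f :: "real^'n::finite \<Rightarrow> 'b::euclidean_space"
  assumes "real_analytic_on f S"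
  shows "smooth_on f S"
proof (rule smooth_on_open_cover)
  fix x assume "x \<in> S"
  then obtain r T where "r > 0" "psum x r T f"
    using assms unfolding real_analytic_on_iff_psum by blast
  then show "\<exists>T. open T \<and> x \<in> T \<and> smooth_on f T" using psum_smooth by (intro exI[of _ "ball x r"]) auto
qed

lemma real_analytic_linear_family:
  fixes M :: "real^'n::finite \<Rightarrow> 'a::euclidean_space \<Rightarrow> 'b::euclidean_space"
  assumes S: "open S" and lin: "\<And>y. y \<in> S \<Longrightarrow> linear (M y)"
    and M: "\<And>w. real_analytic_on (\<lambda>y. M y w) S" and h: "real_analytic_on h S"
  shows "real_analytic_on (\<lambda>y. M y (h y)) S"
  by (rule real_analytic_on_cong[OF S, of "\<lambda>y. \<Sum>b\<in>Basis. (h y \<bullet> b) *\<^sub>R M y b"])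
    (auto simp: linear_basis_expand[OF lin, symmetric]
      intro!: real_analytic_on_sum real_analytic_on_scaleR M
        real_analytic_on_bounded_linear[OF h bounded_linear_inner_left])

section \<open>Vanishing along rays\<close>

text \<open>The functions \<open>g k\<close> are the successive derivatives of the sum. They are given separately, because
  in the application the \<open>k\<close>-th derivative is known through another expression.\<close>

lemma powser_coeffs_zero:
  fixes A :: "nat \<Rightarrow> real"
  assumes "\<And>t. \<bar>t\<bar> < 1 \<Longrightarrow> (\<lambda>m. A m * t ^ m) sums g 0 t"
    and "\<And>k t. \<bar>t\<bar> < 1 \<Longrightarrow> (g k has_real_derivative g (Suc k) t) (at t)"
    and "\<And>k. g k 0 = 0"
  shows "A n = 0"
  using assms
proof (induction n arbitrary: A g)
  case 0
  have "(\<lambda>m. A m * 0 ^ m) sums A 0" using powser_sums_zero[of A] by simp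
  then show ?case using 0(1)[of 0] 0(3)[of 0] sums_unique2 by fastforce
next
  case (Suc n)
  have summ: "\<And>t. norm t < 1 \<Longrightarrow> summable (\<lambda>m. A m * t ^ m)"
    using Suc.prems(1) sums_summable by fastforce
  have "diffs A n = 0"
  proof (rule Suc.IH[of "diffs A" "\<lambda>k. g (Suc k)"])
    fix t :: real assume t: "\<bar>t\<bar> < 1"
    have 1: "((\<lambda>z. \<Sum>m. A m * z ^ m) has_field_derivative (\<Sum>m. diffs A m * t ^ m)) (at t)"
      by (rule termdiffs_strong'[where K = 1]) (use summ t in auto)
    have "(\<Sum>m. A m * z ^ m) = g 0 z" if "z \<in> {-1<..<1}" for z
      using Suc.prems(1)[of z] that sums_unique[of "\<lambda>m. A m * z ^ m" "g 0 z"] by auto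
    then have "(g 0 has_field_derivative (\<Sum>m. diffs A m * t ^ m)) (at t)"
      by (intro has_field_derivative_transform_within_open[OF 1, of "{-1<..<1}"]) (use t in auto)
    then have "(\<Sum>m. diffs A m * t ^ m) = g (Suc 0) t"
      using Suc.prems(2)[OF t] DERIV_unique by blast
    moreover have "summable (\<lambda>m. diffs A m * t ^ m)"
      by (rule termdiff_converges[where K = 1]) (use summ t in auto)
    ultimately show "(\<lambda>m. diffs A m * t ^ m) sums g (Suc 0) t"
      using summable_sums by metis
  qed (use Suc.prems in auto)
  then show ?case by (simp add: diffs_def)
qed

text \<open>Restricted to a ray, a power series in several variables becomes one in \<open>t\<close>; here
  \<open>g k\<close> is its \<open>k\<close>-th derivative.\<close>

lemma psum_zero_on_ray:
  fixes f :: "real^'n::finite \<Rightarrow> 'b::euclidean_space"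
  assumes f: "psum a r S f" and r: "r > 0" and v: "norm v < r"
    and g0: "\<And>t. \<bar>t\<bar> < 1 \<Longrightarrow> g 0 t = f (a + t *\<^sub>R v)"
    and g': "\<And>k t. \<bar>t\<bar> < 1 \<Longrightarrow> (g k has_vector_derivative g (Suc k) t) (at t)"
    and gz: "\<And>k. g k 0 = 0" and t: "\<bar>t\<bar> < 1"
  shows "f (a + t *\<^sub>R v) = 0"
proof (rule euclidean_eqI)
  fix b :: 'b assume b: "b \<in> Basis"
  obtain c where "psum_coeffs a r S c f" using f unfolding psum_def by blast
  note c = psum_coeffsD[OF this]
  define w where "w \<alpha> = mpow \<alpha> v * (c \<alpha> \<bullet> b)" for \<alpha>
  define I where "I m = {\<alpha>::'n\<Rightarrow>nat. tdeg \<alpha> = m}" for m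
  define A where "A m = infsum w (I m)" for m
  have "(\<lambda>\<alpha>. norm (w \<alpha>)) summable_on UNIV"
  proof (rule Infinite_Sum.abs_summable_on_comparison_test'[OF psum_abs_summable(1)[OF r c(1), of v]])
    show "norm v \<le> r" using v by simp
    show "norm (w \<alpha>) \<le> norm (mpow \<alpha> v *\<^sub>R c \<alpha>)" for \<alpha>
      using Basis_le_norm[OF b, of "c \<alpha>"] by (auto simp: w_def abs_mult intro!: mult_left_mono)
  qed
  then have ws: "w summable_on B" for B
    using abs_summable_summable summable_on_subset_banach by blast
  have "(\<lambda>m. A m * s ^ m) sums (f (a + s *\<^sub>R v) \<bullet> b)" if s: "\<bar>s\<bar> < 1" for s
  proof -
    have "norm (s *\<^sub>R v) < r"
      using mult_right_mono[of "\<bar>s\<bar>" 1 "norm v"] s v by simp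
    then have "a + s *\<^sub>R v \<in> ball a r" by (simp add: dist_norm)
    from has_sum_bounded_linear[OF bounded_linear_inner_left c(2)[OF this], of b]
    have 1: "((\<lambda>\<alpha>. s ^ tdeg \<alpha> * w \<alpha>) has_sum (f (a + s *\<^sub>R v) \<bullet> b)) UNIV"
      by (simp add: mpow_scale w_def mult.assoc)
    have "((\<lambda>p. s ^ fst p * w (snd p)) has_sum (f (a + s *\<^sub>R v) \<bullet> b)) (Sigma UNIV I)
        \<longleftrightarrow> ((\<lambda>\<alpha>. s ^ tdeg \<alpha> * w \<alpha>) has_sum (f (a + s *\<^sub>R v) \<bullet> b)) UNIV"
      by (rule has_sum_reindex_bij_witness[where i = "\<lambda>\<alpha>. (tdeg \<alpha>, \<alpha>)" and j = snd]) (auto simp: I_def)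
    then have "((\<lambda>p. s ^ fst p * w (snd p)) has_sum (f (a + s *\<^sub>R v) \<bullet> b)) (Sigma UNIV I)"
      using 1 by simp
    then have "((\<lambda>m. s ^ m * A m) has_sum (f (a + s *\<^sub>R v) \<bullet> b)) UNIV"
      by (rule has_sum_SigmaD) (auto intro!: has_sum_cmult_right has_sum_infsum ws simp: A_def)
    then show ?thesis using has_sum_imp_sums by (force simp: mult.commute)
  qed
  note sums = this
  have "A m = 0" for m
  proof (rule powser_coeffs_zero[of A "\<lambda>k t. g k t \<bullet> b"])
    show "(\<lambda>m. A m * t ^ m) sums (g 0 t \<bullet> b)" if "\<bar>t\<bar> < 1" for t using sums[OF that] g0[OF that] by simp
    show "((\<lambda>t. g k t \<bullet> b) has_real_derivative g (Suc k) t \<bullet> b) (at t)" if "\<bar>t\<bar> < 1" for k t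
      using bounded_linear.has_vector_derivative[OF bounded_linear_inner_left g'[OF that]]
      by (simp add: has_real_derivative_iff_has_vector_derivative)
  qed (simp add: gz)
  then show "f (a + t *\<^sub>R v) \<bullet> b = 0 \<bullet> b"
    using sums[OF t] sums_unique2[OF sums_zero] by simp
qed

section \<open>Radial transport by Picard iteration\<close>

lemma geometric_half_sum_le:
  assumes "finite F" "0 \<le> (W::real)"
  shows "(\<Sum>n\<in>F. (1/2)^n * W) \<le> 2 * W"
proof -
  have "(\<Sum>n\<in>F. (1/2::real)^n) \<le> (\<Sum>n. (1/2)^n)"
    by (rule sum_le_suminf) (use assms in \<open>auto intro: summable_geometric\<close>)
  also have "\<dots> = 2" by (simp add: suminf_geometric)
  finally have "(\<Sum>n\<in>F. (1/2::real)^n) * W \<le> 2 * W" by (rule mult_right_mono[OF _ assms(2)])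
  then show ?thesis by (simp add: sum_distrib_right)
qed

lemma bilinear_family_expand:
  fixes B :: "real^'n::finite \<Rightarrow> 'b::euclidean_space \<Rightarrow> 'c::real_vector"
  assumes "\<And>w. linear (\<lambda>\<nu>. B \<nu> w)" "\<And>\<nu>. linear (B \<nu>)"
  shows "B \<nu> w = (\<Sum>i\<in>UNIV. \<Sum>b\<in>Basis. (\<nu> $ i) *\<^sub>R (w \<bullet> b) *\<^sub>R B (axis i 1) b)"
proof -
  have "B \<nu> w = (\<Sum>i\<in>UNIV. \<nu> $ i *\<^sub>R B (axis i 1) w)"
    by (rule linear_axis_expand[OF assms(1)])
  also have "\<dots> = (\<Sum>i\<in>UNIV. \<nu> $ i *\<^sub>R (\<Sum>b\<in>Basis. (w \<bullet> b) *\<^sub>R B (axis i 1) b))"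
    by (intro sum.cong refl arg_cong[where f = "scaleR _"] linear_basis_expand assms)
  finally show ?thesis by (simp add: scaleR_sum_right)
qed

text \<open>Transport along all rays from \<open>a\<close> at once, by Picard iteration on power series. One
  step applies \<open>L\<close>, whose radial argument \<open>z - a\<close> is small, and then takes a radial primitive. On a
  small ball this halves the weighted norm, so the iterates \<open>s n\<close> sum up to the solution.\<close>

lemma radial_series:
  fixes L :: "real^'n::finite \<Rightarrow> real^'n \<Rightarrow> 'b::euclidean_space \<Rightarrow> 'b"
  assumes r: "r > 0"
    and lin1: "\<And>z w. z \<in> ball a r \<Longrightarrow> linear (\<lambda>\<nu>. L z \<nu> w)"
    and lin2: "\<And>z \<nu>. z \<in> ball a r \<Longrightarrow> linear (L z \<nu>)"
    and P: "\<And>i b. b \<in> Basis \<Longrightarrow> psum a r T (\<lambda>z. L z (axis i 1) b)"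
  shows "\<exists>\<rho>>0. \<rho> \<le> r \<and> (\<forall>w. \<exists>\<sigma>. psum a \<rho> (2 * norm w) \<sigma> \<and> \<sigma> a = w \<and>
     (\<forall>z\<in>ball a \<rho>. frechet_derivative \<sigma> (at z) (z - a) = L z (z - a) (\<sigma> z)))"
proof -
  have T0: "T \<ge> 0" using P psum_bound_nonneg nonempty_Basis by blast
\<comment> \<open>\<open>K\<close> bounds the sum of the norms of the entries of \<open>L\<close>, and \<open>\<rho> * K \<le> 1/2\<close> makes a step contract.\<close>
  define K where "K = real CARD('n) * (real DIM('b) * T)"
  have K0: "K \<ge> 0" using T0 by (simp add: K_def)
  define \<rho> where "\<rho> = min r (1 / (2 * (K + 1)))"
  have \<rho>: "\<rho> > 0" "\<rho> \<le> r" using r K0 by (auto simp: \<rho>_def)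
  have \<rho>K: "\<rho> * K \<le> 1 / 2"
  proof -
    have "\<rho> * K \<le> 1 / (2 * (K + 1)) * K" using K0 by (intro mult_right_mono) (auto simp: \<rho>_def)
    also have "\<dots> \<le> 1 / 2" using K0 by (simp add: field_simps)
    finally show ?thesis .
  qed
  have sub: "z \<in> ball a r" if "z \<in> ball a \<rho>" for z using that \<rho> by auto
  have step: "psum a \<rho> (S / 2) (\<lambda>z. L z (z - a) (s z))" if s: "psum a \<rho> S s" for S s
  proof -
    have S0: "S \<ge> 0" using psum_bound_nonneg[OF s] .
    have "psum a \<rho> (1 * S) (\<lambda>z. s z \<bullet> b)" if "b \<in> Basis" for b
      by (rule psum_bounded_linear[OF s bounded_linear_inner_left]) (use that \<rho> Basis_le_norm in auto)
    then have "psum a \<rho> (\<Sum>i\<in>(UNIV::'n set). \<Sum>b\<in>(Basis::'b set). \<rho> * ((1 * S) * T))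
       (\<lambda>z. \<Sum>i\<in>UNIV. \<Sum>b\<in>Basis. ((z - a) $ i) *\<^sub>R (s z \<bullet> b) *\<^sub>R L z (axis i 1) b)"
      by (intro psum_sum psum_scaleR psum_coord \<rho> psum_shrink[OF P]) auto
    then have "psum a \<rho> (\<rho> * K * S) (\<lambda>z. \<Sum>i\<in>UNIV. \<Sum>b\<in>Basis. ((z - a) $ i) *\<^sub>R (s z \<bullet> b) *\<^sub>R L z (axis i 1) b)"
      by (simp add: K_def mult_ac)
    then have "psum a \<rho> (\<rho> * K * S) (\<lambda>z. L z (z - a) (s z))"
      by (rule psum_cong) (use bilinear_family_expand[OF lin1[OF sub] lin2[OF sub]] in auto)
    then show ?thesis
      by (rule psum_mono) (use mult_right_mono[OF \<rho>K S0] in simp)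
  qed
  have "\<exists>\<sigma>. psum a \<rho> (2 * norm w) \<sigma> \<and> \<sigma> a = w \<and>
     (\<forall>z\<in>ball a \<rho>. frechet_derivative \<sigma> (at z) (z - a) = L z (z - a) (\<sigma> z))" for w
  proof -
    have "\<exists>s. \<forall>n. (psum a \<rho> ((1/2)^n * norm w) (s n) \<and> (n = 0 \<longrightarrow> s n = (\<lambda>_. w))) \<and>
       (s (Suc n) a = 0 \<and> (\<forall>z\<in>ball a \<rho>. frechet_derivative (s (Suc n)) (at z) (z - a) = L z (z - a) (s n z)))"
    proof (rule dependent_nat_choice)
      show "\<exists>s. psum a \<rho> ((1/2)^0 * norm w) s \<and> (0 = (0::nat) \<longrightarrow> s = (\<lambda>_. w))"
        using psum_const[OF \<rho>(1), of a w] by auto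
      fix s n assume "psum a \<rho> ((1/2)^n * norm w) s \<and> (n = 0 \<longrightarrow> s = (\<lambda>_. w))"
      then have 1: "psum a \<rho> ((1/2)^n * norm w / 2) (\<lambda>z. L z (z - a) (s z))" using step by blast
      have "L a 0 (s a) = 0" using linear_0[OF lin1[of a "s a"]] r by simp
      then obtain F where "psum a \<rho> ((1/2)^n * norm w / 2) F" "F a = 0"
        "\<forall>x\<in>ball a \<rho>. frechet_derivative F (at x) (x - a) = L x (x - a) (s x)"
        using psum_euler_primitive[OF 1 \<rho>(1)] by auto
      then show "\<exists>s'. (psum a \<rho> ((1/2)^Suc n * norm w) s' \<and> (Suc n = 0 \<longrightarrow> s' = (\<lambda>_. w))) \<and>
       (s' a = 0 \<and> (\<forall>z\<in>ball a \<rho>. frechet_derivative s' (at z) (z - a) = L z (z - a) (s z)))"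
        by (intro exI[of _ F]) simp
    qed
    then obtain s where s: "\<forall>n. (psum a \<rho> ((1/2)^n * norm w) (s n) \<and> (n = 0 \<longrightarrow> s n = (\<lambda>_. w))) \<and>
       (s (Suc n) a = 0 \<and> (\<forall>z\<in>ball a \<rho>. frechet_derivative (s (Suc n)) (at z) (z - a) = L z (z - a) (s n z)))"
      by (rule exE)
    have ps: "\<And>n. psum a \<rho> ((1/2)^n * norm w) (s n)" and s0: "s 0 = (\<lambda>_. w)"
      and sa: "\<And>n. s (Suc n) a = 0"
      and sd: "\<And>n z. z \<in> ball a \<rho> \<Longrightarrow> frechet_derivative (s (Suc n)) (at z) (z - a) = L z (z - a) (s n z)"
      using s by blast+
    define \<sigma> where "\<sigma> z = infsum (\<lambda>n. s n z) UNIV" for z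
    have gs: "(\<lambda>n. (1/2)^n * W) summable_on UNIV" if "0 \<le> W" for W :: real
      by (rule nonneg_bounded_sums(1)[where S = "2 * W"]) (use geometric_half_sum_le that in auto)
    have hs: "((\<lambda>n. s n z) has_sum \<sigma> z) UNIV" if "z \<in> ball a \<rho>" for z
    proof -
      have "(\<lambda>n. norm (s n z)) summable_on UNIV"
        by (rule Infinite_Sum.abs_summable_on_comparison_test'[OF gs[of "norm w"]])
          (use psum_norm_le[OF \<rho>(1) ps that] in auto)
      from abs_summable_summable[OF this] show ?thesis by (simp add: \<sigma>_def)
    qed
    have p\<sigma>: "psum a \<rho> (2 * norm w) \<sigma>"
      by (rule psum_infinite_sum[OF \<rho>(1) ps _ hs]) (use geometric_half_sum_le in auto)
    have "((\<lambda>n. s n a) has_sum w) UNIV"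
    proof (rule has_sum_finite_neutralI[where B = "{0}"])
      show "s n a = 0" if "n \<in> UNIV - {0}" for n using that sa[of "n - 1"] by auto
    qed (auto simp: s0)
    then have \<sigma>a: "\<sigma> a = w" using hs[of a] \<rho> has_sum_unique by (metis centre_in_ball)
    have "frechet_derivative \<sigma> (at z) (z - a) = L z (z - a) (\<sigma> z)" if z: "z \<in> ball a \<rho>" for z
    proof -
      obtain \<rho>' where \<rho>': "dist a z < \<rho>'" "\<rho>' < \<rho>" using dense[of "dist a z" \<rho>] z by auto
      have \<rho>'0: "\<rho>' > 0" using \<rho>'(1) zero_le_dist[of a z] by linarith
      define B where "B n = (1/2)^n * (norm w / (\<rho> - \<rho>'))" for n :: nat
      have sub': "y \<in> ball a \<rho>" if "y \<in> ball a \<rho>'" for y using that \<rho>' by auto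
      note D = has_derivative_has_sum[OF open_ball[of a \<rho>'] convex_ball, where f = s and g = \<sigma> and B = B and x = z
          and f' = "\<lambda>n y. frechet_derivative (s n) (at y)"]
      have prem: "\<And>n x. x \<in> ball a \<rho>' \<Longrightarrow> (s n has_derivative frechet_derivative (s n) (at x)) (at x)"
        using has_derivative_frechet[OF psum_differentiable[OF ps \<rho>(1) sub']] by blast
      have bnd: "norm (frechet_derivative (s n) (at y) h) \<le> B n * norm h" if "y \<in> ball a \<rho>'" for n y h
        using psum_norm_le[OF \<rho>'0 psum_deriv[OF ps \<rho>'0 \<rho>'(2)] that] by (simp add: B_def)
      have Bs: "B summable_on UNIV" unfolding B_def[abs_def] using \<rho>' by (intro gs) auto
      have B0: "0 \<le> B n" for n using \<rho>' by (simp add: B_def)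
      have hs': "((\<lambda>i. s i y) has_sum \<sigma> y) UNIV" if "y \<in> ball a \<rho>'" for y using hs sub' that by blast
      have z': "z \<in> ball a \<rho>'" using \<rho>' by simp
      have 1: "(\<sigma> has_derivative (\<lambda>h. infsum (\<lambda>n. frechet_derivative (s n) (at z) h) UNIV)) (at z)"
        by (rule D(1)[OF prem bnd Bs B0 hs' z'])
      have 2: "((\<lambda>n. frechet_derivative (s n) (at z) (z - a)) has_sum infsum (\<lambda>n. frechet_derivative (s n) (at z) (z - a)) UNIV) UNIV"
        by (rule D(2)[OF prem bnd Bs B0 hs' z'])
\<comment> \<open>The radial derivative of the next iterate is \<open>L\<close> applied to the present one, and the first
  iterate is constant: summing up gives the equation for \<open>\<sigma>\<close>.\<close>
      have "((\<lambda>n. L z (z - a) (s n z)) has_sum L z (z - a) (\<sigma> z)) UNIV"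
        by (rule has_sum_bounded_linear[OF _ hs[OF z]]) (use lin2[OF sub[OF z]] linear_conv_bounded_linear in blast)
      then have "((\<lambda>n. frechet_derivative (s (Suc n)) (at z) (z - a)) has_sum L z (z - a) (\<sigma> z)) UNIV"
        by (simp add: sd[OF z])
      then have "((\<lambda>n. frechet_derivative (s n) (at z) (z - a)) has_sum L z (z - a) (\<sigma> z)) (range Suc)"
        by (simp add: has_sum_reindex comp_def)
      from has_sum_insert[OF _ this, of 0]
      have "((\<lambda>n. frechet_derivative (s n) (at z) (z - a)) has_sum L z (z - a) (\<sigma> z)) (insert 0 (range Suc))"
        by (simp add: s0 frechet_derivative_const)
      moreover have "insert 0 (range Suc) = UNIV" using not0_implies_Suc by blast
      ultimately have "infsum (\<lambda>n. frechet_derivative (s n) (at z) (z - a)) UNIV = L z (z - a) (\<sigma> z)"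
        using 2 has_sum_unique by simp
      then show ?thesis using frechet_derivative_at[OF 1] by metis
    qed
    with p\<sigma> \<sigma>a show ?thesis by blast
  qed
  with \<rho> show ?thesis by blast
qed

text \<open>Where \<open>norm (\<psi> t)\<close> is maximal, at \<open>s\<close> say, the mean value inequality gives
  \<open>norm (\<psi> s) \<le> q * norm (\<psi> s)\<close>. With a rate \<open>q < 1\<close> over unit time no
  exponential estimate is involved.\<close>

lemma linear_ode_zero:
  fixes \<psi> :: "real \<Rightarrow> 'b::real_normed_vector"
  assumes d: "\<And>t. 0 \<le> t \<Longrightarrow> t \<le> 1 \<Longrightarrow> (\<psi> has_vector_derivative \<psi>' t) (at t)"
    and b: "\<And>t. 0 \<le> t \<Longrightarrow> t \<le> 1 \<Longrightarrow> norm (\<psi>' t) \<le> q * norm (\<psi> t)"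
    and q: "0 \<le> q" "q < 1" and z: "\<psi> 0 = 0" and t: "0 \<le> t" "t \<le> 1"
  shows "\<psi> t = 0"
proof -
  have cont: "continuous_on {0..1} (\<lambda>t. norm (\<psi> t))"
    by (intro continuous_on_norm continuous_at_imp_continuous_on)
      (use d has_vector_derivative_continuous in fastforce)
  then obtain s where s: "s \<in> {0..1}" "\<And>t. t \<in> {0..1} \<Longrightarrow> norm (\<psi> t) \<le> norm (\<psi> s)"
    using continuous_attains_sup[of "{0..1::real}" "\<lambda>t. norm (\<psi> t)"] by auto
  have "norm (\<psi> s - \<psi> 0) \<le> q * norm (\<psi> s) * norm (s - 0)"
  proof (rule differentiable_bound[of "{0..1}" \<psi> "\<lambda>t h. h *\<^sub>R \<psi>' t"])
    show "(\<psi> has_derivative (\<lambda>h. h *\<^sub>R \<psi>' x)) (at x within {0..1})" if "x \<in> {0..1}" for x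
      using d[of x] that by (auto simp: has_vector_derivative_def intro: has_derivative_at_withinI)
    fix x assume x: "x \<in> {0..1::real}"
    have "norm (\<psi>' x) \<le> q * norm (\<psi> s)"
      using b[of x] s(2)[OF x] x q mult_left_mono[of "norm (\<psi> x)" "norm (\<psi> s)" q] by force
    then show "onorm (\<lambda>h. h *\<^sub>R \<psi>' x) \<le> q * norm (\<psi> s)"
      by (intro onorm_bound) (use q in \<open>auto simp: mult.commute intro: mult_left_mono\<close>)
  qed (use s in auto)
  also have "\<dots> \<le> q * norm (\<psi> s) * 1" using s q by (intro mult_left_mono) auto
  finally have "(1 - q) * norm (\<psi> s) \<le> 0" using z by (simp add: algebra_simps)
  then have "norm (\<psi> s) \<le> 0" using q by (simp add: mult_le_0_iff)
  then show ?thesis using s(2)[of t] t by simp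
qed

section \<open>Flat sections of an analytic connection form\<close>

text \<open>\<open>L\<close> stands for the covariant derivative \<open>\<nabla>\<^sub>\<nu> h = dh(\<nu>) - L \<nu> h\<close> on the trivial bundle over
  \<open>D\<close>. The fibre is arbitrary, because both bilinear forms and tangent vectors are transported.\<close>

locale connection_form =
  fixes D :: "(real^'n::finite) set" and L :: "real^'n \<Rightarrow> real^'n \<Rightarrow> 'b::euclidean_space \<Rightarrow> 'b"
  assumes open_D: "open D"
    and lin1: "\<And>p w. p \<in> D \<Longrightarrow> linear (\<lambda>\<nu>. L p \<nu> w)"
    and lin2: "\<And>p \<nu>. p \<in> D \<Longrightarrow> linear (L p \<nu>)"
    and ana: "\<And>\<nu> w. real_analytic_on (\<lambda>p. L p \<nu> w) D"
begin

text \<open>The curvature of \<open>d - L\<close>.\<close>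

definition curv :: "real^'n \<Rightarrow> real^'n \<Rightarrow> real^'n \<Rightarrow> 'b \<Rightarrow> 'b" where
  "curv p u v w = frechet_derivative (\<lambda>q. L q u w) (at p) v - frechet_derivative (\<lambda>q. L q v w) (at p) u
     + L p u (L p v w) - L p v (L p u w)"

text \<open>The curvature \<open>R(v, e)\<close>, differentiated \<open>k\<close> times in the fixed direction \<open>v\<close> along sections
  that are transported in this direction: the second summand is the contribution of the argument,
  whose derivative is \<open>L p v w\<close>. The values are differentiated as vectors of the trivial bundle,
  not covariantly; only their vanishing matters.\<close>

primrec icurv :: "nat \<Rightarrow> real^'n \<Rightarrow> real^'n \<Rightarrow> real^'n \<Rightarrow> 'b \<Rightarrow> 'b" where
  "icurv 0 v e p w = curv p v e w"
| "icurv (Suc k) v e p w = frechet_derivative (\<lambda>q. icurv k v e q w) (at p) v + icurv k v e p (L p v w)"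

definition flat_jets :: "real^'n \<Rightarrow> 'b set" where
  "flat_jets p = {w. \<forall>k v e. icurv k v e p w = 0}"

definition flat_on :: "(real^'n) set \<Rightarrow> (real^'n \<Rightarrow> 'b) \<Rightarrow> bool" where
  "flat_on U h \<longleftrightarrow> smooth_on h U \<and> (\<forall>p\<in>U. \<forall>\<nu>. frechet_derivative h (at p) \<nu> = L p \<nu> (h p))"

lemma diffL: "p \<in> D \<Longrightarrow> (\<lambda>q. L q \<nu> w) differentiable (at p)"
  using real_analytic_on_differentiable[OF ana] .

lemma linear_deriv_family:
  fixes M :: "real^'n \<Rightarrow> 'x::real_vector \<Rightarrow> 'y::real_normed_vector"
  assumes "p \<in> D" and "\<And>q. q \<in> D \<Longrightarrow> linear (M q)" and "\<And>w. (\<lambda>q. M q w) differentiable (at p)"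
  shows "linear (\<lambda>w. frechet_derivative (\<lambda>q. M q w) (at p) v)"
proof (rule linearI)
  fix w w' :: 'x and c :: real
  have "frechet_derivative (\<lambda>q. M q (w + w')) (at p) = frechet_derivative (\<lambda>q. M q w + M q w') (at p)"
    by (rule frechet_derivative_cong_open[OF open_D assms(1)]) (simp add: linear_add[OF assms(2)])
  also have "\<dots> = (\<lambda>v. frechet_derivative (\<lambda>q. M q w) (at p) v + frechet_derivative (\<lambda>q. M q w') (at p) v)"
    by (rule frechet_derivative_at[symmetric]) (intro has_derivative_add has_derivative_frechet assms(3))
  finally show "frechet_derivative (\<lambda>q. M q (w + w')) (at p) v
      = frechet_derivative (\<lambda>q. M q w) (at p) v + frechet_derivative (\<lambda>q. M q w') (at p) v" by simp
  have "frechet_derivative (\<lambda>q. M q (c *\<^sub>R w)) (at p) = frechet_derivative (\<lambda>q. c *\<^sub>R M q w) (at p)"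
    by (rule frechet_derivative_cong_open[OF open_D assms(1)]) (simp add: linear_scale[OF assms(2)])
  also have "\<dots> = (\<lambda>v. c *\<^sub>R frechet_derivative (\<lambda>q. M q w) (at p) v)"
    by (rule frechet_derivative_at[symmetric]) (intro has_derivative_scaleR_right has_derivative_frechet assms(3))
  finally show "frechet_derivative (\<lambda>q. M q (c *\<^sub>R w)) (at p) v = c *\<^sub>R frechet_derivative (\<lambda>q. M q w) (at p) v" by simp
qed

lemma linear_curv:
  assumes p: "p \<in> D"
  shows "linear (curv p u v)" and "linear (\<lambda>u. curv p u v w)" and "linear (\<lambda>v. curv p u v w)"
proof -
  note simps = linear_add[OF lin1[OF p]] linear_scale[OF lin1[OF p]] linear_add[OF lin2[OF p]] linear_scale[OF lin2[OF p]]
  note d1 = linear_deriv_family[OF p, of "\<lambda>q \<nu>. L q \<nu> w" for w, OF lin1 diffL[OF p]]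
  note d2 = linear_deriv_family[OF p, of "\<lambda>q. L q \<nu>" for \<nu>, OF lin2 diffL[OF p]]
  note d3 = linear_frechet[OF diffL[OF p]]
  note ds = linear_add[OF d1] linear_scale[OF d1] linear_add[OF d2] linear_scale[OF d2] linear_add[OF d3] linear_scale[OF d3]
  show "linear (curv p u v)" by (rule linearI) (simp_all add: curv_def simps ds algebra_simps)
  show "linear (\<lambda>u. curv p u v w)" by (rule linearI) (simp_all add: curv_def simps ds algebra_simps)
  show "linear (\<lambda>v. curv p u v w)" by (rule linearI) (simp_all add: curv_def simps ds algebra_simps)
qed

lemma analytic_curv: "real_analytic_on (\<lambda>p. curv p u v w) D"
proof -
  have m: "real_analytic_on (\<lambda>p. - f p) D" if "real_analytic_on f D" for f :: "real^'n \<Rightarrow> 'b"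
    using real_analytic_on_bounded_linear[OF that bounded_linear_minus[OF bounded_linear_ident]] .
  have "real_analytic_on (\<lambda>p. frechet_derivative (\<lambda>q. L q u w) (at p) v + - frechet_derivative (\<lambda>q. L q v w) (at p) u
     + L p u (L p v w) + - L p v (L p u w)) D"
    by (intro real_analytic_on_add m real_analytic_on_deriv ana real_analytic_linear_family[OF open_D lin2])
  then show ?thesis unfolding curv_def[abs_def] by simp
qed

lemma icurv_regular:
  shows "(\<forall>p\<in>D. linear (icurv k v e p)) \<and> (\<forall>w. real_analytic_on (\<lambda>p. icurv k v e p w) D)"
proof (induction k)
  case 0 show ?case using linear_curv(1) analytic_curv by (simp add: eta_contract_eq)
next
  case (Suc k)
  have l: "\<And>p. p \<in> D \<Longrightarrow> linear (icurv k v e p)" and a: "\<And>w. real_analytic_on (\<lambda>p. icurv k v e p w) D"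
    using Suc by auto
  have "linear (\<lambda>w. frechet_derivative (\<lambda>q. icurv k v e q w) (at p) v + icurv k v e p (L p v w))" if p: "p \<in> D" for p
    by (intro linear_compose_add linear_deriv_family[OF p l] real_analytic_on_differentiable[OF a p]
        linear_compose[OF lin2[OF p] l[OF p], unfolded comp_def])
  moreover have "real_analytic_on (\<lambda>p. frechet_derivative (\<lambda>q. icurv k v e q w) (at p) v + icurv k v e p (L p v w)) D" for w
    by (intro real_analytic_on_add real_analytic_on_deriv a real_analytic_linear_family[OF open_D l a] ana)
  ultimately show ?case by simp
qed

lemma linear_icurv: "p \<in> D \<Longrightarrow> linear (icurv k v e p)" using icurv_regular by blast
lemma analytic_icurv: "real_analytic_on (\<lambda>p. icurv k v e p w) D" using icurv_regular by blast

lemma subspace_flat_jets: "p \<in> D \<Longrightarrow> subspace (flat_jets p)"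
  unfolding subspace_def flat_jets_def using linear_icurv
  by (auto simp: linear_0 linear_add linear_scale)

lemma deriv_icurv_section:
  assumes U: "U \<subseteq> D" and p: "p \<in> U" and h: "h differentiable (at p)"
  shows "((\<lambda>q. icurv k v e q (h q)) has_derivative
     (\<lambda>\<eta>. frechet_derivative (\<lambda>q. icurv k v e q (h p)) (at p) \<eta> + icurv k v e p (frechet_derivative h (at p) \<eta>))) (at p)"
  by (rule has_derivative_linear_family[OF open_D _ linear_icurv])
    (use U p h real_analytic_on_differentiable[OF analytic_icurv] in auto)

text \<open>The product rule. The derivative of the zero function \<open>icurv k v e q (h q)\<close> contains
  \<open>dh(v)\<close> where \<open>icurv (Suc k)\<close> contains \<open>L p v (h p)\<close>, so the two differ by the
  covariant derivative.\<close>

lemma icurv_Suc_section: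
  assumes U: "open U" "U \<subseteq> D" and p: "p \<in> U" and h: "h differentiable (at p)"
    and z: "\<And>q. q \<in> U \<Longrightarrow> icurv k v e q (h q) = 0"
  shows "icurv (Suc k) v e p (h p) = - icurv k v e p (frechet_derivative h (at p) v - L p v (h p))"
proof -
  have "((\<lambda>q. icurv k v e q (h q)) has_derivative (\<lambda>_. 0)) (at p)"
    by (rule has_derivative_transform_within_open[OF has_derivative_const U(1) p]) (simp add: z)
  from has_derivative_unique[OF this deriv_icurv_section[OF U(2) p h, of k v e]]
  have "frechet_derivative (\<lambda>q. icurv k v e q (h p)) (at p) v + icurv k v e p (frechet_derivative h (at p) v) = 0"
    by (metis (no_types))
  moreover have "linear (icurv k v e p)" using linear_icurv U p by auto
  ultimately show ?thesis by (simp add: linear_diff algebra_simps eq_neg_iff_add_eq_0)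
qed

lemma deriv_L_section:
  assumes p: "p \<in> D" and h: "h differentiable (at p)"
  shows "frechet_derivative (\<lambda>q. L q u (h q)) (at p) \<eta>
     = frechet_derivative (\<lambda>q. L q u (h p)) (at p) \<eta> + L p u (frechet_derivative h (at p) \<eta>)"
  and "(\<lambda>q. L q u (h q)) differentiable (at p)"
proof -
  have *: "((\<lambda>q. L q u (h q)) has_derivative
     (\<lambda>\<eta>. frechet_derivative (\<lambda>q. L q u (h p)) (at p) \<eta> + L p u (frechet_derivative h (at p) \<eta>))) (at p)"
    by (rule has_derivative_linear_family[OF open_D p lin2 diffL[OF p] h])
  show "(\<lambda>q. L q u (h q)) differentiable (at p)" using * by (auto simp: differentiable_def)
  show "frechet_derivative (\<lambda>q. L q u (h q)) (at p) \<eta>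
     = frechet_derivative (\<lambda>q. L q u (h p)) (at p) \<eta> + L p u (frechet_derivative h (at p) \<eta>)"
    unfolding frechet_derivative_at[OF *, symmetric] by simp
qed

text \<open>Differentiating \<open>dh(u) = L u h\<close> in the direction \<open>v\<close> gives an expression that
  must be symmetric in \<open>u\<close> and \<open>v\<close>.\<close>

lemma flat_on_curv:
  assumes U: "open U" "U \<subseteq> D" and h: "flat_on U h" and p: "p \<in> U"
  shows "curv p u v (h p) = 0"
proof -
  have sm: "smooth_on h U" and fl: "\<And>q \<nu>. q \<in> U \<Longrightarrow> frechet_derivative h (at q) \<nu> = L q \<nu> (h q)"
    using h by (auto simp: flat_on_def)
  have pD: "p \<in> D" using U p by auto
  have 1: "frechet_derivative (\<lambda>q. frechet_derivative h (at q) u) (at p) v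
     = frechet_derivative (\<lambda>q. L q u (h p)) (at p) v + L p u (L p v (h p))" for u v
  proof -
    have "frechet_derivative (\<lambda>q. frechet_derivative h (at q) u) (at p) = frechet_derivative (\<lambda>q. L q u (h q)) (at p)"
      by (rule frechet_derivative_cong_open[OF U(1) p]) (rule fl)
    then show ?thesis
      using deriv_L_section(1)[OF pD smooth_on_differentiable[OF sm p]] fl[OF p] by simp
  qed
  from symmetric_second_derivative[OF U(1) sm p, of u v]
  show ?thesis unfolding 1 curv_def by (simp add: algebra_simps)
qed

lemma flat_on_jets:
  assumes U: "open U" "U \<subseteq> D" and h: "flat_on U h" and p: "p \<in> U"
  shows "h p \<in> flat_jets p"
proof -
  have "icurv k v e p (h p) = 0" if "p \<in> U" for k v e p
    using that
  proof (induction k arbitrary: p)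
    case 0 then show ?case using flat_on_curv[OF U h] by simp
  next
    case (Suc k)
    have "h differentiable (at p)" using h Suc.prems smooth_on_differentiable by (auto simp: flat_on_def)
    from icurv_Suc_section[OF U Suc.prems this Suc.IH]
    show ?case using h Suc.prems linear_0[OF linear_icurv, of p k v e] U by (auto simp: flat_on_def)
  qed
  with p show ?thesis by (simp add: flat_jets_def)
qed

lemma flat_on_linear:
  assumes U: "open U" "U \<subseteq> D"
  shows "flat_on U h \<Longrightarrow> flat_on U k \<Longrightarrow> flat_on U (\<lambda>p. h p + k p)"
    and "flat_on U h \<Longrightarrow> flat_on U (\<lambda>p. c *\<^sub>R h p)"
proof -
  assume h: "flat_on U h"
  have d: "(h has_derivative frechet_derivative h (at p)) (at p)" if "p \<in> U" for p
    using h that smooth_on_differentiable has_derivative_frechet unfolding flat_on_def by blast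
  have "frechet_derivative (\<lambda>p. c *\<^sub>R h p) (at p) = (\<lambda>v. c *\<^sub>R frechet_derivative h (at p) v)" if "p \<in> U" for p
    by (rule frechet_derivative_at[symmetric]) (intro has_derivative_scaleR_right d that)
  then show "flat_on U (\<lambda>p. c *\<^sub>R h p)"
    using h U linear_scale[OF lin2] unfolding flat_on_def
    by (auto intro!: smooth_on_bounded_linear[OF _ bounded_linear_scaleR_right])
  assume k: "flat_on U k"
  have e: "(k has_derivative frechet_derivative k (at p)) (at p)" if "p \<in> U" for p
    using k that smooth_on_differentiable has_derivative_frechet unfolding flat_on_def by blast
  have "frechet_derivative (\<lambda>p. h p + k p) (at p) = (\<lambda>v. frechet_derivative h (at p) v + frechet_derivative k (at p) v)" if "p \<in> U" for p
    by (rule frechet_derivative_at[symmetric]) (intro has_derivative_add d e that)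
  then show "flat_on U (\<lambda>p. h p + k p)"
    using h k U linear_add[OF lin2] unfolding flat_on_def
    by (auto intro!: smooth_on_add)
qed

lemma local_series:
  assumes "p \<in> D"
  shows "\<exists>r>0. \<exists>T. ball p r \<subseteq> D \<and> (\<forall>i. \<forall>b\<in>Basis. psum p r T (\<lambda>z. L z (axis i 1) b))"
proof -
  have "\<exists>r>0. \<exists>T. \<forall>x\<in>UNIV \<times> Basis. psum p r T (\<lambda>z. L z (axis (fst x) 1) (snd x))"
    using ana assms unfolding real_analytic_on_iff_psum by (intro common_radius) auto
  then obtain r T where r: "r > 0" "\<And>i b. b \<in> Basis \<Longrightarrow> psum p r T (\<lambda>z. L z (axis i 1) b)" by force
  obtain d where d: "d > 0" "ball p d \<subseteq> D" using open_D assms openE by blast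
  show ?thesis
    using r d psum_shrink[OF r(2), of _ "min r d"] by (intro exI[of _ "min r d"] conjI exI[of _ T]) auto
qed

lemma local_bound:
  assumes "p \<in> D"
  shows "\<exists>r>0. \<exists>C\<ge>0. ball p r \<subseteq> D \<and> (\<forall>z\<in>ball p r. \<forall>\<nu> w. norm (L z \<nu> w) \<le> C * norm \<nu> * norm w)"
proof -
  obtain r T where r: "r > 0" "ball p r \<subseteq> D" "\<And>i b. b \<in> Basis \<Longrightarrow> psum p r T (\<lambda>z. L z (axis i 1) b)"
    using local_series[OF assms] by blast
  have T0: "T \<ge> 0" using r(3) psum_bound_nonneg nonempty_Basis by blast
  define C where "C = real CARD('n) * (real DIM('b) * T)"
  have "norm (L z \<nu> w) \<le> C * norm \<nu> * norm w" if z: "z \<in> ball p r" for z \<nu> w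
  proof -
    have zD: "z \<in> D" using z r by auto
    have "norm (L z \<nu> w) = norm (\<Sum>i\<in>UNIV. \<Sum>b\<in>Basis. (\<nu> $ i) *\<^sub>R (w \<bullet> b) *\<^sub>R L z (axis i 1) b)"
      by (rule arg_cong[where f = norm], rule bilinear_family_expand[OF lin1[OF zD] lin2[OF zD]])
    also have "\<dots> \<le> (\<Sum>i\<in>(UNIV::'n set). \<Sum>b\<in>(Basis::'b set). norm \<nu> * (norm w * T))"
    proof (intro sum_norm_le)
      fix i and b :: 'b assume b: "b \<in> Basis"
      have "norm ((\<nu> $ i) *\<^sub>R (w \<bullet> b) *\<^sub>R L z (axis i 1) b) = \<bar>\<nu> $ i\<bar> * (\<bar>w \<bullet> b\<bar> * norm (L z (axis i 1) b))" by (simp add: abs_mult)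
      also have "\<dots> \<le> norm \<nu> * (norm w * T)"
        using component_le_norm_cart[of \<nu> i] Basis_le_norm[OF b, of w] psum_norm_le[OF r(1) r(3)[OF b] z]
        by (intro mult_mono) auto
      finally show "norm ((\<nu> $ i) *\<^sub>R (w \<bullet> b) *\<^sub>R L z (axis i 1) b) \<le> norm \<nu> * (norm w * T)" .
    qed
    also have "\<dots> = C * norm \<nu> * norm w" by (simp add: C_def mult_ac)
    finally show ?thesis .
  qed
  moreover have "C \<ge> 0" using T0 by (simp add: C_def)
  ultimately show ?thesis using r by blast
qed

text \<open>The same number \<open>r\<close> limits the base point and the direction, so that \<open>linear_ode_zero\<close>
  applies to transport over a whole ray in the ball.\<close>

lemma local_bound_small:
  assumes "p \<in> D"
  shows "\<exists>r>0. ball p r \<subseteq> D \<and> (\<forall>z\<in>ball p r. \<forall>\<nu> w. norm \<nu> < r \<longrightarrow> norm (L z \<nu> w) \<le> 1/2 * norm w)"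
proof -
  obtain r C where r: "r > 0" "C \<ge> 0" "ball p r \<subseteq> D" "\<And>z \<nu> w. z \<in> ball p r \<Longrightarrow> norm (L z \<nu> w) \<le> C * norm \<nu> * norm w"
    using local_bound[OF assms] by blast
  define s where "s = min r (1 / (2 * (C + 1)))"
  have s: "s > 0" "s \<le> r" using r by (auto simp: s_def)
  have "C * s \<le> C * (1 / (2 * (C + 1)))" using r by (intro mult_left_mono) (auto simp: s_def)
  also have "\<dots> \<le> 1 / 2" using r by (simp add: field_simps)
  finally have Cs: "C * s \<le> 1 / 2" .
  have "norm (L z \<nu> w) \<le> 1/2 * norm w" if "z \<in> ball p s" "norm \<nu> < s" for z \<nu> w
  proof -
    have "norm (L z \<nu> w) \<le> C * norm \<nu> * norm w" using r(4) that s by auto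
    also have "\<dots> \<le> C * s * norm w" using that r by (intro mult_right_mono mult_left_mono) auto
    also have "\<dots> \<le> 1 / 2 * norm w" using Cs by (intro mult_right_mono) auto
    finally show ?thesis .
  qed
  then show ?thesis using s r by (intro exI[of _ s]) auto
qed

lemma flat_on_zero:
  assumes U: "open U" "U \<subseteq> D" and h: "flat_on U h" and p: "p \<in> U" and z: "h p = 0"
  shows "\<exists>r>0. \<forall>q\<in>ball p r. h q = 0"
proof -
  obtain r where r: "r > 0" "ball p r \<subseteq> D"
    "\<And>z \<nu> w. z \<in> ball p r \<Longrightarrow> norm \<nu> < r \<Longrightarrow> norm (L z \<nu> w) \<le> 1/2 * norm w"
    using local_bound_small[of p] p U(2) by (metis subsetD)
  obtain d where d: "d > 0" "ball p d \<subseteq> U" using U p openE by blast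
  have "h q = 0" if q: "q \<in> ball p (min r d)" for q
  proof -
    define \<zeta> where "\<zeta> = q - p"
    have n\<zeta>: "norm \<zeta> < min r d" using q by (simp add: \<zeta>_def dist_norm norm_minus_commute)
    have inb: "p + t *\<^sub>R \<zeta> \<in> ball p (min r d)" if "0 \<le> t" "t \<le> 1" for t
      using mult_right_mono[of t 1 "norm \<zeta>"] that n\<zeta> by (simp add: dist_norm)
    have "h (p + t *\<^sub>R \<zeta>) = 0" if t: "0 \<le> t" "t \<le> 1" for t
    proof (rule linear_ode_zero[where \<psi> = "\<lambda>t. h (p + t *\<^sub>R \<zeta>)" and q = "1/2" and \<psi>' = "\<lambda>t. L (p + t *\<^sub>R \<zeta>) \<zeta> (h (p + t *\<^sub>R \<zeta>))"])
      fix t :: real assume t: "0 \<le> t" "t \<le> 1"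
      have "p + t *\<^sub>R \<zeta> \<in> U" using inb[OF t] d by auto
      then show "((\<lambda>t. h (p + t *\<^sub>R \<zeta>)) has_vector_derivative L (p + t *\<^sub>R \<zeta>) \<zeta> (h (p + t *\<^sub>R \<zeta>))) (at t)"
        using has_vector_derivative_line[of h p t \<zeta>] h smooth_on_differentiable[of h U] by (auto simp: flat_on_def)
      show "norm (L (p + t *\<^sub>R \<zeta>) \<zeta> (h (p + t *\<^sub>R \<zeta>))) \<le> 1/2 * norm (h (p + t *\<^sub>R \<zeta>))"
        using r(3) inb[OF t] n\<zeta> by auto
    qed (use z t in auto)
    from this[of 1] show "h q = 0" by (simp add: \<zeta>_def)
  qed
  then show ?thesis using r d by (intro exI[of _ "min r d"]) auto
qed

text \<open>The second form of the transport equation has the direction \<open>\<zeta>\<close> of the ray in place of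
  \<open>z - p = t *\<^sub>R \<zeta>\<close>. It follows by cancelling \<open>t\<close>, and by continuity at the centre.\<close>

lemma radial_transport:
  assumes p: "p \<in> D"
  shows "\<exists>r>0. ball p r \<subseteq> D \<and> (\<forall>z\<in>ball p r. \<forall>\<nu> w. norm \<nu> < r \<longrightarrow> norm (L z \<nu> w) \<le> 1/2 * norm w) \<and>
    (\<forall>w. \<exists>\<sigma> T. psum p r T \<sigma> \<and> smooth_on \<sigma> (ball p r) \<and> \<sigma> p = w \<and>
      (\<forall>z\<in>ball p r. frechet_derivative \<sigma> (at z) (z - p) = L z (z - p) (\<sigma> z)) \<and>
      (\<forall>t \<zeta>. p + t *\<^sub>R \<zeta> \<in> ball p r \<longrightarrow> frechet_derivative \<sigma> (at (p + t *\<^sub>R \<zeta>)) \<zeta> = L (p + t *\<^sub>R \<zeta>) \<zeta> (\<sigma> (p + t *\<^sub>R \<zeta>))))"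
proof -
  obtain r1 where r1: "r1 > 0" "ball p r1 \<subseteq> D"
    "\<And>z \<nu> w. z \<in> ball p r1 \<Longrightarrow> norm \<nu> < r1 \<Longrightarrow> norm (L z \<nu> w) \<le> 1/2 * norm w"
    using local_bound_small[OF p] by blast
  obtain r2 T where r2: "r2 > 0" "ball p r2 \<subseteq> D" "\<And>i b. b \<in> Basis \<Longrightarrow> psum p r2 T (\<lambda>z. L z (axis i 1) b)"
    using local_series[OF p] by blast
  obtain r3 where r3: "r3 > 0" "r3 \<le> r2" "\<And>w. \<exists>\<sigma>. psum p r3 (2 * norm w) \<sigma> \<and> \<sigma> p = w \<and>
     (\<forall>z\<in>ball p r3. frechet_derivative \<sigma> (at z) (z - p) = L z (z - p) (\<sigma> z))"
    using radial_series[OF r2(1) lin1 lin2 r2(3)] r2(2) by blast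
  define r where "r = min r1 r3"
  have r: "r > 0" using r1 r3 by (simp add: r_def)
  have bD: "ball p r \<subseteq> D" using r1 by (auto simp: r_def)
  have "\<exists>\<sigma> T. psum p r T \<sigma> \<and> smooth_on \<sigma> (ball p r) \<and> \<sigma> p = w \<and>
      (\<forall>z\<in>ball p r. frechet_derivative \<sigma> (at z) (z - p) = L z (z - p) (\<sigma> z)) \<and>
      (\<forall>t \<zeta>. p + t *\<^sub>R \<zeta> \<in> ball p r \<longrightarrow> frechet_derivative \<sigma> (at (p + t *\<^sub>R \<zeta>)) \<zeta> = L (p + t *\<^sub>R \<zeta>) \<zeta> (\<sigma> (p + t *\<^sub>R \<zeta>)))" for w
  proof -
    obtain \<sigma> where \<sigma>: "psum p r3 (2 * norm w) \<sigma>" "\<sigma> p = w"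
      "\<And>z. z \<in> ball p r3 \<Longrightarrow> frechet_derivative \<sigma> (at z) (z - p) = L z (z - p) (\<sigma> z)"
      using r3(3) by blast
    have ps: "psum p r (2 * norm w) \<sigma>" by (rule psum_shrink[OF \<sigma>(1)]) (use r in \<open>auto simp: r_def\<close>)
    have sm: "smooth_on \<sigma> (ball p r)" by (rule psum_smooth[OF ps])
    have rad: "frechet_derivative \<sigma> (at z) (z - p) = L z (z - p) (\<sigma> z)" if "z \<in> ball p r" for z
      using \<sigma>(3) that by (auto simp: r_def)
    define f where "f \<zeta> z = frechet_derivative \<sigma> (at z) \<zeta> - L z \<zeta> (\<sigma> z)" for \<zeta> z
    have contf: "continuous_on (ball p r) (f \<zeta>)" for \<zeta>
    proof -
      have "smooth_on (\<lambda>z. L z \<zeta> (\<sigma> z)) (ball p r)"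
        by (rule smooth_linear_family) (use lin2 bD sm real_analytic_on_smooth[OF real_analytic_on_subset[OF ana bD]] in auto)
      then show ?thesis unfolding f_def[abs_def]
        by (intro continuous_on_diff smooth_on_continuous smooth_on_deriv[OF sm])
    qed
    have nz: "f \<zeta> (p + t *\<^sub>R \<zeta>) = 0" if "p + t *\<^sub>R \<zeta> \<in> ball p r" "t \<noteq> 0" for t \<zeta>
    proof -
      let ?z = "p + t *\<^sub>R \<zeta>"
      have zD: "?z \<in> D" using that bD by auto
      have d\<sigma>: "\<sigma> differentiable (at ?z)" using sm that smooth_on_differentiable by blast
      from rad[OF that(1)] have "t *\<^sub>R f \<zeta> ?z = 0"
        using linear_scale[OF linear_frechet[OF d\<sigma>]] linear_scale[OF lin1[OF zD]]
        by (simp add: f_def scaleR_diff_right)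
      with that show ?thesis by simp
    qed
    have z0: "f \<zeta> p = 0" for \<zeta>
    proof (rule ccontr)
      assume "f \<zeta> p \<noteq> 0"
      moreover have "p \<in> ball p r" using r by simp
      ultimately obtain d where d: "d > 0" "\<And>z. z \<in> ball p r \<Longrightarrow> dist z p < d \<Longrightarrow> dist (f \<zeta> z) (f \<zeta> p) < norm (f \<zeta> p)"
        using contf[of \<zeta>] unfolding continuous_on_iff by (metis zero_less_norm_iff)
\<comment> \<open>A nonzero parameter so small that the point on the ray is close to \<open>p\<close>.\<close>
      define t where "t = min d r / (2 * (norm \<zeta> + 1))"
      have t: "t > 0" using d r by (simp add: t_def add_nonneg_pos)
      have "t * norm \<zeta> < min d r"
      proof -
        have "t * norm \<zeta> \<le> t * (norm \<zeta> + 1)" using t by (intro mult_left_mono) auto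
        also have "\<dots> = min d r / 2"
        proof -
          have "m / (2 * N) * N = m / 2" if "N \<noteq> 0" for m N :: real using that by simp
          moreover have "norm \<zeta> + 1 \<noteq> 0" by (smt (verit) norm_ge_zero)
          ultimately show ?thesis unfolding t_def by blast
        qed
        also have "\<dots> < min d r" using d(1) r by (simp only: field_sum_of_halves half_gt_zero_iff min_less_iff_conj) (auto simp: min_def)
        finally show ?thesis .
      qed
      then have "p + t *\<^sub>R \<zeta> \<in> ball p r" "dist (p + t *\<^sub>R \<zeta>) p < d" using t by (auto simp: dist_norm)
      from d(2)[OF this] nz[OF this(1)] t show False by simp
    qed
    have "frechet_derivative \<sigma> (at (p + t *\<^sub>R \<zeta>)) \<zeta> = L (p + t *\<^sub>R \<zeta>) \<zeta> (\<sigma> (p + t *\<^sub>R \<zeta>))"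
      if "p + t *\<^sub>R \<zeta> \<in> ball p r" for t \<zeta>
      using nz[OF that] z0[of \<zeta>] by (cases "t = 0") (auto simp: f_def)
    then show ?thesis using ps sm \<sigma>(2) rad by blast
  qed
  moreover have "norm (L z \<nu> w) \<le> 1/2 * norm w" if "z \<in> ball p r" "norm \<nu> < r" for z \<nu> w
    using r1(3)[of z \<nu> w] that by (auto simp: r_def)
  ultimately show ?thesis using r bD by blast
qed

text \<open>The candidate is the radial transport \<open>\<sigma>\<close> of \<open>w\<close>. On a ray with direction \<open>v\<close>, the \<open>k\<close>-th
  derivative of \<open>curv v e \<sigma>\<close> is \<open>icurv k v e \<sigma>\<close>, which vanishes at the centre, so by analyticity
  \<open>curv z (z - p) e (\<sigma> z) = 0\<close>. This is the inhomogeneous term in the radial equation for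
  the defect \<open>J = d\<sigma>(e) - L e \<sigma>\<close>. The resulting equation \<open>dJ(z - p) = - J + L (z - p) J\<close>
  says that \<open>t * J\<close> is transported along the ray, starting from zero, so \<open>J\<close> vanishes.\<close>

lemma flat_extension:
  assumes p: "p \<in> D" and w: "w \<in> flat_jets p"
  shows "\<exists>r>0. \<exists>h. ball p r \<subseteq> D \<and> flat_on (ball p r) h \<and> h p = w"
proof -
  obtain r T \<sigma> where r: "r > 0" "ball p r \<subseteq> D"
    and bd: "\<And>z \<nu> w. z \<in> ball p r \<Longrightarrow> norm \<nu> < r \<Longrightarrow> norm (L z \<nu> w) \<le> 1/2 * norm w"
    and ps: "psum p r T \<sigma>" and sm: "smooth_on \<sigma> (ball p r)" and \<sigma>p: "\<sigma> p = w"
    and rad: "\<And>z. z \<in> ball p r \<Longrightarrow> frechet_derivative \<sigma> (at z) (z - p) = L z (z - p) (\<sigma> z)"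
    and ray: "\<And>t \<zeta>. p + t *\<^sub>R \<zeta> \<in> ball p r \<Longrightarrow> frechet_derivative \<sigma> (at (p + t *\<^sub>R \<zeta>)) \<zeta> = L (p + t *\<^sub>R \<zeta>) \<zeta> (\<sigma> (p + t *\<^sub>R \<zeta>))"
    using radial_transport[OF p] by metis
  have "\<exists>s>0. \<exists>T. \<forall>x\<in>UNIV \<times> UNIV. psum p s T (\<lambda>z. curv z (axis (fst x) 1) (axis (snd x) 1) (\<sigma> z))"
  proof (rule common_radius)
    fix x :: "'n \<times> 'n"
    have "\<exists>r>0. \<exists>T. \<forall>b\<in>Basis. psum p r T (\<lambda>z. (\<sigma> z \<bullet> b) *\<^sub>R curv z (axis (fst x) 1) (axis (snd x) 1) b)"
    proof (rule common_radius)
      fix b :: 'b assume b: "b \<in> Basis"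
      have 1: "\<exists>r>0. \<exists>T. psum p r T (\<lambda>z. curv z (axis (fst x) 1) (axis (snd x) 1) b)"
        using analytic_curv p unfolding real_analytic_on_iff_psum by blast
      have "psum p r (1 * T) (\<lambda>z. \<sigma> z \<bullet> b)"
        by (rule psum_bounded_linear[OF ps bounded_linear_inner_left]) (use b r Basis_le_norm in auto)
      then have 2: "\<exists>r>0. \<exists>T. psum p r T (\<lambda>z. \<sigma> z \<bullet> b)" using r by blast
      obtain r T T' where "r > 0" "psum p r T (\<lambda>z. \<sigma> z \<bullet> b)" "psum p r T' (\<lambda>z. curv z (axis (fst x) 1) (axis (snd x) 1) b)"
        using 2 1 by (rule common_radius2)
      then show "\<exists>r>0. \<exists>T. psum p r T (\<lambda>z. (\<sigma> z \<bullet> b) *\<^sub>R curv z (axis (fst x) 1) (axis (snd x) 1) b)"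
        using psum_scaleR by blast
    qed simp
    then obtain s T where s: "s > 0" "\<And>b. b \<in> Basis \<Longrightarrow> psum p s T (\<lambda>z. (\<sigma> z \<bullet> b) *\<^sub>R curv z (axis (fst x) 1) (axis (snd x) 1) b)"
      by blast
    have "psum p (min s r) T (\<lambda>z. (\<sigma> z \<bullet> b) *\<^sub>R curv z (axis (fst x) 1) (axis (snd x) 1) b)" if "b \<in> Basis" for b
      by (rule psum_shrink[OF s(2)[OF that]]) (use s r in auto)
    then have "psum p (min s r) (\<Sum>b\<in>(Basis::'b set). T) (\<lambda>z. \<Sum>b\<in>Basis. (\<sigma> z \<bullet> b) *\<^sub>R curv z (axis (fst x) 1) (axis (snd x) 1) b)"
      by (intro psum_sum) (use s r in auto)
    then have "psum p (min s r) (\<Sum>b\<in>(Basis::'b set). T) (\<lambda>z. curv z (axis (fst x) 1) (axis (snd x) 1) (\<sigma> z))"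
    proof (rule psum_cong)
      fix z assume "z \<in> ball p (min s r)"
      then have "z \<in> D" using r by auto
      then show "(\<Sum>b\<in>Basis. (\<sigma> z \<bullet> b) *\<^sub>R curv z (axis (fst x) 1) (axis (snd x) 1) b) = curv z (axis (fst x) 1) (axis (snd x) 1) (\<sigma> z)"
        by (intro linear_basis_expand[symmetric] linear_curv)
    qed
    then show "\<exists>s>0. \<exists>T. psum p s T (\<lambda>z. curv z (axis (fst x) 1) (axis (snd x) 1) (\<sigma> z))"
      using s r by (intro exI[of _ "min s r"]) auto
  qed simp
  then obtain s0 T where s0: "s0 > 0" "\<And>i j. psum p s0 T (\<lambda>z. curv z (axis i 1) (axis j 1) (\<sigma> z))" by force
  define s where "s = min s0 r"
  have s: "s > 0" "s \<le> r" "s \<le> s0" using s0 r by (auto simp: s_def)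
  have sD: "z \<in> D" "z \<in> ball p r" if "z \<in> ball p s" for z using that s r by auto
  have ps': "psum p s (\<Sum>i\<in>(UNIV::'n set). \<Sum>j\<in>(UNIV::'n set). \<bar>v $ i\<bar> * (\<bar>e $ j\<bar> * T)) (\<lambda>z. curv z v e (\<sigma> z))" for v e
  proof -
    have "psum p s (\<Sum>i\<in>(UNIV::'n set). \<Sum>j\<in>(UNIV::'n set). norm (v $ i) * (norm (e $ j) * T))
      (\<lambda>z. \<Sum>i\<in>UNIV. \<Sum>j\<in>UNIV. v $ i *\<^sub>R e $ j *\<^sub>R curv z (axis i 1) (axis j 1) (\<sigma> z))"
      by (intro psum_sum psum_scaleR psum_const s psum_shrink[OF s0(2)]) auto
    then have "psum p s (\<Sum>i\<in>(UNIV::'n set). \<Sum>j\<in>(UNIV::'n set). norm (v $ i) * (norm (e $ j) * T)) (\<lambda>z. curv z v e (\<sigma> z))"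
    proof (rule psum_cong)
      fix z assume "z \<in> ball p s"
      note zD = sD(1)[OF this]
      have "curv z v e (\<sigma> z) = (\<Sum>i\<in>UNIV. v $ i *\<^sub>R curv z (axis i 1) e (\<sigma> z))"
        by (rule linear_axis_expand[OF linear_curv(2)[OF zD]])
      also have "\<dots> = (\<Sum>i\<in>UNIV. v $ i *\<^sub>R (\<Sum>j\<in>UNIV. e $ j *\<^sub>R curv z (axis i 1) (axis j 1) (\<sigma> z)))"
        by (intro sum.cong refl arg_cong[where f = "scaleR _"] linear_axis_expand[OF linear_curv(3)[OF zD]])
      finally show "(\<Sum>i\<in>UNIV. \<Sum>j\<in>UNIV. v $ i *\<^sub>R e $ j *\<^sub>R curv z (axis i 1) (axis j 1) (\<sigma> z)) = curv z v e (\<sigma> z)"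
        by (simp add: scaleR_sum_right)
    qed
    then show ?thesis by simp
  qed
  have curv0: "curv z (z - p) e (\<sigma> z) = 0" if z: "z \<in> ball p (s / 2)" for z e
  proof -
\<comment> \<open>\<open>psum_zero_on_ray\<close> reaches parameters below 1, so \<open>z\<close> is put at the parameter 1/2.\<close>
    define v where "v = 2 *\<^sub>R (z - p)"
    have nv: "norm v < s" using z by (simp add: v_def dist_norm norm_minus_commute)
    have inb: "p + t *\<^sub>R v \<in> ball p s" if "\<bar>t\<bar> < 1" for t
      using mult_right_mono[of "\<bar>t\<bar>" 1 "norm v"] that nv by (simp add: dist_norm)
    have "curv (p + (1/2) *\<^sub>R v) v e (\<sigma> (p + (1/2) *\<^sub>R v)) = 0"
    proof (rule psum_zero_on_ray[OF ps' s(1) nv, where g = "\<lambda>k t. icurv k v e (p + t *\<^sub>R v) (\<sigma> (p + t *\<^sub>R v))"])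
      fix k and t :: real assume t: "\<bar>t\<bar> < 1"
      let ?z = "p + t *\<^sub>R v"
      have d\<sigma>: "\<sigma> differentiable (at ?z)" using smooth_on_differentiable[OF sm sD(2)[OF inb[OF t]]] .
      note d = deriv_icurv_section[OF order_refl sD(1)[OF inb[OF t]] d\<sigma>, of k v e]
      have "frechet_derivative (\<lambda>q. icurv k v e q (\<sigma> q)) (at ?z) v = icurv (Suc k) v e ?z (\<sigma> ?z)"
        unfolding frechet_derivative_at[OF d, symmetric] using ray[OF sD(2)[OF inb[OF t]]] by simp
      moreover have "(\<lambda>q. icurv k v e q (\<sigma> q)) differentiable (at ?z)" using d by (auto simp: differentiable_def)
      ultimately show "((\<lambda>t. icurv k v e (p + t *\<^sub>R v) (\<sigma> (p + t *\<^sub>R v))) has_vector_derivative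
          icurv (Suc k) v e (p + t *\<^sub>R v) (\<sigma> (p + t *\<^sub>R v))) (at t)"
        using has_vector_derivative_line[of "\<lambda>q. icurv k v e q (\<sigma> q)" p t v] by simp
    next
      show "icurv k v e (p + 0 *\<^sub>R v) (\<sigma> (p + 0 *\<^sub>R v)) = 0" for k
        using w by (simp add: \<sigma>p flat_jets_def)
    qed auto
    moreover have "p + (1/2) *\<^sub>R v = z" by (simp add: v_def)
    ultimately have "curv z (2 *\<^sub>R (z - p)) e (\<sigma> z) = 0" by (simp add: v_def)
    moreover have "z \<in> D" using z s sD by auto
    ultimately show ?thesis by (simp add: linear_scale[OF linear_curv(2)])
  qed
  have flat: "frechet_derivative \<sigma> (at z) e = L z e (\<sigma> z)" if z: "z \<in> ball p (s / 2)" for z e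
  proof -
    define J where "J z = frechet_derivative \<sigma> (at z) e - L z e (\<sigma> z)" for z
    have dJ: "J differentiable (at y)" and DJ: "frechet_derivative J (at y) (y - p) = - J y + L y (y - p) (J y)"
      if y: "y \<in> ball p (s / 2)" for y
    proof -
      have yr: "y \<in> ball p r" and yD: "y \<in> D" using y s sD by auto
      have sm1: "smooth_on (\<lambda>z. frechet_derivative \<sigma> (at z) u) (ball p r)" for u by (rule smooth_on_deriv[OF sm])
      have d\<sigma>: "\<sigma> differentiable (at y)" using smooth_on_differentiable[OF sm yr] .
      have dd: "(\<lambda>z. frechet_derivative \<sigma> (at z) u) differentiable (at y)" for u
        using smooth_on_differentiable[OF sm1 yr] .
      note dL = deriv_L_section[OF yD d\<sigma>]
      show "J differentiable (at y)" unfolding J_def[abs_def] by (intro differentiable_diff dd dL)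
      let ?\<zeta> = "y - p"
      let ?h = "\<sigma> y"
      have DJ1: "frechet_derivative J (at y) \<eta> = frechet_derivative (\<lambda>z. frechet_derivative \<sigma> (at z) e) (at y) \<eta>
          - (frechet_derivative (\<lambda>q. L q e ?h) (at y) \<eta> + L y e (frechet_derivative \<sigma> (at y) \<eta>))" for \<eta>
        unfolding J_def[abs_def]
        using fun_cong[OF frechet_derivative_at[OF has_derivative_diff[OF has_derivative_frechet[OF dd] has_derivative_frechet[OF dL(2)]]], of e \<eta> e]
        unfolding dL(1) by simp
\<comment> \<open>Both sides of the radial equation for \<open>\<sigma>\<close> are differentiated in the direction \<open>e\<close>; the
  variable point occurs in the direction \<open>z - p\<close> as well, which accounts for the terms \<open>d\<sigma>(e)\<close>
  and \<open>L e \<sigma>\<close>, that is, for the summand \<open>- J\<close>.\<close>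
      have r1: "frechet_derivative (\<lambda>z. frechet_derivative \<sigma> (at z) (z - p)) (at y) e
         = frechet_derivative (\<lambda>z. frechet_derivative \<sigma> (at z) ?\<zeta>) (at y) e + frechet_derivative \<sigma> (at y) e"
      proof -
        have "((\<lambda>z. frechet_derivative \<sigma> (at z) (z - p)) has_derivative
           (\<lambda>v. frechet_derivative (\<lambda>z. frechet_derivative \<sigma> (at z) (y - p)) (at y) v
              + frechet_derivative \<sigma> (at y) (frechet_derivative (\<lambda>z. z - p) (at y) v))) (at y)"
          by (rule has_derivative_linear_family[OF open_ball[of p r] yr])
            (use smooth_on_differentiable[OF sm] linear_frechet dd in auto)
        moreover have "frechet_derivative (\<lambda>z. z - p) (at y) = (\<lambda>v. v)"
          by (rule frechet_derivative_at[symmetric]) (auto intro!: derivative_eq_intros)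
        ultimately show ?thesis using fun_cong[OF frechet_derivative_at] by fastforce
      qed
      have r2: "frechet_derivative (\<lambda>z. L z (z - p) (\<sigma> z)) (at y) e
         = frechet_derivative (\<lambda>z. L z ?\<zeta> ?h) (at y) e + L y e ?h + L y ?\<zeta> (frechet_derivative \<sigma> (at y) e)"
      proof -
        have A: "((\<lambda>z. L z (z - p) w) has_derivative (\<lambda>v. frechet_derivative (\<lambda>z. L z ?\<zeta> w) (at y) v + L y v w)) (at y)" for w
        proof -
          have "((\<lambda>z. L z (z - p) w) has_derivative (\<lambda>v. frechet_derivative (\<lambda>z. L z (y - p) w) (at y) v
              + L y (frechet_derivative (\<lambda>z. z - p) (at y) v) w)) (at y)"
            by (rule has_derivative_linear_family[OF open_D yD, of "\<lambda>z \<nu>. L z \<nu> w" "\<lambda>z. z - p"])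
              (use lin1 diffL[OF yD] in auto)
          moreover have "frechet_derivative (\<lambda>z. z - p) (at y) = (\<lambda>v. v)"
            by (rule frechet_derivative_at[symmetric]) (auto intro!: derivative_eq_intros)
          ultimately show ?thesis by simp
        qed
        have "((\<lambda>z. L z (z - p) (\<sigma> z)) has_derivative (\<lambda>v. frechet_derivative (\<lambda>z. L z (z - p) ?h) (at y) v
            + L y (y - p) (frechet_derivative \<sigma> (at y) v))) (at y)"
          by (rule has_derivative_linear_family[OF open_D yD, of "\<lambda>z. L z (z - p)"])
            (use lin2 A d\<sigma> in \<open>auto simp: differentiable_def\<close>)
        from fun_cong[OF frechet_derivative_at[OF this], of e] fun_cong[OF frechet_derivative_at[OF A[of ?h]], of e]
        show ?thesis by simp
      qed
      have "frechet_derivative (\<lambda>z. frechet_derivative \<sigma> (at z) (z - p)) (at y) = frechet_derivative (\<lambda>z. L z (z - p) (\<sigma> z)) (at y)"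
        by (rule frechet_derivative_cong_open[OF open_ball yr rad])
      then have key: "frechet_derivative (\<lambda>z. frechet_derivative \<sigma> (at z) ?\<zeta>) (at y) e + frechet_derivative \<sigma> (at y) e
         = frechet_derivative (\<lambda>z. L z ?\<zeta> ?h) (at y) e + L y e ?h + L y ?\<zeta> (frechet_derivative \<sigma> (at y) e)"
        using r1 r2 by simp
      have sym: "frechet_derivative (\<lambda>z. frechet_derivative \<sigma> (at z) e) (at y) ?\<zeta>
         = frechet_derivative (\<lambda>z. frechet_derivative \<sigma> (at z) ?\<zeta>) (at y) e"
        by (rule symmetric_second_derivative[OF open_ball sm yr])
      have "frechet_derivative (\<lambda>z. frechet_derivative \<sigma> (at z) e) (at y) ?\<zeta>
         = frechet_derivative (\<lambda>z. L z ?\<zeta> ?h) (at y) e + L y e ?h + L y ?\<zeta> (frechet_derivative \<sigma> (at y) e)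
           - frechet_derivative \<sigma> (at y) e"
        unfolding sym using key by (metis add_diff_cancel_right')
      then have "frechet_derivative J (at y) ?\<zeta> = - J y + L y ?\<zeta> (J y) + curv y ?\<zeta> e ?h"
        unfolding DJ1 rad[OF yr] by (simp add: J_def curv_def linear_diff[OF lin2[OF yD]])
      then show "frechet_derivative J (at y) (y - p) = - J y + L y (y - p) (J y)"
        using curv0[OF y] by simp
    qed
    define \<zeta> where "\<zeta> = z - p"
    have n\<zeta>: "norm \<zeta> < s / 2" using z by (simp add: \<zeta>_def dist_norm norm_minus_commute)
    have inb: "p + t *\<^sub>R \<zeta> \<in> ball p (s / 2)" if "0 \<le> t" "t \<le> 1" for t
      using mult_right_mono[of t 1 "norm \<zeta>"] that n\<zeta> by (simp add: dist_norm)
    have "1 *\<^sub>R J (p + 1 *\<^sub>R \<zeta>) = 0"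
    proof (rule linear_ode_zero[where \<psi> = "\<lambda>t. t *\<^sub>R J (p + t *\<^sub>R \<zeta>)" and q = "1/2" and t = 1
          and \<psi>' = "\<lambda>t. L (p + t *\<^sub>R \<zeta>) \<zeta> (t *\<^sub>R J (p + t *\<^sub>R \<zeta>))"])
      fix t :: real assume t: "0 \<le> t" "t \<le> 1"
      let ?y = "p + t *\<^sub>R \<zeta>"
      have y: "?y \<in> ball p (s / 2)" by (rule inb[OF t])
      then have yD: "?y \<in> D" and yr: "?y \<in> ball p r" using s sD by auto
      have "((\<lambda>t. t *\<^sub>R J (p + t *\<^sub>R \<zeta>)) has_vector_derivative t *\<^sub>R frechet_derivative J (at ?y) \<zeta> + 1 *\<^sub>R J ?y) (at t)"
        by (intro has_vector_derivative_scaleR DERIV_ident has_vector_derivative_line dJ y)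
      moreover have "t *\<^sub>R frechet_derivative J (at ?y) \<zeta> + 1 *\<^sub>R J ?y = L ?y \<zeta> (t *\<^sub>R J ?y)"
      proof -
        have "t *\<^sub>R frechet_derivative J (at ?y) \<zeta> = frechet_derivative J (at ?y) (?y - p)"
          by (simp add: linear_scale[OF linear_frechet[OF dJ[OF y]]])
        also have "\<dots> = - J ?y + L ?y (t *\<^sub>R \<zeta>) (J ?y)" using DJ[OF y] by simp
        finally show ?thesis by (simp add: linear_scale[OF lin1[OF yD]] linear_scale[OF lin2[OF yD]])
      qed
      ultimately show "((\<lambda>t. t *\<^sub>R J (p + t *\<^sub>R \<zeta>)) has_vector_derivative L (p + t *\<^sub>R \<zeta>) \<zeta> (t *\<^sub>R J (p + t *\<^sub>R \<zeta>))) (at t)"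
        by simp
      show "norm (L ?y \<zeta> (t *\<^sub>R J ?y)) \<le> 1/2 * norm (t *\<^sub>R J ?y)"
        using n\<zeta> s by (intro bd yr) auto
    qed auto
    then show ?thesis by (simp add: J_def \<zeta>_def)
  qed
  have "flat_on (ball p (s / 2)) \<sigma>"
    unfolding flat_on_def using flat smooth_on_subset[OF sm subset_ball, of "s / 2"] s by simp
  then show ?thesis using s r \<sigma>p by (intro exI[of _ "s / 2"] exI[of _ \<sigma>] conjI) auto
qed

end

section \<open>Bilinear forms\<close>

text \<open>The coordinate change of a bilinear form. It is contravariant: \<open>pullback f\<close> with \<open>f\<close> the
  differential from a chart \<open>c\<close> to a chart \<open>d\<close> turns matrices in \<open>d\<close> into matrices in \<open>c\<close>.\<close>

definition pullback :: "(real^'n::finite \<Rightarrow> real^'n) \<Rightarrow> real^'n^'n \<Rightarrow> real^'n^'n" where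
  "pullback f B = transpose (matrix f) ** B ** matrix f"

lemma form_eval_mult_right: "form_eval (B ** M) u v = form_eval B u (M *v v)"
  by (simp add: form_eval_def matrix_vector_mul_assoc)

lemma form_eval_mult_left: "form_eval (transpose M ** B) u v = form_eval B (M *v u) v"
  unfolding form_eval_def matrix_vector_mul_assoc[symmetric]
  by (metis dot_lmul_matrix inner_commute vector_transpose_matrix transpose_transpose)

lemma form_eval_pullback:
  assumes "linear f" shows "form_eval (pullback f B) u v = form_eval B (f u) (f v)"
proof -
  have "form_eval (pullback f B) u v = form_eval (transpose (matrix f) ** B) u (matrix f *v v)"
    unfolding pullback_def by (rule form_eval_mult_right)
  also have "\<dots> = form_eval B (matrix f *v u) (matrix f *v v)" by (rule form_eval_mult_left)
  finally show ?thesis by (simp add: matrix_works assms)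
qed

lemma form_eval_axis: "form_eval B (axis i 1) (axis j 1) = B $ i $ j"
  by (simp add: form_eval_def inner_axis' matrix_vector_mul_component inner_axis)

lemma form_ext: "(\<And>u v. form_eval B u v = form_eval C u v) \<Longrightarrow> B = C"
  by (metis form_eval_axis vec_eq_iff)

lemma bilinear_mult_vec: "bilinear (\<lambda>(B::real^'n::finite^'n) v. B *v v)"
  unfolding bilinear_def
  by (auto intro!: linearI simp: matrix_vector_mult_add_rdistrib matrix_vector_right_distrib
      matrix_vector_mult_scaleR scaleR_matrix_vector_assoc)

lemma bounded_bilinear_mult_vec: "bounded_bilinear (\<lambda>(B::real^'n::finite^'n) v. B *v v)"
  using bilinear_mult_vec bilinear_conv_bounded_bilinear by blast

lemma linear_form_eval1: "linear (\<lambda>B. form_eval B u v)"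
  and linear_form_eval2: "linear (\<lambda>u. form_eval B u v)"
  and linear_form_eval3: "linear (form_eval B u)"
  unfolding form_eval_def
  by (auto intro!: linearI simp: inner_simps matrix_vector_mult_add_rdistrib matrix_vector_right_distrib
      matrix_vector_mult_scaleR simp flip: scaleR_matrix_vector_assoc)

lemmas form_eval_simps =
  linear_add[OF linear_form_eval1] linear_scale[OF linear_form_eval1] linear_diff[OF linear_form_eval1]
  linear_0[OF linear_form_eval1] linear_neg[OF linear_form_eval1]
  linear_add[OF linear_form_eval2] linear_scale[OF linear_form_eval2] linear_diff[OF linear_form_eval2]
  linear_0[OF linear_form_eval2] linear_neg[OF linear_form_eval2]
  linear_add[OF linear_form_eval3] linear_scale[OF linear_form_eval3] linear_diff[OF linear_form_eval3]
  linear_0[OF linear_form_eval3] linear_neg[OF linear_form_eval3]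

lemma pullback_compose:
  "linear f \<Longrightarrow> linear g \<Longrightarrow> pullback g (pullback f B) = pullback (\<lambda>v. f (g v)) B"
  by (rule form_ext) (simp add: form_eval_pullback linear_compose[unfolded comp_def])

lemma pullback_id: "pullback (\<lambda>v. v) B = B"
  by (rule form_ext) (simp add: form_eval_pullback linearI)

lemma linear_pullback: "linear f \<Longrightarrow> linear (pullback f)"
  by (rule linearI; rule form_ext) (simp_all add: form_eval_pullback form_eval_simps)

lemma sym_form_iff: "sym_form B \<longleftrightarrow> (\<forall>u v. form_eval B u v = form_eval B v u)"
proof
  assume s: "sym_form B"
  have "form_eval B u v = form_eval B v u" for u v
  proof -
    have "form_eval B u v = form_eval (transpose B ** mat 1) u v"
      using s by (simp add: sym_form_def)
    also have "\<dots> = form_eval (mat 1) (B *v u) v" by (rule form_eval_mult_left)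
    also have "\<dots> = form_eval B v u" by (simp add: form_eval_def inner_commute)
    finally show ?thesis .
  qed
  then show "\<forall>u v. form_eval B u v = form_eval B v u" by blast
next
  assume "\<forall>u v. form_eval B u v = form_eval B v u"
  then show "sym_form B" unfolding sym_form_def
    by (metis (no_types) form_eval_axis transpose_def vec_eq_iff vec_lambda_beta)
qed

lemma sym_form_pullback: "linear f \<Longrightarrow> sym_form B \<Longrightarrow> sym_form (pullback f B)"
  by (simp add: sym_form_iff form_eval_pullback)

lemma matrix_expand:
  "B = (\<Sum>i\<in>UNIV. \<Sum>j\<in>UNIV. form_eval B (axis i 1) (axis j 1) *\<^sub>R axis i (axis j 1))" for B :: "real^'n::finite^'n"
proof -
  have e: "(\<Sum>k\<in>(UNIV::'n set). if P then h k else 0) = (if P then \<Sum>k\<in>UNIV. h k else 0)" for P and h :: "'n \<Rightarrow> real"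
    by auto
  show ?thesis
    unfolding form_eval_axis by (simp add: vec_eq_iff axis_def if_distrib[of "\<lambda>x. _ * x"] if_distrib[of "\<lambda>x. x $ _"] e cong: if_cong)
qed

lemma smooth_on_matrixI:
  assumes "open S" "\<And>u v. smooth_on (\<lambda>p. form_eval (H p) u v) S"
  shows "smooth_on H S"
  by (rule smooth_on_cong[OF assms(1) matrix_expand[symmetric]])
    (intro smooth_on_sum assms smooth_on_bilinear[OF assms(1) bounded_bilinear_scaleR] smooth_on_const)

lemma real_analytic_on_matrixI:
  fixes H :: "real^'k::finite \<Rightarrow> real^'n::finite^'n"
  assumes "open S" and "\<And>u v. real_analytic_on (\<lambda>p. form_eval (H p) u v) S"
  shows "real_analytic_on H S"
  by (rule real_analytic_on_cong[OF assms(1) matrix_expand[symmetric]])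
    (intro real_analytic_on_sum assms real_analytic_on_scaleR real_analytic_on_const finite)

lemma smooth_on_form_eval:
  assumes "open S" "smooth_on H S" "smooth_on X S" "smooth_on Y S"
  shows "smooth_on (\<lambda>p. form_eval (H p) (X p) (Y p)) S"
  unfolding form_eval_def
  by (intro smooth_on_bilinear[OF assms(1) bounded_bilinear_inner]
      smooth_on_bilinear[OF assms(1) bounded_bilinear_mult_vec] assms)

lemma has_derivative_form_eval:
  assumes "(H has_derivative H') (at p)" "(X has_derivative X') (at p)" "(Y has_derivative Y') (at p)"
  shows "((\<lambda>p. form_eval (H p) (X p) (Y p)) has_derivative
    (\<lambda>v. form_eval (H' v) (X p) (Y p) + form_eval (H p) (X' v) (Y p) + form_eval (H p) (X p) (Y' v))) (at p)"
proof -
  have "((\<lambda>p. X p \<bullet> (H p *v Y p)) has_derivative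
    (\<lambda>v. X p \<bullet> (H p *v Y' v + H' v *v Y p) + X' v \<bullet> (H p *v Y p))) (at p)"
    by (intro bounded_bilinear.FDERIV[OF bounded_bilinear_inner] bounded_bilinear.FDERIV[OF bounded_bilinear_mult_vec] assms)
  then show ?thesis by (simp add: form_eval_def inner_add_right add_ac)
qed

section \<open>Coordinate changes\<close>

locale manifold =
  fixes A :: "('m::topological_space, 'n::finite) chart set"
  assumes atlas: "analytic_atlas A"
begin

abbreviation img :: "('m, 'n) chart \<Rightarrow> (real^'n) set" where "img c \<equiv> cmap c ` cdom c"

lemma chartD:
  assumes "c \<in> A"
  shows open_cdom: "open (cdom c)" and open_img: "open (img c)"
    and chart_homeo: "homeomorphism (cdom c) (img c) (cmap c) (cinv c)"
proof -
  have "is_chart c" using atlas assms unfolding analytic_atlas_def by blast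
  then show "open (cdom c)" "open (img c)" "homeomorphism (cdom c) (img c) (cmap c) (cinv c)"
    unfolding is_chart_def by blast+
qed

lemma cinv_cmap: "c \<in> A \<Longrightarrow> x \<in> cdom c \<Longrightarrow> cinv c (cmap c x) = x"
  using chart_homeo unfolding homeomorphism_def by blast

lemma open_image:
  assumes "c \<in> A" "open U" shows "open (cmap c ` (cdom c \<inter> U))"
proof -
  have "openin (top_of_set (img c)) (cmap c ` (cdom c \<inter> U))"
    by (rule homeomorphism_imp_open_map[OF chart_homeo[OF assms(1)]])
      (simp add: openin_open_eq open_cdom assms open_Int)
  then show ?thesis using open_img[OF assms(1)] openin_open_eq by blast
qed

lemma open_cmap_image: "c \<in> A \<Longrightarrow> open U \<Longrightarrow> U \<subseteq> cdom c \<Longrightarrow> open (cmap c ` U)"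
  using open_image[of c U] by (simp add: Int_absorb1)

lemma open_cinv_image:
  assumes "c \<in> A" "open V" "V \<subseteq> img c" shows "open (cinv c ` V)"
proof -
  have "openin (top_of_set (cdom c)) (cinv c ` V)"
    by (rule homeomorphism_imp_open_map[OF homeomorphism_symD[OF chart_homeo[OF assms(1)]]])
      (use assms open_img in \<open>auto simp: openin_open_eq\<close>)
  then show ?thesis using open_cdom[OF assms(1)] openin_open_eq by blast
qed

lemma continuous_cinv: "c \<in> A \<Longrightarrow> continuous_on (img c) (cinv c)"
  using chart_homeo unfolding homeomorphism_def by blast

lemma chart_at: "chart_at A x \<in> A" "x \<in> cdom (chart_at A x)"
proof -
  have "\<exists>c. c \<in> A \<and> x \<in> cdom c" using atlas unfolding analytic_atlas_def by blast
  then have "chart_at A x \<in> A \<and> x \<in> cdom (chart_at A x)"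
    unfolding chart_at_def by (rule someI_ex)
  then show "chart_at A x \<in> A" "x \<in> cdom (chart_at A x)" by auto
qed

lemma trans_analytic:
  "c \<in> A \<Longrightarrow> d \<in> A \<Longrightarrow> real_analytic_on (cmap d \<circ> cinv c) (cmap c ` (cdom c \<inter> cdom d))"
  using atlas unfolding analytic_atlas_def by blast

lemma cc_has_derivative:
  assumes "c \<in> A" "d \<in> A" "x \<in> cdom c" "x \<in> cdom d"
  shows "((cmap d \<circ> cinv c) has_derivative coord_change c d x) (at (cmap c x))"
  unfolding coord_change_def
  by (intro has_derivative_frechet real_analytic_on_differentiable[OF trans_analytic]) (use assms in auto)

lemma linear_cc:
  "c \<in> A \<Longrightarrow> d \<in> A \<Longrightarrow> x \<in> cdom c \<Longrightarrow> x \<in> cdom d \<Longrightarrow> linear (coord_change c d x)"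
  using cc_has_derivative has_derivative_linear by blast

lemma cc_compose:
  assumes c: "c \<in> A" "d \<in> A" "e \<in> A" and x: "x \<in> cdom c" "x \<in> cdom d" "x \<in> cdom e"
  shows "coord_change d e x (coord_change c d x v) = coord_change c e x v"
proof -
  let ?S = "cmap c ` (cdom c \<inter> (cdom d \<inter> cdom e))"
  have S: "open ?S" by (intro open_image open_Int open_cdom c)
  have "((\<lambda>p. (cmap e \<circ> cinv d) ((cmap d \<circ> cinv c) p)) has_derivative (\<lambda>v. coord_change d e x (coord_change c d x v))) (at (cmap c x))"
  proof (rule has_derivative_compose[OF cc_has_derivative[OF c(1,2) x(1,2)]])
    have "(cmap d \<circ> cinv c) (cmap c x) = cmap d x" by (simp add: cinv_cmap c x)
    then show "((cmap e \<circ> cinv d) has_derivative coord_change d e x) (at ((cmap d \<circ> cinv c) (cmap c x)))"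
      using cc_has_derivative[OF c(2,3) x(2,3)] by metis
  qed
  then have "((cmap e \<circ> cinv c) has_derivative (\<lambda>v. coord_change d e x (coord_change c d x v))) (at (cmap c x))"
    by (rule has_derivative_transform_within_open[OF _ S]) (use c x in \<open>auto simp: cinv_cmap\<close>)
  from has_derivative_unique[OF this cc_has_derivative[OF c(1,3) x(1,3)]]
  show ?thesis by metis
qed

lemma cc_id:
  assumes "c \<in> A" "x \<in> cdom c" shows "coord_change c c x v = v"
proof -
  have "((cmap c \<circ> cinv c) has_derivative (\<lambda>v. v)) (at (cmap c x))"
    by (rule has_derivative_transform_within_open[OF has_derivative_ident open_img[OF assms(1)]])
      (use assms in \<open>auto simp: cinv_cmap\<close>)
  from has_derivative_unique[OF this cc_has_derivative[OF assms(1,1,2,2)]]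
  show ?thesis by metis
qed

lemma cc_inverse:
  "c \<in> A \<Longrightarrow> d \<in> A \<Longrightarrow> x \<in> cdom c \<Longrightarrow> x \<in> cdom d \<Longrightarrow> coord_change d c x (coord_change c d x v) = v"
  by (simp add: cc_compose cc_id)

abbreviation to_chart :: "('m, 'n) chart \<Rightarrow> 'm \<Rightarrow> real^'n \<Rightarrow> real^'n" where
  "to_chart c x \<equiv> coord_change (chart_at A x) c x"

abbreviation from_chart :: "('m, 'n) chart \<Rightarrow> 'm \<Rightarrow> real^'n \<Rightarrow> real^'n" where
  "from_chart c x \<equiv> coord_change c (chart_at A x) x"

lemma chart_conv:
  assumes "c \<in> A" "x \<in> cdom c"
  shows linear_to_chart: "linear (to_chart c x)" and linear_from_chart: "linear (from_chart c x)"
    and to_from: "to_chart c x (from_chart c x v) = v" and from_to: "from_chart c x (to_chart c x v) = v"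
  using assms chart_at linear_cc cc_inverse by auto

lemma vec_rep_cmap: "c \<in> A \<Longrightarrow> x \<in> cdom c \<Longrightarrow> vec_rep A c Y (cmap c x) = to_chart c x (Y x)"
  by (simp add: vec_rep_def Let_def cinv_cmap)

lemma form_rep_cmap: "c \<in> A \<Longrightarrow> x \<in> cdom c \<Longrightarrow> form_rep A c w (cmap c x) = pullback (from_chart c x) (w x)"
  by (simp add: form_rep_def Let_def cinv_cmap pullback_def)

lemma vec_rep_change:
  assumes "c \<in> A" "d \<in> A" "x \<in> cdom c" "x \<in> cdom d"
  shows "vec_rep A d Y (cmap d x) = coord_change c d x (vec_rep A c Y (cmap c x))"
  using assms chart_at by (simp add: vec_rep_cmap cc_compose)

lemma form_rep_change:
  assumes "c \<in> A" "d \<in> A" "x \<in> cdom c" "x \<in> cdom d"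
  shows "form_rep A d w (cmap d x) = pullback (coord_change d c x) (form_rep A c w (cmap c x))"
  using assms chart_at by (simp add: form_rep_cmap pullback_compose linear_cc cc_compose)

lemma pullback_inverse:
  assumes "c \<in> A" "x \<in> cdom c"
  shows "pullback (to_chart c x) (pullback (from_chart c x) B) = B"
    and "pullback (from_chart c x) (pullback (to_chart c x) B) = B"
  using chart_conv[OF assms] by (simp_all add: pullback_compose pullback_id)

lemma form_eval_rep:
  assumes "c \<in> A" "x \<in> cdom c"
  shows "form_eval (w x) u v = form_eval (form_rep A c w (cmap c x)) (to_chart c x u) (to_chart c x v)"
  using chart_conv[OF assms] assms by (simp add: form_rep_cmap form_eval_pullback)

lemma chart_transition:
  assumes "c \<in> A" "d \<in> A" "U \<subseteq> cdom c"
  shows "smooth_on (cmap c \<circ> cinv d) (cmap d ` (cdom d \<inter> U))"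
    "real_analytic_on (cmap c \<circ> cinv d) (cmap d ` (cdom d \<inter> U))"
    "(cmap c \<circ> cinv d) ` (cmap d ` (cdom d \<inter> U)) \<subseteq> cmap c ` U"
proof -
  show 1: "real_analytic_on (cmap c \<circ> cinv d) (cmap d ` (cdom d \<inter> U))"
    by (rule real_analytic_on_subset[OF trans_analytic]) (use assms in auto)
  then show "smooth_on (cmap c \<circ> cinv d) (cmap d ` (cdom d \<inter> U))" by (rule real_analytic_on_smooth)
  show "(cmap c \<circ> cinv d) ` (cmap d ` (cdom d \<inter> U)) \<subseteq> cmap c ` U"
    using assms by (auto simp: cinv_cmap)
qed

lemma analytic_cc:
  assumes "c \<in> A" "d \<in> A" "U \<subseteq> cdom c" "open U"
  shows "real_analytic_on (\<lambda>q. coord_change c d (cinv d q) v) (cmap d ` (cdom d \<inter> U))"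
proof -
  have o: "open (cmap d ` (cdom d \<inter> U))" using open_image assms by auto
  have "real_analytic_on (\<lambda>q. frechet_derivative (cmap d \<circ> cinv c) (at ((cmap c \<circ> cinv d) q)) v) (cmap d ` (cdom d \<inter> U))"
    by (rule real_analytic_on_compose[OF chart_transition(2)[OF assms(1-3)] real_analytic_on_deriv[OF trans_analytic[OF assms(1,2)]]])
      (use assms in \<open>auto simp: cinv_cmap\<close>)
  then show ?thesis
    by (rule real_analytic_on_cong[OF o, rotated]) (auto simp: coord_change_def)
qed

lemma analytic_cc_inverse:
  assumes "c \<in> A" "d \<in> A" "U \<subseteq> cdom c" "open U"
  shows "real_analytic_on (\<lambda>q. coord_change d c (cinv d q) v) (cmap d ` (cdom d \<inter> U))"
proof -
  have o: "open (cmap d ` (cdom d \<inter> U))" using open_image assms by auto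
  show ?thesis
    by (rule real_analytic_on_cong[OF o _ real_analytic_on_deriv[OF chart_transition(2)[OF assms(1-3)], of v]])
      (use assms in \<open>auto simp: coord_change_def cinv_cmap\<close>)
qed

lemma linear_cc_family:
  assumes "c \<in> A" "d \<in> A" "U \<subseteq> cdom c" "q \<in> cmap d ` (cdom d \<inter> U)"
  shows "linear (coord_change c d (cinv d q))" "linear (coord_change d c (cinv d q))"
  using assms by (auto simp: cinv_cmap intro!: linear_cc)

text \<open>Transitions and coordinate changes are analytic, so the regularity of functions and
  fields on a chart domain can be read off in this chart alone.\<close>

lemma smooth_fun_chart:
  assumes "c \<in> A" "open U" "U \<subseteq> cdom c" "smooth_on (f \<circ> cinv c) (cmap c ` U)"
  shows "smooth_fun A U f"
  unfolding smooth_fun_def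
proof
  fix d assume d: "d \<in> A"
  have o: "open (cmap d ` (cdom d \<inter> U))" using open_image assms d by auto
  have "smooth_on (\<lambda>q. (f \<circ> cinv c) ((cmap c \<circ> cinv d) q)) (cmap d ` (cdom d \<inter> U))"
    by (rule smooth_on_compose[OF o chart_transition(1)[OF assms(1) d assms(3)] assms(4) chart_transition(3)[OF assms(1) d assms(3)]])
  then show "smooth_on (f \<circ> cinv d) (cmap d ` (cdom d \<inter> U))"
    by (rule smooth_on_cong[OF o, rotated]) (use assms d in \<open>auto simp: cinv_cmap\<close>)
qed

lemma smooth_vec_chart:
  assumes "c \<in> A" "open U" "U \<subseteq> cdom c" "smooth_on (vec_rep A c Y) (cmap c ` U)"
  shows "smooth_vec A U Y"
  unfolding smooth_vec_def
proof
  fix d assume d: "d \<in> A"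
  have o: "open (cmap d ` (cdom d \<inter> U))" using open_image assms d by auto
  have "smooth_on (\<lambda>q. coord_change c d (cinv d q) (vec_rep A c Y ((cmap c \<circ> cinv d) q))) (cmap d ` (cdom d \<inter> U))"
    by (rule smooth_linear_family[OF o linear_cc_family(1)[OF assms(1) d assms(3)]
          real_analytic_on_smooth[OF analytic_cc[OF assms(1) d assms(3,2)]]
          smooth_on_compose[OF o chart_transition(1)[OF assms(1) d assms(3)] assms(4) chart_transition(3)[OF assms(1) d assms(3)]]])
  then show "smooth_on (vec_rep A d Y) (cmap d ` (cdom d \<inter> U))"
    by (rule smooth_on_cong[OF o, rotated]) (use assms d in \<open>auto simp: cinv_cmap vec_rep_change[OF assms(1) d]\<close>)
qed

lemma analytic_vec_chart:
  assumes "c \<in> A" "open U" "U \<subseteq> cdom c" "real_analytic_on (vec_rep A c Y) (cmap c ` U)"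
  shows "analytic_vec A U Y"
  unfolding analytic_vec_def
proof
  fix d assume d: "d \<in> A"
  have o: "open (cmap d ` (cdom d \<inter> U))" using open_image assms d by auto
  have "real_analytic_on (\<lambda>q. coord_change c d (cinv d q) (vec_rep A c Y ((cmap c \<circ> cinv d) q))) (cmap d ` (cdom d \<inter> U))"
    by (rule real_analytic_linear_family[OF o linear_cc_family(1)[OF assms(1) d assms(3)]
          analytic_cc[OF assms(1) d assms(3,2)]
          real_analytic_on_compose[OF chart_transition(2)[OF assms(1) d assms(3)] assms(4) chart_transition(3)[OF assms(1) d assms(3)]]])
  then show "real_analytic_on (vec_rep A d Y) (cmap d ` (cdom d \<inter> U))"
    by (rule real_analytic_on_cong[OF o, rotated]) (use assms d in \<open>auto simp: cinv_cmap vec_rep_change[OF assms(1) d]\<close>)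
qed

lemma smooth_form_chart:
  assumes "c \<in> A" "open U" "U \<subseteq> cdom c" "smooth_on (form_rep A c w) (cmap c ` U)"
  shows "smooth_form A U w"
  unfolding smooth_form_def
proof
  fix d assume d: "d \<in> A"
  have o: "open (cmap d ` (cdom d \<inter> U))" using open_image assms d by auto
  show "smooth_on (form_rep A d w) (cmap d ` (cdom d \<inter> U))"
  proof (rule smooth_on_matrixI[OF o])
    fix u v
    have "smooth_on (\<lambda>q. form_eval (form_rep A c w ((cmap c \<circ> cinv d) q))
       (coord_change d c (cinv d q) u) (coord_change d c (cinv d q) v)) (cmap d ` (cdom d \<inter> U))"
      by (intro smooth_on_form_eval[OF o] real_analytic_on_smooth[OF analytic_cc_inverse[OF assms(1) d assms(3,2)]]
          smooth_on_compose[OF o chart_transition(1)[OF assms(1) d assms(3)] assms(4) chart_transition(3)[OF assms(1) d assms(3)]])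
    then show "smooth_on (\<lambda>q. form_eval (form_rep A d w q) u v) (cmap d ` (cdom d \<inter> U))"
      by (rule smooth_on_cong[OF o, rotated])
        (use assms d in \<open>auto simp: cinv_cmap form_rep_change[OF assms(1) d] form_eval_pullback linear_cc subset_iff\<close>)
  qed
qed

lemma smooth_vecD: "smooth_vec A U Y \<Longrightarrow> c \<in> A \<Longrightarrow> smooth_on (vec_rep A c Y) (cmap c ` (cdom c \<inter> U))"
  by (simp add: smooth_vec_def)
lemma smooth_formD: "smooth_form A U w \<Longrightarrow> c \<in> A \<Longrightarrow> smooth_on (form_rep A c w) (cmap c ` (cdom c \<inter> U))"
  by (simp add: smooth_form_def)
lemma smooth_funD: "smooth_fun A U f \<Longrightarrow> c \<in> A \<Longrightarrow> smooth_on (f \<circ> cinv c) (cmap c ` (cdom c \<inter> U))"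
  by (simp add: smooth_fun_def)

lemma smooth_subset:
  assumes "V \<subseteq> U"
  shows "smooth_vec A U Y \<Longrightarrow> smooth_vec A V Y" "smooth_form A U w \<Longrightarrow> smooth_form A V w"
    "smooth_fun A U f \<Longrightarrow> smooth_fun A V f" "W_section A U w \<Longrightarrow> W_section A V w"
  using assms unfolding smooth_vec_def smooth_form_def smooth_fun_def W_section_def
  by (blast intro: smooth_on_subset)+

lemma smooth_form_add:
  assumes "open U" "smooth_form A U w" "smooth_form A U w'"
  shows "smooth_form A U (\<lambda>x. w x + w' x)"
  unfolding smooth_form_def
proof
  fix c assume c: "c \<in> A"
  have o: "open (cmap c ` (cdom c \<inter> U))" using open_image assms c by auto
  show "smooth_on (form_rep A c (\<lambda>x. w x + w' x)) (cmap c ` (cdom c \<inter> U))"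
    by (rule smooth_on_cong[OF o _ smooth_on_add[OF o smooth_formD[OF assms(2) c] smooth_formD[OF assms(3) c]]])
      (use c in \<open>auto simp: form_rep_cmap linear_add[OF linear_pullback[OF linear_from_chart]]\<close>)
qed

lemma smooth_form_scale:
  assumes "open U" "smooth_form A U w"
  shows "smooth_form A U (\<lambda>x. r *\<^sub>R w x)"
  unfolding smooth_form_def
proof
  fix c assume c: "c \<in> A"
  have o: "open (cmap c ` (cdom c \<inter> U))" using open_image assms c by auto
  show "smooth_on (form_rep A c (\<lambda>x. r *\<^sub>R w x)) (cmap c ` (cdom c \<inter> U))"
    by (rule smooth_on_cong[OF o _ smooth_on_bounded_linear[OF o bounded_linear_scaleR_right smooth_formD[OF assms(2) c]]])
      (use c in \<open>auto simp: form_rep_cmap linear_scale[OF linear_pullback[OF linear_from_chart]]\<close>)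
qed

text \<open>The field with constant coordinates \<open>b\<close> in the chart \<open>c\<close>.\<close>

definition vec_of :: "('m, 'n) chart \<Rightarrow> real^'n \<Rightarrow> 'm \<Rightarrow> real^'n" where
  "vec_of c b x = from_chart c x b"

definition form_of :: "('m, 'n) chart \<Rightarrow> (real^'n \<Rightarrow> real^'n^'n) \<Rightarrow> 'm \<Rightarrow> real^'n^'n" where
  "form_of c H x = pullback (to_chart c x) (H (cmap c x))"

lemma vec_rep_vec_of: "c \<in> A \<Longrightarrow> x \<in> cdom c \<Longrightarrow> vec_rep A c (vec_of c b) (cmap c x) = b"
  by (simp add: vec_rep_cmap vec_of_def to_from)

lemma form_rep_form_of: "c \<in> A \<Longrightarrow> x \<in> cdom c \<Longrightarrow> form_rep A c (form_of c H) (cmap c x) = H (cmap c x)"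
  by (simp add: form_rep_cmap form_of_def pullback_inverse)

lemma analytic_vec_of: "c \<in> A \<Longrightarrow> analytic_vec A (cdom c) (vec_of c b)"
  by (rule analytic_vec_chart[of c]) (auto simp: open_cdom vec_rep_vec_of
      intro!: real_analytic_on_cong[OF open_img _ real_analytic_on_const[of b]])

lemma smooth_vec_of: "c \<in> A \<Longrightarrow> smooth_vec A (cdom c) (vec_of c b)"
  by (rule smooth_vec_chart[of c]) (auto simp: open_cdom vec_rep_vec_of
      intro!: smooth_on_cong[OF open_img _ smooth_on_const[of b]])

lemma smooth_form_of:
  assumes c: "c \<in> A" and U: "open U" "U \<subseteq> cdom c" and H: "smooth_on H (cmap c ` U)"
  shows "smooth_form A U (form_of c H)"
  by (rule smooth_form_chart[OF c U])
    (use U in \<open>auto simp: form_rep_form_of[OF c] subset_iff intro!: smooth_on_cong[OF open_cmap_image[OF c U] _ H]\<close>)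

lemma deriv_fun_coord:
  assumes f: "smooth_fun A U f" and U: "open U" and c: "c \<in> A" and x: "x \<in> U" "x \<in> cdom c"
  shows "deriv_fun A f x v = frechet_derivative (f \<circ> cinv c) (at (cmap c x)) (to_chart c x v)"
proof -
  let ?d = "chart_at A x"
  have d: "?d \<in> A" "x \<in> cdom ?d" by (rule chart_at)+
  let ?S = "cmap ?d ` (cdom ?d \<inter> (cdom c \<inter> U))"
  have o: "open ?S" using open_image[OF d(1)] U open_cdom[OF c] by auto
  have df: "(f \<circ> cinv c) differentiable (at (cmap c x))"
    by (rule smooth_on_differentiable[OF smooth_funD[OF f c]]) (use x in auto)
  have "((\<lambda>q. (f \<circ> cinv c) ((cmap c \<circ> cinv ?d) q)) has_derivative
     (\<lambda>v. frechet_derivative (f \<circ> cinv c) (at (cmap c x)) (to_chart c x v))) (at (cmap ?d x))"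
  proof (rule has_derivative_compose[OF cc_has_derivative[OF d(1) c d(2) x(2)]])
    have "(cmap c \<circ> cinv ?d) (cmap ?d x) = cmap c x" by (simp add: cinv_cmap d)
    then show "((f \<circ> cinv c) has_derivative frechet_derivative (f \<circ> cinv c) (at (cmap c x))) (at ((cmap c \<circ> cinv ?d) (cmap ?d x)))"
      using has_derivative_frechet[OF df] by metis
  qed
  then have "((f \<circ> cinv ?d) has_derivative
     (\<lambda>v. frechet_derivative (f \<circ> cinv c) (at (cmap c x)) (to_chart c x v))) (at (cmap ?d x))"
    by (rule has_derivative_transform_within_open[OF _ o]) (use x c d in \<open>auto simp: cinv_cmap\<close>)
  from frechet_derivative_at[OF this] show ?thesis by (simp add: deriv_fun_def Let_def fun_eq_iff)
qed

end

section \<open>Connections and curvature in coordinates\<close>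

lemma matrix_mult_vec: "linear f \<Longrightarrow> matrix f *v v = f v" for f :: "real^'n::finite \<Rightarrow> real^'n"
  by (simp add: matrix_works)

lemma axis_expand: "(\<Sum>i\<in>UNIV. x $ i *\<^sub>R axis i 1) = x" for x :: "real^'n::finite"
  using basis_expansion[of x] by (simp add: scalar_mult_eq_scaleR)

context connection_form
begin

text \<open>The commutator formula for \<open>d - L\<close>. All second derivatives of \<open>h\<close> cancel by symmetry, and
  those terms in which \<open>X\<close> or \<open>Y\<close> is differentiated are absorbed by the bracket \<open>B\<close>.\<close>

lemma curvature_identity:
  assumes U: "open U" "U \<subseteq> D" and p: "p \<in> U" and h: "smooth_on h U"
    and X: "X differentiable (at p)" and Y: "Y differentiable (at p)"
  defines "N \<equiv> \<lambda>Z q. frechet_derivative h (at q) (Z q) - L q (Z q) (h q)"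
    and "B \<equiv> frechet_derivative Y (at p) (X p) - frechet_derivative X (at p) (Y p)"
  shows "frechet_derivative (N Y) (at p) (X p) - L p (X p) (N Y p)
     - (frechet_derivative (N X) (at p) (Y p) - L p (Y p) (N X p))
     - (frechet_derivative h (at p) B - L p B (h p)) = curv p (X p) (Y p) (h p)"
proof -
  have pD: "p \<in> D" using U p by auto
  have dh: "h differentiable (at q)" if "q \<in> U" for q using smooth_on_differentiable[OF h that] .
  have ddh: "(\<lambda>q. frechet_derivative h (at q) v) differentiable (at p)" for v
    using smooth_on_differentiable[OF smooth_on_deriv[OF h] p] .
  have DN: "frechet_derivative (N Z) (at p) \<xi> =
      frechet_derivative (\<lambda>q. frechet_derivative h (at q) (Z p)) (at p) \<xi> + frechet_derivative h (at p) (frechet_derivative Z (at p) \<xi>)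
      - (frechet_derivative (\<lambda>q. L q (Z p) (h p)) (at p) \<xi> + L p (frechet_derivative Z (at p) \<xi>) (h p)
         + L p (Z p) (frechet_derivative h (at p) \<xi>))" if Z: "Z differentiable (at p)" for Z \<xi>
  proof -
    have 1: "((\<lambda>q. frechet_derivative h (at q) (Z q)) has_derivative
       (\<lambda>v. frechet_derivative (\<lambda>q. frechet_derivative h (at q) (Z p)) (at p) v + frechet_derivative h (at p) (frechet_derivative Z (at p) v))) (at p)"
      by (rule has_derivative_linear_family[OF U(1) p]) (use linear_frechet dh ddh Z in auto)
    have 2: "((\<lambda>q. L q (Z q) w) has_derivative
       (\<lambda>v. frechet_derivative (\<lambda>q. L q (Z p) w) (at p) v + L p (frechet_derivative Z (at p) v) w)) (at p)" for w
      by (rule has_derivative_linear_family[OF open_D pD, of "\<lambda>q \<nu>. L q \<nu> w"]) (use lin1 diffL[OF pD] Z in auto)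
    have "((\<lambda>q. L q (Z q) (h q)) has_derivative
       (\<lambda>v. frechet_derivative (\<lambda>q. L q (Z q) (h p)) (at p) v + L p (Z p) (frechet_derivative h (at p) v))) (at p)"
      by (rule has_derivative_linear_family[OF open_D pD, of "\<lambda>q. L q (Z q)"])
        (use lin2 2 dh p in \<open>auto simp: differentiable_def\<close>)
    then have 3: "((\<lambda>q. L q (Z q) (h q)) has_derivative
       (\<lambda>v. frechet_derivative (\<lambda>q. L q (Z p) (h p)) (at p) v + L p (frechet_derivative Z (at p) v) (h p)
          + L p (Z p) (frechet_derivative h (at p) v))) (at p)"
      unfolding frechet_derivative_at[OF 2, symmetric] .
    show ?thesis
      unfolding N_def using fun_cong[OF frechet_derivative_at[OF has_derivative_diff[OF 1 3]], of \<xi>] by simp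
  qed
  have lD: "linear (frechet_derivative h (at p))" using linear_frechet[OF dh[OF p]] .
  have sym: "frechet_derivative (\<lambda>q. frechet_derivative h (at q) (Y p)) (at p) (X p)
    = frechet_derivative (\<lambda>q. frechet_derivative h (at q) (X p)) (at p) (Y p)"
    by (rule symmetric_second_derivative[OF U(1) h p])
  show ?thesis
    unfolding DN[OF X] DN[OF Y] sym
    by (simp add: N_def B_def curv_def linear_diff[OF lD] linear_diff[OF lin2[OF pD]] linear_diff[OF lin1[OF pD]])
qed

end

locale analytic_conn = manifold A for A :: "('m::topological_space, 'n::finite) chart set" +
  fixes nabla :: "('m \<Rightarrow> real^'n) \<Rightarrow> 'm \<Rightarrow> real^'n \<Rightarrow> real^'n"
  assumes conn: "analytic_connection A nabla"
begin

lemma connD: "connection A nabla"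
  using conn unfolding analytic_connection_def by blast

lemma nabla_linear:
  assumes "open U" "smooth_vec A U Y" "x \<in> U"
  shows "linear (nabla Y x)"
  using connD[unfolded connection_def, THEN spec, THEN mp, OF assms(1), THEN conjunct1] assms(2,3) by blast

lemma nabla_add:
  assumes "open U" "smooth_vec A U Y" "smooth_vec A U Z" "x \<in> U"
  shows "nabla (\<lambda>y. Y y + Z y) x v = nabla Y x v + nabla Z x v"
  using connD[unfolded connection_def, THEN spec, THEN mp, OF assms(1), THEN conjunct2, THEN conjunct1] assms(2-) by simp

lemma nabla_leibniz:
  assumes "open U" "smooth_fun A U f" "smooth_vec A U Y" "x \<in> U"
  shows "nabla (\<lambda>y. f y *\<^sub>R Y y) x v = deriv_fun A f x v *\<^sub>R Y x + f x *\<^sub>R nabla Y x v"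
  using connD[unfolded connection_def, THEN spec, THEN mp, OF assms(1), THEN conjunct2, THEN conjunct2, THEN conjunct1] assms(2-) by simp

lemma nabla_analytic: "open U \<Longrightarrow> analytic_vec A U Y \<Longrightarrow> analytic_vec A U Z \<Longrightarrow>
    analytic_vec A U (\<lambda>x. nabla Y x (Z x))"
  using conn unfolding analytic_connection_def by blast

lemma constant_fun:
  assumes V: "open V" and f: "\<And>y. y \<in> V \<Longrightarrow> f y = k" and x: "x \<in> V"
  shows "smooth_fun A V f" "deriv_fun A f x v = 0"
proof -
  have e: "(f \<circ> cinv c) q = k" if "c \<in> A" "q \<in> cmap c ` (cdom c \<inter> V)" for c q
    using that f by (auto simp: cinv_cmap)
  show s: "smooth_fun A V f"
    unfolding smooth_fun_def
  proof
    fix c assume c: "c \<in> A"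
    show "smooth_on (f \<circ> cinv c) (cmap c ` (cdom c \<inter> V))"
      by (rule smooth_on_cong[OF open_image[OF c V] _ smooth_on_const[of k]]) (use e[OF c] in auto)
  qed
  let ?c = "chart_at A x"
  have "frechet_derivative (f \<circ> cinv ?c) (at (cmap ?c x)) = frechet_derivative (\<lambda>_. k) (at (cmap ?c x))"
  proof (rule frechet_derivative_cong_open[OF open_image[OF chart_at(1) V]])
    show "cmap ?c x \<in> cmap ?c ` (cdom ?c \<inter> V)" using chart_at x by blast
  qed (rule e[OF chart_at(1)])
  then show "deriv_fun A f x v = 0" by (simp add: deriv_fun_def Let_def frechet_derivative_const)
qed

text \<open>Multiplication by the indicator function of \<open>V\<close> makes the two fields equal. This function is constant on
  \<open>V\<close>, so the Leibniz rule on \<open>V\<close> shows that it changes neither covariant derivative at \<open>x\<close>.\<close>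

lemma nabla_local:
  assumes V: "open V" and Y: "smooth_vec A V Y" and Z: "smooth_vec A V Z"
    and e: "\<And>y. y \<in> V \<Longrightarrow> Y y = Z y" and x: "x \<in> V"
  shows "nabla Y x v = nabla Z x v"
proof -
  define f where "f y = (if y \<in> V then 1 else 0 :: real)" for y
  have f: "\<And>y. y \<in> V \<Longrightarrow> f y = 1" by (simp add: f_def)
  note s = constant_fun[where f = f and k = 1, OF V f x]
  have "(\<lambda>y. f y *\<^sub>R Y y) = (\<lambda>y. f y *\<^sub>R Z y)" using e by (auto simp: f_def)
  then show ?thesis
    using nabla_leibniz[OF V s(1) Y x, where v = v] nabla_leibniz[OF V s(1) Z x, where v = v] s(2) f[OF x] by simp
qed

lemma smooth_vec_combine:
  assumes V: "open V" "V \<subseteq> cdom c" and c: "c \<in> A" and Y: "smooth_vec A V Y" and Z: "smooth_vec A V Z"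
  shows "smooth_vec A V (\<lambda>y. Y y + Z y)"
    and "smooth_fun A V f \<Longrightarrow> smooth_vec A V (\<lambda>y. f y *\<^sub>R Y y)"
proof -
  note o = open_cmap_image[OF c V]
  have e: "cdom c \<inter> V = V" using V by auto
  note sY = smooth_vecD[OF Y c, unfolded e] and sZ = smooth_vecD[OF Z c, unfolded e]
  show "smooth_vec A V (\<lambda>y. Y y + Z y)"
    by (rule smooth_vec_chart[OF c V], rule smooth_on_cong[OF o _ smooth_on_add[OF o sY sZ]])
      (use V c in \<open>auto simp: vec_rep_cmap linear_add[OF linear_to_chart] subset_iff\<close>)
  assume f: "smooth_fun A V f"
  note sf = smooth_funD[OF f c, unfolded e]
  show "smooth_vec A V (\<lambda>y. f y *\<^sub>R Y y)"
    by (rule smooth_vec_chart[OF c V], rule smooth_on_cong[OF o _ smooth_on_bilinear[OF o bounded_bilinear_scaleR sf sY]])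
      (use V c in \<open>auto simp: vec_rep_cmap linear_scale[OF linear_to_chart] subset_iff cinv_cmap\<close>)
qed

lemma nabla_sum:
  assumes V: "open V" "V \<subseteq> cdom c" and c: "c \<in> A" and I: "finite I"
    and Y: "\<And>i. i \<in> I \<Longrightarrow> smooth_vec A V (Y i)" and x: "x \<in> V"
  shows "smooth_vec A V (\<lambda>y. \<Sum>i\<in>I. Y i y) \<and> nabla (\<lambda>y. \<Sum>i\<in>I. Y i y) x v = (\<Sum>i\<in>I. nabla (Y i) x v)"
  using I Y
proof (induction I rule: finite_induct)
  case empty
  note s = constant_fun[where f = "\<lambda>_. 0" and k = 0, OF V(1) refl x]
  note E = smooth_subset(1)[OF V(2) smooth_vec_of[OF c, of 0]]
  show ?case
    using smooth_vec_combine(2)[OF V c E E s(1)] nabla_leibniz[OF V(1) s(1) E x, where v = v] s(2) by simp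
next
  case (insert i I)
  then have 1: "smooth_vec A V (Y i)" "smooth_vec A V (\<lambda>y. \<Sum>i\<in>I. Y i y)"
      "nabla (\<lambda>y. \<Sum>i\<in>I. Y i y) x v = (\<Sum>i\<in>I. nabla (Y i) x v)" by auto
  show ?case
    using smooth_vec_combine(1)[OF V c 1(1,2)] nabla_add[OF V(1) 1(1,2) x, where v = v] 1(3) insert by simp
qed

text \<open>The Christoffel symbols of the chart \<open>c\<close>, as a bilinear map in \<open>\<nu>\<close> and \<open>b\<close>.\<close>

definition Gam :: "('m, 'n) chart \<Rightarrow> real^'n \<Rightarrow> real^'n \<Rightarrow> real^'n \<Rightarrow> real^'n" where
  "Gam c p \<nu> b = vec_rep A c (\<lambda>x. nabla (vec_of c b) x (vec_of c \<nu> x)) p"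

lemma Gam_cmap:
  "c \<in> A \<Longrightarrow> x \<in> cdom c \<Longrightarrow> Gam c (cmap c x) \<nu> b = to_chart c x (nabla (vec_of c b) x (from_chart c x \<nu>))"
  by (simp add: Gam_def vec_rep_cmap vec_of_def)

lemma Gam_analytic: "c \<in> A \<Longrightarrow> real_analytic_on (\<lambda>p. Gam c p \<nu> b) (img c)"
proof -
  assume c: "c \<in> A"
  have "analytic_vec A (cdom c) (\<lambda>x. nabla (vec_of c b) x (vec_of c \<nu> x))"
    by (rule nabla_analytic[OF open_cdom[OF c] analytic_vec_of[OF c] analytic_vec_of[OF c]])
  then have "real_analytic_on (vec_rep A c (\<lambda>x. nabla (vec_of c b) x (vec_of c \<nu> x))) (cmap c ` (cdom c \<inter> cdom c))"
    using c unfolding analytic_vec_def by blast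
  then show ?thesis by (simp add: Gam_def[abs_def])
qed

lemma Gam_linear:
  assumes c: "c \<in> A" and p: "p \<in> img c"
  shows "linear (\<lambda>\<nu>. Gam c p \<nu> b)" "linear (Gam c p \<nu>)"
proof -
  obtain x where x: "x \<in> cdom c" "p = cmap c x" using p by auto
  note o = open_cdom[OF c]
  have "linear (\<lambda>\<nu>. to_chart c x (nabla (vec_of c b) x (from_chart c x \<nu>)))"
    using linear_compose[OF linear_compose[OF linear_from_chart[OF c x(1)] nabla_linear[OF o smooth_vec_of[OF c] x(1)]] linear_to_chart[OF c x(1)]]
    by (simp add: comp_def)
  then show "linear (\<lambda>\<nu>. Gam c p \<nu> b)" using Gam_cmap[OF c x(1)] by (simp add: x)
  have "nabla (vec_of c (b + b')) x v = nabla (vec_of c b) x v + nabla (vec_of c b') x v" for b b' v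
  proof -
    have "nabla (vec_of c (b + b')) x v = nabla (\<lambda>y. vec_of c b y + vec_of c b' y) x v"
      by (rule nabla_local[OF o smooth_vec_of[OF c] smooth_vec_combine(1)[OF o order_refl c smooth_vec_of[OF c] smooth_vec_of[OF c]] _ x(1)])
        (simp add: vec_of_def linear_add[OF linear_from_chart[OF c]])
    then show ?thesis using nabla_add[OF o smooth_vec_of[OF c] smooth_vec_of[OF c] x(1)] by simp
  qed
  moreover have "nabla (vec_of c (k *\<^sub>R b)) x v = k *\<^sub>R nabla (vec_of c b) x v" for b k v
  proof -
    note s = constant_fun[where f = "\<lambda>_. k" and k = k, OF o refl x(1)]
    have "nabla (vec_of c (k *\<^sub>R b)) x v = nabla (\<lambda>y. k *\<^sub>R vec_of c b y) x v"
      by (rule nabla_local[OF o smooth_vec_of[OF c] smooth_vec_combine(2)[OF o order_refl c smooth_vec_of[OF c] smooth_vec_of[OF c] s(1)] _ x(1)])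
        (simp add: vec_of_def linear_scale[OF linear_from_chart[OF c]])
    then show ?thesis using nabla_leibniz[OF o s(1) smooth_vec_of[OF c] x(1)] s(2) by simp
  qed
  ultimately show "linear (Gam c p \<nu>)"
    using linear_to_chart[OF c x(1)]
    by (intro linearI) (simp_all add: x(2) Gam_cmap[OF c x(1)] linear_add linear_scale)
qed

text \<open>In the chart, \<open>Y\<close> is a combination of the coordinate fields with smooth coefficients, to which
  the Leibniz rule applies.\<close>

lemma nabla_coord:
  assumes U: "open U" and Y: "smooth_vec A U Y" and x: "x \<in> U" "x \<in> cdom c" and c: "c \<in> A"
  shows "to_chart c x (nabla Y x v) = frechet_derivative (vec_rep A c Y) (at (cmap c x)) (to_chart c x v)
     + Gam c (cmap c x) (to_chart c x v) (vec_rep A c Y (cmap c x))"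
proof -
  define V where "V = U \<inter> cdom c"
  have V: "open V" "V \<subseteq> cdom c" "x \<in> V" using U x open_cdom[OF c] by (auto simp: V_def)
  have VU: "V \<subseteq> U" by (auto simp: V_def)
  define f where "f i y = vec_rep A c Y (cmap c y) $ i" for i y
  define E where "E i = vec_of c (axis i 1)" for i
  let ?p = "cmap c x" and ?\<nu> = "to_chart c x v"
  have dc: "cdom c \<inter> V = V" using V by auto
  note o = open_cmap_image[OF c V(1,2)]
  note sY = smooth_vecD[OF smooth_subset(1)[OF VU Y] c, unfolded dc]
  have ef: "f i (cinv c q) = vec_rep A c Y q $ i" if "q \<in> cmap c ` V" for q i
    using that V c by (auto simp: f_def cinv_cmap subset_iff)
  have sf: "smooth_fun A V (f i)" for i
    by (rule smooth_fun_chart[OF c V(1,2)],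
        rule smooth_on_cong[OF o _ smooth_on_bounded_linear[OF o bounded_linear_vec_nth sY]]) (use ef in auto)
  have sE: "smooth_vec A V (E i)" for i
    unfolding E_def by (rule smooth_subset(1)[OF V(2) smooth_vec_of[OF c]])
  have sfE: "smooth_vec A V (\<lambda>y. f i y *\<^sub>R E i y)" for i
    by (rule smooth_vec_combine(2)[OF V(1,2) c sE sE sf])
  have eY: "Y y = (\<Sum>i\<in>UNIV. f i y *\<^sub>R E i y)" if "y \<in> V" for y
  proof -
    have y: "y \<in> cdom c" using that V by auto
    have "Y y = from_chart c y (vec_rep A c Y (cmap c y))"
      by (simp add: vec_rep_cmap[OF c y] from_to[OF c y])
    also have "\<dots> = (\<Sum>i\<in>UNIV. f i y *\<^sub>R E i y)"
      unfolding f_def E_def vec_of_def by (rule linear_axis_expand[OF linear_from_chart[OF c y]])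
    finally show ?thesis .
  qed
  note ns = nabla_sum[OF V(1,2) c finite[of UNIV] sfE V(3), where v = v]
  have "nabla Y x v = nabla (\<lambda>y. \<Sum>i\<in>UNIV. f i y *\<^sub>R E i y) x v"
    by (rule nabla_local[OF V(1) smooth_subset(1)[OF VU Y] conjunct1[OF ns] eY V(3)])
  also have "\<dots> = (\<Sum>i\<in>UNIV. deriv_fun A (f i) x v *\<^sub>R E i x + f i x *\<^sub>R nabla (E i) x v)"
    using conjunct2[OF ns] by (simp add: nabla_leibniz[OF V(1) sf sE V(3)])
  finally have "to_chart c x (nabla Y x v)
      = (\<Sum>i\<in>UNIV. deriv_fun A (f i) x v *\<^sub>R to_chart c x (E i x) + f i x *\<^sub>R to_chart c x (nabla (E i) x v))"
    by (simp add: linear_sum[OF linear_to_chart[OF c x(2)]] linear_add[OF linear_to_chart[OF c x(2)]] linear_scale[OF linear_to_chart[OF c x(2)]])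
  moreover have "to_chart c x (E i x) = axis i 1" for i
    by (simp add: E_def vec_of_def to_from c x)
  moreover have "to_chart c x (nabla (E i) x v) = Gam c ?p ?\<nu> (axis i 1)" for i
    by (simp add: Gam_cmap c x E_def from_to)
  moreover have "deriv_fun A (f i) x v = frechet_derivative (vec_rep A c Y) (at ?p) ?\<nu> $ i" for i
  proof -
    have "deriv_fun A (f i) x v = frechet_derivative (f i \<circ> cinv c) (at ?p) ?\<nu>"
      by (rule deriv_fun_coord[OF sf V(1) c V(3) x(2)])
    also have "frechet_derivative (f i \<circ> cinv c) (at ?p) = frechet_derivative (\<lambda>q. vec_rep A c Y q $ i) (at ?p)"
      by (rule frechet_derivative_cong_open[OF o]) (use ef V in auto)
    also have "\<dots> = (\<lambda>v. frechet_derivative (vec_rep A c Y) (at ?p) v $ i)"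
      by (rule frechet_derivative_at[symmetric], rule bounded_linear.has_derivative[OF bounded_linear_vec_nth],
          rule has_derivative_frechet, rule smooth_on_differentiable[OF sY]) (use V in auto)
    finally show ?thesis .
  qed
  ultimately have "to_chart c x (nabla Y x v) = (\<Sum>i\<in>UNIV. frechet_derivative (vec_rep A c Y) (at ?p) ?\<nu> $ i *\<^sub>R axis i 1)
     + (\<Sum>i\<in>UNIV. vec_rep A c Y ?p $ i *\<^sub>R Gam c ?p ?\<nu> (axis i 1))"
    by (simp add: sum.distrib f_def)
  also have "(\<Sum>i\<in>UNIV. frechet_derivative (vec_rep A c Y) (at ?p) ?\<nu> $ i *\<^sub>R axis i 1) = frechet_derivative (vec_rep A c Y) (at ?p) ?\<nu>"
    by (rule axis_expand)
  also have "(\<Sum>i\<in>UNIV. vec_rep A c Y ?p $ i *\<^sub>R Gam c ?p ?\<nu> (axis i 1)) = Gam c ?p ?\<nu> (vec_rep A c Y ?p)"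
    by (rule linear_axis_expand[symmetric]) (use Gam_linear(2)[OF c] x in auto)
  finally show ?thesis .
qed

text \<open>The connection form of the induced connection on bilinear forms. Its sign is such that
  \<open>\<nabla>\<^sub>\<nu> h = dh(\<nu>) - Lform c p \<nu> h\<close>.\<close>

definition Lform :: "('m, 'n) chart \<Rightarrow> real^'n \<Rightarrow> real^'n \<Rightarrow> real^'n^'n \<Rightarrow> real^'n^'n" where
  "Lform c p \<nu> h = transpose (matrix (Gam c p \<nu>)) ** h + h ** matrix (Gam c p \<nu>)"

lemma form_eval_Lform:
  assumes "c \<in> A" "p \<in> img c"
  shows "form_eval (Lform c p \<nu> h) u v = form_eval h (Gam c p \<nu> u) v + form_eval h u (Gam c p \<nu> v)"
  using Gam_linear(2)[OF assms, of \<nu>, THEN matrix_mult_vec]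
  unfolding Lform_def linear_add[OF linear_form_eval1] form_eval_mult_left
  by (simp add: form_eval_mult_right)

lemma connection_form_Lform:
  assumes c: "c \<in> A" shows "connection_form (img c) (Lform c)"
proof (rule connection_form.intro)
  show "open (img c)" by (rule open_img[OF c])
  show "linear (\<lambda>\<nu>. Lform c p \<nu> w)" if "p \<in> img c" for p w
    by (rule linearI; rule form_ext)
      (simp_all add: form_eval_Lform[OF c that] form_eval_simps linear_add[OF Gam_linear(1)[OF c that]]
        linear_scale[OF Gam_linear(1)[OF c that]] algebra_simps)
  show "linear (Lform c p \<nu>)" if "p \<in> img c" for p \<nu>
    by (rule linearI; rule form_ext)
      (simp_all add: form_eval_Lform[OF c that] form_eval_simps algebra_simps)
  show "real_analytic_on (\<lambda>p. Lform c p \<nu> w) (img c)" for \<nu> w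
  proof (rule real_analytic_on_matrixI[OF open_img[OF c]])
    fix u v
    have "real_analytic_on (\<lambda>p. form_eval w (Gam c p \<nu> u) v + form_eval w u (Gam c p \<nu> v)) (img c)"
      by (intro real_analytic_on_add real_analytic_on_bounded_linear[OF Gam_analytic[OF c]])
        (auto simp: linear_form_eval2 linear_form_eval3 simp flip: linear_conv_bounded_linear)
    then show "real_analytic_on (\<lambda>p. form_eval (Lform c p \<nu> w) u v) (img c)"
      by (rule real_analytic_on_cong[OF open_img[OF c], rotated]) (simp add: form_eval_Lform[OF c])
  qed
qed

text \<open>Transport of tangent vectors: \<open>u\<close> is parallel if \<open>du(\<nu>) = - Gam \<nu> u\<close>.\<close>

lemma connection_form_tangent:
  assumes c: "c \<in> A" shows "connection_form (img c) (\<lambda>p \<nu> u. - Gam c p \<nu> u)"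
proof (rule connection_form.intro)
  show "open (img c)" by (rule open_img[OF c])
  show "linear (\<lambda>\<nu>. - Gam c p \<nu> w)" if "p \<in> img c" for p w
    using linear_compose_neg[OF Gam_linear(1)[OF c that]] .
  show "linear (\<lambda>u. - Gam c p \<nu> u)" if "p \<in> img c" for p \<nu>
    using linear_compose_neg[OF Gam_linear(2)[OF c that]] .
  show "real_analytic_on (\<lambda>p. - Gam c p \<nu> w) (img c)" for \<nu> w
    by (rule real_analytic_on_bounded_linear[OF Gam_analytic[OF c] bounded_linear_minus[OF bounded_linear_ident]])
qed

text \<open>The coordinate expression satisfies the product rule that characterizes the covariant
  derivative, and the rule determines the form because coordinate fields attain all pairs of
  tangent vectors.\<close>

lemma form_nabla_coord:
  assumes U: "open U" and w: "smooth_form A U w" and x: "x \<in> U" "x \<in> cdom c" and c: "c \<in> A"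
  shows "form_nabla A nabla w x v = pullback (to_chart c x)
     (frechet_derivative (form_rep A c w) (at (cmap c x)) (to_chart c x v)
      - Lform c (cmap c x) (to_chart c x v) (form_rep A c w (cmap c x)))"
proof -
  let ?p = "cmap c x" and ?\<nu> = "to_chart c x v" and ?H = "form_rep A c w"
  let ?B = "pullback (to_chart c x) (frechet_derivative ?H (at ?p) ?\<nu> - Lform c ?p ?\<nu> (?H ?p))"
  have pi: "?p \<in> img c" using x by auto
  have main: "form_eval ?B (Y x) (Z x) = deriv_fun A (\<lambda>y. form_eval (w y) (Y y) (Z y)) x v
          - form_eval (w x) (nabla Y x v) (Z x) - form_eval (w x) (Y x) (nabla Z x v)"
    if U': "open U'" "x \<in> U'" and Y: "smooth_vec A U' Y" and Z: "smooth_vec A U' Z" for U' Y Z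
  proof -
    define V where "V = U \<inter> U' \<inter> cdom c"
    have V: "open V" "V \<subseteq> cdom c" "x \<in> V" "V \<subseteq> U" "V \<subseteq> U'" using U U' x open_cdom[OF c] by (auto simp: V_def)
    have dc: "cdom c \<inter> V = V" using V by auto
    note o = open_cmap_image[OF c V(1,2)]
    note sY = smooth_vecD[OF smooth_subset(1)[OF V(5) Y] c, unfolded dc]
    note sZ = smooth_vecD[OF smooth_subset(1)[OF V(5) Z] c, unfolded dc]
    note sH = smooth_formD[OF smooth_subset(2)[OF V(4) w] c, unfolded dc]
    let ?F = "\<lambda>y. form_eval (w y) (Y y) (Z y)"
    let ?G = "\<lambda>q. form_eval (?H q) (vec_rep A c Y q) (vec_rep A c Z q)"
    have e: "(?F \<circ> cinv c) q = ?G q" if "q \<in> cmap c ` V" for q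
      using that V c by (auto simp: cinv_cmap subset_iff form_eval_rep[OF c] vec_rep_cmap)
    have sG: "smooth_on ?G (cmap c ` V)" by (rule smooth_on_form_eval[OF o sH sY sZ])
    have sF: "smooth_fun A V ?F"
      by (rule smooth_fun_chart[OF c V(1,2)], rule smooth_on_cong[OF o _ sG]) (use e in auto)
    have pV: "?p \<in> cmap c ` V" using V by auto
    have "deriv_fun A ?F x v = frechet_derivative (?F \<circ> cinv c) (at ?p) ?\<nu>"
      by (rule deriv_fun_coord[OF sF V(1) c V(3) x(2)])
    also have "frechet_derivative (?F \<circ> cinv c) (at ?p) = frechet_derivative ?G (at ?p)"
      by (rule frechet_derivative_cong_open[OF o pV e])
    also have "frechet_derivative ?G (at ?p) = (\<lambda>\<nu>. form_eval (frechet_derivative ?H (at ?p) \<nu>) (vec_rep A c Y ?p) (vec_rep A c Z ?p)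
        + form_eval (?H ?p) (frechet_derivative (vec_rep A c Y) (at ?p) \<nu>) (vec_rep A c Z ?p)
        + form_eval (?H ?p) (vec_rep A c Y ?p) (frechet_derivative (vec_rep A c Z) (at ?p) \<nu>))"
      by (rule frechet_derivative_at[symmetric])
        (intro has_derivative_form_eval has_derivative_frechet smooth_on_differentiable[OF sH pV]
          smooth_on_differentiable[OF sY pV] smooth_on_differentiable[OF sZ pV])
    finally have dF: "deriv_fun A ?F x v = form_eval (frechet_derivative ?H (at ?p) ?\<nu>) (vec_rep A c Y ?p) (vec_rep A c Z ?p)
        + form_eval (?H ?p) (frechet_derivative (vec_rep A c Y) (at ?p) ?\<nu>) (vec_rep A c Z ?p)
        + form_eval (?H ?p) (vec_rep A c Y ?p) (frechet_derivative (vec_rep A c Z) (at ?p) ?\<nu>)" by simp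
    have eY: "to_chart c x (Y x) = vec_rep A c Y ?p" and eZ: "to_chart c x (Z x) = vec_rep A c Z ?p"
      by (simp_all add: vec_rep_cmap c x)
    show ?thesis
      unfolding dF form_eval_rep[OF c x(2), of w] nabla_coord[OF U'(1) Y U'(2) x(2) c] nabla_coord[OF U'(1) Z U'(2) x(2) c]
        form_eval_pullback[OF linear_to_chart[OF c x(2)]] eY eZ
      by (simp add: form_eval_simps form_eval_Lform[OF c pi])
  qed
  show ?thesis
    unfolding form_nabla_def
  proof (rule the_equality)
    show "\<forall>U Y Z. open U \<and> x \<in> U \<and> smooth_vec A U Y \<and> smooth_vec A U Z \<longrightarrow>
        form_eval ?B (Y x) (Z x) = deriv_fun A (\<lambda>y. form_eval (w y) (Y y) (Z y)) x v
          - form_eval (w x) (nabla Y x v) (Z x) - form_eval (w x) (Y x) (nabla Z x v)"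
      using main by blast
    fix B' assume B': "\<forall>U Y Z. open U \<and> x \<in> U \<and> smooth_vec A U Y \<and> smooth_vec A U Z \<longrightarrow>
        form_eval B' (Y x) (Z x) = deriv_fun A (\<lambda>y. form_eval (w y) (Y y) (Z y)) x v
          - form_eval (w x) (nabla Y x v) (Z x) - form_eval (w x) (Y x) (nabla Z x v)"
    show "B' = ?B"
    proof (rule form_ext)
      fix a b
      let ?Y = "vec_of c (to_chart c x a)" and ?Z = "vec_of c (to_chart c x b)"
      have "open (cdom c) \<and> x \<in> cdom c \<and> smooth_vec A (cdom c) ?Y \<and> smooth_vec A (cdom c) ?Z"
        using open_cdom[OF c] x(2) smooth_vec_of[OF c] by blast
      from B'[rule_format, OF this] have "form_eval B' (?Y x) (?Z x) = form_eval ?B (?Y x) (?Z x)"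
        unfolding main[OF open_cdom[OF c] x(2) smooth_vec_of[OF c] smooth_vec_of[OF c]] .
      then show "form_eval B' a b = form_eval ?B a b"
        by (simp add: vec_of_def from_to[OF c x(2)])
    qed
  qed
qed

lemma form_rep_nabla:
  assumes U: "open U" and w: "smooth_form A U w" and x: "x \<in> U" "x \<in> cdom c" and c: "c \<in> A"
  shows "form_rep A c (\<lambda>y. form_nabla A nabla w y (Y y)) (cmap c x) =
     frechet_derivative (form_rep A c w) (at (cmap c x)) (vec_rep A c Y (cmap c x))
      - Lform c (cmap c x) (vec_rep A c Y (cmap c x)) (form_rep A c w (cmap c x))"
  by (simp add: form_rep_cmap c x form_nabla_coord[OF U w x c] pullback_inverse[OF c x(2)] vec_rep_cmap)

lemma smooth_nabla_form:
  assumes U: "open U" "U \<subseteq> cdom c" and c: "c \<in> A" and w: "smooth_form A U w" and Y: "smooth_vec A U Y"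
  shows "smooth_form A U (\<lambda>y. form_nabla A nabla w y (Y y))"
proof -
  interpret connection_form "img c" "Lform c" by (rule connection_form_Lform[OF c])
  have dc: "cdom c \<inter> U = U" using U by auto
  note o = open_cmap_image[OF c U]
  note sY = smooth_vecD[OF Y c, unfolded dc] and sH = smooth_formD[OF w c, unfolded dc]
  have sub: "cmap c ` U \<subseteq> img c" using U by auto
  let ?H = "form_rep A c w" and ?Y = "vec_rep A c Y"
  have 1: "smooth_on (\<lambda>q. frechet_derivative ?H (at q) (?Y q)) (cmap c ` U)"
    by (rule smooth_linear_family[OF o linear_frechet[OF smooth_on_differentiable[OF sH]] smooth_on_deriv[OF sH] sY])
  have 2: "smooth_on (\<lambda>q. Lform c q (?Y q) w) (cmap c ` U)" for w
    by (rule smooth_linear_family[OF o lin1 real_analytic_on_smooth[OF real_analytic_on_subset[OF ana sub]] sY]) (use sub in auto)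
  have 3: "smooth_on (\<lambda>q. - Lform c q (?Y q) (?H q)) (cmap c ` U)"
    by (rule smooth_on_bounded_linear[OF o bounded_linear_minus[OF bounded_linear_ident]],
        rule smooth_linear_family[OF o lin2 2 sH]) (use sub in auto)
  show ?thesis
    by (rule smooth_form_chart[OF c U], rule smooth_on_cong[OF o _ smooth_on_add[OF o 1 3]])
      (use U form_rep_nabla[OF U(1) w _ _ c] in auto)
qed

text \<open>The coordinate expression of the bracket is a hypothesis, because it is used in two situations
  where it holds for different reasons: for arbitrary fields in the chart chosen at \<open>x\<close>, which
  defines the bracket, and for coordinate fields in an arbitrary chart.\<close>

lemma curvature_expression:
  assumes U: "open U" "x \<in> U" and X: "smooth_vec A U X" and Y: "smooth_vec A U Y" and s: "smooth_form A U s"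
    and c: "c \<in> A" "x \<in> cdom c"
    and lb: "to_chart c x (lie_bracket A X Y x) = frechet_derivative (vec_rep A c Y) (at (cmap c x)) (vec_rep A c X (cmap c x))
      - frechet_derivative (vec_rep A c X) (at (cmap c x)) (vec_rep A c Y (cmap c x))"
  shows "form_nabla A nabla (\<lambda>y. form_nabla A nabla s y (Y y)) x (X x)
          - form_nabla A nabla (\<lambda>y. form_nabla A nabla s y (X y)) x (Y x)
          - form_nabla A nabla s x (lie_bracket A X Y x)
     = pullback (to_chart c x) (connection_form.curv (Lform c) (cmap c x)
         (to_chart c x (X x)) (to_chart c x (Y x)) (pullback (from_chart c x) (s x)))"
proof -
  interpret connection_form "img c" "Lform c" by (rule connection_form_Lform[OF c(1)])
  define V where "V = U \<inter> cdom c"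
  have V: "open V" "V \<subseteq> cdom c" "x \<in> V" "V \<subseteq> U" using open_Int[OF U(1) open_cdom[OF c(1)]] U c by (auto simp: V_def)
  have dc: "cdom c \<inter> V = V" using V by auto
  note o = open_cmap_image[OF c(1) V(1,2)]
  note vX = smooth_subset(1)[OF V(4) X] and vY = smooth_subset(1)[OF V(4) Y] and vs = smooth_subset(2)[OF V(4) s]
  let ?p = "cmap c x" and ?H = "form_rep A c s" and ?X = "vec_rep A c X" and ?Y = "vec_rep A c Y"
  have pV: "?p \<in> cmap c ` V" using V by auto
  note dX = smooth_on_differentiable[OF smooth_vecD[OF vX c(1), unfolded dc] pV]
  note dY = smooth_on_differentiable[OF smooth_vecD[OF vY c(1), unfolded dc] pV]
  note sH = smooth_formD[OF vs c(1), unfolded dc]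
  define N where "N = (\<lambda>Z q. frechet_derivative ?H (at q) (Z q) - Lform c q (Z q) (?H q))"
  have step: "form_nabla A nabla (\<lambda>y. form_nabla A nabla s y (Z y)) x v = pullback (to_chart c x)
     (frechet_derivative (N (vec_rep A c Z)) (at ?p) (to_chart c x v) - Lform c ?p (to_chart c x v) (N (vec_rep A c Z) ?p))"
    if Z: "smooth_vec A V Z" for Z v
  proof -
    have e: "form_rep A c (\<lambda>y. form_nabla A nabla s y (Z y)) q = N (vec_rep A c Z) q" if "q \<in> cmap c ` V" for q
      using that V(2) form_rep_nabla[OF V(1) vs _ _ c(1), where Y = Z] by (auto simp: N_def)
    have e': "frechet_derivative (form_rep A c (\<lambda>y. form_nabla A nabla s y (Z y))) (at ?p) = frechet_derivative (N (vec_rep A c Z)) (at ?p)"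
      by (rule frechet_derivative_cong_open[OF o pV e])
    show ?thesis
      unfolding form_nabla_coord[OF V(1) smooth_nabla_form[OF V(1,2) c(1) vs Z] V(3) c(2,1)]
        e[OF pV] e' by (rule refl)
  qed
  have sub: "cmap c ` V \<subseteq> img c" using V by auto
  note ci = curvature_identity[OF o sub pV sH dX dY]
  have eX: "to_chart c x (X x) = ?X ?p" and eY: "to_chart c x (Y x) = ?Y ?p" and eH: "pullback (from_chart c x) (s x) = ?H ?p"
    by (simp_all add: vec_rep_cmap form_rep_cmap c)
  note lp = linear_diff[OF linear_pullback[OF linear_to_chart[OF c]]]
  show ?thesis
    unfolding step[OF vX] step[OF vY] form_nabla_coord[OF V(1) vs V(3) c(2,1)] lb eX eY eH lp[symmetric]
    using ci unfolding N_def by simp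
qed

lemma lie_bracket_chart_at:
  "to_chart (chart_at A x) x (lie_bracket A X Y x) =
     frechet_derivative (vec_rep A (chart_at A x) Y) (at (cmap (chart_at A x) x)) (vec_rep A (chart_at A x) X (cmap (chart_at A x) x))
      - frechet_derivative (vec_rep A (chart_at A x) X) (at (cmap (chart_at A x) x)) (vec_rep A (chart_at A x) Y (cmap (chart_at A x) x))"
  by (simp add: lie_bracket_def Let_def vec_rep_cmap chart_at cc_id)

lemma W_section_const:
  assumes c: "c \<in> A" and x: "x \<in> cdom c" and w: "sym_form w"
  obtains s where "W_section A (cdom c) s" "s x = w"
proof -
  define s where "s = form_of c (\<lambda>_. pullback (from_chart c x) w)"
  have "smooth_form A (cdom c) s"
    unfolding s_def by (rule smooth_form_of[OF c open_cdom[OF c] order_refl smooth_on_const])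
  moreover have "sym_form (s y)" if "y \<in> cdom c" for y
    unfolding s_def form_of_def by (intro sym_form_pullback linear_to_chart linear_from_chart c x that w)
  moreover have "s x = w" by (simp add: s_def form_of_def pullback_inverse[OF c x])
  ultimately show thesis using that by (auto simp: W_section_def)
qed

text \<open>In the chart chosen at \<open>x\<close> the commutator only depends on the values of the fields at \<open>x\<close>,
  which makes the definition of the curvature meaningful.\<close>

lemma W_curvature_eq:
  assumes w: "sym_form w" and U: "open U" "x \<in> U" and X: "smooth_vec A U X" and Y: "smooth_vec A U Y" and s: "W_section A U s"
    and at: "X x = u" "Y x = v" "s x = w"
  shows "W_curvature A nabla x u v w = form_nabla A nabla (\<lambda>y. form_nabla A nabla s y (Y y)) x (X x)
          - form_nabla A nabla (\<lambda>y. form_nabla A nabla s y (X y)) x (Y x)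
          - form_nabla A nabla s x (lie_bracket A X Y x)" (is "_ = ?E U X Y s")
proof -
  let ?c = "chart_at A x"
  let ?R = "pullback (to_chart ?c x) (connection_form.curv (Lform ?c) (cmap ?c x)
         (to_chart ?c x u) (to_chart ?c x v) (pullback (from_chart ?c x) w))"
  have all: "?E U X Y s = ?R" if "open U" "x \<in> U" "smooth_vec A U X" "smooth_vec A U Y" "W_section A U s"
     "X x = u" "Y x = v" "s x = w" for U X Y s
    using curvature_expression[OF that(1-4) _ chart_at lie_bracket_chart_at] that(5-8)
    unfolding W_section_def by simp
  have "W_curvature A nabla x u v w = ?R"
    unfolding W_curvature_def
  proof (rule the_equality)
    show "\<forall>U X Y s. open U \<and> x \<in> U \<and> smooth_vec A U X \<and> smooth_vec A U Y \<and> W_section A U s \<and>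
          X x = u \<and> Y x = v \<and> s x = w \<longrightarrow> ?R = ?E U X Y s"
      by (intro allI impI, elim conjE) (rule all[symmetric])
    fix r assume r: "\<forall>U X Y s. open U \<and> x \<in> U \<and> smooth_vec A U X \<and> smooth_vec A U Y \<and> W_section A U s \<and>
          X x = u \<and> Y x = v \<and> s x = w \<longrightarrow> r = ?E U X Y s"
    have "open U \<and> x \<in> U \<and> smooth_vec A U X \<and> smooth_vec A U Y \<and> W_section A U s \<and> X x = u \<and> Y x = v \<and> s x = w"
      using U X Y s at by blast
    from r[rule_format, OF this] show "r = ?R" unfolding all[OF U X Y s at] .
  qed
  then show ?thesis using all[OF U X Y s at] by simp
qed

text \<open>In the chart chosen at \<open>x\<close> the field \<open>vec_of c b\<close> is the derivative of the chart
  transition in the direction \<open>b\<close>, so the bracket vanishes by symmetry of second derivatives.\<close>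

lemma lie_bracket_vec_of:
  assumes c: "c \<in> A" "x \<in> cdom c"
  shows "lie_bracket A (vec_of c a) (vec_of c b) x = 0"
proof -
  let ?d = "chart_at A x"
  have d: "?d \<in> A" "x \<in> cdom ?d" by (rule chart_at)+
  let ?\<tau> = "cmap ?d \<circ> cinv c" and ?p = "cmap c x" and ?q = "cmap ?d x"
  let ?S = "cmap ?d ` (cdom ?d \<inter> cdom c)"
  have o: "open ?S" by (rule open_image[OF d(1) open_cdom[OF c(1)]])
  have oT: "open (cmap c ` (cdom c \<inter> cdom ?d))" by (rule open_image[OF c(1) open_cdom[OF d(1)]])
  have qS: "?q \<in> ?S" using c d by auto
  have pT: "?p \<in> cmap c ` (cdom c \<inter> cdom ?d)" using c d by auto
  note sm = real_analytic_on_smooth[OF trans_analytic[OF c(1) d(1)]]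
  have inv: "(cmap c \<circ> cinv ?d) ?q = ?p" by (simp add: cinv_cmap d)
  have D: "frechet_derivative (vec_rep A ?d (vec_of c b)) (at ?q) (vec_of c a x)
      = frechet_derivative (\<lambda>p. frechet_derivative ?\<tau> (at p) b) (at ?p) a" for a b
  proof -
    have "((\<lambda>q. frechet_derivative ?\<tau> (at ((cmap c \<circ> cinv ?d) q)) b) has_derivative
       (\<lambda>v. frechet_derivative (\<lambda>p. frechet_derivative ?\<tau> (at p) b) (at ?p) (to_chart c x v))) (at ?q)"
    proof (rule has_derivative_compose[OF cc_has_derivative[OF d(1) c(1) d(2) c(2)]])
      show "((\<lambda>p. frechet_derivative ?\<tau> (at p) b) has_derivative frechet_derivative (\<lambda>p. frechet_derivative ?\<tau> (at p) b) (at ?p))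
         (at ((cmap c \<circ> cinv ?d) ?q))"
        unfolding inv by (rule has_derivative_frechet[OF smooth_on_differentiable[OF smooth_on_deriv[OF sm] pT]])
    qed
    then have "(vec_rep A ?d (vec_of c b) has_derivative
       (\<lambda>v. frechet_derivative (\<lambda>p. frechet_derivative ?\<tau> (at p) b) (at ?p) (to_chart c x v))) (at ?q)"
    proof (rule has_derivative_transform_within_open[OF _ o qS])
      fix q assume "q \<in> ?S"
      then obtain y where y: "y \<in> cdom ?d" "y \<in> cdom c" "q = cmap ?d y" by auto
      have "vec_rep A ?d (vec_of c b) q = coord_change c ?d y b"
        using vec_rep_change[OF c(1) d(1) y(2,1)] y vec_rep_vec_of[OF c(1) y(2)] by simp
      then show "frechet_derivative ?\<tau> (at ((cmap c \<circ> cinv ?d) q)) b = vec_rep A ?d (vec_of c b) q"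
        using y d by (simp add: coord_change_def cinv_cmap)
    qed
    from fun_cong[OF frechet_derivative_at[OF this], of "vec_of c a x"]
    show ?thesis by (simp add: vec_of_def to_from[OF c])
  qed
  have "lie_bracket A (vec_of c a) (vec_of c b) x = 
     frechet_derivative (\<lambda>p. frechet_derivative ?\<tau> (at p) b) (at ?p) a - frechet_derivative (\<lambda>p. frechet_derivative ?\<tau> (at p) a) (at ?p) b"
    by (simp only: lie_bracket_def Let_def D)
  then show ?thesis using symmetric_second_derivative[OF oT sm pT, of b a] by simp
qed

lemma W_curvature_coord:
  assumes c: "c \<in> A" "x \<in> cdom c" and w: "sym_form w"
  shows "W_curvature A nabla x (from_chart c x a) (from_chart c x b) w =
    pullback (to_chart c x) (connection_form.curv (Lform c) (cmap c x) a b (pullback (from_chart c x) w))"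
proof -
  obtain s where s: "W_section A (cdom c) s" "s x = w" using W_section_const[OF c w] by metis
  note sv = smooth_vec_of[OF c(1)]
  have const: "frechet_derivative (vec_rep A c (vec_of c b)) (at (cmap c x)) = frechet_derivative (\<lambda>_. b) (at (cmap c x))" for b
    by (rule frechet_derivative_cong_open[OF open_img[OF c(1)]]) (use c in \<open>auto simp: vec_rep_vec_of\<close>)
  have "W_curvature A nabla x (from_chart c x a) (from_chart c x b) w =
     form_nabla A nabla (\<lambda>y. form_nabla A nabla s y (vec_of c b y)) x (vec_of c a x)
          - form_nabla A nabla (\<lambda>y. form_nabla A nabla s y (vec_of c a y)) x (vec_of c b x)
          - form_nabla A nabla s x (lie_bracket A (vec_of c a) (vec_of c b) x)"
    by (rule W_curvature_eq[OF w open_cdom[OF c(1)] c(2) sv sv s(1) _ _ s(2)]) (simp_all add: vec_of_def)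
  also have "\<dots> = pullback (to_chart c x) (connection_form.curv (Lform c) (cmap c x)
         (to_chart c x (vec_of c a x)) (to_chart c x (vec_of c b x)) (pullback (from_chart c x) (s x)))"
    by (rule curvature_expression[OF open_cdom[OF c(1)] c(2) sv sv _ c])
      (use s in \<open>simp_all add: W_section_def lie_bracket_vec_of[OF c] const frechet_derivative_const linear_0[OF linear_to_chart[OF c]]\<close>)
  finally show ?thesis by (simp add: vec_of_def to_from[OF c] s)
qed

end

section \<open>Semicontinuity of dimensions\<close>

text \<open>With \<open>\<phi> i\<close> dual to the vectors \<open>X i p\<close>, the linear map
  \<open>u \<mapsto> u + (\<Sum>i. \<phi> i u *\<^sub>R (X i z - X i p))\<close> sends \<open>X i p\<close> to \<open>X i z\<close>, and it is
  injective for \<open>z\<close> near \<open>p\<close> as a small perturbation of the identity.\<close>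

lemma independent_family_open:
  fixes X :: "'i \<Rightarrow> 'a::metric_space \<Rightarrow> 'b::euclidean_space"
  assumes I: "finite I" and inj: "inj_on (\<lambda>i. X i p) I" and ind: "independent ((\<lambda>i. X i p) ` I)"
    and cont: "\<And>i. i \<in> I \<Longrightarrow> isCont (X i) p"
  shows "\<exists>d>0. \<forall>z\<in>ball p d. inj_on (\<lambda>i. X i z) I \<and> independent ((\<lambda>i. X i z) ` I)"
proof -
  have "\<exists>\<phi>. \<forall>i\<in>I. linear (\<phi> i) \<and> (\<forall>j\<in>I. \<phi> i (X j p) = (if j = i then 1 else 0 :: real))"
  proof (intro bchoice ballI)
    fix i assume i: "i \<in> I"
    obtain g where g: "linear g" "\<And>x. x \<in> (\<lambda>i. X i p) ` I \<Longrightarrow> g x = (if x = X i p then 1 else 0 :: real)"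
      using linear_independent_extend[OF ind, of "\<lambda>x. if x = X i p then 1 else 0 :: real"] by blast
    have "g (X j p) = (if j = i then 1 else 0)" if "j \<in> I" for j
      using g(2)[of "X j p"] that i inj_onD[OF inj, of j i] by auto
    with g show "\<exists>\<phi>. linear \<phi> \<and> (\<forall>j\<in>I. \<phi> (X j p) = (if j = i then 1 else 0 :: real))" by blast
  qed
  then obtain \<phi> where \<phi>: "\<And>i. i \<in> I \<Longrightarrow> linear (\<phi> i)"
    "\<And>i j. i \<in> I \<Longrightarrow> j \<in> I \<Longrightarrow> \<phi> i (X j p) = (if j = i then 1 else 0 :: real)" by blast
  have "\<exists>K. \<forall>i\<in>I. K i > 0 \<and> (\<forall>u. norm (\<phi> i u) \<le> K i * norm u)"
    by (intro bchoice ballI) (use \<phi>(1) linear_bounded_pos in blast)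
  then obtain K where K: "\<And>i. i \<in> I \<Longrightarrow> K i > 0" "\<And>i u. i \<in> I \<Longrightarrow> norm (\<phi> i u) \<le> K i * norm u" by blast
  have "((\<lambda>z. \<Sum>i\<in>I. K i * norm (X i z - X i p)) \<longlongrightarrow> (\<Sum>i\<in>I. K i * norm (X i p - X i p))) (at p)"
    using cont by (intro tendsto_intros) (auto simp: isCont_def)
  then have "\<forall>\<^sub>F z in at p. (\<Sum>i\<in>I. K i * norm (X i z - X i p)) < 1"
    by (intro order_tendstoD(2)) auto
  then obtain d where d: "d > 0" "\<And>z. z \<noteq> p \<Longrightarrow> dist z p < d \<Longrightarrow> (\<Sum>i\<in>I. K i * norm (X i z - X i p)) < 1"
    unfolding eventually_at by auto
  have "inj_on (\<lambda>i. X i z) I \<and> independent ((\<lambda>i. X i z) ` I)" if z: "z \<in> ball p d" for z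
  proof -
    have small: "(\<Sum>i\<in>I. K i * norm (X i z - X i p)) < 1"
      using d(2)[of z] z by (cases "z = p") (auto simp: dist_commute)
    define \<Psi> where "\<Psi> u = u + (\<Sum>i\<in>I. \<phi> i u *\<^sub>R (X i z - X i p))" for u
    have lin: "linear \<Psi>"
      unfolding \<Psi>_def using \<phi>(1)
      by (intro linearI) (simp_all add: linear_add linear_scale scaleR_add_left sum.distrib scaleR_sum_right scaleR_add_right)
    have \<Psi>X: "\<Psi> (X j p) = X j z" if "j \<in> I" for j
    proof -
      have "(\<Sum>i\<in>I. \<phi> i (X j p) *\<^sub>R (X i z - X i p)) = (\<Sum>i\<in>I. if j = i then X i z - X i p else 0)"
        by (intro sum.cong) (use \<phi>(2) that in auto)
      then show ?thesis using I that by (simp add: \<Psi>_def)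
    qed
    have "u = 0" if "\<Psi> u = 0" for u
    proof (rule ccontr)
      assume u: "u \<noteq> 0"
      have "norm u = norm (\<Sum>i\<in>I. \<phi> i u *\<^sub>R (X i z - X i p))"
        using that unfolding \<Psi>_def by (metis add_eq_0_iff norm_minus_cancel)
      also have "\<dots> \<le> (\<Sum>i\<in>I. (K i * norm u) * norm (X i z - X i p))"
        by (intro sum_norm_le) (use K(2) in \<open>auto intro!: mult_right_mono\<close>)
      also have "\<dots> = (\<Sum>i\<in>I. K i * norm (X i z - X i p)) * norm u" by (simp add: sum_distrib_left mult_ac)
      also have "\<dots> < 1 * norm u" using small u by (intro mult_strict_right_mono) auto
      finally show False by simp
    qed
    then have injP: "inj \<Psi>" using linear_injective_0[OF lin] by blast
    have im: "(\<lambda>i. X i z) ` I = \<Psi> ` (\<lambda>i. X i p) ` I" using \<Psi>X by (force simp: image_image)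
    have "independent (\<Psi> ` (\<lambda>i. X i p) ` I)"
      by (rule linear_independent_injective_image[OF lin ind]) (use injP inj_on_subset in blast)
    moreover have "inj_on (\<lambda>i. X i z) I"
    proof (rule inj_onI)
      fix i j assume "i \<in> I" "j \<in> I" "X i z = X j z"
      then show "i = j" using \<Psi>X injD[OF injP, of "X i p" "X j p"] inj_onD[OF inj] by auto
    qed
    ultimately show ?thesis by (simp add: im)
  qed
  then show ?thesis using d by blast
qed

text \<open>The unit vectors orthogonal to the kernel at \<open>p\<close> form a compact set. If kernels at
  points arbitrarily close to \<open>p\<close> met it, a limit would lie in the kernel at \<open>p\<close>. So nearby kernels meet
  the orthogonal complement of the kernel at \<open>p\<close> trivially.\<close>

lemma kernel_dim_upper_semicontinuous:
  fixes M :: "'i \<Rightarrow> 'a::metric_space \<Rightarrow> 'b::euclidean_space \<Rightarrow> 'c::real_normed_vector"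
  assumes D: "open D" "p \<in> D" and V: "subspace V"
    and lin: "\<And>i z. z \<in> D \<Longrightarrow> linear (M i z)" and cont: "\<And>i w. continuous_on D (\<lambda>z. M i z w)"
  shows "\<exists>d>0. ball p d \<subseteq> D \<and> (\<forall>z\<in>ball p d. dim {w\<in>V. \<forall>i. M i z w = 0} \<le> dim {w\<in>V. \<forall>i. M i p w = 0})"
proof -
  define K where "K z = {w\<in>V. \<forall>i. M i z w = 0}" for z
  have subK: "subspace (K z)" if "z \<in> D" for z
    using V lin[OF that] unfolding K_def subspace_def by (auto simp: linear_0 linear_add linear_scale)
  obtain d0 where d0: "d0 > 0" "ball p d0 \<subseteq> D" using D openE by blast
  define S where "S = {w\<in>V. norm w = 1 \<and> (\<forall>x\<in>K p. x \<bullet> w = 0)}"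
  have "closed S"
  proof -
    have "S = V \<inter> {w. norm w = 1} \<inter> (\<Inter>x\<in>K p. {w. x \<bullet> w = 0})" by (auto simp: S_def)
    moreover have "closed {w::'b. norm w = 1}" by (intro closed_Collect_eq continuous_intros)
    moreover have "closed {w. x \<bullet> w = 0}" for x :: 'b by (intro closed_Collect_eq continuous_intros)
    ultimately show ?thesis using closed_subspace[OF V] by auto
  qed
  moreover have "bounded S" unfolding bounded_iff S_def by auto
  ultimately have cS: "compact S" using compact_eq_bounded_closed by blast
  have "\<exists>d>0. d \<le> d0 \<and> (\<forall>z\<in>ball p d. K z \<inter> S = {})"
  proof (rule ccontr)
    assume neg: "\<not> ?thesis"
    have "\<exists>z w. z \<in> ball p (min d0 (1 / real (Suc n))) \<and> w \<in> K z \<and> w \<in> S" for n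
    proof -
      have "min d0 (1 / real (Suc n)) > 0" using d0 by simp
      then have "\<not> (\<forall>z\<in>ball p (min d0 (1 / real (Suc n))). K z \<inter> S = {})"
        using neg min.cobounded1 by blast
      then show ?thesis by blast
    qed
    then obtain z w where zw: "\<And>n. z n \<in> ball p (min d0 (1 / real (Suc n)))" "\<And>n. w n \<in> K (z n)" "\<And>n. w n \<in> S"
      by metis
    obtain l r where l: "l \<in> S" "strict_mono r" "(w \<circ> r) \<longlonglongrightarrow> l"
      using cS zw(3) unfolding compact_def by metis
    have "z \<longlonglongrightarrow> p"
    proof (rule metric_tendsto_imp_tendsto[OF LIMSEQ_inverse_real_of_nat])
      show "\<forall>\<^sub>F n in sequentially. dist (z n) p \<le> dist (inverse (real (Suc n))) 0"
        using zw(1) by (intro always_eventually allI) (auto simp: dist_commute inverse_eq_divide less_imp_le)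
    qed
    then have zr: "(z \<circ> r) \<longlonglongrightarrow> p" using l(2) LIMSEQ_subseq_LIMSEQ by blast
    have zD: "z n \<in> D" for n using zw(1)[of n] d0 by auto
    have "M i p l = 0" for i
    proof -
      have 1: "(\<lambda>n. M i ((z \<circ> r) n) b) \<longlonglongrightarrow> M i p b" for b
        by (rule continuous_on_tendsto_compose[OF cont zr]) (use D zD in auto)
      have "(\<lambda>n. \<Sum>b\<in>Basis. ((w \<circ> r) n \<bullet> b) *\<^sub>R M i ((z \<circ> r) n) b) \<longlonglongrightarrow> (\<Sum>b\<in>Basis. (l \<bullet> b) *\<^sub>R M i p b)"
        by (intro tendsto_intros 1 l)
      moreover have "(\<Sum>b\<in>Basis. ((w \<circ> r) n \<bullet> b) *\<^sub>R M i ((z \<circ> r) n) b) = 0" for n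
        using linear_basis_expand[OF lin[OF zD[of "r n"]], of i "w (r n)"] zw(2)[of "r n"] by (simp add: K_def)
      ultimately have "(\<Sum>b\<in>Basis. (l \<bullet> b) *\<^sub>R M i p b) = 0" by (simp add: LIMSEQ_const_iff)
      then show ?thesis using linear_basis_expand[OF lin[OF D(2)], of i l] by simp
    qed
    then have "l \<in> K p" using l(1) by (simp add: K_def S_def)
    then have "l \<bullet> l = 0" using l(1) by (simp add: S_def)
    then show False using l(1) by (simp add: S_def)
  qed
  then obtain d where d: "d > 0" "d \<le> d0" "\<And>z. z \<in> ball p d \<Longrightarrow> K z \<inter> S = {}" by blast
  have "dim (K z) \<le> dim (K p)" if z: "z \<in> ball p d" for z
  proof -
    have zD: "z \<in> D" using z d d0 by auto
    define T where "T = {y\<in>V. \<forall>x\<in>K p. orthogonal x y}"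
    have subT: "subspace T"
      using V unfolding T_def subspace_def orthogonal_def by (auto simp: inner_add_right)
    have dT: "dim T + dim (K p) = dim V"
      unfolding T_def by (rule dim_subspace_orthogonal_to_vectors[OF subK[OF D(2)] V]) (auto simp: K_def)
    have "K z \<inter> T \<subseteq> {0}"
    proof
      fix w assume w: "w \<in> K z \<inter> T"
      show "w \<in> {0}"
      proof (rule ccontr)
        assume "w \<notin> {0}"
        then have w0: "w \<noteq> 0" by simp
        let ?w = "(1 / norm w) *\<^sub>R w"
        have "?w \<in> K z" using w subspace_scale[OF subK[OF zD]] by blast
        moreover have "?w \<in> S"
          using w w0 subspace_scale[OF V] by (auto simp: S_def T_def orthogonal_def)
        ultimately show False using d(3)[OF z] by blast
      qed
    qed
    then have "dim (K z \<inter> T) = 0" using dim_eq_0 by blast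
    moreover have "dim {x + y |x y. x \<in> K z \<and> y \<in> T} \<le> dim V"
      by (rule dim_subset) (use subspace_add[OF V] in \<open>auto simp: K_def T_def\<close>)
    ultimately show ?thesis using dim_sums_Int[OF subK[OF zD] subT] dT by linarith
  qed
  then show ?thesis using d d0 unfolding K_def by (intro exI[of _ d]) auto
qed

section \<open>The sheaf of parallel sections\<close>

context analytic_conn
begin

lemma form_nabla_add:
  assumes U: "open U" "x \<in> U" and w: "smooth_form A U w" "smooth_form A U w'"
  shows "form_nabla A nabla (\<lambda>y. w y + w' y) x v = form_nabla A nabla w x v + form_nabla A nabla w' x v"
proof -
  let ?c = "chart_at A x"
  have c: "?c \<in> A" "x \<in> cdom ?c" by (rule chart_at)+
  interpret L: connection_form "img ?c" "Lform ?c" by (rule connection_form_Lform[OF c(1)])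
  let ?S = "cmap ?c ` (cdom ?c \<inter> U)"
  have o: "open ?S" by (rule open_image[OF c(1) U(1)])
  have pS: "cmap ?c x \<in> ?S" using c U by auto
  have e: "form_rep A ?c (\<lambda>y. w y + w' y) q = form_rep A ?c w q + form_rep A ?c w' q" if "q \<in> ?S" for q
    using that c(1) by (auto simp: form_rep_cmap linear_add[OF linear_pullback[OF linear_from_chart]])
  have d: "frechet_derivative (form_rep A ?c (\<lambda>y. w y + w' y)) (at (cmap ?c x))
     = (\<lambda>v. frechet_derivative (form_rep A ?c w) (at (cmap ?c x)) v + frechet_derivative (form_rep A ?c w') (at (cmap ?c x)) v)"
  proof (rule trans[OF frechet_derivative_cong_open[OF o pS e]])
    show "frechet_derivative (\<lambda>q. form_rep A ?c w q + form_rep A ?c w' q) (at (cmap ?c x))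
     = (\<lambda>v. frechet_derivative (form_rep A ?c w) (at (cmap ?c x)) v + frechet_derivative (form_rep A ?c w') (at (cmap ?c x)) v)"
    by (rule frechet_derivative_at[symmetric])
      (intro has_derivative_add has_derivative_frechet smooth_on_differentiable[OF smooth_formD pS] w c)
  qed
  have pi: "cmap ?c x \<in> img ?c" using c by auto
  show ?thesis
    unfolding form_nabla_coord[OF U(1) smooth_form_add[OF U(1) w] U(2) c(2,1)] form_nabla_coord[OF U(1) w(1) U(2) c(2,1)]
      form_nabla_coord[OF U(1) w(2) U(2) c(2,1)] d e[OF pS] linear_add[OF L.lin2[OF pi]]
      linear_add[OF linear_pullback[OF linear_to_chart[OF c]], symmetric]
    by (simp add: algebra_simps)
qed

lemma form_nabla_scale:
  assumes U: "open U" "x \<in> U" and w: "smooth_form A U w"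
  shows "form_nabla A nabla (\<lambda>y. r *\<^sub>R w y) x v = r *\<^sub>R form_nabla A nabla w x v"
proof -
  let ?c = "chart_at A x"
  have c: "?c \<in> A" "x \<in> cdom ?c" by (rule chart_at)+
  interpret L: connection_form "img ?c" "Lform ?c" by (rule connection_form_Lform[OF c(1)])
  let ?S = "cmap ?c ` (cdom ?c \<inter> U)"
  have o: "open ?S" by (rule open_image[OF c(1) U(1)])
  have pS: "cmap ?c x \<in> ?S" using c U by auto
  have e: "form_rep A ?c (\<lambda>y. r *\<^sub>R w y) q = r *\<^sub>R form_rep A ?c w q" if "q \<in> ?S" for q
    using that c(1) by (auto simp: form_rep_cmap linear_scale[OF linear_pullback[OF linear_from_chart]])
  have d: "frechet_derivative (form_rep A ?c (\<lambda>y. r *\<^sub>R w y)) (at (cmap ?c x))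
     = (\<lambda>v. r *\<^sub>R frechet_derivative (form_rep A ?c w) (at (cmap ?c x)) v)"
  proof (rule trans[OF frechet_derivative_cong_open[OF o pS e]])
    show "frechet_derivative (\<lambda>q. r *\<^sub>R form_rep A ?c w q) (at (cmap ?c x))
     = (\<lambda>v. r *\<^sub>R frechet_derivative (form_rep A ?c w) (at (cmap ?c x)) v)"
    by (rule frechet_derivative_at[symmetric])
      (intro has_derivative_scaleR_right has_derivative_frechet smooth_on_differentiable[OF smooth_formD pS] w c)
  qed
  have pi: "cmap ?c x \<in> img ?c" using c by auto
  show ?thesis
    unfolding form_nabla_coord[OF U(1) smooth_form_scale[OF U(1) w] U(2) c(2,1)] form_nabla_coord[OF U(1) w(1) U(2) c(2,1)]
      d e[OF pS] linear_scale[OF L.lin2[OF pi]] linear_scale[OF linear_pullback[OF linear_to_chart[OF c]], symmetric]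
    by (simp add: algebra_simps)
qed

definition parallel_sec :: "'m set \<Rightarrow> ('m \<Rightarrow> real^'n^'n) \<Rightarrow> bool" where
  "parallel_sec U s \<longleftrightarrow> open U \<and> W_section A U s \<and> parallel_on A nabla U s"

definition parallel_fibre :: "'m \<Rightarrow> (real^'n^'n) set" where
  "parallel_fibre x = {w. \<exists>U s. x \<in> U \<and> parallel_sec U s \<and> s x = w}"

abbreviation jets :: "('m, 'n) chart \<Rightarrow> real^'n \<Rightarrow> (real^'n^'n) set" where
  "jets c \<equiv> connection_form.flat_jets (Lform c)"

abbreviation flat :: "('m, 'n) chart \<Rightarrow> (real^'n) set \<Rightarrow> (real^'n \<Rightarrow> real^'n^'n) \<Rightarrow> bool" where
  "flat c \<equiv> connection_form.flat_on (Lform c)"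

lemma parallel_sec_subset: "parallel_sec U s \<Longrightarrow> open V \<Longrightarrow> V \<subseteq> U \<Longrightarrow> parallel_sec V s"
  unfolding parallel_sec_def parallel_on_def using smooth_subset(4) by blast

lemma parallel_sec_add: "parallel_sec U s \<Longrightarrow> parallel_sec U t \<Longrightarrow> parallel_sec U (\<lambda>x. s x + t x)"
  unfolding parallel_sec_def W_section_def parallel_on_def
  by (auto simp: smooth_form_add form_nabla_add[where U = U] sym_form_iff form_eval_simps)

lemma parallel_sec_scale: "parallel_sec U s \<Longrightarrow> parallel_sec U (\<lambda>x. r *\<^sub>R s x)"
  unfolding parallel_sec_def W_section_def parallel_on_def
  by (auto simp: smooth_form_scale form_nabla_scale[where U = U] sym_form_iff form_eval_simps)

lemma parallel_sec_flat:
  assumes s: "parallel_sec U s" and c: "c \<in> A"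
  shows "flat c (cmap c ` (cdom c \<inter> U)) (form_rep A c s)"
proof -
  interpret connection_form "img c" "Lform c" by (rule connection_form_Lform[OF c])
  have sm: "smooth_form A U s" and U: "open U" and par: "\<And>x v. x \<in> U \<Longrightarrow> form_nabla A nabla s x v = 0"
    using s by (auto simp: parallel_sec_def W_section_def parallel_on_def)
  have "frechet_derivative (form_rep A c s) (at (cmap c x)) \<nu> = Lform c (cmap c x) \<nu> (form_rep A c s (cmap c x))"
    if x: "x \<in> cdom c" "x \<in> U" for x \<nu>
  proof -
    have "pullback (to_chart c x) (frechet_derivative (form_rep A c s) (at (cmap c x)) \<nu> - Lform c (cmap c x) \<nu> (form_rep A c s (cmap c x))) = 0"
      using form_nabla_coord[OF U sm x(2,1) c, of "from_chart c x \<nu>"] par[OF x(2)] by (simp add: to_from[OF c x(1)])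
    then have "frechet_derivative (form_rep A c s) (at (cmap c x)) \<nu> - Lform c (cmap c x) \<nu> (form_rep A c s (cmap c x)) = 0"
      using pullback_inverse(2)[OF c x(1)] linear_0[OF linear_pullback[OF linear_from_chart[OF c x(1)]]] by metis
    then show ?thesis by simp
  qed
  then show ?thesis unfolding flat_on_def using smooth_formD[OF sm c] by auto
qed

lemma flat_parallel_sec:
  assumes c: "c \<in> A" and U: "open U" "U \<subseteq> cdom c" and f: "flat c (cmap c ` U) (form_rep A c s)"
    and sym: "\<And>x. x \<in> U \<Longrightarrow> sym_form (s x)"
  shows "parallel_sec U s"
proof -
  interpret connection_form "img c" "Lform c" by (rule connection_form_Lform[OF c])
  have sm: "smooth_form A U s" by (rule smooth_form_chart[OF c U]) (use f in \<open>simp add: flat_on_def\<close>)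
  have "form_nabla A nabla s x v = 0" if x: "x \<in> U" for x v
  proof -
    have xc: "x \<in> cdom c" using x U by auto
    have "frechet_derivative (form_rep A c s) (at (cmap c x)) (to_chart c x v) = Lform c (cmap c x) (to_chart c x v) (form_rep A c s (cmap c x))"
      using f x unfolding flat_on_def by blast
    then show ?thesis using form_nabla_coord[OF U(1) sm x xc c] linear_0[OF linear_pullback[OF linear_to_chart[OF c xc]]] by simp
  qed
  then show ?thesis using sm U sym by (simp add: parallel_sec_def W_section_def parallel_on_def)
qed

lemma parallel_sec_unique:
  assumes s: "parallel_sec U s" and t: "parallel_sec V t" and x: "x \<in> U" "x \<in> V" and e: "s x = t x"
  shows "\<exists>N. open N \<and> x \<in> N \<and> N \<subseteq> U \<inter> V \<and> (\<forall>y\<in>N. s y = t y)"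
proof -
  let ?c = "chart_at A x"
  have c: "?c \<in> A" "x \<in> cdom ?c" by (rule chart_at)+
  interpret connection_form "img ?c" "Lform ?c" by (rule connection_form_Lform[OF c(1)])
  define W where "W = U \<inter> V \<inter> cdom ?c"
  have W: "open W" "x \<in> W" "W \<subseteq> U" "W \<subseteq> V" "W \<subseteq> cdom ?c"
    using s t x c open_cdom[OF c(1)] by (auto simp: W_def parallel_sec_def)
  have dW: "cdom ?c \<inter> W = W" using W by auto
  have "parallel_sec W (\<lambda>x. s x + (-1) *\<^sub>R t x)"
    by (intro parallel_sec_add parallel_sec_scale parallel_sec_subset[OF s] parallel_sec_subset[OF t] W)
  from parallel_sec_flat[OF this c(1)] have f: "flat ?c (cmap ?c ` W) (form_rep A ?c (\<lambda>x. s x + (-1) *\<^sub>R t x))" by (simp add: dW)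
  have o: "open (cmap ?c ` W)" by (rule open_cmap_image[OF c(1) W(1,5)])
  have "form_rep A ?c (\<lambda>x. s x + (-1) *\<^sub>R t x) (cmap ?c x) = 0"
    using e linear_0[OF linear_pullback[OF linear_from_chart[OF c]]] by (simp add: form_rep_cmap c)
  then obtain r where r: "r > 0" "\<And>q. q \<in> ball (cmap ?c x) r \<Longrightarrow> form_rep A ?c (\<lambda>x. s x + (-1) *\<^sub>R t x) q = 0"
    using flat_on_zero[OF o _ f, of "cmap ?c x"] W by blast
  define N where "N = cinv ?c ` (ball (cmap ?c x) r \<inter> cmap ?c ` W)"
  have "open N" unfolding N_def by (rule open_cinv_image[OF c(1)]) (use o W in auto)
  moreover have "x \<in> N"
    unfolding N_def using r W c by (intro image_eqI[of _ _ "cmap ?c x"]) (auto simp: cinv_cmap)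
  moreover have "N \<subseteq> W" using W(5) cinv_cmap[OF c(1)] by (auto simp: N_def)
  moreover have "s y = t y" if y: "y \<in> N" for y
  proof -
    have yc: "y \<in> cdom ?c" using y \<open>N \<subseteq> W\<close> W by auto
    have "cmap ?c y \<in> ball (cmap ?c x) r" using y W(5) cinv_cmap[OF c(1)] unfolding N_def by auto
    from r(2)[OF this] have "pullback (from_chart ?c y) (s y - t y) = 0" by (simp add: form_rep_cmap c(1) yc)
    then have "s y - t y = pullback (to_chart ?c y) 0" using pullback_inverse(1)[OF c(1) yc] by metis
    then show ?thesis using linear_0[OF linear_pullback[OF linear_to_chart[OF c(1) yc]]] by simp
  qed
  ultimately show ?thesis using W by (intro exI[of _ N]) blast
qed

lemma Lform_transpose:
  assumes "c \<in> A" "p \<in> img c"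
  shows "Lform c p \<nu> (transpose h) = transpose (Lform c p \<nu> h)"
proof (rule form_ext)
  have t: "form_eval (transpose B) u v = form_eval B v u" for B :: "real^'n^'n" and u v
    using form_eval_mult_left[of B "mat 1" u v] by (simp add: form_eval_def inner_commute)
  show "form_eval (Lform c p \<nu> (transpose h)) u v = form_eval (transpose (Lform c p \<nu> h)) u v" for u v
    by (simp add: t form_eval_Lform[OF assms])
qed

text \<open>Transposition commutes with the induced connection. This makes it possible to symmetrize a
  parallel form, as the transport is constructed among all bilinear forms.\<close>

lemma flat_transpose:
  assumes c: "c \<in> A" and S: "open S" "S \<subseteq> img c" and f: "flat c S h"
  shows "flat c S (\<lambda>q. transpose (h q))"
proof -
  interpret connection_form "img c" "Lform c" by (rule connection_form_Lform[OF c])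
  have lt: "linear (transpose :: real^'n^'n \<Rightarrow> real^'n^'n)"
    by (rule linearI) (simp_all add: transpose_def vec_eq_iff)
  then have bt: "bounded_linear (transpose :: real^'n^'n \<Rightarrow> real^'n^'n)" using linear_conv_bounded_linear by blast
  have sm: "smooth_on h S" using f by (simp add: flat_on_def)
  have "frechet_derivative (\<lambda>q. transpose (h q)) (at p) \<nu> = Lform c p \<nu> (transpose (h p))" if p: "p \<in> S" for p \<nu>
  proof -
    have "frechet_derivative (\<lambda>q. transpose (h q)) (at p) = (\<lambda>\<nu>. transpose (frechet_derivative h (at p) \<nu>))"
      by (rule frechet_derivative_at[symmetric], rule bounded_linear.has_derivative[OF bt])
        (rule has_derivative_frechet[OF smooth_on_differentiable[OF sm p]])
    then show ?thesis using f p S Lform_transpose[OF c] by (auto simp: flat_on_def)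
  qed
  then show ?thesis using smooth_on_bounded_linear[OF S(1) bt sm] by (simp add: flat_on_def)
qed

text \<open>Parallel extension of a value is a system of linear conditions at the point. The sheaf-theoretic
  left hand side is thereby accessible to semicontinuity.\<close>

lemma parallel_fibre_jets:
  assumes c: "c \<in> A" and x: "x \<in> cdom c"
  shows "w \<in> parallel_fibre x \<longleftrightarrow> sym_form w \<and> pullback (from_chart c x) w \<in> jets c (cmap c x)"
proof
  interpret connection_form "img c" "Lform c" by (rule connection_form_Lform[OF c])
  let ?p = "cmap c x"
  {
    assume "w \<in> parallel_fibre x"
    then obtain U s where s: "x \<in> U" "parallel_sec U s" "s x = w" by (auto simp: parallel_fibre_def)
    have o: "open (cmap c ` (cdom c \<inter> U))" using open_image[OF c] s(2) by (simp add: parallel_sec_def)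
    have "form_rep A c s ?p \<in> flat_jets ?p"
      by (rule flat_on_jets[OF o _ parallel_sec_flat[OF s(2) c]]) (use s x in auto)
    moreover have "sym_form w" using s by (auto simp: parallel_sec_def W_section_def)
    ultimately show "sym_form w \<and> pullback (from_chart c x) w \<in> flat_jets ?p" by (simp add: form_rep_cmap c x s)
  next
    assume w: "sym_form w \<and> pullback (from_chart c x) w \<in> flat_jets ?p"
    have pi: "?p \<in> img c" using x by auto
    obtain r h where r: "r > 0" "ball ?p r \<subseteq> img c" "flat_on (ball ?p r) h" "h ?p = pullback (from_chart c x) w"
      using flat_extension[OF pi] w by blast
    define h' where "h' q = (1/2) *\<^sub>R (h q + transpose (h q))" for q
    have f': "flat_on (ball ?p r) h'"
      unfolding h'_def by (intro flat_on_linear open_ball r flat_transpose[OF c])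
    have symh': "sym_form (h' q)" for q
      unfolding sym_form_def h'_def by (simp add: transpose_def vec_eq_iff)
    have "transpose (h ?p) = h ?p"
      using sym_form_pullback[OF linear_from_chart[OF c x]] w r(4) unfolding sym_form_def by simp
    then have h'p: "h' ?p = pullback (from_chart c x) w" by (simp add: h'_def r(4) scaleR_2[symmetric])
    define U where "U = cinv c ` ball ?p r"
    have U: "open U" unfolding U_def by (rule open_cinv_image[OF c open_ball r(2)])
    have Uc: "U \<subseteq> cdom c" using r(2) cinv_cmap[OF c] unfolding U_def by force
    have im: "cmap c ` U = ball ?p r"
    proof -
      have "cmap c (cinv c q) = q" if "q \<in> ball ?p r" for q using that r(2) cinv_cmap[OF c] by force
      then show ?thesis unfolding U_def by (force simp: image_image)
    qed
    have xU: "x \<in> U" unfolding U_def using r(1) cinv_cmap[OF c x] by (intro image_eqI[of _ _ ?p]) auto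
    have "parallel_sec U (form_of c h')"
    proof (rule flat_parallel_sec[OF c U Uc])
      have e: "form_rep A c (form_of c h') q = h' q" if "q \<in> ball ?p r" for q
        using that Uc form_rep_form_of[OF c] unfolding im[symmetric] by auto
      have e': "frechet_derivative (form_rep A c (form_of c h')) (at q) = frechet_derivative h' (at q)" if "q \<in> ball ?p r" for q
        by (rule frechet_derivative_cong_open[OF open_ball that e])
      have "smooth_on (form_rep A c (form_of c h')) (ball ?p r)"
        by (rule smooth_on_cong[OF open_ball, of _ _ h']) (use e f' in \<open>auto simp: flat_on_def\<close>)
      then show "flat_on (cmap c ` U) (form_rep A c (form_of c h'))"
        unfolding im using f' e e' unfolding flat_on_def by simp
      show "sym_form (form_of c h' y)" if "y \<in> U" for y
        unfolding form_of_def by (rule sym_form_pullback[OF linear_to_chart[OF c] symh']) (use that Uc in auto)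
    qed
    moreover have "form_of c h' x = w" by (simp add: form_of_def h'p pullback_inverse[OF c x])
    ultimately show "w \<in> parallel_fibre x" using xU by (auto simp: parallel_fibre_def)
  }
qed

lemma subspace_parallel_fibre: "subspace (parallel_fibre x)"
proof -
  let ?c = "chart_at A x"
  have c: "?c \<in> A" "x \<in> cdom ?c" by (rule chart_at)+
  interpret connection_form "img ?c" "Lform ?c" by (rule connection_form_Lform[OF c(1)])
  have "subspace (flat_jets (cmap ?c x))" using c by (intro subspace_flat_jets) auto
  then show ?thesis
    using linear_pullback[OF linear_from_chart[OF c]]
    unfolding subspace_def by (auto simp: parallel_fibre_jets[OF c] sym_form_iff form_eval_simps linear_0 linear_add linear_scale)
qed

lemma parallel_sec_in_parallel_fibre: "parallel_sec U s \<Longrightarrow> x \<in> U \<Longrightarrow> s x \<in> parallel_fibre x"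
  by (auto simp: parallel_fibre_def)

lemma isCont_form_rep:
  assumes "open U" "smooth_form A U s" "x \<in> U" "x \<in> cdom c" "c \<in> A"
  shows "isCont (form_rep A c s) (cmap c x)"
  using smooth_on_continuous[OF smooth_formD[OF assms(2,5)]] open_image[OF assms(5,1)] assms(3,4)
    continuous_on_eq_continuous_at by blast

lemma independent_sections_open:
  assumes B: "finite B" "independent B" and U: "open U" "x \<in> U"
    and X: "\<And>b. b \<in> B \<Longrightarrow> smooth_form A U (X b)" "\<And>b. b \<in> B \<Longrightarrow> X b x = b"
  shows "\<exists>N. open N \<and> x \<in> N \<and> N \<subseteq> U \<and> (\<forall>y\<in>N. inj_on (\<lambda>b. X b y) B \<and> independent ((\<lambda>b. X b y) ` B))"
proof -
  let ?c = "chart_at A x"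
  have c: "?c \<in> A" "x \<in> cdom ?c" by (rule chart_at)+
  let ?p = "cmap ?c x"
  let ?S = "\<lambda>b. form_rep A ?c (X b)"
  have inv: "pullback (to_chart ?c y) (pullback (from_chart ?c y) w) = w" if "y \<in> cdom ?c" for y w
    by (rule pullback_inverse(1)[OF c(1) that])
  have Sp: "?S b ?p = pullback (from_chart ?c x) b" if "b \<in> B" for b using X(2)[OF that] by (simp add: form_rep_cmap c)
  have im: "(\<lambda>b. ?S b ?p) ` B = pullback (from_chart ?c x) ` B" using Sp by auto
  have "inj (pullback (from_chart ?c x))" by (metis injI inv[OF c(2)])
  then have "independent ((\<lambda>b. ?S b ?p) ` B)" unfolding im
    by (intro linear_independent_injective_image[OF linear_pullback[OF linear_from_chart[OF c]] B(2)]) (auto intro: inj_on_subset)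
  moreover have "inj_on (\<lambda>b. ?S b ?p) B" using Sp inv[OF c(2)] by (metis (no_types, lifting) inj_onI)
  ultimately obtain d where d: "d > 0" "\<And>z. z \<in> ball ?p d \<Longrightarrow> inj_on (\<lambda>b. ?S b z) B \<and> independent ((\<lambda>b. ?S b z) ` B)"
    using independent_family_open[OF B(1), of "?S" ?p] isCont_form_rep[OF U(1) X(1) U(2) c(2,1)] by blast
  define N where "N = cinv ?c ` (ball ?p d \<inter> cmap ?c ` (cdom ?c \<inter> U))"
  have "open N" unfolding N_def by (rule open_cinv_image[OF c(1)]) (use open_image[OF c(1) U(1)] in auto)
  moreover have "x \<in> N" unfolding N_def
    using d(1) c U by (intro image_eqI[of _ _ ?p]) (auto simp: cinv_cmap)
  moreover have NU: "N \<subseteq> cdom ?c \<inter> U" using cinv_cmap[OF c(1)] by (auto simp: N_def)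
  moreover have "inj_on (\<lambda>b. X b y) B \<and> independent ((\<lambda>b. X b y) ` B)" if y: "y \<in> N" for y
  proof -
    have yc: "y \<in> cdom ?c" using y NU by auto
    have "cmap ?c y \<in> ball ?p d" using y cinv_cmap[OF c(1)] unfolding N_def by auto
    note D = d(2)[OF this]
    have S: "?S b (cmap ?c y) = pullback (from_chart ?c y) (X b y)" for b by (simp add: form_rep_cmap c yc)
    then have X': "X b y = pullback (to_chart ?c y) (?S b (cmap ?c y))" for b by (simp add: inv[OF yc])
    have injT: "inj (pullback (to_chart ?c y))" by (metis injI pullback_inverse(2)[OF c(1) yc])
    have im: "(\<lambda>b. X b y) ` B = pullback (to_chart ?c y) ` (\<lambda>b. ?S b (cmap ?c y)) ` B"
      unfolding image_image using X' by simp
    have "independent ((\<lambda>b. X b y) ` B)" unfolding im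
      by (rule linear_independent_injective_image[OF linear_pullback[OF linear_to_chart[OF c(1) yc]]])
        (use D injT in \<open>auto intro: inj_on_subset\<close>)
    moreover have "inj_on (\<lambda>b. X b y) B"
      using D unfolding S by (auto simp: inj_on_def)
    ultimately show ?thesis by blast
  qed
  ultimately show ?thesis by (intro exI[of _ N]) blast
qed

lemma parallel_sec_sum:
  assumes "finite B" "open U" "\<And>b. b \<in> B \<Longrightarrow> parallel_sec U (s b)" "B \<noteq> {}"
  shows "parallel_sec U (\<lambda>x. \<Sum>b\<in>B. a b *\<^sub>R s b x)"
  using assms(1,4,3)
  by (induction B rule: finite_ne_induct) (simp_all add: parallel_sec_scale parallel_sec_add)

lemma zero_parallel_sec: "open U \<Longrightarrow> parallel_sec U (\<lambda>_. 0)"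
proof -
  assume U: "open U"
  have sm: "smooth_form A U (\<lambda>_. 0)"
    unfolding smooth_form_def
  proof
    fix c assume c: "c \<in> A"
    show "smooth_on (form_rep A c (\<lambda>_. 0)) (cmap c ` (cdom c \<inter> U))"
      by (rule smooth_on_cong[OF open_image[OF c U] _ smooth_on_const[of 0]])
        (use c in \<open>auto simp: form_rep_cmap linear_0[OF linear_pullback[OF linear_from_chart]]\<close>)
  qed
  have "form_nabla A nabla (\<lambda>_. 0) x v = 0" if "x \<in> U" for x v
    using form_nabla_scale[OF U that sm, of 0 v] by simp
  with sm U show ?thesis by (simp add: parallel_sec_def W_section_def parallel_on_def sym_form_iff form_eval_simps)
qed

text \<open>A basis of the fibre at \<open>x\<close> extends to parallel sections that remain independent nearby, and
  by semicontinuity of the kernel of the iterated curvatures the fibres nearby have no larger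
  dimension. So the sections span each fibre near \<open>x\<close>.\<close>

lemma local_frame:
  "\<exists>N. open N \<and> x \<in> N \<and> (\<forall>y\<in>N. \<forall>w\<in>parallel_fibre y. \<exists>s. parallel_sec N s \<and> s y = w)"
proof -
  let ?c = "chart_at A x"
  have c: "?c \<in> A" "x \<in> cdom ?c" by (rule chart_at)+
  interpret connection_form "img ?c" "Lform ?c" by (rule connection_form_Lform[OF c(1)])
  let ?p = "cmap ?c x"
  have pi: "?p \<in> img ?c" using c by auto
  obtain B where B: "B \<subseteq> parallel_fibre x" "independent B" "parallel_fibre x \<subseteq> span B" "card B = dim (parallel_fibre x)"
    using basis_exists by blast
  have fB: "finite B" using B(2) independent_imp_finite by blast
  have "\<forall>b\<in>B. \<exists>q. x \<in> fst q \<and> parallel_sec (fst q) (snd q) \<and> snd q x = b"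
    using B(1) unfolding parallel_fibre_def by auto
  then obtain q where q: "\<And>b. b \<in> B \<Longrightarrow> x \<in> fst (q b) \<and> parallel_sec (fst (q b)) (snd (q b)) \<and> snd (q b) x = b"
    using bchoice[of B "\<lambda>b q. x \<in> fst q \<and> parallel_sec (fst q) (snd q) \<and> snd q x = b"] by blast
  define U where "U = (\<Inter>b\<in>B. fst (q b)) \<inter> cdom ?c"
  have "open (\<Inter>b\<in>B. fst (q b))" using fB q by (intro open_INT) (auto simp: parallel_sec_def)
  then have U: "open U" "x \<in> U" using q c open_cdom[OF c(1)] by (auto simp: U_def)
  define s where "s b = snd (q b)" for b
  have sU: "parallel_sec U (s b)" "s b x = b" if "b \<in> B" for b
    using parallel_sec_subset[OF _ U(1), of "fst (q b)" "s b"] q[OF that] that by (auto simp: s_def U_def)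
  obtain N1 where N1: "open N1" "x \<in> N1" "N1 \<subseteq> U" "\<And>y. y \<in> N1 \<Longrightarrow> inj_on (\<lambda>b. s b y) B \<and> independent ((\<lambda>b. s b y) ` B)"
    using independent_sections_open[OF fB B(2) U, of s] sU by (auto simp: parallel_sec_def W_section_def)
  have symV: "subspace {w::real^'n^'n. sym_form w}" by (auto simp: subspace_def sym_form_iff form_eval_simps)
  obtain d where d: "d > 0" "ball ?p d \<subseteq> img ?c"
    "\<And>z. z \<in> ball ?p d \<Longrightarrow> dim {w\<in>{w. sym_form w}. \<forall>i. (\<lambda>(k, v, e) z. icurv k v e z) i z w = 0}
       \<le> dim {w\<in>{w. sym_form w}. \<forall>i. (\<lambda>(k, v, e) z. icurv k v e z) i ?p w = 0}"
    using kernel_dim_upper_semicontinuous[OF open_D pi symV, of "\<lambda>(k, v, e) z. icurv k v e z"]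
      linear_icurv smooth_on_continuous[OF real_analytic_on_smooth[OF analytic_icurv]] by (auto simp: split_beta)
  have K: "{w\<in>{w. sym_form w}. \<forall>i. (\<lambda>(k, v, e) z. icurv k v e z) i (cmap ?c y) w = 0} = pullback (from_chart ?c y) ` parallel_fibre y"
    if y: "y \<in> cdom ?c" for y
  proof -
    have "{w\<in>{w. sym_form w}. \<forall>i. (\<lambda>(k, v, e) z. icurv k v e z) i (cmap ?c y) w = 0} = {w. sym_form w \<and> w \<in> flat_jets (cmap ?c y)}"
      by (auto simp: flat_jets_def)
    also have "\<dots> = pullback (from_chart ?c y) ` parallel_fibre y"
    proof (intro equalityI subsetI)
      fix w assume w: "w \<in> {w. sym_form w \<and> w \<in> flat_jets (cmap ?c y)}"
      have "pullback (to_chart ?c y) w \<in> parallel_fibre y"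
        unfolding parallel_fibre_jets[OF c(1) y] using w pullback_inverse(2)[OF c(1) y] sym_form_pullback[OF linear_to_chart[OF c(1) y]] by simp
      then show "w \<in> pullback (from_chart ?c y) ` parallel_fibre y" using pullback_inverse(2)[OF c(1) y] by (metis image_eqI)
    qed (use parallel_fibre_jets[OF c(1) y] sym_form_pullback[OF linear_from_chart[OF c(1) y]] in auto)
    finally show ?thesis .
  qed
  have dimP: "dim (pullback (from_chart ?c y) ` parallel_fibre y) = dim (parallel_fibre y)" if y: "y \<in> cdom ?c" for y
    by (rule dim_image_eq[OF linear_pullback[OF linear_from_chart[OF c(1) y]]])
      (metis inj_onI pullback_inverse(1)[OF c(1) y])
  define N where "N = N1 \<inter> cinv ?c ` ball ?p d"
  have "open N" unfolding N_def using N1 open_cinv_image[OF c(1) open_ball d(2)] by auto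
  moreover have "x \<in> N" unfolding N_def using N1 d(1) cinv_cmap[OF c] by (auto intro!: image_eqI[of _ _ ?p])
  moreover have "\<exists>t. parallel_sec N t \<and> t y = w" if y: "y \<in> N" and w: "w \<in> parallel_fibre y" for y w
  proof -
    have NU: "N \<subseteq> U" using N1 by (auto simp: N_def)
    have yc: "y \<in> cdom ?c" using y NU by (auto simp: U_def)
    have "cmap ?c y \<in> ball ?p d"
    proof -
      obtain z where z: "z \<in> ball ?p d" "y = cinv ?c z" using y by (auto simp: N_def)
      then obtain y' where "y' \<in> cdom ?c" "z = cmap ?c y'" using d(2) by blast
      then show ?thesis using z cinv_cmap[OF c(1)] by simp
    qed
    from d(3)[OF this] have "dim (parallel_fibre y) \<le> dim (parallel_fibre x)"
      unfolding K[OF yc] K[OF c(2)] dimP[OF yc] dimP[OF c(2)] .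
    moreover have ind: "inj_on (\<lambda>b. s b y) B" "independent ((\<lambda>b. s b y) ` B)" using N1(4)[of y] y by (auto simp: N_def)
    then have "card ((\<lambda>b. s b y) ` B) = dim (parallel_fibre x)" using card_image B(4) by metis
    moreover have sub: "(\<lambda>b. s b y) ` B \<subseteq> parallel_fibre y" using sU(1) parallel_sec_in_parallel_fibre y NU by blast
    ultimately have "parallel_fibre y \<subseteq> span ((\<lambda>b. s b y) ` B)"
      using card_ge_dim_independent[OF sub ind(2)] by simp
    then have "w \<in> span ((\<lambda>b. s b y) ` B)" using w by blast
    then obtain a where a: "w = (\<Sum>v\<in>(\<lambda>b. s b y) ` B. a v *\<^sub>R v)"
      using span_finite[of "(\<lambda>b. s b y) ` B"] fB by auto
    then have w': "w = (\<Sum>b\<in>B. a (s b y) *\<^sub>R s b y)" by (simp add: sum.reindex[OF ind(1)])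
    show ?thesis
    proof (cases "B = {}")
      case True
      then show ?thesis using w' zero_parallel_sec[OF \<open>open N\<close>] by auto
    next
      case False
      have "parallel_sec N (\<lambda>z. \<Sum>b\<in>B. a (s b y) *\<^sub>R s b z)"
        by (rule parallel_sec_sum[OF fB \<open>open N\<close> _ False]) (use parallel_sec_subset[OF sU(1) \<open>open N\<close> NU] in auto)
      then show ?thesis using w' by blast
    qed
  qed
  ultimately show ?thesis by blast
qed

end

section \<open>The derived flag\<close>

context analytic_conn
begin

abbreviation FV :: "nat \<Rightarrow> 'm \<Rightarrow> (real^'n^'n) set" where "FV \<equiv> flag_V A nabla"
abbreviation FW :: "nat \<Rightarrow> 'm \<Rightarrow> (real^'n^'n) set" where "FW \<equiv> flag_W A nabla"

lemma smooth_part_subset: "smooth_part A V x \<subseteq> V x"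
  by (auto simp: smooth_part_def)

lemma smooth_part_section:
  assumes "local_section_in A V U X" "y \<in> U" shows "X y \<in> smooth_part A V y"
  using assms unfolding smooth_part_def local_section_in_def by blast

lemma FV_Suc_subset: "FV (Suc i) x \<subseteq> FW i x"
  by (auto simp: second_fundamental_kernel_def flag_W_def)

lemma FW_subset_FV: "FW i x \<subseteq> FV i x"
  unfolding flag_W_def by (rule smooth_part_subset)

lemma FW_Suc_subset: "FW (Suc i) x \<subseteq> FW i x"
  using FW_subset_FV FV_Suc_subset by blast

lemma FW_mono: "i \<le> j \<Longrightarrow> FW j x \<subseteq> FW i x"
  by (induction rule: dec_induct) (use FW_Suc_subset in blast)+

lemma FW_in_FV0: "FW i x \<subseteq> FV 0 x"
  using FW_mono[of 0 i x] FW_subset_FV by blast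

lemma W_curvature_zero_iff:
  assumes c: "c \<in> A" "x \<in> cdom c" and w: "sym_form w"
  shows "(\<forall>u v. W_curvature A nabla x u v w = 0) \<longleftrightarrow>
    (\<forall>a b. connection_form.curv (Lform c) (cmap c x) a b (pullback (from_chart c x) w) = 0)"
proof -
  have z: "pullback (to_chart c x) B = 0 \<longleftrightarrow> B = 0" for B
    using pullback_inverse(2)[OF c] linear_0[OF linear_pullback[OF linear_from_chart[OF c]]]
      linear_0[OF linear_pullback[OF linear_to_chart[OF c]]] by metis
  have "(\<forall>u v. W_curvature A nabla x u v w = 0) \<longleftrightarrow>
    (\<forall>a b. W_curvature A nabla x (from_chart c x a) (from_chart c x b) w = 0)"
    using from_to[OF c] by metis
  then show ?thesis by (simp add: W_curvature_coord[OF c w] z)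
qed

lemma parallel_fibre_sym: "w \<in> parallel_fibre x \<Longrightarrow> sym_form w"
  using parallel_fibre_jets[OF chart_at(1) chart_at(2)] by blast

lemma parallel_fibre_subset_FV0: "parallel_fibre x \<subseteq> FV 0 x"
proof
  fix w assume w: "w \<in> parallel_fibre x"
  note c = chart_at[of x]
  interpret connection_form "img (chart_at A x)" "Lform (chart_at A x)" by (rule connection_form_Lform[OF c(1)])
  have j: "pullback (from_chart (chart_at A x) x) w \<in> flat_jets (cmap (chart_at A x) x)"
    using w parallel_fibre_jets[OF c] by blast
  have "curv (cmap (chart_at A x) x) a b (pullback (from_chart (chart_at A x) x) w) = 0" for a b
  proof -
    have "icurv 0 a b (cmap (chart_at A x) x) (pullback (from_chart (chart_at A x) x) w) = 0"
      using j unfolding flat_jets_def by blast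
    then show ?thesis by simp
  qed
  then show "w \<in> FV 0 x" using W_curvature_zero_iff[OF c parallel_fibre_sym[OF w]] parallel_fibre_sym[OF w] by simp
qed

lemma parallel_sec_local_section:
  assumes "parallel_sec U s" "\<And>y. parallel_fibre y \<subseteq> V y"
  shows "local_section_in A V U s"
  using assms parallel_sec_in_parallel_fibre unfolding local_section_in_def parallel_sec_def by blast

lemma parallel_fibre_subset_smooth_part:
  assumes "\<And>y. parallel_fibre y \<subseteq> V y" shows "parallel_fibre x \<subseteq> smooth_part A V x"
proof
  fix w assume "w \<in> parallel_fibre x"
  then obtain U s where "x \<in> U" "parallel_sec U s" "s x = w" by (auto simp: parallel_fibre_def)
  then show "w \<in> smooth_part A V x" using smooth_part_section[OF parallel_sec_local_section[OF _ assms]] by blast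
qed

lemma parallel_fibre_subset_FV: "parallel_fibre x \<subseteq> FV i x"
proof (induction i arbitrary: x)
  case 0 show ?case by (rule parallel_fibre_subset_FV0)
next
  case (Suc i)
  let ?V = "smooth_part A (FV i)"
  have sub: "parallel_fibre y \<subseteq> ?V y" for y by (rule parallel_fibre_subset_smooth_part[OF Suc])
  show ?case
  proof
    fix w assume w: "w \<in> parallel_fibre x"
    then obtain U s where s: "x \<in> U" "parallel_sec U s" "s x = w" by (auto simp: parallel_fibre_def)
    have "form_nabla A nabla s x v = 0" for v using s by (auto simp: parallel_sec_def parallel_on_def)
    then have "second_fundamental_form A nabla ?V x w (\<lambda>v. ?V x)"
      unfolding second_fundamental_form_def
      using s parallel_sec_local_section[OF s(2) sub] by (intro exI[of _ U] exI[of _ s]) auto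
    then show "w \<in> FV (Suc i) x" using sub w by (auto simp: second_fundamental_kernel_def)
  qed
qed

lemma parallel_fibre_subset_FW: "parallel_fibre x \<subseteq> FW i x"
  unfolding flag_W_def by (rule parallel_fibre_subset_smooth_part[OF parallel_fibre_subset_FV])

lemma FV0_sym: "w \<in> FV 0 x \<Longrightarrow> sym_form w"
  by simp

text \<open>By induction on the order, each iterated curvature kills \<open>FW i\<close> on \<open>Om\<close>. An element \<open>w\<close> of
  \<open>FW (Suc i)\<close> is the value of a section of \<open>FW i\<close> whose covariant derivatives at the point lie in \<open>FW i\<close>
  again; differentiating along this section, the next iterated curvature of \<open>w\<close> is a previous one of
  a covariant derivative, hence zero. The span appears in the hypothesis because second fundamental
  kernels are defined through a choice of sections and are not evidently linear subspaces.\<close>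

lemma flag_stationary_parallel:
  assumes Om: "open Om" "Om \<subseteq> cdom c" and c: "c \<in> A"
    and stat: "\<And>y. y \<in> Om \<Longrightarrow> FW i y \<subseteq> span (FW (Suc i) y)" and y: "y \<in> Om"
  shows "FW i y \<subseteq> parallel_fibre y"
proof -
  interpret connection_form "img c" "Lform c" by (rule connection_form_Lform[OF c])
  have kill: "icurv k v e (cmap c y) (pullback (from_chart c y) w) = 0" if "y \<in> Om" "w \<in> FW i y" for k v e y w
    using that
  proof (induction k arbitrary: y w)
    case 0
    have yc: "y \<in> cdom c" using 0 Om by auto
    have w: "w \<in> FV 0 y" using 0 FW_in_FV0 by blast
    then show ?case using W_curvature_zero_iff[OF c yc FV0_sym[OF w]] by simp
  next
    case (Suc k)
    have yc: "y \<in> cdom c" using Suc Om by auto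
    have pi: "cmap c y \<in> img c" using yc by auto
    note lf = linear_pullback[OF linear_from_chart[OF c yc]]
    let ?F = "\<lambda>w. icurv (Suc k) v e (cmap c y) (pullback (from_chart c y) w)"
    have "?F w = 0" if w: "w \<in> FW (Suc i) y" for w
    proof -
      have "w \<in> second_fundamental_kernel A nabla (FW i) y"
        using w FW_subset_FV[of "Suc i" y] by (auto simp: flag_W_def[abs_def])
      then obtain U X where wi: "w \<in> FW i y" and X: "y \<in> U" "local_section_in A (FW i) U X" "X y = w"
        and b: "(\<lambda>v. FW i y) = (\<lambda>v. {form_nabla A nabla X y v + u | u. u \<in> FW i y})"
        unfolding second_fundamental_kernel_def second_fundamental_form_def by blast
\<comment> \<open>Equality of the cosets is exploited with the representative \<open>u = w\<close>, as \<open>0 \<in> FW i y\<close> has not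
  been established; the summand \<open>w\<close> is subtracted again after applying the induction hypothesis.\<close>
      have in1: "form_nabla A nabla X y v' + w \<in> FW i y" for v' using fun_cong[OF b, of v'] wi by blast
      have oU: "open U" and sX: "smooth_form A U X" using X(2) by (auto simp: local_section_in_def W_section_def)
      define V where "V = U \<inter> Om"
      have V: "open V" "y \<in> V" "V \<subseteq> cdom c" "V \<subseteq> U" "V \<subseteq> Om" using oU Om X Suc by (auto simp: V_def)
      have dV: "cdom c \<inter> V = V" using V by auto
      let ?H = "form_rep A c X"
      have dH: "?H differentiable (at (cmap c y))"
        by (rule smooth_on_differentiable[OF smooth_formD[OF smooth_subset(2)[OF V(4) sX] c]]) (use V in auto)
      have o: "open (cmap c ` V)" by (rule open_cmap_image[OF c V(1,3)])
      have z: "icurv k v e q (?H q) = 0" if q: "q \<in> cmap c ` V" for q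
      proof -
        obtain y' where y': "y' \<in> V" "q = cmap c y'" using q by auto
        have "X y' \<in> FW i y'" using X(2) y' V by (auto simp: local_section_in_def)
        moreover have "y' \<in> cdom c" using y' V by auto
        ultimately show ?thesis using Suc.IH[of y' "X y'"] y' V by (auto simp: form_rep_cmap c)
      qed
      have "icurv (Suc k) v e (cmap c y) (?H (cmap c y))
         = - icurv k v e (cmap c y) (frechet_derivative ?H (at (cmap c y)) v - Lform c (cmap c y) v (?H (cmap c y)))"
        by (rule icurv_Suc_section[OF o _ _ dH z]) (use V in auto)
      also have "frechet_derivative ?H (at (cmap c y)) v - Lform c (cmap c y) v (?H (cmap c y))
         = pullback (from_chart c y) (form_nabla A nabla X y (from_chart c y v))"
        unfolding form_nabla_coord[OF oU sX X(1) yc c] by (simp add: pullback_inverse[OF c yc] to_from[OF c yc])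
      also have "icurv k v e (cmap c y) \<dots> = 0"
      proof -
        have "icurv k v e (cmap c y) (pullback (from_chart c y) (form_nabla A nabla X y (from_chart c y v) + w)) = 0"
          by (rule Suc.IH[OF Suc.prems(1) in1])
        moreover have "icurv k v e (cmap c y) (pullback (from_chart c y) w) = 0"
          by (rule Suc.IH[OF Suc.prems(1) wi])
        ultimately show ?thesis by (simp add: linear_add[OF lf] linear_add[OF linear_icurv[OF pi]])
      qed
      finally show ?thesis using X(3) by (simp add: form_rep_cmap c yc)
    qed
    moreover have lF: "linear ?F"
      using linear_compose[OF lf linear_icurv[OF pi, of "Suc k" v e]] by (simp add: comp_def)
    ultimately have "?F u = 0" if "u \<in> span (FW (Suc i) y)" for u
      using linear_eq_0_on_span[OF lF _ that] by blast
    then show ?case using stat[OF Suc.prems(1)] Suc.prems(2) by blast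
  qed
  have yc: "y \<in> cdom c" using y Om by auto
  show ?thesis
  proof
    fix w assume w: "w \<in> FW i y"
    have "sym_form w" using w FW_in_FV0 FV0_sym by blast
    then show "w \<in> parallel_fibre y" unfolding parallel_fibre_jets[OF c yc] flat_jets_def using kill[OF y w] by blast
  qed
qed

text \<open>A basis of \<open>FW i y\<close> consists of values of smooth sections, which stay in \<open>FW i\<close> and stay
  independent nearby.\<close>

lemma FW_dim_lower_semicontinuous:
  "\<exists>N. open N \<and> y \<in> N \<and> (\<forall>z\<in>N. dim (FW i y) \<le> dim (FW i z))"
proof -
  obtain B where B: "B \<subseteq> FW i y" "independent B" "FW i y \<subseteq> span B" "card B = dim (FW i y)"
    using basis_exists by blast
  have fB: "finite B" using B(2) independent_imp_finite by blast
  have "\<forall>b\<in>B. \<exists>q. y \<in> fst q \<and> local_section_in A (FV i) (fst q) (snd q) \<and> snd q y = b"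
  proof
    fix b assume "b \<in> B"
    then have "b \<in> smooth_part A (FV i) y" using B(1) by (auto simp: flag_W_def)
    then obtain U X where "y \<in> U" "local_section_in A (FV i) U X" "X y = b" unfolding smooth_part_def by blast
    then show "\<exists>q. y \<in> fst q \<and> local_section_in A (FV i) (fst q) (snd q) \<and> snd q y = b"
      by (intro exI[of _ "(U, X)"]) simp
  qed
  then obtain q where q: "\<And>b. b \<in> B \<Longrightarrow> y \<in> fst (q b) \<and> local_section_in A (FV i) (fst (q b)) (snd (q b)) \<and> snd (q b) y = b"
    using bchoice[of B "\<lambda>b q. y \<in> fst q \<and> local_section_in A (FV i) (fst q) (snd q) \<and> snd q y = b"] by blast
  define U where "U = (\<Inter>b\<in>B. fst (q b))"
  have U: "open U" "y \<in> U" using fB q by (auto simp: U_def local_section_in_def)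
  define X where "X b = snd (q b)" for b
  have "smooth_form A U (X b)" if "b \<in> B" for b
    using smooth_subset(2)[of U "fst (q b)" "X b"] q[OF that] that by (auto simp: X_def U_def local_section_in_def W_section_def)
  moreover have "X b y = b" if "b \<in> B" for b using q[OF that] by (simp add: X_def)
  ultimately obtain N where N: "open N" "y \<in> N" "N \<subseteq> U"
    "\<And>z. z \<in> N \<Longrightarrow> inj_on (\<lambda>b. X b z) B \<and> independent ((\<lambda>b. X b z) ` B)"
    using independent_sections_open[OF fB B(2) U, of X] by blast
  have "dim (FW i y) \<le> dim (FW i z)" if z: "z \<in> N" for z
  proof -
    have "(\<lambda>b. X b z) ` B \<subseteq> FW i z"
    proof (rule image_subsetI)
      fix b assume b: "b \<in> B"
      have "z \<in> fst (q b)" using z N(3) b by (auto simp: U_def)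
      then show "X b z \<in> FW i z"
        unfolding flag_W_def X_def using q[OF b] smooth_part_section by blast
    qed
    then have "card ((\<lambda>b. X b z) ` B) \<le> dim (FW i z)"
      using N(4)[OF z] by (intro independent_card_le_dim) auto
    then show ?thesis using N(4)[OF z] card_image B(4) by metis
  qed
  with N show ?thesis by blast
qed

text \<open>The dimension of the space of all matrices, so that the dimensions of the terms of the flag
  cannot drop at each of the first \<open>top_level + 1\<close> steps.\<close>

definition top_level :: nat where "top_level = DIM(real^'n^'n)"

text \<open>At a point of \<open>Om\<close> where the sum of the dimensions of the first terms of the flag is
  maximal, lower semicontinuity forces each dimension to be locally constant. Of the
  \<open>top_level + 2\<close> terms considered, two consecutive ones have equal dimension.\<close>

lemma flag_generically_stationary:
  assumes Om: "open Om" "Om \<noteq> {}"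
  shows "\<exists>Om' i. open Om' \<and> Om' \<noteq> {} \<and> Om' \<subseteq> Om \<and> i \<le> top_level \<and> (\<forall>y\<in>Om'. FW i y \<subseteq> span (FW (Suc i) y))"
proof -
  define d where "d i y = dim (FW i y)" for i y
  define s where "s y = (\<Sum>i\<le>Suc top_level. d i y)" for y
  have dle: "d i y \<le> top_level" for i y unfolding d_def top_level_def by (rule dim_subset_UNIV)
  have "s y \<le> (Suc (Suc top_level)) * top_level" for y
    unfolding s_def using sum_bounded_above[of "{..Suc top_level}" "\<lambda>i. d i y" top_level] dle by simp
  then have "finite (s ` Om)" by (intro finite_subset[of "s ` Om" "{..(Suc (Suc top_level)) * top_level}"]) auto
  then have "Max (s ` Om) \<in> s ` Om" using Om by simp
  then obtain y where y: "y \<in> Om" "s y = Max (s ` Om)" by auto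
  have max: "s z \<le> s y" if "z \<in> Om" for z using that y \<open>finite (s ` Om)\<close> by simp
  have "\<forall>i. \<exists>N. open N \<and> y \<in> N \<and> (\<forall>z\<in>N. d i y \<le> d i z)" unfolding d_def using FW_dim_lower_semicontinuous by blast
  then obtain N where N: "\<And>i. open (N i)" "\<And>i. y \<in> N i" "\<And>i z. z \<in> N i \<Longrightarrow> d i y \<le> d i z" by metis
  define Om' where "Om' = Om \<inter> (\<Inter>i\<le>Suc top_level. N i)"
  have Om': "open Om'" "y \<in> Om'" "Om' \<subseteq> Om" using open_Int[OF Om(1) open_INT[of "{..Suc top_level}" N]] N(1,2) y(1) by (auto simp: Om'_def)
  have eq: "d i z = d i y" if z: "z \<in> Om'" and i: "i \<le> Suc top_level" for i z
  proof (rule ccontr)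
    assume ne: "d i z \<noteq> d i y"
    have "s y < s z"
      unfolding s_def
    proof (rule sum_strict_mono_ex1)
      show "\<forall>j\<in>{..Suc top_level}. d j y \<le> d j z" using N(3)[of z] z by (auto simp: Om'_def)
      have "d i y < d i z" using ne N(3)[of z i] z i by (force simp: Om'_def)
      then show "\<exists>j\<in>{..Suc top_level}. d j y < d j z" using i by blast
    qed auto
    then show False using max[of z] z Om' by auto
  qed
  have "\<exists>i\<le>top_level. d i y = d (Suc i) y"
  proof (rule ccontr)
    assume "\<not> ?thesis"
    then have lt: "d (Suc i) y < d i y" if "i \<le> top_level" for i
      using that dim_subset[OF FW_Suc_subset, of i y] unfolding d_def by (metis le_neq_implies_less)
    have "i \<le> Suc top_level \<Longrightarrow> d i y + i \<le> d 0 y" for i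
    proof (induction i)
      case (Suc i) then show ?case using lt[of i] by simp
    qed simp
    from this[of "Suc top_level"] show False using dle[of 0 y] by simp
  qed
  then obtain i where i: "i \<le> top_level" "d i y = d (Suc i) y" by blast
  have "FW i z \<subseteq> span (FW (Suc i) z)" if z: "z \<in> Om'" for z
  proof -
    have "dim (FW i z) \<le> dim (FW (Suc i) z)" using eq[OF z, of i] eq[OF z, of "Suc i"] i by (simp add: d_def)
    then have "span (FW (Suc i) z) = span (FW i z)" by (intro dim_eq_span FW_Suc_subset)
    then show ?thesis using span_superset by blast
  qed
  then show ?thesis using Om' i by blast
qed

text \<open>If \<open>X\<close> is a section of the last term whose value at \<open>x\<close> is not parallel, then some iterated
  curvature of \<open>X\<close> is nonzero on a whole open set. But every nonempty open set contains points where
  the flag is stationary at that level or an earlier one, and there all iterated curvatures of \<open>X\<close> vanish.\<close>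

lemma FW_top_level: "FW top_level x = parallel_fibre x"
proof
  show "FW top_level x \<subseteq> parallel_fibre x"
  proof
    fix w assume w: "w \<in> FW top_level x"
    let ?c = "chart_at A x"
    have c: "?c \<in> A" "x \<in> cdom ?c" by (rule chart_at)+
    interpret connection_form "img ?c" "Lform ?c" by (rule connection_form_Lform[OF c(1)])
    have sw: "sym_form w" using w FW_in_FV0 FV0_sym by blast
    obtain U X where X: "x \<in> U" "local_section_in A (FV top_level) U X" "X x = w"
      using w unfolding flag_W_def smooth_part_def by blast
    have oU: "open U" and sX: "smooth_form A U X" using X(2) by (auto simp: local_section_in_def W_section_def)
    show "w \<in> parallel_fibre x"
    proof (rule ccontr)
      assume "w \<notin> parallel_fibre x"
      then obtain k v e where ne: "icurv k v e (cmap ?c x) (form_rep A ?c X (cmap ?c x)) \<noteq> 0"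
        unfolding parallel_fibre_jets[OF c] flat_jets_def using sw X(3) by (auto simp: form_rep_cmap c)
      define S where "S = cmap ?c ` (cdom ?c \<inter> U)"
      have oS: "open S" and Si: "S \<subseteq> img ?c" and pS: "cmap ?c x \<in> S"
        using open_image[OF c(1) oU] c X(1) by (auto simp: S_def)
      have sm: "smooth_on (\<lambda>q. icurv k v e q (form_rep A ?c X q)) S"
        by (rule smooth_linear_family[OF oS linear_icurv real_analytic_on_smooth[OF real_analytic_on_subset[OF analytic_icurv Si]]])
          (use Si smooth_formD[OF sX c(1)] in \<open>auto simp: S_def\<close>)
      define T where "T = {q \<in> S. icurv k v e q (form_rep A ?c X q) \<noteq> 0}"
      have oT: "open T"
      proof -
        have "T = S \<inter> (\<lambda>q. icurv k v e q (form_rep A ?c X q)) -` (- {0})" by (auto simp: T_def)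
        moreover have "open (S \<inter> (\<lambda>q. icurv k v e q (form_rep A ?c X q)) -` (- {0}))"
          by (rule continuous_open_preimage[OF smooth_on_continuous[OF sm] oS]) auto
        ultimately show ?thesis by simp
      qed
      define Om where "Om = cinv ?c ` T"
      have oO: "open Om" unfolding Om_def by (rule open_cinv_image[OF c(1) oT]) (use Si in \<open>auto simp: T_def\<close>)
      have OU: "Om \<subseteq> cdom ?c \<inter> U" using cinv_cmap[OF c(1)] by (auto simp: Om_def T_def S_def)
      have nz: "icurv k v e (cmap ?c y) (form_rep A ?c X (cmap ?c y)) \<noteq> 0" if "y \<in> Om" for y
        using that cinv_cmap[OF c(1)] by (auto simp: Om_def T_def S_def)
      have "Om \<noteq> {}" using ne pS by (auto simp: Om_def T_def)
      then obtain Om' i where Om': "open Om'" "Om' \<noteq> {}" "Om' \<subseteq> Om" "i \<le> top_level" "\<And>y. y \<in> Om' \<Longrightarrow> FW i y \<subseteq> span (FW (Suc i) y)"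
        using flag_generically_stationary[OF oO] by blast
      then obtain y where y: "y \<in> Om'" by blast
      have yc: "y \<in> cdom ?c" "y \<in> U" using y Om' OU by auto
      have "X y \<in> FW top_level y" unfolding flag_W_def by (rule smooth_part_section[OF X(2) yc(2)])
      then have "X y \<in> FW i y" using FW_mono[OF Om'(4)] by blast
      then have "X y \<in> parallel_fibre y"
        using flag_stationary_parallel[OF Om'(1) _ c(1) Om'(5) y] Om' OU by blast
      then have "icurv k v e (cmap ?c y) (form_rep A ?c X (cmap ?c y)) = 0"
        unfolding parallel_fibre_jets[OF c(1) yc(1)] flat_jets_def by (simp add: form_rep_cmap c yc)
      then show False using nz y Om' by blast
    qed
  qed
qed (rule parallel_fibre_subset_FW)

lemma W_tilde_parallel_fibre: "W_tilde A nabla = parallel_fibre"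
proof -
  have st: "FW l = parallel_fibre" if "top_level \<le> l" for l
  proof
    fix x show "FW l x = parallel_fibre x" using FW_mono[OF that, of x] FW_top_level parallel_fibre_subset_FW[of x l] by blast
  qed
  let ?P = "\<lambda>k. \<forall>l\<ge>k. FW l = FW k"
  define k where "k = (LEAST k. ?P k)"
  have "?P top_level" using st by simp
  then have k: "?P k" unfolding k_def by (rule LeastI)
  have "FW k = FW (max top_level k)" using k[rule_format, of "max top_level k"] by simp
  also have "\<dots> = parallel_fibre" by (rule st) simp
  finally show ?thesis unfolding W_tilde_def k_def .
qed

end

section \<open>Monodromy\<close>

text \<open>\<open>sec U s\<close> says that \<open>s\<close> is a section over \<open>U\<close>. The axioms are those of a locally constant sheaf, seen
  through the values of its sections: agreement and disagreement are open conditions, and near each point there is a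
  set over which all values extend, no matter at which point of this set they are taken.\<close>

locale local_system =
  fixes sec :: "'m::topological_space set \<Rightarrow> ('m \<Rightarrow> 'e) \<Rightarrow> bool"
  assumes sec_open: "sec U s \<Longrightarrow> open U"
    and sec_unique: "sec U s \<Longrightarrow> sec V t \<Longrightarrow> x \<in> U \<Longrightarrow> x \<in> V \<Longrightarrow> s x = t x \<Longrightarrow>
        \<exists>N. open N \<and> x \<in> N \<and> (\<forall>y\<in>N. y \<in> U \<and> y \<in> V \<and> s y = t y)"
    and sec_separated: "sec U s \<Longrightarrow> sec V t \<Longrightarrow> x \<in> U \<Longrightarrow> x \<in> V \<Longrightarrow> s x \<noteq> t x \<Longrightarrow>
        \<exists>N. open N \<and> x \<in> N \<and> (\<forall>y\<in>N. y \<in> U \<and> y \<in> V \<and> s y \<noteq> t y)"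
    and sec_extend: "\<exists>N. open N \<and> x \<in> N \<and> (\<forall>y\<in>N. \<forall>U s. sec U s \<longrightarrow> y \<in> U \<longrightarrow> (\<exists>t. sec N t \<and> t y = s y))"
begin

text \<open>A lift of \<open>f\<close> to the sheaf, that is, a continuous choice of values \<open>\<phi> k\<close> over the points
  \<open>f k\<close>. Germs are represented by values, which determine them, so that no topology on the
  set of germs has to be introduced.\<close>

definition lift_at :: "'a::topological_space set \<Rightarrow> ('a \<Rightarrow> 'm) \<Rightarrow> ('a \<Rightarrow> 'e) \<Rightarrow> 'a \<Rightarrow> bool" where
  "lift_at K f \<phi> k \<longleftrightarrow> (\<exists>U s T. sec U s \<and> open T \<and> k \<in> T \<and> (\<forall>k'\<in>K \<inter> T. f k' \<in> U \<and> \<phi> k' = s (f k')))"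

definition lift :: "'a::topological_space set \<Rightarrow> ('a \<Rightarrow> 'm) \<Rightarrow> ('a \<Rightarrow> 'e) \<Rightarrow> bool" where
  "lift K f \<phi> \<longleftrightarrow> (\<forall>k\<in>K. lift_at K f \<phi> k)"

lemma lift_atE:
  assumes "lift_at K f \<phi> k"
  obtains U s T where "sec U s" "open T" "k \<in> T" "\<And>k'. k' \<in> K \<Longrightarrow> k' \<in> T \<Longrightarrow> f k' \<in> U \<and> \<phi> k' = s (f k')"
  using assms unfolding lift_at_def by blast

lemma lift_subset: "lift K f \<phi> \<Longrightarrow> J \<subseteq> K \<Longrightarrow> lift J f \<phi>"
  unfolding lift_def
proof
  fix k assume l: "\<forall>k\<in>K. lift_at K f \<phi> k" and J: "J \<subseteq> K" and k: "k \<in> J"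
  then have "lift_at K f \<phi> k" by blast
  then obtain U s T where T: "sec U s" "open T" "k \<in> T" "\<And>k'. k' \<in> K \<Longrightarrow> k' \<in> T \<Longrightarrow> f k' \<in> U \<and> \<phi> k' = s (f k')"
    by (rule lift_atE) blast
  then show "lift_at J f \<phi> k"
    unfolding lift_at_def using J by (intro exI[of _ U] exI[of _ s] exI[of _ T]) auto
qed

lemma lift_cong:
  assumes "lift K f \<phi>" "\<And>k. k \<in> K \<Longrightarrow> f k = g k" "\<And>k. k \<in> K \<Longrightarrow> \<phi> k = \<psi> k"
  shows "lift K g \<psi>"
  using assms unfolding lift_def lift_at_def by (metis IntD1)

lemma preimage_nbhd:
  fixes f :: "'a::topological_space \<Rightarrow> 'm"
  assumes "continuous_on K f" "open N"
  obtains T where "open T" "\<And>k. k \<in> K \<Longrightarrow> k \<in> T \<longleftrightarrow> f k \<in> N"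
proof -
  obtain T where "open T" "T \<inter> K = f -` N \<inter> K"
    using assms unfolding continuous_on_open_invariant by blast
  then show thesis by (intro that[of T]) blast+
qed

lemma lift_section:
  assumes "continuous_on K f" "sec U s" "\<And>k. k \<in> K \<Longrightarrow> f k \<in> U"
  shows "lift K f (\<lambda>k. s (f k))"
  unfolding lift_def lift_at_def using assms by (intro ballI exI[of _ U] exI[of _ s] exI[of _ UNIV]) auto

lemma lift_compose:
  fixes g :: "'b::topological_space \<Rightarrow> 'a::topological_space"
  assumes l: "lift K f \<phi>" and g: "continuous_on J g" "g ` J \<subseteq> K"
  shows "lift J (\<lambda>j. f (g j)) (\<lambda>j. \<phi> (g j))"
  unfolding lift_def
proof
  fix j assume j: "j \<in> J"
  then have "lift_at K f \<phi> (g j)" using l g by (auto simp: lift_def)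
  then obtain U s T where T: "sec U s" "open T" "g j \<in> T" "\<And>k'. k' \<in> K \<Longrightarrow> k' \<in> T \<Longrightarrow> f k' \<in> U \<and> \<phi> k' = s (f k')"
    by (rule lift_atE) blast
  obtain T' where T': "open T'" "T' \<inter> J = g -` T \<inter> J"
    using g(1) T(2) unfolding continuous_on_open_invariant by metis
  have "j \<in> T'" using T' T j by blast
  moreover have "f (g k) \<in> U \<and> \<phi> (g k) = s (f (g k))" if "k \<in> J \<inter> T'" for k
    using T(4)[of "g k"] T' g(2) that by blast
  ultimately show "lift_at J (\<lambda>j. f (g j)) (\<lambda>j. \<phi> (g j)) j"
    unfolding lift_at_def using T(1) T'(1) by (intro exI[of _ U] exI[of _ s] exI[of _ T']) blast
qed

text \<open>The set where two lifts agree is open and closed.\<close>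

lemma lift_unique:
  fixes f :: "'a::topological_space \<Rightarrow> 'm"
  assumes K: "connected K" and f: "continuous_on K f" and l: "lift K f \<phi>" "lift K f \<psi>"
    and k0: "k0 \<in> K" "\<phi> k0 = \<psi> k0" and k: "k \<in> K"
  shows "\<phi> k = \<psi> k"
proof -
  have loc: "\<exists>T. open T \<and> x \<in> T \<and> (\<forall>y\<in>K \<inter> T. (\<phi> y = \<psi> y) = (\<phi> x = \<psi> x))" if x: "x \<in> K" for x
  proof -
    obtain U s T where T: "sec U s" "open T" "x \<in> T" "\<And>k'. k' \<in> K \<Longrightarrow> k' \<in> T \<Longrightarrow> f k' \<in> U \<and> \<phi> k' = s (f k')"
      using lift_atE l(1) x unfolding lift_def by metis
    obtain V t T' where T': "sec V t" "open T'" "x \<in> T'" "\<And>k'. k' \<in> K \<Longrightarrow> k' \<in> T' \<Longrightarrow> f k' \<in> V \<and> \<psi> k' = t (f k')"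
      using lift_atE l(2) x unfolding lift_def by metis
    have xs: "f x \<in> U" "f x \<in> V" "\<phi> x = s (f x)" "\<psi> x = t (f x)" using T(3,4) T'(3,4) x by auto
    obtain N where N: "open N" "f x \<in> N" "\<And>y. y \<in> N \<Longrightarrow> (s y = t y) = (s (f x) = t (f x))"
    proof (cases "s (f x) = t (f x)")
      case True then show thesis using sec_unique[OF T(1) T'(1) xs(1,2)] that by metis
    next
      case False then show thesis using sec_separated[OF T(1) T'(1) xs(1,2)] that by metis
    qed
    obtain T'' where T'': "open T''" "\<And>k. k \<in> K \<Longrightarrow> k \<in> T'' \<longleftrightarrow> f k \<in> N"
      using preimage_nbhd[OF f N(1)] by metis
    show ?thesis
    proof (intro exI[of _ "T \<inter> T' \<inter> T''"] conjI ballI)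
      show "open (T \<inter> T' \<inter> T'')" using T T' T'' by auto
      show "x \<in> T \<inter> T' \<inter> T''" using T T' T'' x N by auto
      fix y assume "y \<in> K \<inter> (T \<inter> T' \<inter> T'')"
      then show "(\<phi> y = \<psi> y) = (\<phi> x = \<psi> x)" using T(4)[of y] T'(4)[of y] T''(2)[of y] N(3)[of "f y"] xs by auto
    qed
  qed
  show ?thesis
  proof (rule connected_induction_simple[OF K k0(1) k, of "\<lambda>a. \<phi> a = \<psi> a"])
    fix a assume a: "a \<in> K"
    obtain T where T: "open T" "a \<in> T" "\<And>y. y \<in> K \<inter> T \<Longrightarrow> (\<phi> y = \<psi> y) = (\<phi> a = \<psi> a)" using loc[OF a] by blast
    show "\<exists>T. openin (top_of_set K) T \<and> a \<in> T \<and> (\<forall>x\<in>T. \<forall>y\<in>T. \<phi> x = \<psi> x \<longrightarrow> \<phi> y = \<psi> y)"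
    proof (intro exI[of _ "K \<inter> T"] conjI ballI impI)
      show "openin (top_of_set K) (K \<inter> T)" using T(1) by (rule openin_open_Int)
      show "a \<in> K \<inter> T" using a T(2) by blast
      show "\<phi> y = \<psi> y" if "x \<in> K \<inter> T" "y \<in> K \<inter> T" "\<phi> x = \<psi> x" for x y
        using T(3)[OF that(1)] T(3)[OF that(2)] that(3) by blast
    qed
  qed (rule k0(2))
qed

text \<open>Short paths lift by a single section. Lifts over adjacent intervals are glued: at the common
  point \<open>b\<close> they are given by two sections that agree at \<open>p b\<close>, hence near it.\<close>

lemma lift_exists:
  assumes p: "continuous_on {0..1::real} p" and s: "sec U s" "p 0 \<in> U"
  shows "\<exists>\<phi>. lift {0..1} p \<phi> \<and> \<phi> 0 = s (p 0)"
proof -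
  define P where "P a b \<longleftrightarrow> (0 \<le> a \<longrightarrow> b \<le> 1 \<longrightarrow> (\<forall>U s. sec U s \<longrightarrow> p a \<in> U \<longrightarrow>
     (\<exists>\<phi>. lift {a..b} p \<phi> \<and> \<phi> a = s (p a))))" for a b
  have "P 0 1"
  proof (rule Bolzano)
    fix a b c assume ab: "P a b" and bc: "P b c" and le: "a \<le> b" "b \<le> c"
    show "P a c"
      unfolding P_def
    proof (intro impI allI)
      fix U s assume a0: "0 \<le> a" and c1: "c \<le> 1" and s: "sec U s" "p a \<in> U"
      obtain \<phi> where \<phi>: "lift {a..b} p \<phi>" "\<phi> a = s (p a)"
        using ab s a0 c1 le unfolding P_def by (metis order_trans)
      obtain V t T where T: "sec V t" "open T" "b \<in> T" "\<And>k. k \<in> {a..b} \<Longrightarrow> k \<in> T \<Longrightarrow> p k \<in> V \<and> \<phi> k = t (p k)"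
        using \<phi>(1) le lift_atE[of "{a..b}" p \<phi> b] unfolding lift_def by (metis atLeastAtMost_iff order_refl)
      have pb: "p b \<in> V" "\<phi> b = t (p b)" using T(3,4) le by auto
      obtain \<psi> where \<psi>: "lift {b..c} p \<psi>" "\<psi> b = t (p b)"
        using bc T(1) pb a0 c1 le unfolding P_def by (metis order_trans)
      obtain V' t' T' where T': "sec V' t'" "open T'" "b \<in> T'" "\<And>k. k \<in> {b..c} \<Longrightarrow> k \<in> T' \<Longrightarrow> p k \<in> V' \<and> \<psi> k = t' (p k)"
        using \<psi>(1) le lift_atE[of "{b..c}" p \<psi> b] unfolding lift_def by (metis atLeastAtMost_iff order_refl)
      have pb': "p b \<in> V'" "t (p b) = t' (p b)" using T'(3,4) le \<psi>(2) by auto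
      obtain N where N: "open N" "p b \<in> N" "\<And>y. y \<in> N \<Longrightarrow> y \<in> V \<and> y \<in> V' \<and> t y = t' y"
        using sec_unique[OF T(1) T'(1) pb(1) pb'] by blast
      obtain T'' where T'': "open T''" "\<And>k. k \<in> {0..1} \<Longrightarrow> k \<in> T'' \<longleftrightarrow> p k \<in> N"
        using preimage_nbhd[OF p N(1)] by metis
      define \<theta> where "\<theta> k = (if k \<le> b then \<phi> k else \<psi> k)" for k
      have "lift_at {a..c} p \<theta> k" if k: "k \<in> {a..c}" for k
      proof -
        consider "k < b" | "k = b" | "k > b" by linarith
        then show ?thesis
        proof cases
          case 1
          obtain U s S where S: "sec U s" "open S" "k \<in> S" "\<And>k'. k' \<in> {a..b} \<Longrightarrow> k' \<in> S \<Longrightarrow> p k' \<in> U \<and> \<phi> k' = s (p k')"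
            using \<phi>(1) 1 k lift_atE[of "{a..b}" p \<phi> k] unfolding lift_def by (metis atLeastAtMost_iff less_imp_le)
          show ?thesis
            unfolding lift_at_def
            by (intro exI[of _ U] exI[of _ s] exI[of _ "S \<inter> {..<b}"]) (use S 1 in \<open>auto simp: \<theta>_def\<close>)
        next
          case 2
          have bT: "b \<in> T''" using T''(2)[of b] N(2) a0 c1 le by auto
          have "p k' \<in> V \<and> \<theta> k' = t (p k')" if k': "k' \<in> {a..c}" "k' \<in> T \<inter> T' \<inter> T''" for k'
          proof (cases "k' \<le> b")
            case True then show ?thesis using T(4)[of k'] k' by (auto simp: \<theta>_def)
          next
            case False
            then have "p k' \<in> N" using T''(2)[of k'] k' a0 c1 by auto
            then show ?thesis using False N(3) T'(4)[of k'] k' by (auto simp: \<theta>_def)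
          qed
          then show ?thesis
            unfolding lift_at_def
            by (intro exI[of _ V] exI[of _ t] exI[of _ "T \<inter> T' \<inter> T''"]) (use T T' T'' bT 2 in auto)
        next
          case 3
          obtain U s S where S: "sec U s" "open S" "k \<in> S" "\<And>k'. k' \<in> {b..c} \<Longrightarrow> k' \<in> S \<Longrightarrow> p k' \<in> U \<and> \<psi> k' = s (p k')"
            using \<psi>(1) 3 k lift_atE[of "{b..c}" p \<psi> k] unfolding lift_def by (metis atLeastAtMost_iff less_imp_le)
          show ?thesis
            unfolding lift_at_def
            by (intro exI[of _ U] exI[of _ s] exI[of _ "S \<inter> {b<..}"]) (use S 3 in \<open>auto simp: \<theta>_def\<close>)
        qed
      qed
      then show "\<exists>\<phi>. lift {a..c} p \<phi> \<and> \<phi> a = s (p a)"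
        using \<phi>(2) le by (intro exI[of _ \<theta>]) (auto simp: lift_def \<theta>_def)
    qed
  next
    fix x :: real assume x: "0 \<le> x" "x \<le> 1"
    obtain N where N: "open N" "p x \<in> N" "\<And>y U s. y \<in> N \<Longrightarrow> sec U s \<Longrightarrow> y \<in> U \<Longrightarrow> \<exists>t. sec N t \<and> t y = s y"
      using sec_extend[of "p x"] by metis
    obtain T where T: "open T" "\<And>k. k \<in> {0..1} \<Longrightarrow> k \<in> T \<longleftrightarrow> p k \<in> N"
      using preimage_nbhd[OF p N(1)] by metis
    have "x \<in> T" using T(2)[of x] N(2) x by auto
    then obtain d where d: "d > 0" "ball x d \<subseteq> T" using T(1) openE by blast
    have "P a b" if ab: "a \<le> x" "x \<le> b" "b - a < d" for a b
      unfolding P_def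
    proof (intro impI allI)
      fix U s assume a0: "0 \<le> a" and b1: "b \<le> 1" and s: "sec U s" "p a \<in> U"
      have inN: "p k \<in> N" if "k \<in> {a..b}" for k
        using T(2)[of k] d(2) that ab a0 b1 by (auto simp: dist_real_def subset_iff)
      obtain t where t: "sec N t" "t (p a) = s (p a)" using N(3)[OF inN s] ab by auto
      have "continuous_on {a..b} p" using continuous_on_subset[OF p] a0 b1 by auto
      then have "lift {a..b} p (\<lambda>k. t (p k))" using lift_section[OF _ t(1)] inN by blast
      then show "\<exists>\<phi>. lift {a..b} p \<phi> \<and> \<phi> a = s (p a)" using t(2) by blast
    qed
    then show "\<exists>d>0. \<forall>a b. a \<le> x \<and> x \<le> b \<and> b - a < d \<longrightarrow> P a b" using d(1) by blast
  qed simp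
  then show ?thesis using s unfolding P_def by auto
qed

text \<open>Each row of the homotopy is lifted separately. If the lifts depend well on the parameter \<open>s\<close>
  at \<open>t = a\<close>, they do so a bit further: near \<open>(s0, x)\<close> the rows are continued by one and the same
  section, by uniqueness of lifts.\<close>

lemma lift_homotopy:
  fixes h :: "real \<times> real \<Rightarrow> 'm"
  assumes h: "continuous_on ({0..1} \<times> {0..1}) h"
    and base: "lift {0..1} (\<lambda>s. h (s, 0)) (\<lambda>s. \<phi> s 0)"
    and rows: "\<And>s. s \<in> {0..1} \<Longrightarrow> lift {0..1} (\<lambda>t. h (s, t)) (\<phi> s)"
  shows "lift {0..1} (\<lambda>s. h (s, 1)) (\<lambda>s. \<phi> s 1)"
proof -
  define Q where "Q s0 t = lift_at {0..1} (\<lambda>s. h (s, t)) (\<lambda>s. \<phi> s t) s0" for s0 t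
  have "Q s0 1" if s0: "s0 \<in> {0..1}" for s0
  proof -
    define P where "P a b \<longleftrightarrow> (0 \<le> a \<longrightarrow> b \<le> 1 \<longrightarrow> Q s0 a \<longrightarrow> Q s0 b)" for a b
    have "P 0 1"
    proof (rule Bolzano)
      show "P a c" if "P a b" "P b c" "a \<le> b" "b \<le> c" for a b c using that unfolding P_def by auto
      fix x :: real assume x: "0 \<le> x" "x \<le> 1"
      obtain N where N: "open N" "h (s0, x) \<in> N" "\<And>y U s. y \<in> N \<Longrightarrow> sec U s \<Longrightarrow> y \<in> U \<Longrightarrow> \<exists>t. sec N t \<and> t y = s y"
        using sec_extend[of "h (s0, x)"] by metis
      obtain T where T: "open T" "\<And>k. k \<in> {0..1} \<times> {0..1} \<Longrightarrow> k \<in> T \<longleftrightarrow> h k \<in> N"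
        using preimage_nbhd[OF h N(1)] by metis
      have "(s0, x) \<in> T" using T(2)[of "(s0, x)"] N(2) x s0 by auto
      then obtain A B where AB: "open A" "open B" "s0 \<in> A" "x \<in> B" "A \<times> B \<subseteq> T"
        using open_prod_elim[OF T(1)] by (metis mem_Sigma_iff)
      obtain d where d: "d > 0" "ball x d \<subseteq> B" using AB openE by blast
\<comment> \<open>On this rectangle all values extend to sections over the single set \<open>N\<close>.\<close>
      have "P a b" if ab: "a \<le> x" "x \<le> b" "b - a < d" for a b
        unfolding P_def
      proof (intro impI)
        assume a0: "0 \<le> a" and b1: "b \<le> 1" and Qa: "Q s0 a"
        have inN: "h (s, t) \<in> N" if "s \<in> {0..1}" "s \<in> A" "t \<in> {a..b}" for s t
        proof -
          have "t \<in> B" using that d(2) ab by (auto simp: dist_real_def subset_iff)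
          then have "(s, t) \<in> T" using AB that by auto
          then show ?thesis using T(2)[of "(s, t)"] that a0 b1 ab by auto
        qed
        obtain U \<sigma> S where S: "sec U \<sigma>" "open S" "s0 \<in> S"
          "\<And>s. s \<in> {0..1} \<Longrightarrow> s \<in> S \<Longrightarrow> h (s, a) \<in> U \<and> \<phi> s a = \<sigma> (h (s, a))"
          using lift_atE[OF Qa[unfolded Q_def]] by blast
        have ha: "h (s0, a) \<in> N" "h (s0, a) \<in> U" using inN[OF s0 AB(3), of a] S(3) S(4)[OF s0] ab by auto
        obtain t where t: "sec N t" "t (h (s0, a)) = \<sigma> (h (s0, a))" using N(3)[OF ha(1) S(1) ha(2)] by blast
        obtain N' where N': "open N'" "h (s0, a) \<in> N'" "\<And>y. y \<in> N' \<Longrightarrow> t y = \<sigma> y"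
          using sec_unique[OF t(1) S(1) ha t(2)] by blast
        have "continuous_on {0..1} (\<lambda>s. h (s, a))"
          by (rule continuous_on_compose2[OF h]) (use a0 b1 ab in \<open>auto intro!: continuous_intros\<close>)
        then obtain R where R: "open R" "\<And>s. s \<in> {0..1} \<Longrightarrow> s \<in> R \<longleftrightarrow> h (s, a) \<in> N'"
          using preimage_nbhd[OF _ N'(1)] by metis
        have s0R: "s0 \<in> R" using R(2)[OF s0] N'(2) by simp
        have "h (s, b) \<in> N \<and> \<phi> s b = t (h (s, b))" if s: "s \<in> {0..1}" "s \<in> A \<inter> S \<inter> R" for s
        proof -
          have cont: "continuous_on {a..b} (\<lambda>t. h (s, t))"
            by (rule continuous_on_compose2[OF h]) (use a0 b1 ab s in \<open>auto intro!: continuous_intros\<close>)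
          have l1: "lift {a..b} (\<lambda>t. h (s, t)) (\<phi> s)" by (rule lift_subset[OF rows[OF s(1)]]) (use a0 b1 in auto)
          have l2: "lift {a..b} (\<lambda>t. h (s, t)) (\<lambda>k. t (h (s, k)))"
            by (rule lift_section[OF cont t(1)]) (use inN s in auto)
          have "\<phi> s a = t (h (s, a))" using S(4)[of s] N'(3)[of "h (s, a)"] R(2)[of s] s by auto
          then have "\<phi> s b = t (h (s, b))"
            using lift_unique[OF _ cont l1 l2, of a b] ab by auto
          then show ?thesis using inN[of s b] s ab by auto
        qed
        then show "Q s0 b"
          unfolding Q_def lift_at_def
          by (intro exI[of _ N] exI[of _ t] exI[of _ "A \<inter> S \<inter> R"]) (use t AB S R s0R in auto)
      qed
      then show "\<exists>d>0. \<forall>a b. a \<le> x \<and> x \<le> b \<and> b - a < d \<longrightarrow> P a b" using d(1) by blast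
    qed simp
    moreover have "Q s0 0" using base s0 by (simp add: lift_def Q_def)
    ultimately show ?thesis by (simp add: P_def)
  qed
  then show ?thesis by (simp add: lift_def Q_def)
qed

text \<open>A contraction of the loop through loops. The lift of the loop at time 1 is a lift of a
  constant path, hence constant. The paths traced by the two endpoints coincide, and
  their lifts agree at time 1, so they agree at time 0 as well.\<close>

lemma lift_loop:
  assumes sc: "simply_connected (UNIV :: 'm set)"
    and p: "continuous_on {0..1::real} p" "p 0 = p 1" and l: "lift {0..1} p \<theta>"
  shows "\<theta> 0 = \<theta> 1"
proof -
  have "path p" using p by (simp add: path_def)
  moreover have "path (\<lambda>_::real. p 0)" by (simp add: path_def)
  ultimately have "homotopic_loops UNIV p (\<lambda>_. p 0)"
    using sc[unfolded simply_connected_def, rule_format, of p "\<lambda>_. p 0"] p(2) by (simp add: pathstart_def pathfinish_def)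
  then obtain h where h: "continuous_on ({0..1::real} \<times> {0..1}) h" "\<And>x. x \<in> {0..1} \<Longrightarrow> h (0, x) = p x"
     "\<And>x. x \<in> {0..1} \<Longrightarrow> h (1, x) = p 0" "\<And>t. t \<in> {0..1} \<Longrightarrow> h (t, 1) = h (t, 0)"
    unfolding homotopic_loops by (auto simp: pathstart_def pathfinish_def)
\<comment> \<open>The first argument of \<open>H\<close> runs along the loop, the second is the time of the contraction.\<close>
  define H where "H st = h (snd st, fst st)" for st :: "real \<times> real"
  have H: "continuous_on ({0..1} \<times> {0..1}) H"
    unfolding H_def by (rule continuous_on_compose2[OF h(1)]) (auto intro!: continuous_intros)
  have row: "continuous_on {0..1} (\<lambda>t. H (s, t))" if "s \<in> {0..1}" for s
    by (rule continuous_on_compose2[OF H]) (use that in \<open>auto intro!: continuous_intros\<close>)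
  have "\<exists>\<psi>. lift {0..1} (\<lambda>t. H (s, t)) \<psi> \<and> \<psi> 0 = \<theta> s" if s: "s \<in> {0..1}" for s
  proof -
    obtain U \<sigma> T where T: "sec U \<sigma>" "open T" "s \<in> T" "\<And>k. k \<in> {0..1} \<Longrightarrow> k \<in> T \<Longrightarrow> p k \<in> U \<and> \<theta> k = \<sigma> (p k)"
      using l s lift_atE[of "{0..1}" p \<theta> s] unfolding lift_def by metis
    have "H (s, 0) = p s" using h(2)[OF s] by (simp add: H_def)
    then show ?thesis using lift_exists[OF row[OF s] T(1)] T(4)[OF s T(3)] by auto
  qed
  then obtain \<phi> where \<phi>: "\<And>s. s \<in> {0..1} \<Longrightarrow> lift {0..1} (\<lambda>t. H (s, t)) (\<phi> s)" "\<And>s. s \<in> {0..1} \<Longrightarrow> \<phi> s 0 = \<theta> s" by metis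
  have "lift {0..1} (\<lambda>s. H (s, 0)) (\<lambda>s. \<phi> s 0)"
    by (rule lift_cong[OF l]) (use h(2) \<phi>(2) in \<open>auto simp: H_def\<close>)
  from lift_homotopy[OF H this \<phi>(1)] have l1: "lift {0..1} (\<lambda>s. H (s, 1)) (\<lambda>s. \<phi> s 1)" .
  have "\<phi> 0 1 = \<phi> 1 1"
  proof -
    obtain U \<sigma> T where T: "sec U \<sigma>" "open T" "(0::real) \<in> T" "\<And>k. k \<in> {0..1} \<Longrightarrow> k \<in> T \<Longrightarrow> H (k, 1) \<in> U \<and> \<phi> k 1 = \<sigma> (H (k, 1))"
      using l1 lift_atE[of "{0..1}" "\<lambda>s. H (s, 1)" "\<lambda>s. \<phi> s 1" 0] unfolding lift_def by (metis atLeastAtMost_iff order_refl zero_le_one)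
    have c: "H (k, 1) = p 0" if "k \<in> {0..1}" for k using h(3)[OF that] by (simp add: H_def)
    have cc: "continuous_on {0..1} (\<lambda>s. H (s, 1))"
      by (rule continuous_on_eq[of _ "\<lambda>_. p 0"]) (use c in auto)
    have l2: "lift {0..1} (\<lambda>s. H (s, 1)) (\<lambda>s. \<sigma> (H (s, 1)))"
      by (rule lift_section[OF _ T(1)]) (use T(3) T(4)[of 0] c cc in auto)
    have "\<phi> 1 1 = \<sigma> (H (1, 1))"
      by (rule lift_unique[OF _ cc l1 l2, of 0 1]) (use T(3) T(4)[of 0] in auto)
    moreover have "\<phi> 0 1 = \<sigma> (H (0, 1))" using T(3) T(4)[of 0] by simp
    ultimately show ?thesis using c by simp
  qed
  moreover have e: "H (0, t) = H (1, t)" if "t \<in> {0..1}" for t using h(4)[OF that] by (simp add: H_def)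
  have l0: "lift {0..1} (\<lambda>t. H (0, t)) (\<phi> 1)"
    by (rule lift_cong[OF \<phi>(1)[of 1]]) (use e in auto)
  ultimately have "\<phi> 0 0 = \<phi> 1 0"
    by (intro lift_unique[OF _ row[of 0] \<phi>(1)[of 0] l0, of 1 0]) auto
  then show ?thesis using \<phi>(2) by simp
qed

lemma lift_path_independent:
  assumes sc: "simply_connected (UNIV :: 'm set)"
    and p: "continuous_on {0..1::real} p" and q: "continuous_on {0..1::real} q"
    and ends: "p 0 = q 0" "p 1 = q 1"
    and l: "lift {0..1} p \<phi>" "lift {0..1} q \<psi>" and start: "\<phi> 0 = \<psi> 0"
  shows "\<phi> 1 = \<psi> 1"
proof -
  let ?r = "p +++ reversepath q"
  have "pathfinish p = pathstart (reversepath q)" using ends by (simp add: pathfinish_def pathstart_def reversepath_def)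
  then have "path ?r" using p q by (intro path_join_imp) (simp_all add: path_def[symmetric])
  then have r: "continuous_on {0..1} ?r" by (simp add: path_def)
  have rl: "?r 0 = ?r 1" using ends by (simp add: joinpaths_def reversepath_def)
  obtain U \<sigma> T where T: "sec U \<sigma>" "open T" "(0::real) \<in> T" "\<And>k. k \<in> {0..1} \<Longrightarrow> k \<in> T \<Longrightarrow> p k \<in> U \<and> \<phi> k = \<sigma> (p k)"
    using l(1) lift_atE[of "{0..1}" p \<phi> 0] unfolding lift_def by (metis atLeastAtMost_iff order_refl zero_le_one)
  have r0: "?r 0 = p 0" by (simp add: joinpaths_def)
  obtain \<theta> where \<theta>: "lift {0..1} ?r \<theta>" "\<theta> 0 = \<phi> 0"
    using lift_exists[OF r T(1)] T(3) T(4)[of 0] r0 by auto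
  have \<theta>1: "\<theta> 1 = \<phi> 0" using lift_loop[OF sc r rl \<theta>(1)] \<theta>(2) by simp
  have "lift {0..1} (\<lambda>t. ?r (t / 2)) (\<lambda>t. \<theta> (t / 2))"
    by (rule lift_compose[OF \<theta>(1)]) (auto intro!: continuous_intros)
  then have "lift {0..1} p (\<lambda>t. \<theta> (t / 2))"
    by (rule lift_cong) (auto simp: joinpaths_def)
  then have 1: "\<theta> (1 / 2) = \<phi> 1"
    using lift_unique[OF _ p _ l(1), of "\<lambda>t. \<theta> (t / 2)" 0 1] \<theta>(2) by auto
  have "lift {0..1} (\<lambda>t. ?r (1 - t / 2)) (\<lambda>t. \<theta> (1 - t / 2))"
    by (rule lift_compose[OF \<theta>(1)]) (auto intro!: continuous_intros)
  then have "lift {0..1} q (\<lambda>t. \<theta> (1 - t / 2))"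
    by (rule lift_cong) (use ends in \<open>auto simp: joinpaths_def reversepath_def\<close>)
  then have "\<theta> (1 / 2) = \<psi> 1"
    using lift_unique[OF _ q _ l(2), of "\<lambda>t. \<theta> (1 - t / 2)" 0 1] \<theta>1 start by auto
  with 1 show ?thesis by simp
qed

text \<open>The value at \<open>x\<close> is obtained by continuation along any path from \<open>x0\<close>. Near \<open>x\<close> the result is
  a section: paths to nearby points may be taken to pass through \<open>x\<close> and to stay
  in a path connected neighbourhood inside the domain of a section.\<close>

theorem global_section:
  assumes sc: "simply_connected (UNIV :: 'm set)"
    and lpc: "\<And>(x::'m) U. open U \<Longrightarrow> x \<in> U \<Longrightarrow> \<exists>V. open V \<and> x \<in> V \<and> V \<subseteq> U \<and> path_connected V"
    and s0: "sec U0 s0" "x0 \<in> U0"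
  shows "\<exists>G. G x0 = s0 x0 \<and> (\<forall>x. \<exists>V \<sigma> N. open V \<and> x \<in> V \<and> V \<subseteq> N \<and> sec N \<sigma> \<and> (\<forall>y\<in>V. G y = \<sigma> y))"
proof -
  have pc: "\<exists>p. continuous_on {0..1::real} p \<and> p 0 = x \<and> p 1 = y" for x y :: 'm
  proof -
\<comment> \<open>Simple connectedness is expressed by free homotopies of loops. Applied to constant loops it
  yields path connectedness.\<close>
    have "homotopic_loops UNIV (\<lambda>_::real. x) (\<lambda>_. y)"
      using sc[unfolded simply_connected_def, rule_format, of "\<lambda>_. x" "\<lambda>_. y"] by (simp add: path_def pathstart_def pathfinish_def)
    then obtain h where h: "continuous_on ({0..1::real} \<times> {0..1::real}) h" "\<And>t. t \<in> {0..1} \<Longrightarrow> h (0, t) = x" "\<And>t. t \<in> {0..1} \<Longrightarrow> h (1, t) = y"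
      unfolding homotopic_loops by auto
    have "continuous_on {0..1} (\<lambda>t. h (t, 0))"
      by (rule continuous_on_compose2[OF h(1)]) (auto intro!: continuous_intros)
    then show ?thesis using h(2)[of 0] h(3)[of 0] by (intro exI[of _ "\<lambda>t. h (t, 0)"]) auto
  qed
  define R where "R x w \<longleftrightarrow> (\<exists>p \<phi>. continuous_on {0..1::real} p \<and> p 0 = x0 \<and> p 1 = x \<and> lift {0..1} p \<phi> \<and> \<phi> 0 = s0 x0 \<and> \<phi> 1 = w)" for x w
  have ex: "\<exists>w. R x w" for x
  proof -
    obtain p where p: "continuous_on {0..1::real} p" "p 0 = x0" "p 1 = x" using pc by blast
    then obtain \<phi> where "lift {0..1} p \<phi>" "\<phi> 0 = s0 x0" using lift_exists[OF p(1) s0(1)] s0(2) by auto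
    then show ?thesis unfolding R_def using p by blast
  qed
  have un: "w = w'" if w: "R x w" and w': "R x w'" for x w w'
  proof -
    obtain p \<phi> where 1: "continuous_on {0..1::real} p" "p 0 = x0" "p 1 = x" "lift {0..1} p \<phi>" "\<phi> 0 = s0 x0" "\<phi> 1 = w"
      using w unfolding R_def by blast
    obtain q \<psi> where 2: "continuous_on {0..1::real} q" "q 0 = x0" "q 1 = x" "lift {0..1} q \<psi>" "\<psi> 0 = s0 x0" "\<psi> 1 = w'"
      using w' unfolding R_def by blast
    show ?thesis using lift_path_independent[OF sc 1(1) 2(1) _ _ 1(4) 2(4)] 1 2 by simp
  qed
  obtain G where G: "\<And>x. R x (G x)" using ex by metis
  have "R x0 (s0 x0)"
    unfolding R_def using lift_section[OF _ s0(1), of "{0..1::real}" "\<lambda>_. x0"] s0(2)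
    by (intro exI[of _ "\<lambda>_. x0"] exI[of _ "\<lambda>_. s0 x0"]) auto
  then have G0: "G x0 = s0 x0" using un G by blast
  have "\<exists>V \<sigma> N. open V \<and> x \<in> V \<and> V \<subseteq> N \<and> sec N \<sigma> \<and> (\<forall>y\<in>V. G y = \<sigma> y)" for x
  proof -
    obtain p \<phi> where 1: "continuous_on {0..1::real} p" "p 0 = x0" "p 1 = x" "lift {0..1} p \<phi>" "\<phi> 0 = s0 x0" "\<phi> 1 = G x"
      using G[of x] unfolding R_def by blast
    obtain U \<sigma> T where T: "sec U \<sigma>" "open T" "(1::real) \<in> T" "\<And>k. k \<in> {0..1} \<Longrightarrow> k \<in> T \<Longrightarrow> p k \<in> U \<and> \<phi> k = \<sigma> (p k)"
      using 1(4) lift_atE[of "{0..1}" p \<phi> 1] unfolding lift_def by (metis atLeastAtMost_iff order_refl zero_le_one)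
    have xU: "x \<in> U" "G x = \<sigma> x" using T(3) T(4)[of 1] 1 by auto
    obtain V where V: "open V" "x \<in> V" "V \<subseteq> U" "path_connected V" using lpc[OF sec_open[OF T(1)] xU(1)] by blast
    have "G y = \<sigma> y" if y: "y \<in> V" for y
    proof -
      obtain g where g: "path g" "path_image g \<subseteq> V" "pathstart g = x" "pathfinish g = y"
        using V(2,4) y unfolding path_connected_def by blast
      have gc: "continuous_on {0..1} g" using g by (simp add: path_def)
      let ?r = "p +++ g"
      have "path ?r" using 1 g by (simp add: path_def pathstart_def pathfinish_def path_join_imp[unfolded path_def pathstart_def pathfinish_def])
      then have r: "continuous_on {0..1} ?r" by (simp add: path_def)
      have r0: "?r 0 = x0" "?r 1 = y" using 1 g by (auto simp: joinpaths_def pathfinish_def)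
      obtain \<theta> where \<theta>: "lift {0..1} ?r \<theta>" "\<theta> 0 = s0 x0"
        using lift_exists[OF r s0(1)] s0(2) r0 by auto
      have "lift {0..1} (\<lambda>t. ?r (t / 2)) (\<lambda>t. \<theta> (t / 2))"
        by (rule lift_compose[OF \<theta>(1)]) (auto intro!: continuous_intros)
      then have "lift {0..1} p (\<lambda>t. \<theta> (t / 2))"
        by (rule lift_cong) (auto simp: joinpaths_def)
      then have h: "\<theta> (1 / 2) = \<sigma> x"
        using lift_unique[OF _ 1(1) _ 1(4), of "\<lambda>t. \<theta> (t / 2)" 0 1] \<theta>(2) 1(5,6) xU by auto
      have "lift {0..1} (\<lambda>t. ?r (1/2 + t / 2)) (\<lambda>t. \<theta> (1/2 + t / 2))"
        by (rule lift_compose[OF \<theta>(1)]) (auto intro!: continuous_intros)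
      then have l2: "lift {0..1} g (\<lambda>t. \<theta> (1/2 + t / 2))"
        by (rule lift_cong) (use 1 g in \<open>auto simp: joinpaths_def pathstart_def\<close>)
      have l3: "lift {0..1} g (\<lambda>t. \<sigma> (g t))"
      proof (rule lift_section[OF gc T(1)])
        show "g t \<in> U" if "t \<in> {0..1}" for t
          using g(2) V(3) that unfolding path_image_def by blast
      qed
      have "\<theta> 1 = \<sigma> (g 1)"
        using lift_unique[OF _ gc l2 l3, of 0 1] h g by (auto simp: pathstart_def)
      then have "R y (\<sigma> y)" unfolding R_def using r r0 \<theta> g by (auto simp: pathfinish_def)
      then show ?thesis using un G by blast
    qed
    then show ?thesis using V T(1) by blast
  qed
  with G0 show ?thesis by blast
qed

end

section \<open>Positive definite forms\<close>

definition pos_def :: "real^'n::finite^'n \<Rightarrow> bool" where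
  "pos_def B \<longleftrightarrow> (\<forall>v. v \<noteq> 0 \<longrightarrow> form_eval B v v > 0)"

text \<open>The minimum of the form on the unit sphere is a positive number.\<close>

lemma pos_def_open:
  fixes B :: "real^'n::finite^'n"
  assumes "pos_def B"
  shows "\<exists>e>0. \<forall>C. norm C < e \<longrightarrow> pos_def (B + C)"
proof -
  obtain K where K0: "K > 0 \<and> (\<forall>(C::real^'n^'n) v. norm (C *v v) \<le> norm C * norm v * K)"
    using bounded_bilinear.pos_bounded[OF bounded_bilinear_mult_vec] by (rule exE)
  have K: "K > 0" "\<And>(C::real^'n^'n) v. norm (C *v v) \<le> norm C * norm v * K" using K0 by blast+
  have "axis undefined 1 \<in> sphere (0::real^'n) 1" by simp
  then have ne: "sphere (0::real^'n) 1 \<noteq> {}" by blast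
  have "continuous_on (sphere 0 1) (\<lambda>v. form_eval B v v)"
    unfolding form_eval_def
    by (intro continuous_on_inner continuous_on_id linear_continuous_on matrix_vector_mul_bounded_linear)
  then have "\<exists>v0\<in>sphere 0 1. \<forall>v\<in>sphere 0 1. form_eval B v0 v0 \<le> form_eval B v v"
    by (rule continuous_attains_inf[OF compact_sphere ne, where f = "\<lambda>v. form_eval B v v"])
  then obtain v0 where v0: "v0 \<in> sphere 0 1" "\<And>v. v \<in> sphere 0 1 \<Longrightarrow> form_eval B v0 v0 \<le> form_eval B v v"
    by blast
  define m where "m = form_eval B v0 v0"
  have m: "m > 0" using assms v0(1) unfolding pos_def_def m_def by (metis mem_sphere_0 norm_zero zero_neq_one)
  have lower: "m * (norm v)\<^sup>2 \<le> form_eval B v v" if v: "v \<noteq> 0" for v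
  proof -
    let ?u = "(1 / norm v) *\<^sub>R v"
    have "m \<le> form_eval B ?u ?u" unfolding m_def by (rule v0(2)) (use v in simp)
    also have "\<dots> = form_eval B v v / (norm v)\<^sup>2" by (simp add: form_eval_simps power2_eq_square)
    finally show ?thesis using v by (simp add: pos_le_divide_eq)
  qed
  have "pos_def (B + C)" if C: "norm C < m / K" for C
    unfolding pos_def_def
  proof (intro allI impI)
    fix v :: "real^'n" assume v: "v \<noteq> 0"
    have "\<bar>form_eval C v v\<bar> \<le> norm v * norm (C *v v)" unfolding form_eval_def by (rule Cauchy_Schwarz_ineq2)
    also have "\<dots> \<le> norm v * (norm C * norm v * K)" by (intro mult_left_mono K) auto
    also have "\<dots> = (norm C * K) * (norm v)\<^sup>2" by (simp add: power2_eq_square)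
    also have "\<dots> < m * (norm v)\<^sup>2" using C K v by (intro mult_strict_right_mono) (auto simp: pos_less_divide_eq)
    finally show "form_eval (B + C) v v > 0" using lower[OF v] by (simp add: form_eval_simps)
  qed
  then show ?thesis using m K by (intro exI[of _ "m / K"]) auto
qed

lemma pos_def_pullback:
  fixes f g :: "real^'n::finite \<Rightarrow> real^'n"
  assumes f: "linear f" "\<And>v. g (f v) = v" and g: "linear g" and B: "pos_def B"
  shows "pos_def (pullback f B)"
  unfolding pos_def_def
proof (intro allI impI)
  fix v :: "real^'n" assume "v \<noteq> 0"
  then have "f v \<noteq> 0" using f(2) linear_0[OF g] by metis
  then show "form_eval (pullback f B) v v > 0" using B by (simp add: form_eval_pullback[OF f(1)] pos_def_def)
qed

section \<open>Global parallel sections\<close>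

context analytic_conn
begin

lemma parallel_sec_separated:
  assumes s: "parallel_sec U s" and t: "parallel_sec V t" and x: "x \<in> U" "x \<in> V" and ne: "s x \<noteq> t x"
  shows "\<exists>N. open N \<and> x \<in> N \<and> (\<forall>y\<in>N. y \<in> U \<and> y \<in> V \<and> s y \<noteq> t y)"
proof -
  let ?c = "chart_at A x"
  have c: "?c \<in> A" "x \<in> cdom ?c" by (rule chart_at)+
  define W where "W = U \<inter> V"
  have W: "open W" "x \<in> W" using s t x by (auto simp: W_def parallel_sec_def)
  have sm: "smooth_form A W s" "smooth_form A W t"
    using s t smooth_subset(2) unfolding parallel_sec_def W_section_def W_def by blast+
  define S where "S = cmap ?c ` (cdom ?c \<inter> W)"
  have oS: "open S" unfolding S_def by (rule open_image[OF c(1) W(1)])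
  let ?D = "\<lambda>q. form_rep A ?c s q - form_rep A ?c t q"
  have cont: "continuous_on S ?D"
    unfolding S_def by (intro continuous_on_diff smooth_on_continuous smooth_formD sm c)
  define T where "T = S \<inter> ?D -` (- {0})"
  have oT: "open T" unfolding T_def by (rule continuous_open_preimage[OF cont oS]) auto
  define N where "N = cinv ?c ` T"
  have "open N" unfolding N_def by (rule open_cinv_image[OF c(1) oT]) (auto simp: T_def S_def)
  moreover have "x \<in> N"
  proof -
    have "form_rep A ?c s (cmap ?c x) \<noteq> form_rep A ?c t (cmap ?c x)"
      using ne pullback_inverse(1)[OF c] by (metis form_rep_cmap[OF c])
    then have "cmap ?c x \<in> T" using c W by (auto simp: T_def S_def)
    then show ?thesis unfolding N_def using cinv_cmap[OF c] by (intro image_eqI[of _ _ "cmap ?c x"]) auto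
  qed
  moreover have "y \<in> U \<and> y \<in> V \<and> s y \<noteq> t y" if yN: "y \<in> N" for y
  proof -
    obtain q where q: "q \<in> T" "y = cinv ?c q" using yN unfolding N_def by blast
    then obtain z where z: "z \<in> cdom ?c" "z \<in> W" "q = cmap ?c z" by (auto simp: T_def S_def)
    then have "y = z" using q cinv_cmap[OF c(1)] by simp
    then show ?thesis using q z by (auto simp: T_def W_def form_rep_cmap c)
  qed
  ultimately show ?thesis by blast
qed

lemma local_system_parallel_sec: "local_system parallel_sec"
proof
  show "open U" if "parallel_sec U s" for U s using that by (simp add: parallel_sec_def)
  show "\<exists>N. open N \<and> x \<in> N \<and> (\<forall>y\<in>N. y \<in> U \<and> y \<in> V \<and> s y = t y)"
    if "parallel_sec U s" "parallel_sec V t" "x \<in> U" "x \<in> V" "s x = t x" for U s V t x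
    using parallel_sec_unique[OF that] by blast
  show "\<exists>N. open N \<and> x \<in> N \<and> (\<forall>y\<in>N. y \<in> U \<and> y \<in> V \<and> s y \<noteq> t y)"
    if "parallel_sec U s" "parallel_sec V t" "x \<in> U" "x \<in> V" "s x \<noteq> t x" for U s V t x
    by (rule parallel_sec_separated[OF that])
  show "\<exists>N. open N \<and> x \<in> N \<and> (\<forall>y\<in>N. \<forall>U s. parallel_sec U s \<longrightarrow> y \<in> U \<longrightarrow> (\<exists>t. parallel_sec N t \<and> t y = s y))" for x
    using local_frame[of x] parallel_sec_in_parallel_fibre by meson
qed

lemma locally_path_connected:
  assumes U: "open U" "(x :: 'm) \<in> U"
  shows "\<exists>V. open V \<and> x \<in> V \<and> V \<subseteq> U \<and> path_connected V"
proof -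
  let ?c = "chart_at A x"
  have c: "?c \<in> A" "x \<in> cdom ?c" by (rule chart_at)+
  have "cmap ?c x \<in> cmap ?c ` (cdom ?c \<inter> U)" using c U by auto
  then obtain r where r: "r > 0" "ball (cmap ?c x) r \<subseteq> cmap ?c ` (cdom ?c \<inter> U)"
    using open_image[OF c(1) U(1)] openE by blast
  have sub: "ball (cmap ?c x) r \<subseteq> img ?c" using r(2) by blast
  define V where "V = cinv ?c ` ball (cmap ?c x) r"
  have "open V" unfolding V_def by (rule open_cinv_image[OF c(1) open_ball sub])
  moreover have "x \<in> V" unfolding V_def using r(1) cinv_cmap[OF c] by (intro image_eqI[of _ _ "cmap ?c x"]) auto
  moreover have "V \<subseteq> U" unfolding V_def using r(2) cinv_cmap[OF c(1)] by force
  moreover have "path_connected V" unfolding V_def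
    by (intro path_connected_continuous_image continuous_on_subset[OF continuous_cinv[OF c(1)] sub] convex_imp_path_connected convex_ball)
  ultimately show ?thesis by blast
qed

lemma parallel_sec_glue:
  assumes "\<And>x. \<exists>V \<sigma>. x \<in> V \<and> parallel_sec V \<sigma> \<and> (\<forall>y\<in>V. G y = \<sigma> y)"
  shows "parallel_sec UNIV G"
proof -
  have rep: "form_rep A c G q = form_rep A c \<sigma> q"
    if "c \<in> A" "\<forall>y\<in>V. G y = \<sigma> y" "q \<in> cmap c ` (cdom c \<inter> V)" for c V \<sigma> q
    using that by (auto simp: form_rep_cmap)
  have sm: "smooth_form A UNIV G"
    unfolding smooth_form_def
  proof (intro ballI smooth_on_open_cover)
    fix c q assume c: "c \<in> A" and "q \<in> cmap c ` (cdom c \<inter> UNIV)"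
    then obtain x where x: "x \<in> cdom c" "q = cmap c x" by auto
    obtain V \<sigma> where V: "x \<in> V" "parallel_sec V \<sigma>" "\<forall>y\<in>V. G y = \<sigma> y" using assms[of x] by blast
    have o: "open (cmap c ` (cdom c \<inter> V))" using V(2) open_image[OF c] by (simp add: parallel_sec_def)
    have "smooth_on (form_rep A c G) (cmap c ` (cdom c \<inter> V))"
      by (rule smooth_on_cong[OF o, of "form_rep A c \<sigma>"])
        (use rep[OF c V(3)] V(2) smooth_formD[OF _ c] in \<open>auto simp: parallel_sec_def W_section_def\<close>)
    then show "\<exists>T. open T \<and> q \<in> T \<and> smooth_on (form_rep A c G) T" using o x V(1) by blast
  qed
  have "sym_form (G x) \<and> form_nabla A nabla G x v = 0" for x v
  proof -
    obtain V \<sigma> where V: "x \<in> V" "parallel_sec V \<sigma>" "\<forall>y\<in>V. G y = \<sigma> y" using assms[of x] by blast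
    have \<sigma>: "open V" "smooth_form A V \<sigma>" "sym_form (\<sigma> x)" "form_nabla A nabla \<sigma> x v = 0"
      using V by (auto simp: parallel_sec_def W_section_def parallel_on_def)
    let ?c = "chart_at A x"
    have c: "?c \<in> A" "x \<in> cdom ?c" by (rule chart_at)+
    have pS: "cmap ?c x \<in> cmap ?c ` (cdom ?c \<inter> V)" using c V by auto
    have d: "frechet_derivative (form_rep A ?c G) (at (cmap ?c x)) = frechet_derivative (form_rep A ?c \<sigma>) (at (cmap ?c x))"
      by (rule frechet_derivative_cong_open[OF open_image[OF c(1) \<sigma>(1)] pS rep[OF c(1) V(3)]])
    have "form_nabla A nabla G x v = form_nabla A nabla \<sigma> x v"
      unfolding form_nabla_coord[OF open_UNIV sm UNIV_I c(2,1)] form_nabla_coord[OF \<sigma>(1,2) V(1) c(2,1)] d rep[OF c(1) V(3) pS] ..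
    then show ?thesis using \<sigma> V by simp
  qed
  then show ?thesis using sm by (simp add: parallel_sec_def W_section_def parallel_on_def)
qed

lemma global_extension:
  assumes sc: "simply_connected (UNIV :: 'm set)" and w: "w \<in> parallel_fibre x0"
  shows "\<exists>G. parallel_sec UNIV G \<and> G x0 = w"
proof -
  obtain U s where s: "x0 \<in> U" "parallel_sec U s" "s x0 = w" using w by (auto simp: parallel_fibre_def)
  have lpc: "\<And>(x::'m) U. open U \<Longrightarrow> x \<in> U \<Longrightarrow> \<exists>V. open V \<and> x \<in> V \<and> V \<subseteq> U \<and> path_connected V"
    by (rule locally_path_connected)
  interpret local_system parallel_sec by (rule local_system_parallel_sec)
  have "\<exists>G. G x0 = s x0 \<and> (\<forall>x. \<exists>V \<sigma> N. open V \<and> x \<in> V \<and> V \<subseteq> N \<and> parallel_sec N \<sigma> \<and> (\<forall>y\<in>V. G y = \<sigma> y))"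
    by (rule global_section[OF sc lpc s(2,1)])
  then obtain G where G: "G x0 = s x0" "\<And>x. \<exists>V \<sigma> N. open V \<and> x \<in> V \<and> V \<subseteq> N \<and> parallel_sec N \<sigma> \<and> (\<forall>y\<in>V. G y = \<sigma> y)"
    by blast
  have "parallel_sec UNIV G"
  proof (rule parallel_sec_glue)
    fix x
    obtain V \<sigma> N where V: "open V" "x \<in> V" "V \<subseteq> N" "parallel_sec N \<sigma>" "\<forall>y\<in>V. G y = \<sigma> y" using G(2)[of x] by blast
    then show "\<exists>V \<sigma>. x \<in> V \<and> parallel_sec V \<sigma> \<and> (\<forall>y\<in>V. G y = \<sigma> y)"
      using parallel_sec_subset[OF V(4,1,3)] by blast
  qed
  then show ?thesis using G(1) s(3) by blast
qed

lemma global_section_unique: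
  assumes conn: "connected (UNIV :: 'm set)" and G: "parallel_sec UNIV G" and H: "parallel_sec UNIV H" and e: "G x0 = H x0"
  shows "G x = H x"
proof -
  interpret local_system parallel_sec by (rule local_system_parallel_sec)
  have "lift UNIV (\<lambda>x. x) G" "lift UNIV (\<lambda>x. x) H"
    using lift_section[OF continuous_on_id G] lift_section[OF continuous_on_id H] by auto
  from lift_unique[OF conn continuous_on_id this UNIV_I e UNIV_I] show ?thesis .
qed

text \<open>Extending a basis at \<open>x\<close> to global parallel sections and evaluating at \<open>y\<close> is a linear map, which
  is injective as a global parallel section that vanishes at \<open>y\<close> is zero.\<close>

lemma parallel_fibre_dim_le:
  assumes sc: "simply_connected (UNIV :: 'm set)" and conn: "connected (UNIV :: 'm set)"
  shows "dim (parallel_fibre x) \<le> dim (parallel_fibre y)"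
proof -
  obtain B where B: "B \<subseteq> parallel_fibre x" "independent B" "parallel_fibre x \<subseteq> span B" "card B = dim (parallel_fibre x)"
    using basis_exists by blast
  have fB: "finite B" using B(2) independent_imp_finite by blast
  have "\<forall>b\<in>B. \<exists>G. parallel_sec UNIV G \<and> G x = b" using global_extension[OF sc] B(1) by blast
  then obtain G where G: "\<And>b. b \<in> B \<Longrightarrow> parallel_sec UNIV (G b)" "\<And>b. b \<in> B \<Longrightarrow> G b x = b" by metis
  obtain L where L: "linear L" "\<And>b. b \<in> B \<Longrightarrow> L b = G b y"
    using linear_independent_extend[OF B(2), of "\<lambda>b. G b y"] by blast
  have rep: "\<exists>S. parallel_sec UNIV S \<and> S x = u \<and> S y = L u" if u: "u \<in> span B" for u
  proof (cases "B = {}")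
    case True
    then show ?thesis using u zero_parallel_sec[OF open_UNIV] linear_0[OF L(1)] by auto
  next
    case False
    obtain a where a: "u = (\<Sum>b\<in>B. a b *\<^sub>R b)" using u span_finite[OF fB] by auto
    have "parallel_sec UNIV (\<lambda>z. \<Sum>b\<in>B. a b *\<^sub>R G b z)" by (rule parallel_sec_sum[OF fB open_UNIV G(1) False])
    moreover have "(\<Sum>b\<in>B. a b *\<^sub>R G b x) = u" unfolding a by (rule sum.cong) (use G(2) in auto)
    moreover have "(\<Sum>b\<in>B. a b *\<^sub>R G b y) = L u"
      unfolding a linear_sum[OF L(1)] linear_scale[OF L(1)] by (rule sum.cong) (use L(2) in auto)
    ultimately show ?thesis by blast
  qed
  have "inj_on L (span B)"
  proof (rule inj_onI)
    fix u v assume uv: "u \<in> span B" "v \<in> span B" "L u = L v"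
    obtain S where S: "parallel_sec UNIV S" "S x = u - v" "S y = L (u - v)" using rep[OF span_diff[OF uv(1,2)]] by blast
    have "S y = 0" using S(3) uv(3) by (simp add: linear_diff[OF L(1)])
    then have "S x = 0" using global_section_unique[OF conn S(1) zero_parallel_sec[OF open_UNIV], of y x] by simp
    then show "u = v" using S(2) by simp
  qed
  then have "dim (L ` span B) = dim (span B)" by (intro dim_image_eq[OF L(1)]) (simp add: span_span)
  also have "dim (span B) = dim (parallel_fibre x)" using dim_eq_card_independent[OF B(2)] dim_span[of B] B(4) by simp
  finally have "dim (parallel_fibre x) = dim (L ` span B)" ..
  also have "\<dots> \<le> dim (parallel_fibre y)"
    by (rule dim_subset) (use rep parallel_sec_in_parallel_fibre[of UNIV _ y] in \<open>metis UNIV_I image_subsetI\<close>)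
  finally show ?thesis .
qed

text \<open>The rank is a definite description; it denotes the common dimension of the fibres of \<open>P\<close>.\<close>

lemma bundle_rank_W_tilde:
  assumes "simply_connected (UNIV :: 'm set)" "connected (UNIV :: 'm set)"
  shows "bundle_rank (W_tilde A nabla) = dim (parallel_fibre x0)"
  unfolding bundle_rank_def W_tilde_parallel_fibre
proof (rule the_equality)
  show "\<forall>x. dim (parallel_fibre x) = dim (parallel_fibre x0)" using parallel_fibre_dim_le[OF assms] by (meson order_antisym)
qed auto

section \<open>Parallel metrics\<close>

lemma pos_def_chart:
  assumes "c \<in> A" "x \<in> cdom c"
  shows "pos_def (form_rep A c G (cmap c x)) \<longleftrightarrow> pos_def (G x)"
proof
  note ch = chart_conv[OF assms]
  show "pos_def (G x) \<Longrightarrow> pos_def (form_rep A c G (cmap c x))"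
    unfolding form_rep_cmap[OF assms] by (rule pos_def_pullback[OF ch(2) ch(3) ch(1)])
  assume "pos_def (form_rep A c G (cmap c x))"
  from pos_def_pullback[OF ch(1) ch(4) ch(2) this] show "pos_def (G x)"
    by (simp add: form_rep_cmap assms pullback_inverse)
qed

text \<open>Let \<open>G y\<close> be positive definite for some \<open>y\<close> near \<open>x\<close>. A tangent vector \<open>u\<close> at \<open>x\<close> is
  transported along the ray to \<open>y\<close>. The value of \<open>G\<close> on the transported vector \<open>\<sigma>\<close> is constant, and
  \<open>\<sigma>\<close> is nonzero at \<open>y\<close>, because transport back along the ray would carry zero to zero.\<close>

lemma pos_def_closed:
  assumes G: "parallel_sec UNIV G"
  shows "\<exists>N. open N \<and> x \<in> N \<and> (\<forall>y\<in>N. pos_def (G y) \<longrightarrow> pos_def (G x))"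
proof -
  let ?c = "chart_at A x"
  have c: "?c \<in> A" "x \<in> cdom ?c" by (rule chart_at)+
  let ?p = "cmap ?c x" and ?H = "form_rep A ?c G"
  have pi: "?p \<in> img ?c" using c by auto
  interpret T: connection_form "img ?c" "\<lambda>p \<nu> u. - Gam ?c p \<nu> u" by (rule connection_form_tangent[OF c(1)])
  interpret connection_form "img ?c" "Lform ?c" by (rule connection_form_Lform[OF c(1)])
  obtain r where r: "r > 0" "ball ?p r \<subseteq> img ?c"
    and bd: "\<And>z \<nu> u. z \<in> ball ?p r \<Longrightarrow> norm \<nu> < r \<Longrightarrow> norm (- Gam ?c z \<nu> u) \<le> 1/2 * norm u"
    and tr: "\<And>u. \<exists>\<sigma> S. psum ?p r S \<sigma> \<and> smooth_on \<sigma> (ball ?p r) \<and> \<sigma> ?p = u \<and>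
      (\<forall>z\<in>ball ?p r. frechet_derivative \<sigma> (at z) (z - ?p) = - Gam ?c z (z - ?p) (\<sigma> z)) \<and>
      (\<forall>t \<zeta>. ?p + t *\<^sub>R \<zeta> \<in> ball ?p r \<longrightarrow> frechet_derivative \<sigma> (at (?p + t *\<^sub>R \<zeta>)) \<zeta> = - Gam ?c (?p + t *\<^sub>R \<zeta>) \<zeta> (\<sigma> (?p + t *\<^sub>R \<zeta>)))"
    using T.radial_transport[OF pi] by blast
  have fH: "flat_on (img ?c) ?H" using parallel_sec_flat[OF G c(1)] by simp
  define N where "N = cinv ?c ` ball ?p r"
  have "open N" unfolding N_def by (rule open_cinv_image[OF c(1) open_ball r(2)])
  moreover have "x \<in> N" unfolding N_def using r(1) cinv_cmap[OF c] by (intro image_eqI[of _ _ ?p]) auto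
  moreover have "pos_def (G x)" if y: "y \<in> N" and pd: "pos_def (G y)" for y
  proof -
    obtain z where z: "z \<in> ball ?p r" "y = cinv ?c z" using y by (auto simp: N_def)
    then obtain y' where y': "y' \<in> cdom ?c" "z = cmap ?c y'" using r(2) by blast
    then have yc: "y \<in> cdom ?c" "z = cmap ?c y" using z cinv_cmap[OF c(1)] by auto
    have pdz: "pos_def (?H z)" using pd pos_def_chart[OF c(1) yc(1)] yc(2) by simp
    define \<zeta> where "\<zeta> = z - ?p"
    have n\<zeta>: "norm \<zeta> < r" using z by (simp add: \<zeta>_def dist_norm norm_minus_commute)
    have inb: "?p + t *\<^sub>R \<zeta> \<in> ball ?p r" if "0 \<le> t" "t \<le> 1" for t
      using mult_right_mono[of t 1 "norm \<zeta>"] that n\<zeta> by (simp add: dist_norm)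
    have "pos_def (?H ?p)"
      unfolding pos_def_def
    proof (intro allI impI)
      fix u :: "real^'n" assume u: "u \<noteq> 0"
      obtain \<sigma> where sm: "smooth_on \<sigma> (ball ?p r)" and \<sigma>p: "\<sigma> ?p = u"
        and ray: "\<And>t. ?p + t *\<^sub>R \<zeta> \<in> ball ?p r \<Longrightarrow> frechet_derivative \<sigma> (at (?p + t *\<^sub>R \<zeta>)) \<zeta> = - Gam ?c (?p + t *\<^sub>R \<zeta>) \<zeta> (\<sigma> (?p + t *\<^sub>R \<zeta>))"
        using tr[of u] by blast
      have \<sigma>z: "\<sigma> z \<noteq> 0"
      proof
        assume z0: "\<sigma> z = 0"
\<comment> \<open>The ray is traversed backwards, from \<open>z\<close> to the centre.\<close>
        have "(\<lambda>t. \<sigma> (z + t *\<^sub>R (- \<zeta>))) 1 = 0"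
        proof (rule linear_ode_zero[where q = "1/2" and \<psi>' = "\<lambda>t. Gam ?c (z + t *\<^sub>R (- \<zeta>)) \<zeta> (\<sigma> (z + t *\<^sub>R (- \<zeta>)))"])
          fix t :: real assume t: "0 \<le> t" "t \<le> 1"
          have e: "z + t *\<^sub>R (- \<zeta>) = ?p + (1 - t) *\<^sub>R \<zeta>" by (simp add: \<zeta>_def algebra_simps)
          have i: "z + t *\<^sub>R (- \<zeta>) \<in> ball ?p r" unfolding e by (rule inb) (use t in auto)
          have ds: "\<sigma> differentiable (at (z + t *\<^sub>R (- \<zeta>)))" by (rule smooth_on_differentiable[OF sm i])
          have "frechet_derivative \<sigma> (at (z + t *\<^sub>R (- \<zeta>))) (- \<zeta>) = Gam ?c (z + t *\<^sub>R (- \<zeta>)) \<zeta> (\<sigma> (z + t *\<^sub>R (- \<zeta>)))"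
            using ray[OF i[unfolded e]] linear_neg[OF linear_frechet[OF ds]] unfolding e by simp
          then show "((\<lambda>t. \<sigma> (z + t *\<^sub>R (- \<zeta>))) has_vector_derivative Gam ?c (z + t *\<^sub>R (- \<zeta>)) \<zeta> (\<sigma> (z + t *\<^sub>R (- \<zeta>)))) (at t)"
            using has_vector_derivative_line[OF ds] by simp
          show "norm (Gam ?c (z + t *\<^sub>R (- \<zeta>)) \<zeta> (\<sigma> (z + t *\<^sub>R (- \<zeta>)))) \<le> 1/2 * norm (\<sigma> (z + t *\<^sub>R (- \<zeta>)))"
            using bd[OF i n\<zeta>] by simp
        qed (use z0 in auto)
        then show False using \<sigma>p u by (simp add: \<zeta>_def)
      qed
      define F where "F q = form_eval (?H q) (\<sigma> q) (\<sigma> q)" for q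
      have F0: "((\<lambda>t. F (?p + t *\<^sub>R \<zeta>)) has_real_derivative 0) (at t)" if t: "0 \<le> t" "t \<le> 1" for t
      proof -
        let ?q = "?p + t *\<^sub>R \<zeta>"
        have qb: "?q \<in> ball ?p r" and qi: "?q \<in> img ?c" using inb[OF t] r(2) by auto
        have dH: "?H differentiable (at ?q)" using fH qi smooth_on_differentiable unfolding flat_on_def by blast
        have ds: "\<sigma> differentiable (at ?q)" by (rule smooth_on_differentiable[OF sm qb])
        note d = has_derivative_form_eval[OF has_derivative_frechet[OF dH] has_derivative_frechet[OF ds] has_derivative_frechet[OF ds]]
        have "frechet_derivative F (at ?q) \<zeta> = form_eval (frechet_derivative ?H (at ?q) \<zeta>) (\<sigma> ?q) (\<sigma> ?q)
          + form_eval (?H ?q) (frechet_derivative \<sigma> (at ?q) \<zeta>) (\<sigma> ?q) + form_eval (?H ?q) (\<sigma> ?q) (frechet_derivative \<sigma> (at ?q) \<zeta>)"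
          unfolding F_def[abs_def] frechet_derivative_at[OF d, symmetric] ..
        also have "frechet_derivative ?H (at ?q) \<zeta> = Lform ?c ?q \<zeta> (?H ?q)" using fH qi unfolding flat_on_def by blast
        also have "frechet_derivative \<sigma> (at ?q) \<zeta> = - Gam ?c ?q \<zeta> (\<sigma> ?q)" by (rule ray[OF qb])
        finally have z: "frechet_derivative F (at ?q) \<zeta> = 0"
          by (simp add: form_eval_Lform[OF c(1) qi] form_eval_simps)
        have "F differentiable (at ?q)" using d unfolding F_def[abs_def] by (auto simp: differentiable_def)
        from DERIV_line[OF this] show ?thesis unfolding z .
      qed
      have "F ?p = F z"
        using MVT2[OF zero_less_one F0] by (auto simp: \<zeta>_def)
      then show "form_eval (?H ?p) u u > 0" using pdz \<sigma>z \<sigma>p unfolding F_def pos_def_def by simp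
    qed
    then show ?thesis using pos_def_chart[OF c] by simp
  qed
  ultimately show ?thesis by blast
qed

lemma pos_def_nearby:
  assumes G: "parallel_sec UNIV G" and pd: "pos_def (G x)"
  shows "\<exists>N. open N \<and> x \<in> N \<and> (\<forall>y\<in>N. pos_def (G y))"
proof -
  let ?c = "chart_at A x"
  have c: "?c \<in> A" "x \<in> cdom ?c" by (rule chart_at)+
  let ?p = "cmap ?c x" and ?H = "form_rep A ?c G"
  have sm: "smooth_form A UNIV G" using G by (simp add: parallel_sec_def W_section_def)
  have pdp: "pos_def (?H ?p)" using pd pos_def_chart[OF c] by simp
  obtain e where e: "e > 0" "\<And>C. norm C < e \<Longrightarrow> pos_def (?H ?p + C)" using pos_def_open[OF pdp] by blast
  have "isCont ?H ?p" by (rule isCont_form_rep[OF open_UNIV sm UNIV_I c(2,1)])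
  then obtain d where d: "d > 0" "\<And>q. dist q ?p < d \<Longrightarrow> dist (?H q) (?H ?p) < e"
    using e(1) unfolding continuous_at_eps_delta by (metis dist_commute)
  have pdq: "pos_def (?H q)" if "q \<in> ball ?p d" for q
    using e(2)[of "?H q - ?H ?p"] d(2)[of q] that by (simp add: dist_norm norm_minus_commute)
  define N where "N = cinv ?c ` (ball ?p d \<inter> img ?c)"
  have "open N" unfolding N_def by (rule open_cinv_image[OF c(1)]) (use open_img[OF c(1)] in auto)
  moreover have "x \<in> N" unfolding N_def using d(1) c cinv_cmap[OF c] by (intro image_eqI[of _ _ ?p]) auto
  moreover have "pos_def (G y)" if "y \<in> N" for y
  proof -
    have y: "y \<in> cdom ?c" "cmap ?c y \<in> ball ?p d" using that cinv_cmap[OF c(1)] unfolding N_def by auto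
    then show ?thesis using pdq pos_def_chart[OF c(1) y(1)] by blast
  qed
  ultimately show ?thesis by blast
qed

lemma pos_def_global:
  assumes conn: "connected (UNIV :: 'm set)" and G: "parallel_sec UNIV G" and pd: "pos_def (G x0)"
  shows "pos_def (G x)"
proof (rule connected_induction_simple[OF conn UNIV_I UNIV_I, of "\<lambda>x. pos_def (G x)", OF pd])
  fix a :: 'm
  show "\<exists>T. openin (top_of_set UNIV) T \<and> a \<in> T \<and> (\<forall>x\<in>T. \<forall>y\<in>T. pos_def (G x) \<longrightarrow> pos_def (G y))"
  proof (cases "pos_def (G a)")
    case True then show ?thesis using pos_def_nearby[OF G] by (auto simp: openin_open)
  next
    case False
    obtain N where "open N" "a \<in> N" "\<forall>y\<in>N. pos_def (G y) \<longrightarrow> pos_def (G a)" using pos_def_closed[OF G] by blast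
    then show ?thesis using False by (auto simp: openin_open)
  qed
qed

lemma parallel_sec_metric:
  assumes "connected (UNIV :: 'm set)" "parallel_sec UNIV G" "pos_def (G x0)"
  shows "metric_on A UNIV G \<and> parallel_on A nabla UNIV G"
  using pos_def_global[OF assms] assms(2) unfolding metric_on_def parallel_sec_def pos_def_def by blast

text \<open>The fibre of \<open>P\<close> at a base point \<open>x0\<close> contains a positive definite element \<open>w0\<close>, and it is spanned by
  its positive definite elements: any \<open>b\<close> is a multiple of a difference of \<open>w0 + k *\<^sub>R b\<close> and
  \<open>w0\<close>, which are both positive definite for small \<open>k\<close>. So it has a basis of
  positive definite elements.\<close>

lemma parallel_metrics_exist:
  assumes conn: "connected (UNIV :: 'm set)" and sc: "simply_connected (UNIV :: 'm set)"
    and lm: "locally_metric_connection A nabla"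
  shows "metric_connection A nabla \<and>
    (\<exists>g :: nat \<Rightarrow> 'm \<Rightarrow> real^'n^'n.
       (\<forall>i < bundle_rank (W_tilde A nabla). metric_on A UNIV (g i) \<and> parallel_on A nabla UNIV (g i)) \<and>
       independent_sections (bundle_rank (W_tilde A nabla)) g)"
proof -
  fix x0 :: 'm
  obtain U g0 where g0: "open U" "x0 \<in> U" "metric_on A U g0" "parallel_on A nabla U g0"
    using lm unfolding locally_metric_connection_def by blast
  then have ps: "parallel_sec U g0" and pd0: "pos_def (g0 x0)" by (auto simp: parallel_sec_def metric_on_def pos_def_def)
  define w0 where "w0 = g0 x0"
  have w0: "w0 \<in> parallel_fibre x0" "pos_def w0" using parallel_sec_in_parallel_fibre[OF ps g0(2)] pd0 by (auto simp: w0_def)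
  obtain G0 where "parallel_sec UNIV G0" "G0 x0 = w0" using global_extension[OF sc w0(1)] by blast
  then have mc: "metric_connection A nabla"
    unfolding metric_connection_def using parallel_sec_metric[OF conn] w0(2) by blast
  define C where "C = {w \<in> parallel_fibre x0. pos_def w}"
  obtain B where B: "B \<subseteq> C" "independent B" "C \<subseteq> span B" "card B = dim C" using basis_exists by blast
  have fB: "finite B" using B(2) independent_imp_finite by blast
  have "parallel_fibre x0 \<subseteq> span C"
  proof
    fix b assume b: "b \<in> parallel_fibre x0"
    obtain e where e: "e > 0" "\<And>D. norm D < e \<Longrightarrow> pos_def (w0 + D)" using pos_def_open[OF w0(2)] by blast
\<comment> \<open>Chosen such that \<open>norm (k *\<^sub>R b) < e\<close>, also for \<open>b = 0\<close>.\<close>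
    define k where "k = e / (2 * (norm b + 1))"
    have k: "k > 0" using e by (simp add: k_def add_nonneg_pos)
    have "norm (k *\<^sub>R b) < e"
    proof -
      have "norm (k *\<^sub>R b) = k * norm b" using k by simp
      also have "\<dots> < k * (norm b + 1)" using k by simp
      also have "\<dots> = e / 2"
      proof -
        have "m / (2 * M) * M = m / 2" if "M \<noteq> 0" for m M :: real using that by simp
        moreover have "norm b + 1 \<noteq> 0" by (smt (verit) norm_ge_zero)
        ultimately show ?thesis unfolding k_def by blast
      qed
      finally show ?thesis using e(1) by simp
    qed
    then have "w0 + k *\<^sub>R b \<in> C"
      using e(2) b w0(1) subspace_parallel_fibre[of x0] by (auto simp: C_def intro: subspace_add subspace_scale)
    moreover have "w0 \<in> C" using w0 by (simp add: C_def)
    ultimately have "(1 / k) *\<^sub>R ((w0 + k *\<^sub>R b) - w0) \<in> span C"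
      by (intro span_scale span_diff span_base)
    then show "b \<in> span C" using k by simp
  qed
  then have "dim (parallel_fibre x0) \<le> dim C" using dim_subset[of "parallel_fibre x0" "span C"] by simp
  moreover have "dim C \<le> dim (parallel_fibre x0)" by (rule dim_subset) (auto simp: C_def)
  ultimately have r: "bundle_rank (W_tilde A nabla) = card B"
    using bundle_rank_W_tilde[OF sc conn, of x0] B(4) by simp
  obtain h where h: "bij_betw h {0..<card B} B" using ex_bij_betw_nat_finite[OF fB] by blast
  have "\<forall>b\<in>B. \<exists>G. parallel_sec UNIV G \<and> G x0 = b" using global_extension[OF sc] B(1) by (auto simp: C_def)
  then obtain G where G: "\<And>b. b \<in> B \<Longrightarrow> parallel_sec UNIV (G b)" "\<And>b. b \<in> B \<Longrightarrow> G b x0 = b" by metis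
  define g where "g i = G (h i)" for i
  have hB: "h i \<in> B" if "i < card B" for i using h that by (auto simp: bij_betw_def)
  have "metric_on A UNIV (g i) \<and> parallel_on A nabla UNIV (g i)" if "i < card B" for i
    unfolding g_def using hB[OF that] G B(1) by (intro parallel_sec_metric[OF conn, of _ x0]) (auto simp: C_def)
  moreover have "independent_sections (card B) g"
    unfolding independent_sections_def
  proof (intro allI impI)
    fix c :: "nat \<Rightarrow> real" and i assume z: "\<forall>x. (\<Sum>i<card B. c i *\<^sub>R g i x) = 0" and i: "i < card B"
    define a where "a b = c (the_inv_into {0..<card B} h b)" for b
    have ah: "a (h j) = c j" if "j < card B" for j
      using that h by (simp add: a_def the_inv_into_f_f bij_betw_def)
    have "(\<Sum>b\<in>B. a b *\<^sub>R b) = (\<Sum>j\<in>{0..<card B}. a (h j) *\<^sub>R h j)"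
      by (rule sum.reindex_bij_betw[OF h, symmetric])
    also have "\<dots> = (\<Sum>j<card B. c j *\<^sub>R g j x0)"
      unfolding atLeast0LessThan by (rule sum.cong) (use ah hB G(2) in \<open>auto simp: g_def\<close>)
    also have "\<dots> = 0" using z by blast
    finally have "a (h i) = 0" using independentD[OF B(2) fB order_refl] hB[OF i] by blast
    then show "c i = 0" using ah[OF i] by simp
  qed
  ultimately show ?thesis using mc r by auto
qed

end

theorem corollary20:
  fixes A :: "('m::{t2_space, second_countable_topology}, 'n::finite) chart set"
    and nabla :: "('m \<Rightarrow> real^'n) \<Rightarrow> 'm \<Rightarrow> real^'n \<Rightarrow> real^'n"
  assumes "analytic_atlas A"
    and "connected (UNIV :: 'm set)"
    and "simply_connected (UNIV :: 'm set)"
    and "analytic_connection A nabla"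
    and "locally_metric_connection A nabla"
  shows "metric_connection A nabla \<and>
    (\<exists>g :: nat \<Rightarrow> 'm \<Rightarrow> real^'n^'n.
       (\<forall>i < bundle_rank (W_tilde A nabla).
          metric_on A UNIV (g i) \<and> parallel_on A nabla UNIV (g i)) \<and>
       independent_sections (bundle_rank (W_tilde A nabla)) g)"
proof -
  interpret analytic_conn A nabla
    by unfold_locales (use assms in auto)
  show ?thesis by (rule parallel_metrics_exist[OF assms(2,3,5)])
qed

end
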